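(* Let $H$ be a real separable Hilbert space with norm $\|\cdot\|$, let $X,X_1,X_2,\ldots$ be i.i.d. $H$-valued random vectors with $E(X)=0$ such that for every $f\in H^*$ there is $t_f>0$ with $E(\|X\|^3e^{t|f(X)|})<\infty$ for $0<|t|<t_f$, and set $S_n=\sum_{j=1}^nX_j$. Let $\gamma$ be the centered Gaussian measure on $H$ which is the weak limit of $\mathcal{L}(S_n/n^{1/2})$, and let $G$ be a Gaussian random vector on $H$ with $\mathcal{L}(G)=\gamma$. Let $D=\{x:\|x-a\|<R\}$ ($a\in H$, $R>0$) be a ball in $H$ with $D\cap H_\gamma\neq\emptyset$ and $0\notin\overline D$. Then, for any sequence $\{b_n\}$ of positive constants with $b_n/n^{1/2}\to\infty$ and $b_n/n^{2/3}\to0$, $$\lim_{n\to\infty}P(S_n\in b_nD)/P(G\in n^{-1/2}b_nD)=1.$$ Furthermore, both probabilities are asymptotically equivalent (ratio tending to $1$ as $n\to\infty$) to $$(2\pi\sigma_g^2b_n^2/n)^{-1/2}\exp\{-n^{-1}b_n^2\lambda_\gamma(a_0)\}\int_0^\infty e^{-s}P(\|G_2\|^2\le2sbR^2)\,ds,$$ where $a_0$ is the unique dominating point for $(D,\gamma)$, $g=t_0f$ is the functional associated with $a_0$ (see context), $1/b=g(a-a_0)$, $\sigma_g^2=E(g^2(X))$, and $G_2=G-G_1$ is a centered Gaussian random vector on $H$ with $G_1=g(G)E(Gg(G))/\sigma_g^2$.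
   Context: Notation (with $B=H$): $\hat\gamma(f)=\int_B e^{f(x)}\,d\gamma(x)$ for $f\in B^*$. For the centered Gaussian measure $\gamma$, $H_\gamma\subset B$ is the Hilbert space generating $\gamma$: the completion of $S(B^* )$, where $Sf=\int_B xf(x)\,d\gamma(x)$ (Bochner integral), under the inner product $\langle Sf,Sg\rangle_\gamma=\int_B fg\,d\gamma$. The rate function is $\lambda_\gamma(x)=\sup_{f\in B^*}[f(x)-\log\hat\gamma(f)]$, which equals $\|x\|_\gamma^2/2$ for $x\in H_\gamma$ and $+\infty$ otherwise. Dominating point (known facts): for open convex $D$ with $D\cap H_\gamma\ne\emptyset$ and $0\notin\overline D$, there is a unique point $a_0\in\partial D$ (the dominating point for $(D,\gamma)$) such that (i) $\lambda_\gamma(a_0)=\inf_{x\in D}\lambda_\gamma(x)=\inf_{x\in\overline D}\lambda_\gamma(x)<\infty$, and for some $g\in B^*$: (ii) $D\subset\{x:g(x)\ge g(a_0)\}$; (iii) $\lambda_\gamma(a_0)=g(a_0)-\log\hat\gamma(g)$; (iv) $a_0=\int_B x\exp\{g(x)-\log\hat\gamma(g)\}\,d\gamma(x)$ (Bochner integral). Moreover, if $f\in B^*$ satisfies $\sup_{\{z:\lambda_\gamma(z)\le\lambda_\gamma(a_0)\}}f(z)=f(a_0)<f(x)$ for all $x\in D$ (such $f$ exists by Hahn–Banach), there is a unique $t_0>0$ such that $g=t_0f$ satisfies (ii)–(iv). "The functional $g=t_0f$ associated with $a_0$" means such a $g$. *)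

theory Defs
  imports "HOL-Probability.Probability"
begin

text \<open>
  The topological dual of a real normed space \<open>'h\<close> is the type \<open>'h \<Rightarrow>\<^sub>L real\<close>.
  Second countability is separability for metric spaces, so a real separable Hilbert space is a
  type of sort
  \<open>{real_inner, banach, second_countable_topology}\<close>.
\<close>

text \<open>The library's \<open>weak_conv_m\<close> covers distributions on the real line only.\<close>

definition weak_conv_measure ::
  "(nat \<Rightarrow> 'h::metric_space measure) \<Rightarrow> 'h measure \<Rightarrow> bool" where
  "weak_conv_measure \<mu> \<nu> \<longleftrightarrow>
     (\<forall>f::'h \<Rightarrow> real. continuous_on UNIV f \<and> bounded (range f) \<longrightarrow>
        (\<lambda>n. \<integral>x. f x \<partial>\<mu> n) \<longlonglongrightarrow> (\<integral>x. f x \<partial>\<nu>))"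

text \<open>One-dimensional marginals may be degenerate, i.e. have variance \<open>0\<close>.\<close>

definition centered_gaussian :: "'h::real_normed_vector measure \<Rightarrow> bool" where
  "centered_gaussian \<mu> \<longleftrightarrow> prob_space \<mu> \<and> sets \<mu> = sets borel \<and>
     (\<forall>f::'h \<Rightarrow>\<^sub>L real.
        distr \<mu> borel (blinfun_apply f) = return borel 0 \<or>
        (\<exists>\<sigma>>0. distr \<mu> borel (blinfun_apply f) =
           density lborel (\<lambda>x. ennreal (normal_density 0 \<sigma> x))))"

text \<open>
  In the definitions below \<open>\<gamma>\<close> is meant to be Gaussian; all the integrals then exist and are
  finite, so no default value for a divergent integral enters.
\<close>

definition mgf :: "'h::real_normed_vector measure \<Rightarrow> ('h \<Rightarrow>\<^sub>L real) \<Rightarrow> real" where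
  "mgf \<gamma> f = (\<integral>x. exp (blinfun_apply f x) \<partial>\<gamma>)"

definition rate_fun :: "'h::real_normed_vector measure \<Rightarrow> 'h \<Rightarrow> ereal" where
  "rate_fun \<gamma> x = (SUP f::'h \<Rightarrow>\<^sub>L real. ereal (blinfun_apply f x - ln (mgf \<gamma> f)))"

definition cov_op ::
  "'h::{banach, second_countable_topology} measure \<Rightarrow> ('h \<Rightarrow>\<^sub>L real) \<Rightarrow> 'h" where
  "cov_op \<gamma> f = (\<integral>x. blinfun_apply f x *\<^sub>R x \<partial>\<gamma>)"

text \<open>The inner product of \<open>cov_op \<gamma> f\<close> and \<open>cov_op \<gamma> g\<close> in the Hilbert space generating \<open>\<gamma>\<close>.\<close>

definition cov_inner ::
  "'h::real_normed_vector measure \<Rightarrow> ('h \<Rightarrow>\<^sub>L real) \<Rightarrow> ('h \<Rightarrow>\<^sub>L real) \<Rightarrow> real" where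
  "cov_inner \<gamma> f g = (\<integral>x. blinfun_apply f x * blinfun_apply g x \<partial>\<gamma>)"

text \<open>
  The completion of the range of \<open>cov_op \<gamma>\<close>, realised inside the ambient space: its elements are
  the ambient limits of sequences \<open>cov_op \<gamma> (f n)\<close> that are Cauchy for the norm induced by
  \<open>cov_inner \<gamma>\<close>. That norm dominates a multiple of the ambient norm, so such limits exist.
\<close>

definition gaussian_hilbert ::
  "'h::{banach, second_countable_topology} measure \<Rightarrow> 'h set" where
  "gaussian_hilbert \<gamma> =
     {x. \<exists>f :: nat \<Rightarrow> ('h \<Rightarrow>\<^sub>L real).
        (\<forall>e>0. \<exists>N. \<forall>m\<ge>N. \<forall>n\<ge>N. sqrt (cov_inner \<gamma> (f m - f n) (f m - f n)) < e) \<and>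
        (\<lambda>n. cov_op \<gamma> (f n)) \<longlonglongrightarrow> x}"

definition dominating_functional ::
  "'h::{banach, second_countable_topology} set \<Rightarrow> 'h measure \<Rightarrow> 'h \<Rightarrow> ('h \<Rightarrow>\<^sub>L real) \<Rightarrow> bool" where
  "dominating_functional D \<gamma> a\<^sub>0 g \<longleftrightarrow>
     D \<subseteq> {x. blinfun_apply g x \<ge> blinfun_apply g a\<^sub>0} \<and>
     rate_fun \<gamma> a\<^sub>0 = ereal (blinfun_apply g a\<^sub>0 - ln (mgf \<gamma> g)) \<and>
     a\<^sub>0 = (\<integral>x. exp (blinfun_apply g x - ln (mgf \<gamma> g)) *\<^sub>R x \<partial>\<gamma>)"

definition dominating_point ::
  "'h::{banach, second_countable_topology} set \<Rightarrow> 'h measure \<Rightarrow> 'h \<Rightarrow> bool" where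
  "dominating_point D \<gamma> a\<^sub>0 \<longleftrightarrow>
     a\<^sub>0 \<in> frontier D \<and>
     rate_fun \<gamma> a\<^sub>0 = (INF x\<in>D. rate_fun \<gamma> x) \<and>
     rate_fun \<gamma> a\<^sub>0 = (INF x\<in>closure D. rate_fun \<gamma> x) \<and>
     rate_fun \<gamma> a\<^sub>0 < \<infinity> \<and>
     (\<exists>g. dominating_functional D \<gamma> a\<^sub>0 g)"

definition associated_functional ::
  "'h::{banach, second_countable_topology} set \<Rightarrow> 'h measure \<Rightarrow> 'h \<Rightarrow> ('h \<Rightarrow>\<^sub>L real) \<Rightarrow> bool" where
  "associated_functional D \<gamma> a\<^sub>0 g \<longleftrightarrow>
     (\<exists>(f::'h \<Rightarrow>\<^sub>L real) (t\<^sub>0::real).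
        (SUP z\<in>{z. rate_fun \<gamma> z \<le> rate_fun \<gamma> a\<^sub>0}. ereal (blinfun_apply f z))
          = ereal (blinfun_apply f a\<^sub>0) \<and>
        (\<forall>x\<in>D. blinfun_apply f a\<^sub>0 < blinfun_apply f x) \<and>
        t\<^sub>0 > 0 \<and> g = t\<^sub>0 *\<^sub>R f \<and> dominating_functional D \<gamma> a\<^sub>0 g)"

end

theory Submission
  imports Defs "HOL-Real_Asymp.Real_Asymp"
begin

text \<open>
  Since \<open>a - a\<^sub>0\<close> is a positive multiple \<open>(\<kappa> / 2) g\<close> of the vector \<open>g\<close> representing the
  dominating functional, and \<open>a\<^sub>0 = E (g \<bullet> X) X\<close>, a point \<open>b n (a\<^sub>0 + y / m)\<close> with \<open>m = b n / sqrt n\<close>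
  lies in the scaled ball iff \<open>(norm y)\<^sup>2 < \<kappa> m (g \<bullet> y)\<close>.  Tilting the law of \<open>X\<close> by
  \<open>exp (\<tau> (g \<bullet> x))\<close>, \<open>\<tau> = b n / n\<close>, therefore turns the probability of the scaled ball into an explicit
  exponential factor times \<open>E (exp (- m (g \<bullet> Y)); (norm Y)\<^sup>2 < \<kappa> m (g \<bullet> Y))\<close>, with \<open>Y\<close> the normalised sum
  of the tilted and recentred vectors.  The variable \<open>m (g \<bullet> Y)\<close> spreads out as \<open>m\<close> grows, so this is a
  local limit problem in the direction \<open>g\<close>, solved by smoothing with a Gaussian kernel and Fourier inversion;
  given \<open>m (g \<bullet> Y) = c\<close>, the vector \<open>Y\<close> is close in law to the part \<open>G\<^sub>2\<close> of the Gaussian limit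
  independent of \<open>g\<close>, whence the limit
  \<open>(2 \<pi> \<sigma>\<^sup>2) powr (- 1 / 2) * E (exp (- (norm G\<^sub>2)\<^sup>2 / \<kappa>))\<close>.
  The condition \<open>n \<tau>\<^sup>3 \<rightarrow> 0\<close>, i.e. \<open>b n = o (n powr (2 / 3))\<close>, makes the exponential factor the Gaussian one,
  and the Gaussian probability has the same asymptotics by a direct substitution along \<open>a\<^sub>0\<close>.
\<close>

section \<open>Uniqueness of characteristic functions on a Hilbert space\<close>

text \<open>In infinite dimension, convergence of characteristic functions does not control the
  norm, because mass may escape into ever higher coordinates. Tightness is a separate task, and it
  is required under the weight \<open>m n * normal_density c s (m n * (g \<bullet> y))\<close>,
  whose height grows with n. Splitting the sum into two independent blocks lets second moments
  survive this weight: over either block alone the kernel integrates to at most a constant over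
  \<open>m n\<close>. Functions of the norm are then reached through
  \<open>exp (- (norm y)\<^sup>2)\<close>, a limit of products of one-dimensional Gaussian weights.
  A lattice law of g \<bullet> X is no obstacle, since the span of m (g \<bullet> Y) is proportional
  to \<tau> and vanishes; the kernel keeps a fixed width s while n grows, and s shrinks only
  afterwards. By Fubini the integral over s in the claim is the expectation of
  \<open>exp (- (norm y)\<^sup>2 / \<kappa>)\<close> with
  \<open>\<kappa> = 2 * \<beta> * R\<^sup>2\<close>, which is the form that both limits take. The
  ratio claim names no dominating point, so one has to be constructed.\<close>

definition chf :: "'h::real_inner measure \<Rightarrow> 'h \<Rightarrow> complex" where
  "chf \<mu> u = (\<integral>y. iexp (u \<bullet> y) \<partial>\<mu>)"

lemma (in finite_measure) integrable_bounded:
  fixes f :: "'a \<Rightarrow> 'b::{banach, second_countable_topology}"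
  assumes "f \<in> borel_measurable M" "\<And>x. norm (f x) \<le> B"
  shows "integrable M f"
  using assms by (intro integrable_const_bound[where B = B]) auto

text \<open>
  The class of weights \<open>\<phi>\<close> for which \<open>\<phi> \<mu>\<close> and \<open>\<phi> \<nu>\<close> have the same characteristic function is closed
  under restriction to half-spaces, so \<open>\<mu>\<close> and \<open>\<nu>\<close> agree on finite intersections of half-spaces.
\<close>

definition same_chf ::
  "'h::{real_inner, second_countable_topology} measure \<Rightarrow> 'h measure \<Rightarrow> ('h \<Rightarrow> real) \<Rightarrow> bool" where
  "same_chf \<mu> \<nu> \<phi> \<longleftrightarrow> \<phi> \<in> borel_measurable borel \<and> (\<forall>y. 0 \<le> \<phi> y) \<and> (\<exists>B. \<forall>y. \<phi> y \<le> B) \<and>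
     (\<forall>u. (\<integral>y. of_real (\<phi> y) * iexp (u \<bullet> y) \<partial>\<mu>) = (\<integral>y. of_real (\<phi> y) * iexp (u \<bullet> y) \<partial>\<nu>))"

lemma same_chf_mass:
  fixes \<mu> \<nu> :: "'h::{real_inner, second_countable_topology} measure"
  assumes "same_chf \<mu> \<nu> \<phi>"
  shows "(\<integral>y. \<phi> y \<partial>\<mu>) = (\<integral>y. \<phi> y \<partial>\<nu>)"
proof -
  have "(\<integral>y. complex_of_real (\<phi> y) * iexp (0 \<bullet> y) \<partial>\<mu>) = (\<integral>y. of_real (\<phi> y) * iexp (0 \<bullet> y) \<partial>\<nu>)"
    using assms unfolding same_chf_def by blast
  then show ?thesis by simp
qed

text \<open>Divided by its total mass, the weighted law of u \<bullet> y is a probability law on the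
  line whose characteristic function at t is the weighted transform at t u, so one-dimensional
  uniqueness applies. A vanishing mass cannot be normalised; then both sides are 0.\<close>

lemma same_chf_halfspace_mass:
  fixes \<mu> \<nu> :: "'h::{real_inner, second_countable_topology} measure"
  assumes \<mu>: "finite_measure \<mu>" "sets \<mu> = sets borel"
    and \<nu>: "finite_measure \<nu>" "sets \<nu> = sets borel"
    and \<phi>: "same_chf \<mu> \<nu> \<phi>"
  shows "(\<integral>y. \<phi> y * indicator {y. u \<bullet> y \<le> a} y \<partial>\<mu>) = (\<integral>y. \<phi> y * indicator {y. u \<bullet> y \<le> a} y \<partial>\<nu>)"
proof -
  note [measurable_cong] = \<mu>(2) \<nu>(2)
  have [measurable]: "\<phi> \<in> borel_measurable borel" using \<phi> by (simp add: same_chf_def)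
  have nn: "0 \<le> \<phi> y" for y using \<phi> by (simp add: same_chf_def)
  obtain B where B: "\<phi> y \<le> B" for y using \<phi> by (auto simp: same_chf_def)
  define Z where "Z = (\<integral>y. \<phi> y \<partial>\<mu>)"
  have Z\<nu>: "Z = (\<integral>y. \<phi> y \<partial>\<nu>)" unfolding Z_def by (rule same_chf_mass[OF \<phi>])
  have int: "integrable \<kappa> (\<lambda>y. \<phi> y * indicator A y)" "integrable \<kappa> \<phi>"
    if "finite_measure \<kappa>" "sets \<kappa> = sets borel" "A \<in> sets borel" for \<kappa> A
  proof -
    interpret finite_measure \<kappa> by fact
    note [measurable_cong] = that(2)
    note [measurable] = that(3)
    show "integrable \<kappa> (\<lambda>y. \<phi> y * indicator A y)"
      using nn B by (intro integrable_bounded[where B = B]) (auto simp: indicator_def intro: order_trans[OF nn B])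
    show "integrable \<kappa> \<phi>"
      using nn B by (intro integrable_bounded[where B = B]) (auto simp: indicator_def)
  qed
  have H: "{y. u \<bullet> y \<le> a} \<in> sets borel" by measurable
  show ?thesis
  proof (cases "Z = 0")
    case True
    have "(\<integral>y. \<phi> y * indicator {y. u \<bullet> y \<le> a} y \<partial>\<kappa>) = 0"
      if "finite_measure \<kappa>" "sets \<kappa> = sets borel" "(\<integral>y. \<phi> y \<partial>\<kappa>) = 0" for \<kappa>
    proof (rule antisym)
      show "(\<integral>y. \<phi> y * indicator {y. u \<bullet> y \<le> a} y \<partial>\<kappa>) \<le> 0"
        unfolding that(3)[symmetric]
        by (rule integral_mono[OF int(1)[OF that(1,2) H] int(2)[OF that(1,2) H]])
          (auto simp: indicator_def nn)
    qed (auto simp: nn intro!: integral_nonneg)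
    then show ?thesis using \<mu> \<nu> Z_def Z\<nu> True by metis
  next
    case False
    have Zpos: "Z > 0" using False nn by (simp add: Z_def less_le integral_nonneg)
    define L where "L \<kappa> = distr (density \<kappa> (\<lambda>y. ennreal (\<phi> y / Z))) borel (\<lambda>y. u \<bullet> y)" for \<kappa>
    have L: "real_distribution (L \<kappa>)" "\<And>t. char (L \<kappa>) t = (\<integral>y. of_real (\<phi> y) * iexp ((t *\<^sub>R u) \<bullet> y) \<partial>\<kappa>) / Z"
       "measure (L \<kappa>) {..a} = (\<integral>y. \<phi> y * indicator {y. u \<bullet> y \<le> a} y \<partial>\<kappa>) / Z"
      if \<kappa>: "finite_measure \<kappa>" "sets \<kappa> = sets borel" "(\<integral>y. \<phi> y \<partial>\<kappa>) = Z" for \<kappa>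
    proof -
      interpret \<kappa>: finite_measure \<kappa> by fact
      note [measurable_cong] = \<kappa>(2)
      have em: "emeasure (density \<kappa> (\<lambda>y. ennreal (\<phi> y / Z))) A = ennreal ((\<integral>y. \<phi> y * indicator A y \<partial>\<kappa>) / Z)"
        if A[measurable]: "A \<in> sets borel" for A
      proof -
        have "emeasure (density \<kappa> (\<lambda>y. ennreal (\<phi> y / Z))) A = (\<integral>\<^sup>+y. ennreal (\<phi> y / Z) * indicator A y \<partial>\<kappa>)"
          by (rule emeasure_density) measurable
        also have "\<dots> = (\<integral>\<^sup>+y. ennreal (\<phi> y * indicator A y / Z) \<partial>\<kappa>)"
          by (rule nn_integral_cong) (auto simp: indicator_def)
        also have "\<dots> = ennreal (\<integral>y. \<phi> y * indicator A y / Z \<partial>\<kappa>)"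
          using int(1)[OF \<kappa>(1,2) A] nn Zpos by (intro nn_integral_eq_integral) (auto simp: indicator_def)
        finally show ?thesis by simp
      qed
      have p: "prob_space (density \<kappa> (\<lambda>y. ennreal (\<phi> y / Z)))"
        using em[of UNIV] \<kappa>(3) Zpos by (intro prob_spaceI) (auto simp: sets_eq_imp_space_eq[OF \<kappa>(2)])
      then interpret p: prob_space "density \<kappa> (\<lambda>y. ennreal (\<phi> y / Z))" .
      show "real_distribution (L \<kappa>)" unfolding L_def
        by (rule p.real_distribution_distr) measurable
      show "char (L \<kappa>) t = (\<integral>y. of_real (\<phi> y) * iexp ((t *\<^sub>R u) \<bullet> y) \<partial>\<kappa>) / Z" for t
      proof -
        have "char (L \<kappa>) t = (\<integral>y. (\<phi> y / Z) *\<^sub>R iexp (t * (u \<bullet> y)) \<partial>\<kappa>)"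
          unfolding L_def char_def
          by (subst integral_distr, measurable, subst integral_density) (use nn Zpos in \<open>auto simp: ac_simps\<close>)
        also have "\<dots> = (\<integral>y. (of_real (\<phi> y) * iexp ((t *\<^sub>R u) \<bullet> y)) / Z \<partial>\<kappa>)"
          by (intro Bochner_Integration.integral_cong) (auto simp: scaleR_conv_of_real)
        finally show ?thesis by simp
      qed
      show "measure (L \<kappa>) {..a} = (\<integral>y. \<phi> y * indicator {y. u \<bullet> y \<le> a} y \<partial>\<kappa>) / Z"
      proof -
        have "emeasure (L \<kappa>) {..a} = emeasure (density \<kappa> (\<lambda>y. ennreal (\<phi> y / Z))) {y. u \<bullet> y \<le> a}"
          unfolding L_def by (subst emeasure_distr) (auto simp: vimage_def sets_eq_imp_space_eq[OF \<kappa>(2)])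
        then show ?thesis using em[OF H] nn Zpos
          by (simp add: measure_def integral_nonneg)
      qed
    qed
    have "char (L \<mu>) = char (L \<nu>)"
      using \<phi> unfolding fun_eq_iff L(2)[OF \<mu> Z_def[symmetric]] L(2)[OF \<nu> Z\<nu>[symmetric]] same_chf_def
      by metis
    then have "L \<mu> = L \<nu>"
      by (intro Levy_uniqueness L(1) \<mu> \<nu> Z_def[symmetric] Z\<nu>[symmetric])
    then show ?thesis
      using L(3)[OF \<mu> Z_def[symmetric]] L(3)[OF \<nu> Z\<nu>[symmetric]] Zpos by simp
  qed
qed

text \<open>Multiplying an admissible weight by 1 + cos (h \<bullet> y) or 1 + sin (h \<bullet> y)
  keeps it nonnegative and bounded and only shifts frequencies by h and -h, so it stays admissible.
  Half-space masses of these modified weights, with h = v, give the real and imaginary parts of the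
  transform of the restricted weight at v.\<close>

lemma same_chf_halfspace:
  fixes \<mu> \<nu> :: "'h::{real_inner, second_countable_topology} measure"
  assumes \<mu>: "finite_measure \<mu>" "sets \<mu> = sets borel"
    and \<nu>: "finite_measure \<nu>" "sets \<nu> = sets borel"
    and \<phi>: "same_chf \<mu> \<nu> \<phi>"
  shows "same_chf \<mu> \<nu> (\<lambda>y. \<phi> y * indicator {y. u \<bullet> y \<le> a} y)"
proof -
  note [measurable_cong] = \<mu>(2) \<nu>(2)
  have [measurable]: "\<phi> \<in> borel_measurable borel" using \<phi> by (simp add: same_chf_def)
  have nn: "0 \<le> \<phi> y" for y using \<phi> by (simp add: same_chf_def)
  obtain B where B: "\<phi> y \<le> B" for y using \<phi> by (auto simp: same_chf_def)
  have eq: "(\<integral>y. of_real (\<phi> y) * iexp (v \<bullet> y) \<partial>\<mu>) = (\<integral>y. of_real (\<phi> y) * iexp (v \<bullet> y) \<partial>\<nu>)" for v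
    using \<phi> by (simp add: same_chf_def)
  have int: "integrable \<kappa> (\<lambda>y. of_real (\<phi> y) * iexp (v \<bullet> y))"
    if "finite_measure \<kappa>" "sets \<kappa> = sets borel" for \<kappa> v
  proof -
    interpret finite_measure \<kappa> by fact
    note [measurable_cong] = that(2)
    show ?thesis
      using nn B by (intro integrable_bounded[where B = B]) (auto simp: norm_mult)
  qed
  have cos_id: "of_real (1 + cos (h \<bullet> y)) * iexp (v \<bullet> y)
      = iexp (v \<bullet> y) + (iexp ((v + h) \<bullet> y) + iexp ((v - h) \<bullet> y)) / 2" for h v y :: 'h
    by (simp add: inner_simps exp_add exp_diff algebra_simps cos_exp_eq cos_of_real[symmetric] exp_minus divide_simps
        del: cos_of_real)
  have sin_id: "of_real (1 + sin (h \<bullet> y)) * iexp (v \<bullet> y)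
      = iexp (v \<bullet> y) + (iexp ((v + h) \<bullet> y) - iexp ((v - h) \<bullet> y)) / (2 * \<i>)" for h v y :: 'h
    by (simp add: inner_simps exp_add exp_diff algebra_simps sin_exp_eq sin_of_real[symmetric] exp_minus divide_simps
        del: sin_of_real)
  have c: "same_chf \<mu> \<nu> (\<lambda>y. \<phi> y * (1 + cos (h \<bullet> y)))" for h
    unfolding same_chf_def
  proof (intro conjI allI exI)
    show "0 \<le> \<phi> y * (1 + cos (h \<bullet> y))" for y using nn[of y] cos_ge_minus_one[of "h \<bullet> y"]
      by (intro mult_nonneg_nonneg) linarith+
    show "\<phi> y * (1 + cos (h \<bullet> y)) \<le> B * 2" for y
      using mult_mono[OF B[of y], of "1 + cos (h \<bullet> y)" 2] order_trans[OF nn[of y] B[of y]] cos_ge_minus_one[of "h \<bullet> y"]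
      cos_le_one[of "h \<bullet> y"] by linarith
    fix v
    have "(\<integral>y. of_real (\<phi> y * (1 + cos (h \<bullet> y))) * iexp (v \<bullet> y) \<partial>\<kappa>)
       = (\<integral>y. of_real (\<phi> y) * iexp (v \<bullet> y) \<partial>\<kappa>) + ((\<integral>y. of_real (\<phi> y) * iexp ((v + h) \<bullet> y) \<partial>\<kappa>)
          + (\<integral>y. of_real (\<phi> y) * iexp ((v - h) \<bullet> y) \<partial>\<kappa>)) / 2"
      if \<kappa>: "finite_measure \<kappa>" "sets \<kappa> = sets borel" for \<kappa>
    proof -
      have "(\<integral>y. of_real (\<phi> y * (1 + cos (h \<bullet> y))) * iexp (v \<bullet> y) \<partial>\<kappa>)
        = (\<integral>y. of_real (\<phi> y) * iexp (v \<bullet> y) + (of_real (\<phi> y) * iexp ((v + h) \<bullet> y)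
              + of_real (\<phi> y) * iexp ((v - h) \<bullet> y)) / 2 \<partial>\<kappa>)"
        by (rule Bochner_Integration.integral_cong)
          (simp_all only: of_real_mult mult.assoc cos_id, simp_all add: algebra_simps)
      then show ?thesis by (simp add: int[OF \<kappa>])
    qed
    then show "(\<integral>y. of_real (\<phi> y * (1 + cos (h \<bullet> y))) * iexp (v \<bullet> y) \<partial>\<mu>) =
       (\<integral>y. of_real (\<phi> y * (1 + cos (h \<bullet> y))) * iexp (v \<bullet> y) \<partial>\<nu>)"
      using \<mu> \<nu> eq by simp
  qed measurable
  have s: "same_chf \<mu> \<nu> (\<lambda>y. \<phi> y * (1 + sin (h \<bullet> y)))" for h
    unfolding same_chf_def
  proof (intro conjI allI exI)
    show "0 \<le> \<phi> y * (1 + sin (h \<bullet> y))" for y using nn[of y] sin_ge_minus_one[of "h \<bullet> y"]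
      by (intro mult_nonneg_nonneg) linarith+
    show "\<phi> y * (1 + sin (h \<bullet> y)) \<le> B * 2" for y
      using mult_mono[OF B[of y], of "1 + sin (h \<bullet> y)" 2] order_trans[OF nn[of y] B[of y]] sin_ge_minus_one[of "h \<bullet> y"]
      sin_le_one[of "h \<bullet> y"] by linarith
    fix v
    have "(\<integral>y. of_real (\<phi> y * (1 + sin (h \<bullet> y))) * iexp (v \<bullet> y) \<partial>\<kappa>)
       = (\<integral>y. of_real (\<phi> y) * iexp (v \<bullet> y) \<partial>\<kappa>) + ((\<integral>y. of_real (\<phi> y) * iexp ((v + h) \<bullet> y) \<partial>\<kappa>)
          - (\<integral>y. of_real (\<phi> y) * iexp ((v - h) \<bullet> y) \<partial>\<kappa>)) / (2 * \<i>)"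
      if \<kappa>: "finite_measure \<kappa>" "sets \<kappa> = sets borel" for \<kappa>
    proof -
      have "(\<integral>y. of_real (\<phi> y * (1 + sin (h \<bullet> y))) * iexp (v \<bullet> y) \<partial>\<kappa>)
        = (\<integral>y. of_real (\<phi> y) * iexp (v \<bullet> y) + (of_real (\<phi> y) * iexp ((v + h) \<bullet> y)
              - of_real (\<phi> y) * iexp ((v - h) \<bullet> y)) / (2 * \<i>) \<partial>\<kappa>)"
        by (rule Bochner_Integration.integral_cong)
          (simp_all only: of_real_mult mult.assoc sin_id, simp_all add: algebra_simps)
      then show ?thesis by (simp add: int[OF \<kappa>])
    qed
    then show "(\<integral>y. of_real (\<phi> y * (1 + sin (h \<bullet> y))) * iexp (v \<bullet> y) \<partial>\<mu>) =
       (\<integral>y. of_real (\<phi> y * (1 + sin (h \<bullet> y))) * iexp (v \<bullet> y) \<partial>\<nu>)"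
      using \<mu> \<nu> eq by simp
  qed measurable
  let ?I = "indicator {y. u \<bullet> y \<le> a} :: 'h \<Rightarrow> real"
  have split: "(\<integral>y. of_real (\<phi> y * ?I y) * iexp (v \<bullet> y) \<partial>\<kappa>)
     = of_real ((\<integral>y. \<phi> y * (1 + cos (v \<bullet> y)) * ?I y \<partial>\<kappa>) - (\<integral>y. \<phi> y * ?I y \<partial>\<kappa>))
     + \<i> * of_real ((\<integral>y. \<phi> y * (1 + sin (v \<bullet> y)) * ?I y \<partial>\<kappa>) - (\<integral>y. \<phi> y * ?I y \<partial>\<kappa>))"
    if \<kappa>: "finite_measure \<kappa>" "sets \<kappa> = sets borel" for \<kappa> v
  proof -
    interpret \<kappa>: finite_measure \<kappa> by fact
    note [measurable_cong] = \<kappa>(2)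
    have i1: "integrable \<kappa> (\<lambda>y. \<phi> y * ?I y * f y)"
      if "f \<in> borel_measurable borel" "\<And>y. \<bar>f y\<bar> \<le> 1" for f
    proof (rule \<kappa>.integrable_bounded[where B = B])
      show "norm (\<phi> y * ?I y * f y) \<le> B" for y
        using mult_mono[OF B[of y] that(2)[of y]] nn[of y] B[of y]
        by (auto simp: abs_mult indicator_def intro: order_trans[OF nn B])
    qed (use that in measurable)
    have i0: "integrable \<kappa> (\<lambda>y. \<phi> y * ?I y)" using i1[of "\<lambda>_. 1"] by simp
    have ic: "integrable \<kappa> (\<lambda>y. \<phi> y * ?I y * cos (v \<bullet> y))" by (rule i1) auto
    have is': "integrable \<kappa> (\<lambda>y. \<phi> y * ?I y * sin (v \<bullet> y))" by (rule i1) auto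
    have c': "(\<integral>y. \<phi> y * (1 + cos (v \<bullet> y)) * ?I y \<partial>\<kappa>) - (\<integral>y. \<phi> y * ?I y \<partial>\<kappa>) = (\<integral>y. \<phi> y * ?I y * cos (v \<bullet> y) \<partial>\<kappa>)"
      using Bochner_Integration.integral_add[OF i0 ic] by (simp add: algebra_simps)
    have s': "(\<integral>y. \<phi> y * (1 + sin (v \<bullet> y)) * ?I y \<partial>\<kappa>) - (\<integral>y. \<phi> y * ?I y \<partial>\<kappa>) = (\<integral>y. \<phi> y * ?I y * sin (v \<bullet> y) \<partial>\<kappa>)"
      using Bochner_Integration.integral_add[OF i0 is'] by (simp add: algebra_simps)
    have "(\<integral>y. of_real (\<phi> y * ?I y) * iexp (v \<bullet> y) \<partial>\<kappa>)
      = (\<integral>y. of_real (\<phi> y * ?I y * cos (v \<bullet> y)) + \<i> * of_real (\<phi> y * ?I y * sin (v \<bullet> y)) \<partial>\<kappa>)"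
      by (rule Bochner_Integration.integral_cong) (auto simp: exp_Euler cos_of_real sin_of_real algebra_simps)
    also have "\<dots> = of_real (\<integral>y. \<phi> y * ?I y * cos (v \<bullet> y) \<partial>\<kappa>) + \<i> * of_real (\<integral>y. \<phi> y * ?I y * sin (v \<bullet> y) \<partial>\<kappa>)"
      by (subst Bochner_Integration.integral_add)
        (use integrable_of_real[OF ic, where 'a=complex] integrable_of_real[OF is', where 'a=complex] in
          \<open>simp_all only: integral_mult_right_zero integral_complex_of_real integrable_mult_right\<close>)
    finally show ?thesis by (simp only: c' s')
  qed
  show ?thesis
    unfolding same_chf_def
  proof (intro conjI allI)
    show "\<exists>B. \<forall>y. \<phi> y * ?I y \<le> B"
      by (rule exI[of _ B]) (auto simp: indicator_def B intro: order_trans[OF nn B])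
    show "(\<integral>y. of_real (\<phi> y * ?I y) * iexp (v \<bullet> y) \<partial>\<mu>) = (\<integral>y. of_real (\<phi> y * ?I y) * iexp (v \<bullet> y) \<partial>\<nu>)" for v
      unfolding split[OF \<mu>] split[OF \<nu>]
      using same_chf_halfspace_mass[OF \<mu> \<nu> \<phi>, of u a] same_chf_halfspace_mass[OF \<mu> \<nu> c[of v], of u a]
        same_chf_halfspace_mass[OF \<mu> \<nu> s[of v], of u a] by simp
  qed (auto simp: nn)
qed

text \<open>The weight 1 belongs to the empty intersection, and each further half-space is cut off
  by \<open>same_chf_halfspace\<close>; the mass of the final weight is the measure.\<close>

lemma measure_inter_halfspaces_eq:
  fixes \<mu> \<nu> :: "'h::{real_inner, second_countable_topology} measure"
  assumes \<mu>: "finite_measure \<mu>" "sets \<mu> = sets borel"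
    and \<nu>: "finite_measure \<nu>" "sets \<nu> = sets borel"
    and eq: "\<And>u. chf \<mu> u = chf \<nu> u" and "finite F"
  shows "measure \<mu> (\<Inter>p\<in>F. {y. fst p \<bullet> y \<le> snd p}) = measure \<nu> (\<Inter>p\<in>F. {y. fst p \<bullet> y \<le> snd p})"
proof -
  have "same_chf \<mu> \<nu> (indicator (\<Inter>p\<in>F. {y. fst p \<bullet> y \<le> snd p}))"
    using \<open>finite F\<close>
  proof (induction F)
    case empty
    then show ?case using eq by (auto simp: same_chf_def chf_def intro!: exI[of _ 1])
  next
    case (insert p F)
    have "(indicator (\<Inter>p\<in>insert p F. {y. fst p \<bullet> y \<le> snd p}) :: 'h \<Rightarrow> real)
       = (\<lambda>y. indicator (\<Inter>p\<in>F. {y. fst p \<bullet> y \<le> snd p}) y * indicator {y. fst p \<bullet> y \<le> snd p} y)"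
      by (auto simp: fun_eq_iff indicator_def)
    then show ?case using same_chf_halfspace[OF \<mu> \<nu> insert.IH] by simp
  qed
  from same_chf_mass[OF this] show ?thesis
    by (simp add: sets_eq_imp_space_eq[OF \<mu>(2)] sets_eq_imp_space_eq[OF \<nu>(2)])
qed

text \<open>A closed ball is the intersection of its supporting half-spaces. The normals violating
  the inequality at y form an open set, so if none lies in the dense set C there is none at all, and
  testing d = y - x bounds the distance by r.\<close>

lemma cball_eq_Inter_halfspaces:
  fixes x :: "'h::real_inner"
  assumes dense: "\<And>X. open X \<Longrightarrow> X \<noteq> {} \<Longrightarrow> \<exists>d\<in>C. d \<in> X" and "r \<ge> 0"
  shows "cball x r = (\<Inter>d\<in>C. {y. d \<bullet> y \<le> norm d * r + d \<bullet> x})"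
proof (intro equalityI subsetI)
  fix y assume "y \<in> cball x r"
  then have "d \<bullet> (y - x) \<le> norm d * r" for d
    using norm_cauchy_schwarz[of d "y - x"] mult_left_mono[of "norm (y - x)" r "norm d"]
    by (simp add: dist_norm norm_minus_commute)
  then show "y \<in> (\<Inter>d\<in>C. {y. d \<bullet> y \<le> norm d * r + d \<bullet> x})"
    by (auto simp: inner_diff_right algebra_simps)
next
  fix y assume y: "y \<in> (\<Inter>d\<in>C. {y. d \<bullet> y \<le> norm d * r + d \<bullet> x})"
  have "open {d. d \<bullet> (y - x) > norm d * r}" by (intro open_Collect_less continuous_intros)
  moreover have "d \<notin> {d. d \<bullet> (y - x) > norm d * r}" if "d \<in> C" for d
    using y that by (auto simp: inner_diff_right algebra_simps)
  ultimately have "{d. d \<bullet> (y - x) > norm d * r} = {}" using dense by blast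
  then have "(y - x) \<bullet> (y - x) \<le> norm (y - x) * r" by (auto simp: not_less)
  then have "norm (y - x) * norm (y - x) \<le> norm (y - x) * r" by (simp add: power2_norm_eq_inner[symmetric] power2_eq_square)
  then have "norm (y - x) \<le> r" using \<open>r \<ge> 0\<close> by (cases "y = x") auto
  then show "y \<in> cball x r" by (simp add: dist_norm norm_minus_commute)
qed

text \<open>Closed balls are countable intersections of half-spaces, open balls are countable unions
  of closed balls, and open sets are countable unions of open balls by the Lindelof property. Finite
  intersections serve as generators because a uniqueness argument requires a generator stable under
  intersection.\<close>

lemma borel_eq_sigma_inter_halfspaces:
  "sets (borel :: 'h::{real_inner, second_countable_topology} measure)
     = sigma_sets UNIV ((\<lambda>F. \<Inter>p\<in>F. {y. fst p \<bullet> y \<le> snd p}) ` {F. finite F})"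
    (is "_ = sigma_sets UNIV ?E")
proof
  obtain C :: "'h set" where C: "countable C" "\<And>X. open X \<Longrightarrow> X \<noteq> {} \<Longrightarrow> \<exists>d\<in>C. d \<in> X"
    using countable_dense_exists by metis
  interpret S: sigma_algebra UNIV "sigma_sets UNIV ?E" by (rule sigma_algebra_sigma_sets) auto
  have half: "{y. d \<bullet> y \<le> c} \<in> sigma_sets UNIV ?E" for d c
    by (rule sigma_sets.Basic, rule image_eqI[of _ _ "{(d, c)}"]) auto
  have cb: "cball x r \<in> sigma_sets UNIV ?E" if "r \<ge> 0" for x :: 'h and r
  proof -
    have "C \<noteq> {}" using C(2)[of UNIV] by auto
    then show ?thesis
      unfolding cball_eq_Inter_halfspaces[OF C(2) that, of x, simplified]
      using half C(1) by (intro S.countable_INT'') auto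
  qed
  have ball: "ball x r \<in> sigma_sets UNIV ?E" for x :: 'h and r
  proof -
    \<comment> \<open>Negative radii are replaced by the empty set, which also settles the case r
      \<le> 0.\<close>
    have "ball x r = (\<Union>n::nat. if r - inverse (real (Suc n)) \<ge> 0 then cball x (r - inverse (real (Suc n))) else {})"
    proof (intro equalityI subsetI)
      fix y assume "y \<in> ball x r"
      then have "r - dist x y > 0" by simp
      then obtain n where "inverse (real (Suc n)) < r - dist x y" using reals_Archimedean by blast
      then have "dist x y \<le> r - inverse (real (Suc n))" "0 \<le> r - inverse (real (Suc n))"
        using zero_le_dist[of x y] by linarith+
      then have "y \<in> (if r - inverse (real (Suc n)) \<ge> 0 then cball x (r - inverse (real (Suc n))) else {})"
        by simp
      then show "y \<in> (\<Union>n::nat. if r - inverse (real (Suc n)) \<ge> 0 then cball x (r - inverse (real (Suc n))) else {})"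
        by (rule UN_I[OF UNIV_I])
    next
      fix y assume "y \<in> (\<Union>n::nat. if r - inverse (real (Suc n)) \<ge> 0 then cball x (r - inverse (real (Suc n))) else {})"
      then obtain n where "dist x y \<le> r - inverse (real (Suc n))" by (auto split: if_splits)
      moreover have "inverse (real (Suc n)) > 0" by simp
      ultimately have "dist x y < r" by linarith
      then show "y \<in> ball x r" by simp
    qed
    moreover have "(if s \<ge> 0 then cball x s else {}) \<in> sigma_sets UNIV ?E" for s
      using cb[of s x] by (simp add: sigma_sets.Empty)
    ultimately show ?thesis by (simp only:) (rule sigma_sets.Union)
  qed
  show "sets borel \<subseteq> sigma_sets UNIV ?E"
  proof -
    have "open U \<Longrightarrow> U \<in> sigma_sets UNIV ?E" for U :: "'h set"
    proof -
      assume "open U"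
      define \<B> where "\<B> = {ball x r |x r. ball x r \<subseteq> U}"
      have "open B" if "B \<in> \<B>" for B using that by (auto simp: \<B>_def)
      then obtain \<D> where \<D>: "\<D> \<subseteq> \<B>" "countable \<D>" "\<Union>\<D> = \<Union>\<B>"
        by (rule Lindelof)
      have "U = \<Union>\<B>"
      proof (intro equalityI subsetI)
        fix x assume "x \<in> U"
        then obtain e where e: "e > 0" "ball x e \<subseteq> U" using \<open>open U\<close> open_contains_ball by metis
        then have "ball x e \<in> \<B>" by (auto simp: \<B>_def)
        then show "x \<in> \<Union>\<B>" by (rule UnionI) (use e(1) in simp)
      qed (auto simp: \<B>_def)
      then have "U = \<Union>\<D>" using \<D>(3) by simp
      moreover have "\<D> \<subseteq> sigma_sets UNIV ?E"
      proof
        fix B assume "B \<in> \<D>"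
        then obtain x r where "B = ball x r" using \<D>(1) by (auto simp: \<B>_def)
        then show "B \<in> sigma_sets UNIV ?E" using ball by simp
      qed
      then have "\<Union>\<D> \<in> sigma_sets UNIV ?E" by (rule S.countable_Union[OF \<D>(2)])
      ultimately show ?thesis by simp
    qed
    then show ?thesis unfolding borel_def
      by (subst sets_measure_of) (auto intro!: S.sigma_sets_subset)
  qed
  show "sigma_sets UNIV ?E \<subseteq> sets borel"
  proof (rule sets.sigma_sets_subset[of _ borel, simplified])
    show "?E \<subseteq> sets borel"
      by (auto intro!: borel_closed closed_INT closed_Collect_le continuous_intros)
  qed
qed

theorem chf_unique:
  fixes \<mu> \<nu> :: "'h::{real_inner, second_countable_topology} measure"
  assumes \<mu>: "finite_measure \<mu>" "sets \<mu> = sets borel"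
    and \<nu>: "finite_measure \<nu>" "sets \<nu> = sets borel"
    and eq: "\<And>u. chf \<mu> u = chf \<nu> u"
  shows "\<mu> = \<nu>"
proof (rule measure_eqI_generator_eq)
  let ?E = "(\<lambda>F. \<Inter>p\<in>F. {y::'h. fst p \<bullet> y \<le> snd p}) ` {F. finite F}"
  interpret \<mu>: finite_measure \<mu> by fact
  interpret \<nu>: finite_measure \<nu> by fact
  show "Int_stable ?E"
  proof (rule Int_stableI_image)
    fix F G :: "('h \<times> real) set" assume "F \<in> {F. finite F}" "G \<in> {F. finite F}"
    then show "\<exists>H\<in>{F. finite F}. (\<Inter>p\<in>F. {y. fst p \<bullet> y \<le> snd p}) \<inter> (\<Inter>p\<in>G. {y. fst p \<bullet> y \<le> snd p})
       = (\<Inter>p\<in>H. {y. fst p \<bullet> y \<le> snd p})"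
      by (intro bexI[of _ "F \<union> G"]) auto
  qed
  show "emeasure \<mu> X = emeasure \<nu> X" if "X \<in> ?E" for X
    using that measure_inter_halfspaces_eq[OF \<mu> \<nu> eq]
    by (auto simp: \<mu>.emeasure_eq_measure \<nu>.emeasure_eq_measure)
  show "sets \<mu> = sigma_sets UNIV ?E" "sets \<nu> = sigma_sets UNIV ?E"
    using \<mu> \<nu> borel_eq_sigma_inter_halfspaces by auto
  show "range (\<lambda>_::nat. UNIV) \<subseteq> ?E" by (auto intro!: image_eqI[of _ _ "{}"])
  show "emeasure \<mu> UNIV \<noteq> \<infinity>" by simp
qed auto

section \<open>Convergence of integrals of functions of the norm\<close>

definition onproj :: "'h::real_inner set \<Rightarrow> 'h \<Rightarrow> 'h" where
  "onproj C y = (\<Sum>c\<in>C. (c \<bullet> y) *\<^sub>R c)"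

definition orthonormal :: "'h::real_inner set \<Rightarrow> bool" where
  "orthonormal C \<longleftrightarrow> finite C \<and> pairwise orthogonal C \<and> (\<forall>c\<in>C. norm c = 1)"

lemma orthonormal_inner:
  assumes "orthonormal C" "c \<in> C" "d \<in> C"
  shows "c \<bullet> d = (if c = d then 1 else 0)"
  using assms by (auto simp: orthonormal_def pairwise_def orthogonal_def norm_eq_1)

lemma inner_onproj:
  assumes "orthonormal C" "c \<in> C"
  shows "c \<bullet> onproj C y = c \<bullet> y"
proof -
  have "c \<bullet> onproj C y = (\<Sum>d\<in>C. if c = d then d \<bullet> y else 0)"
    unfolding onproj_def inner_sum_right
    by (intro sum.cong) (auto simp: orthonormal_inner[OF assms(1,2)])
  then show ?thesis using assms by (simp add: orthonormal_def)
qed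

lemma norm_onproj_square:
  assumes "orthonormal C"
  shows "(norm (onproj C y))\<^sup>2 = (\<Sum>c\<in>C. (c \<bullet> y)\<^sup>2)"
proof -
  have "onproj C y \<bullet> onproj C y = (\<Sum>c\<in>C. (c \<bullet> y) * (c \<bullet> onproj C y))"
    by (subst (1) onproj_def) (simp add: inner_sum_left)
  then show ?thesis
    using inner_onproj[OF assms] unfolding power2_norm_eq_inner by (simp add: power2_eq_square)
qed

lemma norm_diff_onproj_square:
  assumes "orthonormal C"
  shows "(norm (y - onproj C y))\<^sup>2 = (norm y)\<^sup>2 - (\<Sum>c\<in>C. (c \<bullet> y)\<^sup>2)"
proof -
  have "onproj C y \<bullet> y = (\<Sum>c\<in>C. (c \<bullet> y)\<^sup>2)"
    by (simp add: onproj_def inner_sum_left power2_eq_square)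
  moreover have "y \<bullet> onproj C y = onproj C y \<bullet> y" by (rule inner_commute)
  ultimately show ?thesis
    using norm_onproj_square[OF assms, of y]
    by (simp add: power2_norm_eq_inner inner_diff_left inner_diff_right)
qed

lemma onproj_span:
  assumes "orthonormal C" "d \<in> span C"
  shows "onproj C d = d"
  using assms(2)
proof (induction rule: span_induct_alt)
  case base
  then show ?case by (simp add: onproj_def)
next
  case (step c x y)
  have "onproj C x = x" if "x \<in> C" for x
  proof -
    have "onproj C x = (\<Sum>c\<in>C. if c = x then x else 0)"
      unfolding onproj_def by (intro sum.cong) (auto simp: orthonormal_inner[OF assms(1) _ that])
    then show ?thesis using assms(1) that by (simp add: orthonormal_def)
  qed
  moreover have "onproj C (c *\<^sub>R x + y) = c *\<^sub>R onproj C x + onproj C y"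
    by (simp add: onproj_def inner_add_right scaleR_add_left sum.distrib scaleR_sum_right)
  ultimately show ?case using step by simp
qed

text \<open>Since d is fixed by the projection, y and y - d have the same residual, and by
  Pythagoras a residual is no longer than the vector itself.\<close>

lemma onproj_best_approx:
  assumes "orthonormal C" "d \<in> span C"
  shows "norm (y - onproj C y) \<le> norm (y - d)"
proof -
  have "y - onproj C y = (y - d) - onproj C (y - d)"
    using onproj_span[OF assms] by (simp add: onproj_def inner_diff_right scaleR_diff_left sum_subtractf)
  then have "norm (y - onproj C y) = norm ((y - d) - onproj C (y - d))" by (rule arg_cong)
  then have "(norm (y - onproj C y))\<^sup>2 \<le> (norm (y - d))\<^sup>2"
    unfolding norm_diff_onproj_square[OF assms(1), of "y - d"] by (simp add: sum_nonneg norm_diff_onproj_square[OF assms(1), of "y - d"] del: diff_diff_eq2)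
  then show ?thesis by (simp add: power2_le_iff_abs_le)
qed

text \<open>Gram-Schmidt may leave the zero vector, which is removed before normalising.\<close>

lemma orthonormal_span_exists:
  fixes B :: "'h::real_inner set"
  assumes "finite B"
  shows "\<exists>C. orthonormal C \<and> span C = span B"
proof -
  obtain C where C: "finite C" "span C = span B" "pairwise orthogonal C"
    using basis_orthogonal[OF assms] by blast
  define C' where "C' = (\<lambda>c. c /\<^sub>R norm c) ` (C - {0})"
  have "pairwise orthogonal C'"
    using C(3) unfolding C'_def pairwise_image by (auto simp: pairwise_def orthogonal_def)
  moreover have "span C' = span C"
  proof
    show "span C' \<subseteq> span C"
      by (rule span_minimal) (auto simp: C'_def intro: span_mul[OF span_base])
    have "c \<in> span C'" if "c \<in> C" for c
    proof (cases "c = 0")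
      case True then show ?thesis by (simp add: span_zero)
    next
      case False
      then have "c = norm c *\<^sub>R (c /\<^sub>R norm c)" by simp
      also have "\<dots> \<in> span C'" using that False by (intro span_scale span_base) (auto simp: C'_def)
      finally show ?thesis .
    qed
    then show "span C \<subseteq> span C'" by (intro span_minimal) auto
  qed
  ultimately show ?thesis using C by (intro exI[of _ C']) (auto simp: orthonormal_def C'_def)
qed

text \<open>The subspaces are spanned by initial segments of a dense sequence d. By best
  approximation the error at y is at most the distance from y to any d j with j \<le> k.\<close>

lemma orthonormal_exhaustion:
  obtains C :: "nat \<Rightarrow> 'h::{real_inner, second_countable_topology} set"
  where "\<And>k. orthonormal (C k)" "\<And>y. (\<lambda>k. onproj (C k) y) \<longlonglongrightarrow> y"
proof -
  obtain D :: "'h set" where D: "countable D" "\<And>X. open X \<Longrightarrow> X \<noteq> {} \<Longrightarrow> \<exists>d\<in>D. d \<in> X"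
    using countable_dense_exists by metis
  have "D \<noteq> {}" using D(2)[of UNIV] by auto
  define d where "d = from_nat_into D"
  have "\<exists>C. \<forall>k. orthonormal (C k) \<and> span (C k) = span (d ` {..k})"
    by (intro choice allI orthonormal_span_exists) simp
  then obtain C where C: "\<And>k. orthonormal (C k) \<and> span (C k) = span (d ` {..k})" by blast
  have "(\<lambda>k. onproj (C k) y) \<longlonglongrightarrow> y" for y
  proof (rule LIMSEQ_I)
    fix e :: real assume "e > 0"
    then obtain x where "x \<in> D" "x \<in> ball y e" using D(2)[of "ball y e"] by force
    then obtain j where j: "d j = x"
      using from_nat_into_surj[OF D(1)] by (auto simp: d_def)
    have "norm (onproj (C k) y - y) < e" if "k \<ge> j" for k
    proof -
      have "x \<in> span (C k)" using C[of k] that j by (auto intro!: span_base)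
      then have "norm (y - onproj (C k) y) \<le> norm (y - x)" using C onproj_best_approx by blast
      also have "\<dots> < e" using \<open>x \<in> ball y e\<close> by (simp add: dist_norm)
      finally show ?thesis by (simp add: norm_minus_commute)
    qed
    then show "\<exists>k. \<forall>n\<ge>k. norm (onproj (C n) y - y) < e" by blast
  qed
  then show ?thesis using that C by blast
qed

section \<open>Laplace transforms of the squared norm\<close>

lemma borel_measurable_onproj [measurable]:
  "onproj C \<in> borel_measurable (borel :: 'h::{real_inner, second_countable_topology} measure)"
  unfolding onproj_def by measurable

text \<open>This is the characteristic function exp (- t^2 / 2) of the standard normal law at t =
  sqrt (2 l) x. Read backwards, it writes a Gaussian weight as an average of characters.\<close>

lemma exp_neg_square_eq:
  "complex_of_real (exp (- (l * x\<^sup>2))) = (\<integral>z. iexp (sqrt (2 * l) * x * z) \<partial>std_normal_distribution)" if "l \<ge> 0"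
proof -
  have "(\<integral>z. iexp (sqrt (2 * l) * x * z) \<partial>std_normal_distribution) = char std_normal_distribution (sqrt (2 * l) * x)"
    by (simp add: char_def)
  also have "\<dots> = complex_of_real (exp (- (l * x\<^sup>2)))"
    using that by (simp add: char_std_normal_distribution power_mult_distrib)
  finally show ?thesis by simp
qed

text \<open>
  Writing the Gaussian weight as a Fourier transform keeps convergence of characteristic functions,
  so the coordinates of \<open>onproj C y\<close> can be brought in one at a time.
\<close>

lemma tendsto_integral_gauss_weight:
  fixes \<rho> :: "nat \<Rightarrow> 'h::{real_inner, second_countable_topology} measure"
  assumes \<rho>n: "\<And>n. finite_measure (\<rho> n)" "\<And>n. sets (\<rho> n) = sets borel" "\<And>n. measure (\<rho> n) UNIV \<le> B"
    and \<rho>: "finite_measure \<rho>\<^sub>0" "sets \<rho>\<^sub>0 = sets borel"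
    and \<phi>: "\<phi> \<in> borel_measurable borel" "\<And>y. norm (\<phi> y) \<le> 1"
    and lim: "\<And>u. (\<lambda>n. \<integral>y. \<phi> y * iexp (u \<bullet> y) \<partial>\<rho> n) \<longlonglongrightarrow> (\<integral>y. \<phi> y * iexp (u \<bullet> y) \<partial>\<rho>\<^sub>0)"
    and "l \<ge> 0"
  shows "(\<lambda>n. \<integral>y. \<phi> y * of_real (exp (- (l * (c \<bullet> y)\<^sup>2))) * iexp (u \<bullet> y) \<partial>\<rho> n)
     \<longlonglongrightarrow> (\<integral>y. \<phi> y * of_real (exp (- (l * (c \<bullet> y)\<^sup>2))) * iexp (u \<bullet> y) \<partial>\<rho>\<^sub>0)"
proof -
  let ?N = std_normal_distribution
  interpret N: real_distribution ?N by (rule real_dist_normal_dist)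
  note [measurable] = \<phi>(1)
  have *: "(\<integral>y. \<phi> y * of_real (exp (- (l * (c \<bullet> y)\<^sup>2))) * iexp (u \<bullet> y) \<partial>\<kappa>)
     = (\<integral>z. (\<integral>y. \<phi> y * iexp ((u + (sqrt (2 * l) * z) *\<^sub>R c) \<bullet> y) \<partial>\<kappa>) \<partial>?N)"
    if \<kappa>: "finite_measure \<kappa>" "sets \<kappa> = sets borel" for \<kappa>
  proof -
    interpret \<kappa>: finite_measure \<kappa> by fact
    note [measurable_cong] = \<kappa>(2)
    interpret P: pair_sigma_finite ?N \<kappa> ..
    interpret PF: finite_measure "?N \<Otimes>\<^sub>M \<kappa>" by (intro finite_measure_pair_measure) unfold_locales
    have "(\<integral>y. \<phi> y * of_real (exp (- (l * (c \<bullet> y)\<^sup>2))) * iexp (u \<bullet> y) \<partial>\<kappa>)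
      = (\<integral>y. (\<integral>z. \<phi> y * iexp ((u + (sqrt (2 * l) * z) *\<^sub>R c) \<bullet> y) \<partial>?N) \<partial>\<kappa>)"
    proof (rule Bochner_Integration.integral_cong[OF refl])
      fix y
      have "(\<integral>z. \<phi> y * iexp ((u + (sqrt (2 * l) * z) *\<^sub>R c) \<bullet> y) \<partial>?N)
        = (\<integral>z. \<phi> y * iexp (u \<bullet> y) * iexp (sqrt (2 * l) * (c \<bullet> y) * z) \<partial>?N)"
        by (rule Bochner_Integration.integral_cong) (simp_all add: inner_simps exp_add algebra_simps)
      also have "\<dots> = \<phi> y * iexp (u \<bullet> y) * of_real (exp (- (l * (c \<bullet> y)\<^sup>2)))"
        unfolding exp_neg_square_eq[OF \<open>l \<ge> 0\<close>] by simp
      finally show "\<phi> y * of_real (exp (- (l * (c \<bullet> y)\<^sup>2))) * iexp (u \<bullet> y)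
        = (\<integral>z. \<phi> y * iexp ((u + (sqrt (2 * l) * z) *\<^sub>R c) \<bullet> y) \<partial>?N)" by (simp only: mult_ac)
    qed
    also have "\<dots> = (\<integral>z. (\<integral>y. \<phi> y * iexp ((u + (sqrt (2 * l) * z) *\<^sub>R c) \<bullet> y) \<partial>\<kappa>) \<partial>?N)"
    proof (rule P.Fubini_integral)
      show "integrable (?N \<Otimes>\<^sub>M \<kappa>) (\<lambda>(z, y). \<phi> y * iexp ((u + (sqrt (2 * l) * z) *\<^sub>R c) \<bullet> y))"
        using \<phi>(2) by (intro PF.integrable_bounded[where B = 1]) (auto simp: norm_mult)
    qed
    finally show ?thesis .
  qed
  show ?thesis
    unfolding *[OF \<rho>n(1,2)] *[OF \<rho>]
  proof (rule integral_dominated_convergence[where w = "\<lambda>_. B"])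
    fix n
    interpret \<kappa>: finite_measure "\<rho> n" by (rule \<rho>n)
    show "AE z in ?N. norm (\<integral>y. \<phi> y * iexp ((u + (sqrt (2 * l) * z) *\<^sub>R c) \<bullet> y) \<partial>\<rho> n) \<le> B"
    proof (rule AE_I2)
      fix z
      note [measurable_cong] = \<rho>n(2)[of n]
      have i: "integrable (\<rho> n) (\<lambda>y. \<phi> y * iexp ((u + (sqrt (2 * l) * z) *\<^sub>R c) \<bullet> y))"
        using \<phi>(2) by (intro \<kappa>.integrable_bounded[where B = 1]) (auto simp: norm_mult)
      have "norm (\<integral>y. \<phi> y * iexp ((u + (sqrt (2 * l) * z) *\<^sub>R c) \<bullet> y) \<partial>\<rho> n)
        \<le> (\<integral>y. norm (\<phi> y * iexp ((u + (sqrt (2 * l) * z) *\<^sub>R c) \<bullet> y)) \<partial>\<rho> n)" by (rule integral_norm_bound)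
      also have "\<dots> \<le> (\<integral>y. 1 \<partial>\<rho> n)"
        by (rule integral_mono[OF integrable_norm[OF i]]) (use \<phi>(2) in \<open>simp_all add: norm_mult\<close>)
      also have "\<dots> \<le> B" using \<rho>n(3)[of n] by (simp add: sets_eq_imp_space_eq[OF \<rho>n(2)])
      finally show "norm (\<integral>y. \<phi> y * iexp ((u + (sqrt (2 * l) * z) *\<^sub>R c) \<bullet> y) \<partial>\<rho> n) \<le> B" .
    qed
    note [measurable_cong] = \<rho>n(2)[of n]
    show "(\<lambda>z. \<integral>y. \<phi> y * iexp ((u + (sqrt (2 * l) * z) *\<^sub>R c) \<bullet> y) \<partial>\<rho> n) \<in> borel_measurable ?N"
      by measurable
  next
    interpret \<kappa>: finite_measure \<rho>\<^sub>0 by (rule \<rho>)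
    note [measurable_cong] = \<rho>(2)
    show "(\<lambda>z. \<integral>y. \<phi> y * iexp ((u + (sqrt (2 * l) * z) *\<^sub>R c) \<bullet> y) \<partial>\<rho>\<^sub>0) \<in> borel_measurable ?N"
      by measurable
    show "AE z in ?N. (\<lambda>n. \<integral>y. \<phi> y * iexp ((u + (sqrt (2 * l) * z) *\<^sub>R c) \<bullet> y) \<partial>\<rho> n)
        \<longlonglongrightarrow> (\<integral>y. \<phi> y * iexp ((u + (sqrt (2 * l) * z) *\<^sub>R c) \<bullet> y) \<partial>\<rho>\<^sub>0)"
      by (intro AE_I2 lim)
    show "integrable ?N (\<lambda>_. B)" by simp
  qed
qed

lemma tendsto_laplace_onproj:
  fixes \<rho> :: "nat \<Rightarrow> 'h::{real_inner, second_countable_topology} measure"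
  assumes \<rho>n: "\<And>n. finite_measure (\<rho> n)" "\<And>n. sets (\<rho> n) = sets borel" "\<And>n. measure (\<rho> n) UNIV \<le> B"
    and \<rho>: "finite_measure \<rho>\<^sub>0" "sets \<rho>\<^sub>0 = sets borel"
    and lim: "\<And>u. (\<lambda>n. chf (\<rho> n) u) \<longlonglongrightarrow> chf \<rho>\<^sub>0 u"
    and "l \<ge> 0" "finite C"
  shows "(\<lambda>n. \<integral>y. exp (- l * (\<Sum>c\<in>C. (c \<bullet> y)\<^sup>2)) \<partial>\<rho> n) \<longlonglongrightarrow> (\<integral>y. exp (- l * (\<Sum>c\<in>C. (c \<bullet> y)\<^sup>2)) \<partial>\<rho>\<^sub>0)"
proof -
  \<comment> \<open>The induction carries an arbitrary frequency u, because each new coordinate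
    shifts frequencies; the claim itself is the case u = 0.\<close>
  have "(\<lambda>n. \<integral>y. of_real (exp (- l * (\<Sum>c\<in>C. (c \<bullet> y)\<^sup>2))) * iexp (u \<bullet> y) \<partial>\<rho> n)
     \<longlonglongrightarrow> (\<integral>y. of_real (exp (- l * (\<Sum>c\<in>C. (c \<bullet> y)\<^sup>2))) * iexp (u \<bullet> y) \<partial>\<rho>\<^sub>0)" for u
    using \<open>finite C\<close>
  proof (induction C arbitrary: u)
    case empty
    then show ?case using lim by (simp add: chf_def)
  next
    case (insert c C)
    have eq: "complex_of_real (exp (- l * (\<Sum>c\<in>insert c C. (c \<bullet> y)\<^sup>2)))
        = of_real (exp (- l * (\<Sum>c\<in>C. (c \<bullet> y)\<^sup>2))) * of_real (exp (- (l * (c \<bullet> y)\<^sup>2)))" for y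
      using insert by (simp add: exp_add[symmetric] algebra_simps flip: of_real_mult of_real_exp)
    show ?case unfolding eq
      by (rule tendsto_integral_gauss_weight[OF \<rho>n \<rho> _ _ insert.IH \<open>l \<ge> 0\<close>])
        (use \<open>l \<ge> 0\<close> in \<open>auto simp: norm_exp_eq_Re sum_nonneg simp flip: exp_of_real\<close>)
  qed
  from tendsto_Re[OF this[of 0]] show ?thesis
    by simp
qed

text \<open>A three-epsilon argument: the norm is replaced by the norm of the projection, under the
  limit by dominated convergence and under \<open>\<rho> n\<close> by \<open>tight\<close>. By
  Pythagoras the two exponentials differ by at most l times the squared residual.\<close>

lemma tendsto_laplace_norm:
  fixes \<rho> :: "nat \<Rightarrow> 'h::{real_inner, second_countable_topology} measure"
  assumes \<rho>n: "\<And>n. finite_measure (\<rho> n)" "\<And>n. sets (\<rho> n) = sets borel" "\<And>n. measure (\<rho> n) UNIV \<le> B"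
    and \<rho>: "finite_measure \<rho>\<^sub>0" "sets \<rho>\<^sub>0 = sets borel"
    and lim: "\<And>u. (\<lambda>n. chf (\<rho> n) u) \<longlonglongrightarrow> chf \<rho>\<^sub>0 u"
    and C: "\<And>k. orthonormal (C k)" "\<And>y. (\<lambda>k. onproj (C k) y) \<longlonglongrightarrow> y"
    and tight: "\<And>\<epsilon>. \<epsilon> > 0 \<Longrightarrow> eventually (\<lambda>k. eventually (\<lambda>n. integrable (\<rho> n) (\<lambda>y. (norm (y - onproj (C k) y))\<^sup>2)
           \<and> (\<integral>y. (norm (y - onproj (C k) y))\<^sup>2 \<partial>\<rho> n) \<le> \<epsilon>) sequentially) sequentially"
    and "l \<ge> 0"
  shows "(\<lambda>n. \<integral>y. exp (- l * (norm y)\<^sup>2) \<partial>\<rho> n) \<longlonglongrightarrow> (\<integral>y. exp (- l * (norm y)\<^sup>2) \<partial>\<rho>\<^sub>0)"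
proof (rule LIMSEQ_I)
  fix e :: real assume "e > 0"
  let ?N = "\<lambda>k y. \<Sum>c\<in>C k. (c \<bullet> y)\<^sup>2"
  have "(\<lambda>k. \<integral>y. exp (- l * ?N k y) \<partial>\<rho>\<^sub>0) \<longlonglongrightarrow> (\<integral>y. exp (- l * (norm y)\<^sup>2) \<partial>\<rho>\<^sub>0)"
  proof (rule integral_dominated_convergence[where w = "\<lambda>_. 1"])
    interpret finite_measure \<rho>\<^sub>0 by fact
    note [measurable_cong] = \<rho>(2)
    show "integrable \<rho>\<^sub>0 (\<lambda>_. 1::real)" by simp
    show "AE y in \<rho>\<^sub>0. (\<lambda>k. exp (- l * ?N k y)) \<longlonglongrightarrow> exp (- l * (norm y)\<^sup>2)"
      unfolding norm_onproj_square[OF C(1), symmetric] by (intro AE_I2 tendsto_intros C)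
    show "AE y in \<rho>\<^sub>0. norm (exp (- l * ?N k y)) \<le> 1" for k
      using \<open>l \<ge> 0\<close> by (auto simp: sum_nonneg)
    show "(\<lambda>y. exp (- l * (norm y)\<^sup>2)) \<in> borel_measurable \<rho>\<^sub>0" by measurable
    show "(\<lambda>y. exp (- l * ?N k y)) \<in> borel_measurable \<rho>\<^sub>0" for k by measurable
  qed
  then have 1: "\<forall>\<^sub>F k in sequentially. norm ((\<integral>y. exp (- l * ?N k y) \<partial>\<rho>\<^sub>0) - (\<integral>y. exp (- l * (norm y)\<^sup>2) \<partial>\<rho>\<^sub>0)) < e / 3"
    using \<open>e > 0\<close> by (auto dest!: tendstoD[where e = "e/3"] simp: dist_norm)
  \<comment> \<open>Dividing by l + 1 instead of l covers l = 0.\<close>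
  have "e / 3 / (l + 1) > 0" using \<open>e > 0\<close> \<open>l \<ge> 0\<close> by simp
  from eventually_happens'[OF _ eventually_conj[OF 1 tight[OF this]]] obtain k where
    k1: "norm ((\<integral>y. exp (- l * ?N k y) \<partial>\<rho>\<^sub>0) - (\<integral>y. exp (- l * (norm y)\<^sup>2) \<partial>\<rho>\<^sub>0)) < e / 3"
    and k2: "\<forall>\<^sub>F n in sequentially. integrable (\<rho> n) (\<lambda>y. (norm (y - onproj (C k) y))\<^sup>2)
           \<and> (\<integral>y. (norm (y - onproj (C k) y))\<^sup>2 \<partial>\<rho> n) \<le> e / 3 / (l + 1)" using trivial_limit_sequentially by blast
  have 3: "\<forall>\<^sub>F n in sequentially. norm ((\<integral>y. exp (- l * ?N k y) \<partial>\<rho> n) - (\<integral>y. exp (- l * ?N k y) \<partial>\<rho>\<^sub>0)) < e / 3"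
    using \<open>e > 0\<close> tendsto_laplace_onproj[OF \<rho>n \<rho> lim \<open>l \<ge> 0\<close>, of "C k"] C(1)[of k]
    by (auto dest!: tendstoD[where e = "e/3"] simp: dist_norm orthonormal_def)
  have "\<forall>\<^sub>F n in sequentially. norm ((\<integral>y. exp (- l * (norm y)\<^sup>2) \<partial>\<rho> n) - (\<integral>y. exp (- l * (norm y)\<^sup>2) \<partial>\<rho>\<^sub>0)) < e"
    using 3 k2
  proof eventually_elim
    case (elim n)
    interpret finite_measure "\<rho> n" by (rule \<rho>n)
    note [measurable_cong] = \<rho>n(2)[of n]
    have i: "integrable (\<rho> n) (\<lambda>y. exp (- l * ?N k y))" "integrable (\<rho> n) (\<lambda>y. exp (- l * (norm y)\<^sup>2))"
      using \<open>l \<ge> 0\<close> by (auto intro!: integrable_bounded[where B = 1] simp: sum_nonneg)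
    have "norm ((\<integral>y. exp (- l * (norm y)\<^sup>2) \<partial>\<rho> n) - (\<integral>y. exp (- l * ?N k y) \<partial>\<rho> n))
       \<le> (\<integral>y. norm (exp (- l * (norm y)\<^sup>2) - exp (- l * ?N k y)) \<partial>\<rho> n)"
      unfolding Bochner_Integration.integral_diff[OF i(2,1), symmetric] by (rule integral_norm_bound)
    also have "\<dots> \<le> (\<integral>y. l * (norm (y - onproj (C k) y))\<^sup>2 \<partial>\<rho> n)"
    proof (rule integral_mono)
      fix y
      let ?d = "(norm (y - onproj (C k) y))\<^sup>2"
      have "(norm y)\<^sup>2 = ?N k y + ?d" using norm_diff_onproj_square[OF C(1), of y k] by simp
      then have *: "exp (- l * (norm y)\<^sup>2) = exp (- l * ?N k y) * exp (- l * ?d)"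
        by (simp add: exp_add[symmetric] algebra_simps)
      then have "norm (exp (- l * (norm y)\<^sup>2) - exp (- l * ?N k y)) = exp (- l * ?N k y) * (1 - exp (- l * ?d))"
      proof -
        have "exp (- l * (norm y)\<^sup>2) - exp (- l * ?N k y) = - (exp (- l * ?N k y) * (1 - exp (- l * ?d)))"
          using * by (simp only: right_diff_distrib mult_1_right minus_diff_eq)
        moreover have "exp (- l * ?d) \<le> 1" using \<open>l \<ge> 0\<close> by simp
        ultimately show ?thesis by simp
      qed
      also have "\<dots> \<le> 1 * (l * ?d)"
        using exp_ge_add_one_self[of "- l * ?d"] \<open>l \<ge> 0\<close>
        by (intro mult_mono) (auto simp: sum_nonneg)
      finally show "norm (exp (- l * (norm y)\<^sup>2) - exp (- l * ?N k y)) \<le> l * ?d" by simp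
    qed (use i elim in \<open>auto intro: integrable_norm\<close>)
    also have "\<dots> \<le> (l + 1) * (e / 3 / (l + 1))"
      unfolding integral_mult_right_zero using elim \<open>l \<ge> 0\<close> by (intro mult_mono) auto
    also have "\<dots> = e / 3"
    proof -
      have "l + 1 \<noteq> 0" using \<open>l \<ge> 0\<close> by linarith
      then show ?thesis by (metis nonzero_mult_div_cancel_left times_divide_eq_right)
    qed
    finally show ?case using elim(1) k1 unfolding real_norm_def by linarith
  qed
  then show "\<exists>no. \<forall>n\<ge>no. norm ((\<integral>y. exp (- l * (norm y)\<^sup>2) \<partial>\<rho> n) - (\<integral>y. exp (- l * (norm y)\<^sup>2) \<partial>\<rho>\<^sub>0)) < e"
    by (simp add: eventually_sequentially)
qed

text \<open>By Weierstrass a continuous function on [0, 1] is uniformly close to a polynomial;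
  integrals of polynomials converge by \<open>lim\<close>, and the uniform error is multiplied by a
  common bound for the masses.\<close>

lemma tendsto_integral_of_moments:
  fixes \<rho> :: "nat \<Rightarrow> 'a measure" and Z :: "'a \<Rightarrow> real"
  assumes \<rho>n: "\<And>n. finite_measure (\<rho> n)" "\<And>n. measure (\<rho> n) (space (\<rho> n)) \<le> B"
    and \<rho>: "finite_measure \<rho>\<^sub>0"
    and Z: "\<And>n. Z \<in> borel_measurable (\<rho> n)" "Z \<in> borel_measurable \<rho>\<^sub>0" "\<And>y. Z y \<in> {0..1}"
    and lim: "\<And>k::nat. (\<lambda>n. \<integral>y. Z y ^ k \<partial>\<rho> n) \<longlonglongrightarrow> (\<integral>y. Z y ^ k \<partial>\<rho>\<^sub>0)"
    and \<psi>: "continuous_on UNIV \<psi>"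
  shows "(\<lambda>n. \<integral>y. \<psi> (Z y) \<partial>\<rho> n) \<longlonglongrightarrow> (\<integral>y. (\<psi> (Z y) :: real) \<partial>\<rho>\<^sub>0)"
proof (rule LIMSEQ_I)
  fix e :: real assume "e > 0"
  \<comment> \<open>A strictly positive common bound for the masses of all \<open>\<rho> n\<close>
    and of the limit, so that it can be divided by.\<close>
  define b where "b = \<bar>B\<bar> + measure \<rho>\<^sub>0 (space \<rho>\<^sub>0) + 1"
  have "b > 0" by (simp add: b_def add_nonneg_pos)
  then have "e / 3 / b > 0" using \<open>e > 0\<close> by simp
  then obtain p where p: "real_polynomial_function p" "\<And>x. x \<in> {0..1} \<Longrightarrow> \<bar>\<psi> x - p x\<bar> < e / 3 / b"
    using Stone_Weierstrass_real_polynomial_function[of "{0..1::real}" \<psi> "e / 3 / b"] continuous_on_subset[OF \<psi>]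
    by (metis compact_Icc subset_UNIV)
  obtain a N where a: "p = (\<lambda>x. \<Sum>i\<le>N. a i * x ^ i)"
    using p(1) real_polynomial_function_iff_sum by auto
  have psi_meas: "\<psi> \<in> borel_measurable borel" using \<psi> by (rule borel_measurable_continuous_onI)
  have int: "integrable \<kappa> (\<lambda>y. Z y ^ k)" "integrable \<kappa> (\<lambda>y. \<psi> (Z y))" "integrable \<kappa> (\<lambda>y. p (Z y))"
    if "finite_measure \<kappa>" "Z \<in> borel_measurable \<kappa>" for \<kappa> k
  proof -
    interpret finite_measure \<kappa> by fact
    note [measurable] = that(2) psi_meas
    show i: "integrable \<kappa> (\<lambda>y. Z y ^ k)" for k
      using Z(3) by (intro integrable_bounded[where B = 1]) (auto intro!: power_le_one)
    then show "integrable \<kappa> (\<lambda>y. p (Z y))" unfolding a by (auto intro!: Bochner_Integration.integrable_sum)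
    have "compact (\<psi> ` {0..1})" by (intro compact_continuous_image continuous_on_subset[OF \<psi>]) auto
    then obtain K where K: "\<And>x. x \<in> {0..1} \<Longrightarrow> norm (\<psi> x) \<le> K"
      using compact_imp_bounded bounded_iff by (metis imageI)
    show "integrable \<kappa> (\<lambda>y. \<psi> (Z y))"
      by (rule integrable_bounded[where B = K]) (use K Z(3) in auto)
  qed
  have close: "\<bar>(\<integral>y. \<psi> (Z y) \<partial>\<kappa>) - (\<integral>y. p (Z y) \<partial>\<kappa>)\<bar> \<le> e / 3"
    if \<kappa>: "finite_measure \<kappa>" "Z \<in> borel_measurable \<kappa>" "measure \<kappa> (space \<kappa>) \<le> b" for \<kappa>
  proof -
    interpret finite_measure \<kappa> by fact
    have "\<bar>(\<integral>y. \<psi> (Z y) \<partial>\<kappa>) - (\<integral>y. p (Z y) \<partial>\<kappa>)\<bar> \<le> (\<integral>y. \<bar>\<psi> (Z y) - p (Z y)\<bar> \<partial>\<kappa>)"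
      unfolding Bochner_Integration.integral_diff[OF int(2,3)[OF \<kappa>(1,2)], symmetric]
      by (rule integral_abs_bound)
    also have "\<dots> \<le> (\<integral>y. e / 3 / b \<partial>\<kappa>)"
      using p(2) Z(3) int(2,3)[OF \<kappa>(1,2)] by (intro integral_mono) (auto intro: less_imp_le)
    also have "\<dots> = e / 3 / b * measure \<kappa> (space \<kappa>)" by simp
    also have "\<dots> \<le> e / 3 / b * b" using \<open>e / 3 / b > 0\<close> \<kappa>(3) by (intro mult_left_mono) auto
    finally show ?thesis using \<open>b > 0\<close> by simp
  qed
  have "(\<lambda>n. \<integral>y. p (Z y) \<partial>\<rho> n) \<longlonglongrightarrow> (\<integral>y. p (Z y) \<partial>\<rho>\<^sub>0)"
    unfolding a by (subst (1 2) Bochner_Integration.integral_sum) (auto intro!: tendsto_intros lim int \<rho>n \<rho> Z)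
  then have "\<forall>\<^sub>F n in sequentially. \<bar>(\<integral>y. p (Z y) \<partial>\<rho> n) - (\<integral>y. p (Z y) \<partial>\<rho>\<^sub>0)\<bar> < e / 3"
    using \<open>e > 0\<close> by (auto dest!: tendstoD[where e = "e/3"] simp: dist_real_def)
  then have "\<forall>\<^sub>F n in sequentially. norm ((\<integral>y. \<psi> (Z y) \<partial>\<rho> n) - (\<integral>y. \<psi> (Z y) \<partial>\<rho>\<^sub>0)) < e"
  proof eventually_elim
    case (elim n)
    have "measure (\<rho> n) (space (\<rho> n)) \<le> b" "measure \<rho>\<^sub>0 (space \<rho>\<^sub>0) \<le> b"
      using \<rho>n(2)[of n] measure_nonneg[of \<rho>\<^sub>0 "space \<rho>\<^sub>0"] unfolding b_def by linarith+
    from close[OF \<rho>n(1) Z(1) this(1)] close[OF \<rho> Z(2) this(2)] elim show ?case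
      unfolding real_norm_def by linarith
  qed
  then show "\<exists>no. \<forall>n\<ge>no. norm ((\<integral>y. \<psi> (Z y) \<partial>\<rho> n) - (\<integral>y. \<psi> (Z y) \<partial>\<rho>\<^sub>0)) < e"
    by (simp add: eventually_sequentially)
qed

text \<open>The k-th power of \<open>exp (- (norm y)\<^sup>2)\<close> is the Laplace weight with l =
  k, so all moments of this [0, 1]-valued function converge.\<close>

lemma tendsto_integral_exp_norm:
  fixes \<rho> :: "nat \<Rightarrow> 'h::{real_inner, second_countable_topology} measure"
  assumes \<rho>n: "\<And>n. finite_measure (\<rho> n)" "\<And>n. sets (\<rho> n) = sets borel" "\<And>n. measure (\<rho> n) UNIV \<le> B"
    and \<rho>: "finite_measure \<rho>\<^sub>0" "sets \<rho>\<^sub>0 = sets borel"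
    and lim: "\<And>u. (\<lambda>n. chf (\<rho> n) u) \<longlonglongrightarrow> chf \<rho>\<^sub>0 u"
    and C: "\<And>k. orthonormal (C k)" "\<And>y. (\<lambda>k. onproj (C k) y) \<longlonglongrightarrow> y"
    and tight: "\<And>\<epsilon>. \<epsilon> > 0 \<Longrightarrow> eventually (\<lambda>k. eventually (\<lambda>n. integrable (\<rho> n) (\<lambda>y. (norm (y - onproj (C k) y))\<^sup>2)
           \<and> (\<integral>y. (norm (y - onproj (C k) y))\<^sup>2 \<partial>\<rho> n) \<le> \<epsilon>) sequentially) sequentially"
    and \<psi>: "continuous_on UNIV \<psi>"
  shows "(\<lambda>n. \<integral>y. \<psi> (exp (- (norm y)\<^sup>2)) \<partial>\<rho> n) \<longlonglongrightarrow> (\<integral>y. (\<psi> (exp (- (norm y)\<^sup>2)) :: real) \<partial>\<rho>\<^sub>0)"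
proof (rule tendsto_integral_of_moments[OF \<rho>n(1) _ \<rho>(1) _ _ _ _ \<psi>])
  show "measure (\<rho> n) (space (\<rho> n)) \<le> B" for n
    using \<rho>n(3) by (simp add: sets_eq_imp_space_eq[OF \<rho>n(2)])
  note [measurable_cong] = \<rho>n(2) \<rho>(2)
  show "(\<lambda>y. exp (- (norm y)\<^sup>2)) \<in> borel_measurable (\<rho> n)" for n by measurable
  show "(\<lambda>y. exp (- (norm y)\<^sup>2)) \<in> borel_measurable \<rho>\<^sub>0" by measurable
  show "(\<lambda>n. \<integral>y. exp (- (norm y)\<^sup>2) ^ k \<partial>\<rho> n) \<longlonglongrightarrow> (\<integral>y. exp (- (norm y)\<^sup>2) ^ k \<partial>\<rho>\<^sub>0)" for k
    using tendsto_laplace_norm[OF \<rho>n \<rho> lim C tight, of "real k"]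
    by (simp add: exp_of_nat_mult[symmetric])
qed auto

section \<open>Convolution powers\<close>

definition conv :: "'h::{second_countable_topology, real_normed_vector} measure \<Rightarrow> 'h measure \<Rightarrow> 'h measure" where
  "conv \<mu> \<nu> = distr (\<mu> \<Otimes>\<^sub>M \<nu>) borel (\<lambda>(x, y). x + y)"

text \<open>The law of a sum of n independent vectors with law \<mu>. Working with laws spares the
  construction of independent tilted vectors on some probability space.\<close>

primrec cpow :: "'h::{second_countable_topology, real_normed_vector} measure \<Rightarrow> nat \<Rightarrow> 'h measure" where
  "cpow \<mu> 0 = return borel 0"
| "cpow \<mu> (Suc n) = conv (cpow \<mu> n) \<mu>"

definition bprob :: "'h::topological_space measure \<Rightarrow> bool" where
  "bprob \<mu> \<longleftrightarrow> prob_space \<mu> \<and> sets \<mu> = sets borel"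

lemma bprobD: "bprob \<mu> \<Longrightarrow> prob_space \<mu>" "bprob \<mu> \<Longrightarrow> sets \<mu> = sets borel"
  "bprob \<mu> \<Longrightarrow> space \<mu> = UNIV" "bprob \<mu> \<Longrightarrow> finite_measure \<mu>"
  by (auto simp: bprob_def dest: sets_eq_imp_space_eq intro: prob_space.axioms)

lemma sets_conv [simp, measurable_cong]: "sets (conv \<mu> \<nu>) = sets borel"
  by (simp add: conv_def)

lemma bprob_conv:
  fixes \<mu> \<nu> :: "'h::{second_countable_topology, real_normed_vector} measure"
  assumes "bprob \<mu>" "bprob \<nu>"
  shows "bprob (conv \<mu> \<nu>)"
proof -
  note [measurable_cong] = bprobD(2)[OF assms(1)] bprobD(2)[OF assms(2)]
  interpret pair_prob_space \<mu> \<nu>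
    using assms by (auto intro!: pair_prob_space.intro pair_sigma_finite.intro simp: bprob_def prob_space_imp_sigma_finite)
  show ?thesis unfolding bprob_def conv_def by (auto intro!: prob_space_distr)
qed

lemma bprob_cpow: "bprob \<mu> \<Longrightarrow> bprob (cpow \<mu> n)"
  by (induction n) (auto intro!: bprob_conv, simp add: bprob_def prob_space_return)

lemma nn_integral_conv:
  fixes \<mu> \<nu> :: "'h::{second_countable_topology, real_normed_vector} measure"
  assumes "bprob \<mu>" "bprob \<nu>" "f \<in> borel_measurable borel"
  shows "(\<integral>\<^sup>+x. f x \<partial>conv \<mu> \<nu>) = (\<integral>\<^sup>+x. \<integral>\<^sup>+y. f (x + y) \<partial>\<nu> \<partial>\<mu>)"
proof -
  note [measurable_cong] = bprobD(2)[OF assms(1)] bprobD(2)[OF assms(2)]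
  note [measurable] = assms(3)
  interpret pair_prob_space \<mu> \<nu>
    using assms by (auto intro!: pair_prob_space.intro pair_sigma_finite.intro simp: bprob_def prob_space_imp_sigma_finite)
  show ?thesis
    unfolding conv_def by (simp add: nn_integral_distr M2.nn_integral_fst[symmetric])
qed

lemma integrable_conv:
  fixes \<mu> \<nu> :: "'h::{second_countable_topology, real_normed_vector} measure"
    and f :: "'h \<Rightarrow> 'b::{banach, second_countable_topology}"
  assumes "bprob \<mu>" "bprob \<nu>" "f \<in> borel_measurable borel"
  shows "integrable (conv \<mu> \<nu>) f \<longleftrightarrow> integrable (\<mu> \<Otimes>\<^sub>M \<nu>) (\<lambda>(x, y). f (x + y))"
proof -
  note [measurable_cong] = bprobD(2)[OF assms(1)] bprobD(2)[OF assms(2)]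
  note [measurable] = assms(3)
  show ?thesis
    unfolding conv_def by (subst integrable_distr_eq) (auto simp: case_prod_unfold)
qed

lemma integral_conv:
  fixes \<mu> \<nu> :: "'h::{second_countable_topology, real_normed_vector} measure"
    and f :: "'h \<Rightarrow> 'b::{banach, second_countable_topology}"
  assumes "bprob \<mu>" "bprob \<nu>" "f \<in> borel_measurable borel" "integrable (conv \<mu> \<nu>) f"
  shows "(\<integral>x. f x \<partial>conv \<mu> \<nu>) = (\<integral>x. \<integral>y. f (x + y) \<partial>\<nu> \<partial>\<mu>)"
proof -
  note [measurable_cong] = bprobD(2)[OF assms(1)] bprobD(2)[OF assms(2)]
  note [measurable] = assms(3)
  interpret pair_prob_space \<mu> \<nu>
    using assms by (auto intro!: pair_prob_space.intro pair_sigma_finite.intro simp: bprob_def prob_space_imp_sigma_finite)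
  have "(\<integral>x. f x \<partial>conv \<mu> \<nu>) = (\<integral>p. f (fst p + snd p) \<partial>(\<mu> \<Otimes>\<^sub>M \<nu>))"
    unfolding conv_def by (subst integral_distr) (auto simp: case_prod_unfold)
  also have "\<dots> = (\<integral>x. \<integral>y. f (x + y) \<partial>\<nu> \<partial>\<mu>)"
    using integral_fst'[of "\<lambda>p. f (fst p + snd p)"] assms(4) unfolding integrable_conv[OF assms(1-3)]
    by (simp add: case_prod_unfold)
  finally show ?thesis .
qed

lemma integrable_iexp_inner:
  fixes \<mu> :: "'h::{second_countable_topology, real_inner} measure"
  assumes "bprob \<mu>"
  shows "integrable \<mu> (\<lambda>y. iexp (u \<bullet> y))"
proof -
  interpret finite_measure \<mu> by (rule bprobD[OF assms])
  note [measurable_cong] = bprobD(2)[OF assms]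
  show ?thesis by (rule integrable_bounded[where B = 1]) auto
qed

lemma norm_chf_le_1:
  fixes \<mu> :: "'h::{second_countable_topology, real_inner} measure"
  assumes "bprob \<mu>"
  shows "norm (chf \<mu> u) \<le> 1"
proof -
  interpret prob_space \<mu> by (rule bprobD[OF assms])
  have "norm (chf \<mu> u) \<le> (\<integral>y. norm (iexp (u \<bullet> y)) \<partial>\<mu>)" unfolding chf_def by (rule integral_norm_bound)
  also have "\<dots> = 1" by (simp add: prob_space)
  finally show ?thesis .
qed

lemma chf_conv:
  fixes \<mu> \<nu> :: "'h::{second_countable_topology, real_inner} measure"
  assumes "bprob \<mu>" "bprob \<nu>"
  shows "chf (conv \<mu> \<nu>) u = chf \<mu> u * chf \<nu> u"
proof -
  have "chf (conv \<mu> \<nu>) u = (\<integral>x. \<integral>y. iexp (u \<bullet> (x + y)) \<partial>\<nu> \<partial>\<mu>)"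
    unfolding chf_def using assms
    by (intro integral_conv integrable_iexp_inner bprob_conv) auto
  also have "\<dots> = (\<integral>x. iexp (u \<bullet> x) * (\<integral>y. iexp (u \<bullet> y) \<partial>\<nu>) \<partial>\<mu>)"
    by (simp add: inner_add_right exp_add distrib_left)
  finally show ?thesis by (simp add: chf_def)
qed

lemma chf_return: "chf (return borel 0) (u :: 'h::{second_countable_topology, real_inner}) = 1"
  unfolding chf_def by (subst integral_return) auto

lemma chf_cpow:
  fixes \<mu> :: "'h::{second_countable_topology, real_inner} measure"
  assumes "bprob \<mu>"
  shows "chf (cpow \<mu> n) u = chf \<mu> u ^ n"
  by (induction n) (simp_all add: chf_return chf_conv bprob_cpow assms)

text \<open>This cuts a sum into independent blocks. Both sides have the same power of
  \<open>chf \<mu> u\<close> as characteristic function, so uniqueness stands in for associativity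
  of the convolution.\<close>

lemma cpow_add:
  fixes \<mu> :: "'h::{second_countable_topology, real_inner} measure"
  assumes "bprob \<mu>"
  shows "cpow \<mu> (m + n) = conv (cpow \<mu> m) (cpow \<mu> n)"
  by (rule chf_unique)
    (auto intro!: bprobD(4,2) bprob_conv bprob_cpow assms simp: chf_cpow[OF assms] chf_conv[OF bprob_cpow bprob_cpow] assms power_add)

lemma (in pair_prob_space) integrable_pair_components:
  fixes f :: "_ \<Rightarrow> 'c::{banach, second_countable_topology}" and g :: "_ \<Rightarrow> 'd::{banach, second_countable_topology}"
  shows "integrable M1 f \<Longrightarrow> integrable (M1 \<Otimes>\<^sub>M M2) (\<lambda>p. f (fst p))"
    and "integrable M2 g \<Longrightarrow> integrable (M1 \<Otimes>\<^sub>M M2) (\<lambda>p. g (snd p))"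
proof -
  show "integrable (M1 \<Otimes>\<^sub>M M2) (\<lambda>p. f (fst p))" if "integrable M1 f"
    using integrable_distr[of fst "M1 \<Otimes>\<^sub>M M2" M1 f] that by (simp add: M2.distr_pair_fst)
  show "integrable (M1 \<Otimes>\<^sub>M M2) (\<lambda>p. g (snd p))" if "integrable M2 g"
  proof -
    interpret Q: pair_prob_space M2 M1 ..
    have "integrable (M2 \<Otimes>\<^sub>M M1) (\<lambda>p. g (fst p))"
      using integrable_distr[of fst "M2 \<Otimes>\<^sub>M M1" M2 g] that by (simp add: M1.distr_pair_fst)
    from Q.integrable_product_swap[OF this] show ?thesis by (simp add: case_prod_unfold)
  qed
qed

lemma integrable_of_square:
  fixes f :: "'a \<Rightarrow> 'b::{banach, second_countable_topology}"
  assumes "finite_measure M" "f \<in> borel_measurable M" "integrable M (\<lambda>x. (norm (f x))\<^sup>2)"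
  shows "integrable M f"
proof (rule Bochner_Integration.integrable_bound)
  interpret finite_measure M by fact
  show "integrable M (\<lambda>x. 1 + (norm (f x))\<^sup>2)" using assms(3) by simp
  show "AE x in M. norm (f x) \<le> norm (1 + (norm (f x))\<^sup>2)"
  proof (rule AE_I2)
    fix x
    have "0 \<le> (norm (f x) - 1)\<^sup>2" by simp
    then have "2 * norm (f x) \<le> 1 + (norm (f x))\<^sup>2" by (simp add: power2_diff)
    moreover have "0 \<le> norm (f x)" by simp
    ultimately have "norm (f x) \<le> 1 + (norm (f x))\<^sup>2" by linarith
    then show "norm (f x) \<le> norm (1 + (norm (f x))\<^sup>2)" by simp
  qed
qed fact

lemma norm_inner_le_squares: "\<bar>x \<bullet> y\<bar> \<le> (norm x)\<^sup>2 + (norm (y :: 'a::real_inner))\<^sup>2"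
proof -
  have "0 \<le> (norm x - norm y)\<^sup>2" by simp
  then have "2 * (norm x * norm y) \<le> (norm x)\<^sup>2 + (norm y)\<^sup>2" by (simp add: power2_diff algebra_simps)
  moreover have "0 \<le> norm x * norm y" by simp
  ultimately show ?thesis using Cauchy_Schwarz_ineq2[of x y] by linarith
qed

lemma conv_second_moment:
  fixes \<mu> \<nu> :: "'h::{second_countable_topology, real_inner, banach} measure"
  assumes \<mu>: "bprob \<mu>" and \<nu>: "bprob \<nu>"
    and i\<mu>: "integrable \<mu> (\<lambda>x. (norm x)\<^sup>2)" and i\<nu>: "integrable \<nu> (\<lambda>x. (norm x)\<^sup>2)"
  shows "integrable (conv \<nu> \<mu>) (\<lambda>x. (norm x)\<^sup>2)"
    "(\<integral>x. x \<partial>conv \<nu> \<mu>) = (\<integral>x. x \<partial>\<nu>) + (\<integral>x. x \<partial>\<mu>)"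
    "(\<integral>x. (norm x)\<^sup>2 \<partial>conv \<nu> \<mu>) = (\<integral>x. (norm x)\<^sup>2 \<partial>\<nu>) + (\<integral>x. (norm x)\<^sup>2 \<partial>\<mu>) + 2 * ((\<integral>x. x \<partial>\<nu>) \<bullet> (\<integral>x. x \<partial>\<mu>))"
proof -
  interpret \<mu>: prob_space \<mu> by (rule bprobD[OF \<mu>])
  interpret \<nu>: prob_space \<nu> by (rule bprobD[OF \<nu>])
  interpret pair_prob_space \<nu> \<mu> ..
  note [measurable_cong] = bprobD(2)[OF \<mu>] bprobD(2)[OF \<nu>]
  have j\<mu>: "integrable \<mu> (\<lambda>x. x)" by (rule integrable_of_square[OF _ _ i\<mu>]) (unfold_locales, measurable)
  have j\<nu>: "integrable \<nu> (\<lambda>x. x)" by (rule integrable_of_square[OF _ _ i\<nu>]) (unfold_locales, measurable)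
  note c = integrable_pair_components
  have p: "integrable (\<nu> \<Otimes>\<^sub>M \<mu>) (\<lambda>p. fst p \<bullet> snd p)"
  proof (rule Bochner_Integration.integrable_bound)
    show "integrable (\<nu> \<Otimes>\<^sub>M \<mu>) (\<lambda>p. (norm (fst p))\<^sup>2 + (norm (snd p))\<^sup>2)"
      by (intro Bochner_Integration.integrable_add c(1)[OF i\<nu>] c(2)[OF i\<mu>])
    show "AE p in \<nu> \<Otimes>\<^sub>M \<mu>. norm (fst p \<bullet> snd p) \<le> norm ((norm (fst p))\<^sup>2 + (norm (snd p))\<^sup>2)"
      using norm_inner_le_squares by auto
  qed measurable
  have exp: "(norm (x + y))\<^sup>2 = (norm x)\<^sup>2 + (norm y)\<^sup>2 + 2 * (x \<bullet> y)" for x y :: 'h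
    unfolding power2_norm_eq_inner by (simp add: inner_add_left inner_add_right inner_commute)
  have p2: "integrable (\<nu> \<Otimes>\<^sub>M \<mu>) (\<lambda>p. (norm (fst p + snd p))\<^sup>2)"
    unfolding exp using p c(1)[OF i\<nu>] c(2)[OF i\<mu>] by auto
  then show i2: "integrable (conv \<nu> \<mu>) (\<lambda>x. (norm x)\<^sup>2)"
    by (subst integrable_conv[OF \<nu> \<mu>]) (auto simp: case_prod_unfold)
  have i1: "integrable (conv \<nu> \<mu>) (\<lambda>x. x)"
    by (rule integrable_of_square[OF _ _ i2]) (auto intro!: bprobD(4) bprob_conv \<mu> \<nu>)
  show "(\<integral>x. x \<partial>conv \<nu> \<mu>) = (\<integral>x. x \<partial>\<nu>) + (\<integral>x. x \<partial>\<mu>)"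
    by (subst integral_conv[OF \<nu> \<mu> _ i1]) (simp_all add: j\<mu> j\<nu> \<mu>.prob_space \<nu>.prob_space)
  have "(\<integral>x. (norm x)\<^sup>2 \<partial>conv \<nu> \<mu>) = (\<integral>x. (\<integral>y. (norm x)\<^sup>2 + (norm y)\<^sup>2 + 2 * (x \<bullet> y) \<partial>\<mu>) \<partial>\<nu>)"
    by (subst integral_conv[OF \<nu> \<mu> _ i2]) (simp_all add: exp)
  also have "\<dots> = (\<integral>x. (norm x)\<^sup>2 + (\<integral>y. (norm y)\<^sup>2 \<partial>\<mu>) + 2 * (x \<bullet> (\<integral>y. y \<partial>\<mu>)) \<partial>\<nu>)"
    by (simp add: i\<mu> j\<mu> \<mu>.prob_space integral_inner_right)
  also have "\<dots> = (\<integral>x. (norm x)\<^sup>2 \<partial>\<nu>) + (\<integral>x. (norm x)\<^sup>2 \<partial>\<mu>) + 2 * ((\<integral>x. x \<partial>\<nu>) \<bullet> (\<integral>x. x \<partial>\<mu>))"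
    by (simp add: i\<nu> j\<nu> \<nu>.prob_space integral_inner_left)
  finally show "(\<integral>x. (norm x)\<^sup>2 \<partial>conv \<nu> \<mu>) = (\<integral>x. (norm x)\<^sup>2 \<partial>\<nu>) + (\<integral>x. (norm x)\<^sup>2 \<partial>\<mu>) + 2 * ((\<integral>x. x \<partial>\<nu>) \<bullet> (\<integral>x. x \<partial>\<mu>))" .
qed

text \<open>Each of the n (n - 1) ordered pairs of distinct summands contributes the squared norm of
  the mean. This term matters because the tilted laws are recentred only approximately.\<close>

lemma cpow_second_moment:
  fixes \<mu> :: "'h::{second_countable_topology, real_inner, banach} measure"
  assumes \<mu>: "bprob \<mu>" and int: "integrable \<mu> (\<lambda>x. (norm x)\<^sup>2)"
  shows "integrable (cpow \<mu> n) (\<lambda>x. (norm x)\<^sup>2)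
    \<and> (\<integral>x. x \<partial>cpow \<mu> n) = real n *\<^sub>R (\<integral>x. x \<partial>\<mu>)
    \<and> (\<integral>x. (norm x)\<^sup>2 \<partial>cpow \<mu> n) = real n * (\<integral>x. (norm x)\<^sup>2 \<partial>\<mu>) + real n * (real n - 1) * (norm (\<integral>x. x \<partial>\<mu>))\<^sup>2"
proof (induction n)
  case 0
  have "integrable (return borel 0) (\<lambda>x::'h. (norm x)\<^sup>2)"
    by (rule integrableI_bounded) (auto simp: nn_integral_return)
  then show ?case by (auto simp: integral_return)
next
  case (Suc n)
  then show ?case
    using conv_second_moment[OF \<mu> bprob_cpow[OF \<mu>, of n] int, of]
    by (auto simp: algebra_simps power2_norm_eq_inner)
qed

lemma cpow_second_moment_le:
  fixes \<mu> :: "'h::{second_countable_topology, real_inner, banach} measure"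
  assumes \<mu>: "bprob \<mu>" and int: "integrable \<mu> (\<lambda>x. (norm x)\<^sup>2)" and "k \<le> n"
  shows "(\<integral>x. (norm x)\<^sup>2 \<partial>cpow \<mu> k) \<le> real n * (\<integral>x. (norm x)\<^sup>2 \<partial>\<mu>) + (real n * norm (\<integral>x. x \<partial>\<mu>))\<^sup>2"
proof -
  have "(\<integral>x. (norm x)\<^sup>2 \<partial>cpow \<mu> k) = real k * (\<integral>x. (norm x)\<^sup>2 \<partial>\<mu>) + real k * (real k - 1) * (norm (\<integral>x. x \<partial>\<mu>))\<^sup>2"
    using cpow_second_moment[OF \<mu> int] by blast
  also have "\<dots> \<le> real n * (\<integral>x. (norm x)\<^sup>2 \<partial>\<mu>) + (real n * real n) * (norm (\<integral>x. x \<partial>\<mu>))\<^sup>2"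
  proof (intro add_mono mult_right_mono)
    show "real k * (real k - 1) \<le> real n * real n"
      using \<open>k \<le> n\<close> by (cases "k = 0") (auto intro!: mult_mono)
  qed (use \<open>k \<le> n\<close> in auto)
  finally show ?thesis unfolding power_mult_distrib by (simp only: power2_eq_square[of "real n"])
qed

lemma chf_distr:
  fixes \<mu> :: "'h::{second_countable_topology, real_inner} measure"
  assumes "sets \<mu> = sets borel" and "T \<in> borel_measurable borel"
  shows "chf (distr \<mu> borel T) (u :: 'k::{second_countable_topology, real_inner}) = (\<integral>x. iexp (u \<bullet> T x) \<partial>\<mu>)"
proof -
  note [measurable_cong] = assms(1)
  note [measurable] = assms(2)
  show ?thesis unfolding chf_def by (subst integral_distr) auto
qed

text \<open>It lets second moments of a projected sum be computed from those of a sum of projected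
  vectors.\<close>

lemma cpow_distr_linear:
  fixes \<mu> :: "'h::{second_countable_topology, real_inner} measure"
    and A :: "'h \<Rightarrow> 'k::{second_countable_topology, real_inner}"
  assumes \<mu>: "bprob \<mu>" and A: "bounded_linear A"
  shows "cpow (distr \<mu> borel A) n = distr (cpow \<mu> n) borel A"
proof -
  interpret A: bounded_linear A by fact
  have [measurable]: "A \<in> borel_measurable borel"
    by (intro borel_measurable_continuous_onI A.continuous_on continuous_on_id)
  show ?thesis
  proof (induction n)
    case 0
    have "distr (return borel 0) borel A = return borel (A 0)" by (rule distr_return) auto
    then show ?case by (simp add: A.zero)
  next
    case (Suc n)
    let ?\<nu> = "cpow \<mu> n"
    have \<nu>: "bprob ?\<nu>" by (rule bprob_cpow[OF \<mu>])
    interpret \<mu>: prob_space \<mu> by (rule bprobD[OF \<mu>])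
    interpret \<nu>: prob_space ?\<nu> by (rule bprobD[OF \<nu>])
    note [measurable_cong] = bprobD(2)[OF \<mu>] bprobD(2)[OF \<nu>]
    have "cpow (distr \<mu> borel A) (Suc n) = distr (distr ?\<nu> borel A \<Otimes>\<^sub>M distr \<mu> borel A) borel (\<lambda>(x, y). x + y)"
      by (simp add: Suc conv_def)
    also have "\<dots> = distr (distr (?\<nu> \<Otimes>\<^sub>M \<mu>) (borel \<Otimes>\<^sub>M borel) (\<lambda>(x, y). (A x, A y))) borel (\<lambda>(x, y). x + y)"
      by (subst pair_measure_distr)
        (auto intro!: prob_space_imp_sigma_finite \<mu>.prob_space_distr)
    also have "\<dots> = distr (distr (?\<nu> \<Otimes>\<^sub>M \<mu>) borel (\<lambda>(x, y). x + y)) borel A"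
      by (subst (1 2) distr_distr) (auto simp: comp_def case_prod_unfold A.add intro!: measurable_Pair)
    finally show ?case by (simp add: conv_def)
  qed
qed

section \<open>A local limit theorem in one direction\<close>

lemma normal_density_fourier:
  assumes "s > 0"
  shows "complex_of_real (normal_density c s x)
    = (1 / (sqrt (2 * pi) * s)) * (\<integral>z. iexp (z * ((x - c) / s)) \<partial>std_normal_distribution)"
proof -
  have "(\<integral>z. iexp (z * ((x - c) / s)) \<partial>std_normal_distribution) = of_real (exp (- ((1/2) * ((x - c) / s)\<^sup>2)))"
    by (subst exp_neg_square_eq) (simp_all add: mult.commute)
  moreover have "normal_density c s x = (1 / (sqrt (2 * pi) * s)) * exp (- ((1/2) * ((x - c) / s)\<^sup>2))"
    using assms by (simp add: normal_density_def real_sqrt_mult power_divide)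
  ultimately show ?thesis by (simp only: of_real_mult)
qed

lemma borel_measurable_chf [measurable]:
  fixes \<nu> :: "'h::{second_countable_topology, real_inner} measure"
  assumes "bprob \<nu>"
  shows "chf \<nu> \<in> borel_measurable borel"
proof -
  interpret prob_space \<nu> by (rule bprobD[OF assms])
  note [measurable_cong] = bprobD(2)[OF assms]
  have "(\<lambda>u. \<integral>y. iexp (u \<bullet> y) \<partial>\<nu>) \<in> borel_measurable borel" by measurable
  then show ?thesis unfolding chf_def[abs_def] .
qed

text \<open>The kernel is an average of characters, so integrating it against \<nu> and exchanging
  the integrals expresses the left side through values of \<open>chf \<nu>\<close> on a line in
  direction g. The factor M compensates for the spreading of M (g \<bullet> y) and is absorbed by
  the Jacobian of the substitution.\<close>

lemma fourier_normal_weight: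
  fixes \<nu> :: "'h::{second_countable_topology, real_inner} measure"
  assumes \<nu>: "bprob \<nu>" and s: "s > 0" and M: "M > 0"
  shows "M * (\<integral>y. of_real (normal_density c s (M * (g \<bullet> y))) * iexp (u \<bullet> y) \<partial>\<nu>)
     = (1 / sqrt (2 * pi)) * (\<integral>w. of_real (std_normal_density (w * s / M)) * iexp (- (w * c / M)) * chf \<nu> (w *\<^sub>R g + u) \<partial>lborel)"
proof -
  let ?N = std_normal_distribution
  interpret N: real_distribution ?N by (rule real_dist_normal_dist)
  interpret \<nu>: prob_space \<nu> by (rule bprobD[OF \<nu>])
  interpret P: pair_prob_space ?N \<nu> ..
  note [measurable_cong] = bprobD(2)[OF \<nu>]
  note [measurable] = borel_measurable_chf[OF \<nu>]
  define F where "F z = iexp (- (z * c / s)) * chf \<nu> ((z * M / s) *\<^sub>R g + u)" for z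
  have [measurable]: "F \<in> borel_measurable borel" unfolding F_def[abs_def] by measurable
  have "(\<integral>y. of_real (normal_density c s (M * (g \<bullet> y))) * iexp (u \<bullet> y) \<partial>\<nu>)
     = (\<integral>y. (1 / (sqrt (2 * pi) * s)) * (\<integral>z. iexp (z * ((M * (g \<bullet> y) - c) / s)) * iexp (u \<bullet> y) \<partial>?N) \<partial>\<nu>)"
    unfolding normal_density_fourier[OF s] by (simp only: integral_mult_left_zero mult.assoc)
  also have "\<dots> = (1 / (sqrt (2 * pi) * s)) * (\<integral>y. (\<integral>z. iexp (z * ((M * (g \<bullet> y) - c) / s)) * iexp (u \<bullet> y) \<partial>?N) \<partial>\<nu>)"
    by (rule integral_mult_right_zero)
  also have "(\<integral>y. (\<integral>z. iexp (z * ((M * (g \<bullet> y) - c) / s)) * iexp (u \<bullet> y) \<partial>?N) \<partial>\<nu>)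
     = (\<integral>z. (\<integral>y. iexp (z * ((M * (g \<bullet> y) - c) / s)) * iexp (u \<bullet> y) \<partial>\<nu>) \<partial>?N)"
  proof (rule P.Fubini_integral)
    show "integrable (?N \<Otimes>\<^sub>M \<nu>) (\<lambda>(z, y). iexp (z * ((M * (g \<bullet> y) - c) / s)) * iexp (u \<bullet> y))"
      by (rule finite_measure.integrable_bounded[where B = 1], unfold_locales) (auto simp: norm_mult)
  qed
  also have "\<dots> = (\<integral>z. F z \<partial>?N)"
  proof (rule Bochner_Integration.integral_cong[OF refl])
    fix z
    have "iexp (z * ((M * (g \<bullet> y) - c) / s)) * iexp (u \<bullet> y) = iexp (- (z * c / s)) * iexp (((z * M / s) *\<^sub>R g + u) \<bullet> y)" for y
      by (simp add: exp_add[symmetric] inner_add_left) (simp add: field_simps diff_divide_distrib)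
    then show "(\<integral>y. iexp (z * ((M * (g \<bullet> y) - c) / s)) * iexp (u \<bullet> y) \<partial>\<nu>) = F z"
      unfolding F_def chf_def by (simp only: integral_mult_right_zero)
  qed
  also have "\<dots> = (\<integral>z. std_normal_density z *\<^sub>R F z \<partial>lborel)"
    by (rule integral_density) auto
  \<comment> \<open>The substitution z = (s / M) w makes w the frequency along g, the scale on which
    the characteristic functions converge.\<close>
  also have "\<dots> = \<bar>s / M\<bar> *\<^sub>R (\<integral>w. std_normal_density (0 + (s / M) * w) *\<^sub>R F (0 + (s / M) * w) \<partial>lborel)"
    by (rule lborel_integral_real_affine) (use s M in simp)
  also have "(\<lambda>w. std_normal_density (0 + (s / M) * w) *\<^sub>R F (0 + (s / M) * w))
    = (\<lambda>w. of_real (std_normal_density (w * s / M)) * iexp (- (w * c / M)) * chf \<nu> (w *\<^sub>R g + u))"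
    using s M by (simp add: F_def scaleR_conv_of_real fun_eq_iff mult.commute[of s] mult.assoc)
  finally show ?thesis using s M by (simp add: scaleR_conv_of_real field_simps)
qed

text \<open>The centre c enters the Fourier formula through a factor of modulus 1 only, so the bound
  is uniform in c.\<close>

lemma norm_integral_normal_weight_le:
  fixes \<nu> :: "'h::{second_countable_topology, real_inner} measure"
  assumes \<nu>: "bprob \<nu>" and s: "s > 0" and M: "M > 0"
    and D: "integrable lborel D" "\<And>w. std_normal_density (w * s / M) * norm (chf \<nu> (w *\<^sub>R g)) \<le> D w"
  shows "M * (\<integral>y. normal_density c s (M * (g \<bullet> y)) \<partial>\<nu>) \<le> (1 / sqrt (2 * pi)) * (\<integral>w. D w \<partial>lborel)"
proof -
  note [measurable] = borel_measurable_chf[OF \<nu>]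
  have "M * (\<integral>y. normal_density c s (M * (g \<bullet> y)) \<partial>\<nu>) = Re (M * (\<integral>y. of_real (normal_density c s (M * (g \<bullet> y))) * iexp (0 \<bullet> y) \<partial>\<nu>))"
    by simp
  also have "\<dots> \<le> norm (M * (\<integral>y. of_real (normal_density c s (M * (g \<bullet> y))) * iexp (0 \<bullet> y) \<partial>\<nu>))"
    by (rule complex_Re_le_cmod)
  also have "\<dots> = (1 / sqrt (2 * pi)) * norm (\<integral>w. of_real (std_normal_density (w * s / M)) * iexp (- (w * c / M)) * chf \<nu> (w *\<^sub>R g + 0) \<partial>lborel)"
    unfolding fourier_normal_weight[OF \<nu> s M] by (simp add: norm_mult norm_divide)
  also have "\<dots> \<le> (1 / sqrt (2 * pi)) * (\<integral>w. norm (of_real (std_normal_density (w * s / M)) * iexp (- (w * c / M)) * chf \<nu> (w *\<^sub>R g + 0)) \<partial>lborel)"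
    by (intro mult_left_mono integral_norm_bound) simp
  also have "\<dots> \<le> (1 / sqrt (2 * pi)) * (\<integral>w. D w \<partial>lborel)"
  proof (intro mult_left_mono integral_mono')
    fix w show "norm (of_real (std_normal_density (w * s / M)) * iexp (- (w * c / M)) * chf \<nu> (w *\<^sub>R g + 0)) \<le> D w"
      using D(2)[of w] by (simp add: norm_mult)
    then show "0 \<le> D w" using norm_ge_zero order_trans by blast
  qed (use D in auto)
  finally show ?thesis .
qed

text \<open>The common majorant of the frequency integrals: exponential decay in w^2 and exponential
  decay in |w| are both weakened to this form.\<close>

lemma integrable_inverse_1_plus_scaled_square:
  assumes "e > 0"
  shows "integrable lborel (\<lambda>w::real. L / (1 + e * w\<^sup>2))"
proof -
  have "integrable lborel (\<lambda>x::real. inverse (1 + x\<^sup>2))"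
    using integrable_inverse_1_plus_square by (simp add: set_integrable_def einterval_def)
  from lborel_integrable_real_affine[OF this, of "sqrt e" 0]
  have "integrable lborel (\<lambda>x::real. inverse (1 + e * x\<^sup>2))"
    using assms by (simp add: power_mult_distrib)
  then show ?thesis by (simp add: divide_inverse)
qed

lemma exp_neg_le_inverse:
  fixes x :: real assumes "x \<ge> 0"
  shows "exp (- x) \<le> 1 / (1 + x)"
  using exp_ge_add_one_self[of x] assms by (simp add: exp_minus inverse_eq_divide frac_le)

lemma exp_neg_le_inverse_square:
  fixes x :: real assumes "x \<ge> 0"
  shows "exp (- x) \<le> 1 / (1 + x\<^sup>2 / 2)"
proof -
  have "1 + x + x\<^sup>2 / 2 \<le> exp x" using exp_lower_Taylor_quadratic[OF assms] by simp
  then have "1 + x\<^sup>2 / 2 \<le> exp x" using assms by linarith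
  moreover have "0 < 1 + x\<^sup>2 / 2" by (simp add: add_pos_nonneg)
  ultimately show ?thesis by (simp add: exp_minus inverse_eq_divide frac_le)
qed

lemma std_normal_density_le: "std_normal_density x \<le> exp (- x\<^sup>2 / 2)"
proof -
  have "1 / sqrt (2 * pi) \<le> 1" using pi_gt3 by simp
  then show ?thesis unfolding std_normal_density_def by (intro mult_left_le_one_le) simp_all
qed

text \<open>
  \<open>cpow (\<zeta> n) n\<close> is the law of a normalised sum, asymptotically Gaussian with covariance form \<open>q\<close>, and
  \<open>\<zeta>0\<close> is the law of the part of the Gaussian limit that is independent of the direction \<open>g\<close>.
  The \<open>decay\<close> assumption controls the frequencies not reached by \<open>clt\<close>; those with
  \<open>\<bar>w\<bar> > \<delta> sqrt n\<close> are suppressed by the smoothing kernel because of \<open>m_sq\<close>.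
\<close>

locale local_limit =
  fixes \<zeta> :: "nat \<Rightarrow> 'h::{real_inner, banach, second_countable_topology} measure"
    and m :: "nat \<Rightarrow> real" and g a0 :: 'h and \<sigma> :: real and q :: "'h \<Rightarrow> real" and \<zeta>0 :: "'h measure"
  assumes \<zeta>: "\<And>n. bprob (\<zeta> n)" and \<zeta>0: "bprob \<zeta>0"
    and \<zeta>_sq: "\<And>n. integrable (\<zeta> n) (\<lambda>x. (norm x)\<^sup>2)"
    and m_pos: "\<And>n. n \<ge> 1 \<Longrightarrow> m n > 0" and m_top: "filterlim m at_top sequentially"
    and m_sq: "eventually (\<lambda>n. (m n)\<^sup>2 \<le> sqrt n) sequentially"
    and \<sigma>: "\<sigma> > 0"
    and q: "\<And>w u. q (w *\<^sub>R g + u) = \<sigma>\<^sup>2 * w\<^sup>2 + 2 * w * (a0 \<bullet> u) + q u"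
    and chf_\<zeta>0: "\<And>u. chf \<zeta>0 u = exp (- (q u - (a0 \<bullet> u)\<^sup>2 / \<sigma>\<^sup>2) / 2)"
    and clt: "\<And>h. (\<lambda>n. chf (\<zeta> n) h ^ n) \<longlonglongrightarrow> exp (- q h / 2)"
    and decay: "\<And>u. \<exists>K c \<delta>. c > 0 \<and> \<delta> > 0 \<and> eventually (\<lambda>n. \<forall>w. K \<le> \<bar>w\<bar> \<and> \<bar>w\<bar> \<le> \<delta> * sqrt n
        \<longrightarrow> norm (chf (\<zeta> n) (w *\<^sub>R g + u)) \<le> exp (- (c * w\<^sup>2 / n))) sequentially"
begin

lemma eventually_m_pos: "eventually (\<lambda>n. m n > 0) sequentially"
  using eventually_ge_at_top[of 1] by eventually_elim (rule m_pos)

text \<open>There are three ranges of w. For |w| < K the trivial bound 1 suffices; up to \<delta>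
  sqrt n the characteristic function decays; beyond that the kernel is small because
  \<open>(m n)\<^sup>2\<close> is at most sqrt n. The condition n \<le> 3 k admits both the whole
  sum and each of its halves.\<close>

lemma dominated:
  assumes s: "s > 0"
  obtains L e where "e > 0" "eventually (\<lambda>n. \<forall>k w. n \<le> 3 * k \<longrightarrow> k \<le> n \<longrightarrow>
       std_normal_density (w * s / m n) * norm (chf (\<zeta> n) (w *\<^sub>R g + u) ^ k) \<le> L / (1 + e * w\<^sup>2)) sequentially"
proof -
  obtain K c \<delta> where c: "c > 0" and \<delta>: "\<delta> > 0" and ev: "eventually (\<lambda>n. \<forall>w. K \<le> \<bar>w\<bar> \<and> \<bar>w\<bar> \<le> \<delta> * sqrt n
        \<longrightarrow> norm (chf (\<zeta> n) (w *\<^sub>R g + u)) \<le> exp (- (c * w\<^sup>2 / n))) sequentially"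
    using decay by blast
  \<comment> \<open>Beyond \<delta> sqrt n, \<open>m_sq\<close> yields \<delta> m^2 \<le> |w|, hence
    (w s / m)^2 / 2 \<ge> d |w|.\<close>
  define d where "d = \<delta> * s\<^sup>2 / 2"
  have d: "d > 0" using \<delta> s by (simp add: d_def)
  \<comment> \<open>The first entry comes from k / n \<ge> 1 / 3 in the middle range, the second
    from exp (- x) \<le> 1 / (1 + x^2 / 2) at x = d |w|. The constant L below lifts the majorant to
    at least 1 where |w| < K.\<close>
  define e where "e = min (c / 3) (d\<^sup>2 / 2)"
  have e: "e > 0" "e \<le> c / 3" "e \<le> d\<^sup>2 / 2" using c d by (auto simp: e_def)
  define L where "L = 1 + e * K\<^sup>2"
  have L1: "L \<ge> 1" using e(1) by (simp add: L_def)
  have frac: "x \<le> L / (1 + e * w\<^sup>2)" if "x \<le> 1 / (1 + e * w\<^sup>2)" for x w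
    using that L1 e(1) by (intro order_trans[OF that] divide_right_mono) (auto intro: add_nonneg_nonneg)
  have le1: "norm (chf (\<zeta> n) v ^ k) \<le> 1" for n v k
    using norm_chf_le_1[OF \<zeta>] by (simp add: norm_power power_le_one)
  have std1: "std_normal_density x \<le> 1" for x
    using std_normal_density_le[of x] order_trans by (fastforce simp: )
  have "eventually (\<lambda>n. \<forall>k w. n \<le> 3 * k \<longrightarrow> k \<le> n \<longrightarrow>
       std_normal_density (w * s / m n) * norm (chf (\<zeta> n) (w *\<^sub>R g + u) ^ k) \<le> L / (1 + e * w\<^sup>2)) sequentially"
    using ev m_sq eventually_m_pos eventually_gt_at_top[of 0]
  proof eventually_elim
    case (elim n)
    show ?case
    proof (intro allI impI)
      fix k w assume k: "n \<le> 3 * k" "k \<le> n"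
      let ?S = "std_normal_density (w * s / m n)" and ?C = "norm (chf (\<zeta> n) (w *\<^sub>R g + u) ^ k)"
      consider "\<bar>w\<bar> < K" | "K \<le> \<bar>w\<bar>" "\<bar>w\<bar> \<le> \<delta> * sqrt n" | "\<bar>w\<bar> > \<delta> * sqrt n" by linarith
      then show "?S * ?C \<le> L / (1 + e * w\<^sup>2)"
      proof cases
        case 1
        then have "w\<^sup>2 \<le> K\<^sup>2" by (metis abs_ge_zero less_imp_le power2_abs power_mono)
        then have "1 + e * w\<^sup>2 \<le> L" using e(1) by (simp add: L_def)
        moreover have "0 < 1 + e * w\<^sup>2" using e(1) by (simp add: add_pos_nonneg)
        ultimately have "1 \<le> L / (1 + e * w\<^sup>2)" by simp
        moreover have "?S * ?C \<le> 1 * 1" by (intro mult_mono std1 le1) auto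
        ultimately show ?thesis by simp
      next
        case 2
        then have "norm (chf (\<zeta> n) (w *\<^sub>R g + u)) \<le> exp (- (c * w\<^sup>2 / n))" using elim(1) by blast
        then have "?C \<le> exp (- (c * w\<^sup>2 / n)) ^ k" unfolding norm_power by (intro power_mono) auto
        also have "\<dots> = exp (- (c * w\<^sup>2 * (k / n)))" by (simp add: exp_of_nat_mult[symmetric] field_simps)
        also have "\<dots> \<le> exp (- (e * w\<^sup>2))"
        proof -
          have "1 / 3 \<le> k / n" using k(1) elim(4) by (simp add: field_simps)
          then have "c * (1/3) \<le> c * (k / n)" using c by (intro mult_left_mono) auto
          then have "e \<le> c * (k / n)" using e(2) by (simp only: mult.right_neutral times_divide_eq_right)
          then have "e * w\<^sup>2 \<le> c * (k / n) * w\<^sup>2" by (rule mult_right_mono) simp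
          then show ?thesis by (simp add: mult_ac)
        qed
        also have "\<dots> \<le> 1 / (1 + e * w\<^sup>2)" using e(1) by (intro exp_neg_le_inverse) simp
        finally have "?C \<le> 1 / (1 + e * w\<^sup>2)" .
        then have "?S * ?C \<le> 1 * (1 / (1 + e * w\<^sup>2))" by (intro mult_mono std1) auto
        then show ?thesis by (intro frac) simp
      next
        case 3
        have "(m n)\<^sup>2 > 0" using elim(3) by simp
        have "\<delta> * (m n)\<^sup>2 \<le> \<delta> * sqrt n" using elim(2) \<delta> by (intro mult_left_mono) auto
        then have "\<delta> * (m n)\<^sup>2 \<le> \<bar>w\<bar>" using 3 by linarith
        then have "d * \<bar>w\<bar> * (\<delta> * (m n)\<^sup>2) \<le> d * \<bar>w\<bar> * \<bar>w\<bar>" using d by (intro mult_left_mono) auto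
        then have "d * \<bar>w\<bar> \<le> d * \<bar>w\<bar> * \<bar>w\<bar> / (\<delta> * (m n)\<^sup>2)" using \<delta> \<open>(m n)\<^sup>2 > 0\<close> by (simp add: pos_le_divide_eq)
        also have "\<dots> = (w * s / m n)\<^sup>2 / 2"
          using \<delta> elim(3) by (simp add: d_def power_divide power_mult_distrib) (simp add: power2_eq_square mult_ac)
        finally have 4: "d * \<bar>w\<bar> \<le> (w * s / m n)\<^sup>2 / 2" .
        have "?S \<le> exp (- (w * s / m n)\<^sup>2 / 2)" by (rule std_normal_density_le)
        also have "\<dots> \<le> exp (- (d * \<bar>w\<bar>))" using 4 by simp
        also have "\<dots> \<le> 1 / (1 + (d * \<bar>w\<bar>)\<^sup>2 / 2)" using d by (intro exp_neg_le_inverse_square) simp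
        also have "\<dots> \<le> 1 / (1 + e * w\<^sup>2)"
          using e(1) mult_right_mono[OF e(3), of "w\<^sup>2"]
          by (intro divide_left_mono mult_pos_pos add_pos_nonneg) (auto simp: power_mult_distrib)
        finally have "?S * ?C \<le> (1 / (1 + e * w\<^sup>2)) * 1"
          using e(1) by (intro mult_mono le1) (auto intro: add_nonneg_nonneg)
        then show ?thesis by (intro frac) simp
      qed
    qed
  qed
  with e(1) show ?thesis by (rule that)
qed

text \<open>No window of fixed width, wherever its centre, receives more than order 1 /
  \<open>m n\<close> of the mass of m n (g \<bullet> y), and a third of the summands is enough for
  this. That makes it available for one block of a split sum.\<close>

lemma anticoncentration:
  assumes s: "s > 0"
  obtains B where "B > 0" "eventually (\<lambda>n. \<forall>k c. n \<le> 3 * k \<longrightarrow> k \<le> n \<longrightarrow>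
       m n * (\<integral>y. normal_density c s (m n * (g \<bullet> y)) \<partial>cpow (\<zeta> n) k) \<le> B) sequentially"
proof -
  obtain L e where e: "e > 0" and ev: "eventually (\<lambda>n. \<forall>k w. n \<le> 3 * k \<longrightarrow> k \<le> n \<longrightarrow>
       std_normal_density (w * s / m n) * norm (chf (\<zeta> n) (w *\<^sub>R g + 0) ^ k) \<le> L / (1 + e * w\<^sup>2)) sequentially"
    using dominated[OF s, of 0] by blast
  define B where "B = (1 / sqrt (2 * pi)) * (\<integral>w. L / (1 + e * w\<^sup>2) \<partial>lborel)"
  have "eventually (\<lambda>n. \<forall>k c. n \<le> 3 * k \<longrightarrow> k \<le> n \<longrightarrow>
       m n * (\<integral>y. normal_density c s (m n * (g \<bullet> y)) \<partial>cpow (\<zeta> n) k) \<le> max B 1) sequentially"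
    using ev eventually_m_pos
  proof eventually_elim
    case (elim n)
    show ?case
    proof (intro allI impI)
      fix k c assume "n \<le> 3 * k" "k \<le> n"
      then have "m n * (\<integral>y. normal_density c s (m n * (g \<bullet> y)) \<partial>cpow (\<zeta> n) k) \<le> B"
        unfolding B_def using elim integrable_inverse_1_plus_scaled_square[OF e]
        by (intro norm_integral_normal_weight_le bprob_cpow \<zeta> s) (auto simp: chf_cpow[OF \<zeta>])
      then show "m n * (\<integral>y. normal_density c s (m n * (g \<bullet> y)) \<partial>cpow (\<zeta> n) k) \<le> max B 1" by simp
    qed
  qed
  then show ?thesis using that[of "max B 1"] by simp
qed

text \<open>Completing the square in w leaves
  \<open>q u - (a0 \<bullet> u)\<^sup>2 / \<sigma>\<^sup>2\<close>, the exponent of the part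
  independent of the direction g, times a normal density of total mass 1.\<close>

lemma gauss_integral:
  "(\<integral>w. (1 / sqrt (2 * pi)) *\<^sub>R complex_of_real (exp (- q (w *\<^sub>R g + u) / 2)) \<partial>lborel) = (1 / \<sigma>) *\<^sub>R chf \<zeta>0 u"
proof -
  let ?b = "(a0 \<bullet> u) / \<sigma>\<^sup>2"
  have "(1 / sqrt (2 * pi)) * exp (- q (w *\<^sub>R g + u) / 2)
     = (1 / \<sigma>) * exp (- (q u - (a0 \<bullet> u)\<^sup>2 / \<sigma>\<^sup>2) / 2) * normal_density (- ?b) (1 / \<sigma>) w" for w
  proof -
    have "q (w *\<^sub>R g + u) = \<sigma>\<^sup>2 * (w + ?b)\<^sup>2 + (q u - (a0 \<bullet> u)\<^sup>2 / \<sigma>\<^sup>2)"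
      unfolding q using \<sigma> by (simp add: power2_sum power_divide field_simps power2_eq_square)
    then have "exp (- q (w *\<^sub>R g + u) / 2) = exp (- (q u - (a0 \<bullet> u)\<^sup>2 / \<sigma>\<^sup>2) / 2) * exp (- (w + ?b)\<^sup>2 / (2 * (1 / \<sigma>)\<^sup>2))"
      using \<sigma> by (simp add: exp_add[symmetric] field_simps power_divide)
    then show ?thesis using \<sigma> by (simp add: normal_density_def real_sqrt_mult real_sqrt_divide power_divide)
  qed
  note * = this
  have "(\<lambda>w. (1 / sqrt (2 * pi)) *\<^sub>R complex_of_real (exp (- q (w *\<^sub>R g + u) / 2)))
      = (\<lambda>w. complex_of_real ((1 / \<sigma>) * exp (- (q u - (a0 \<bullet> u)\<^sup>2 / \<sigma>\<^sup>2) / 2) * normal_density (- ?b) (1 / \<sigma>) w))"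
    unfolding *[symmetric] by (simp add: fun_eq_iff scaleR_conv_of_real)
  then show ?thesis unfolding chf_\<zeta>0
    using \<sigma> by (simp only: integral_complex_of_real integral_mult_right_zero)
      (simp add: scaleR_conv_of_real)
qed

text \<open>As m grows, w s / m and w c / m tend to 0, so the kernel contributes only its value at
  0. The limit depends on neither c nor s: seen through a window, m (g \<bullet> Y) looks like a
  multiple of Lebesgue measure.\<close>

lemma local_chf_limit:
  assumes s: "s > 0"
  shows "(\<lambda>n. m n * (\<integral>y. of_real (normal_density c s (m n * (g \<bullet> y))) * iexp (u \<bullet> y) \<partial>cpow (\<zeta> n) n))
     \<longlonglongrightarrow> (1 / (sqrt (2 * pi) * \<sigma>)) *\<^sub>R chf \<zeta>0 u"
proof -
  obtain L e where e: "e > 0" and ev: "eventually (\<lambda>n. \<forall>k w. n \<le> 3 * k \<longrightarrow> k \<le> n \<longrightarrow>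
       std_normal_density (w * s / m n) * norm (chf (\<zeta> n) (w *\<^sub>R g + u) ^ k) \<le> L / (1 + e * w\<^sup>2)) sequentially"
    using dominated[OF s, of u] by blast
  obtain n0 where "\<forall>n\<ge>n0. (\<forall>k w. n \<le> 3 * k \<longrightarrow> k \<le> n \<longrightarrow>
       std_normal_density (w * s / m n) * norm (chf (\<zeta> n) (w *\<^sub>R g + u) ^ k) \<le> L / (1 + e * w\<^sup>2)) \<and> m n > 0"
    using eventually_conj[OF ev eventually_m_pos] unfolding eventually_sequentially by blast
  then have n0: "std_normal_density (w * s / m n) * norm (chf (\<zeta> n) (w *\<^sub>R g + u) ^ n) \<le> L / (1 + e * w\<^sup>2)"
      "m n > 0" if "n \<ge> n0" for n w
    using that by (auto simp del: norm_power)
  note [measurable] = borel_measurable_chf[OF \<zeta>]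
  let ?f = "\<lambda>n w. of_real (std_normal_density (w * s / m n)) * iexp (- (w * c / m n)) * chf (cpow (\<zeta> n) n) (w *\<^sub>R g + u)"
  have m0: "(\<lambda>n. inverse (m n)) \<longlonglongrightarrow> 0" using tendsto_inverse_0_at_top[OF m_top] .
  \<comment> \<open>The domination holds from \<open>n0\<close> on, so the shifted sequence is
    treated and the shift is undone afterwards.\<close>
  have "(\<lambda>n. \<integral>w. ?f (n + n0) w \<partial>lborel) \<longlonglongrightarrow> (\<integral>w. (1 / sqrt (2 * pi)) *\<^sub>R complex_of_real (exp (- q (w *\<^sub>R g + u) / 2)) \<partial>lborel)"
  proof (rule integral_dominated_convergence[OF _ _ integrable_inverse_1_plus_scaled_square[OF e, of L]])
    have qm: "(\<lambda>w. q (w *\<^sub>R g + u)) \<in> borel_measurable borel" unfolding q by measurable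
    then show "(\<lambda>w. (1 / sqrt (2 * pi)) *\<^sub>R complex_of_real (exp (- q (w *\<^sub>R g + u) / 2))) \<in> borel_measurable lborel"
      by measurable
    show "?f (n + n0) \<in> borel_measurable lborel" for n unfolding chf_cpow[OF \<zeta>] by measurable
    show "AE w in lborel. norm (?f (n + n0) w) \<le> L / (1 + e * w\<^sup>2)" for n
      using n0(1)[of "n + n0"] by (intro AE_I2) (simp add: norm_mult chf_cpow[OF \<zeta>])
    show "AE w in lborel. (\<lambda>n. ?f (n + n0) w) \<longlonglongrightarrow> (1 / sqrt (2 * pi)) *\<^sub>R complex_of_real (exp (- q (w *\<^sub>R g + u) / 2))"
    proof (rule AE_I2)
      fix w :: real
      have a: "(\<lambda>n. std_normal_density (w * s * inverse (m n))) \<longlonglongrightarrow> 1 / sqrt (2 * pi)"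
      proof -
        have "(\<lambda>n. 1 / sqrt (2 * pi) * exp (- (w * s * inverse (m n))\<^sup>2 / 2)) \<longlonglongrightarrow> 1 / sqrt (2 * pi) * exp (- (w * s * 0)\<^sup>2 / 2)"
          by (intro tendsto_intros m0) simp_all
        then show ?thesis unfolding std_normal_density_def by simp
      qed
      have b: "(\<lambda>n. iexp (- (w * c * inverse (m n)))) \<longlonglongrightarrow> 1"
      proof -
        have "(\<lambda>n. iexp (- (w * c * inverse (m n)))) \<longlonglongrightarrow> iexp (- (w * c * 0))"
          by (intro tendsto_intros m0)
        then show ?thesis by simp
      qed
      have "(\<lambda>n. ?f n w) \<longlonglongrightarrow> complex_of_real (1 / sqrt (2 * pi)) * 1 * complex_of_real (exp (- q (w *\<^sub>R g + u) / 2))"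
        using tendsto_mult[OF tendsto_mult[OF tendsto_of_real[OF a] b] clt[of "w *\<^sub>R g + u"]]
        by (simp only: chf_cpow[OF \<zeta>] divide_inverse[of _ "m _"])
      then show "(\<lambda>n. ?f (n + n0) w) \<longlonglongrightarrow> (1 / sqrt (2 * pi)) *\<^sub>R complex_of_real (exp (- q (w *\<^sub>R g + u) / 2))"
        by (intro LIMSEQ_ignore_initial_segment) (simp add: scaleR_conv_of_real)
    qed
  qed
  then have "(\<lambda>n. \<integral>w. ?f n w \<partial>lborel) \<longlonglongrightarrow> (1 / \<sigma>) *\<^sub>R chf \<zeta>0 u"
    unfolding gauss_integral by (rule LIMSEQ_offset)
  then have "(\<lambda>n. (1 / sqrt (2 * pi)) * (\<integral>w. ?f n w \<partial>lborel)) \<longlonglongrightarrow> of_real (1 / sqrt (2 * pi)) * ((1 / \<sigma>) *\<^sub>R chf \<zeta>0 u)"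
    by (intro tendsto_mult tendsto_const) simp_all
  then have lim: "(\<lambda>n. (1 / sqrt (2 * pi)) * (\<integral>w. ?f n w \<partial>lborel)) \<longlonglongrightarrow> (1 / (sqrt (2 * pi) * \<sigma>)) *\<^sub>R chf \<zeta>0 u"
    by (simp add: scaleR_conv_of_real)
  have "eventually (\<lambda>n. (1 / sqrt (2 * pi)) * (\<integral>w. ?f n w \<partial>lborel)
     = m n * (\<integral>y. of_real (normal_density c s (m n * (g \<bullet> y))) * iexp (u \<bullet> y) \<partial>cpow (\<zeta> n) n)) sequentially"
    using eventually_ge_at_top[of n0]
    by eventually_elim (rule fourier_normal_weight[OF bprob_cpow[OF \<zeta>] s n0(2), symmetric])
  with lim show ?thesis by (rule Lim_transform_eventually)
qed

end

text \<open>
  Splitting a sum into two halves, the weight \<open>f\<close> can be averaged over the half not occurring in the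
  moment \<open>h\<close>; this transfers tightness to the measures weighted by a narrow kernel.
\<close>

lemma integral_conv_weight_le:
  fixes \<mu> \<nu> :: "'h::{second_countable_topology, real_normed_vector} measure" and f h :: "'h \<Rightarrow> real"
  assumes \<mu>: "bprob \<mu>" and \<nu>: "bprob \<nu>"
    and f: "f \<in> borel_measurable borel" "\<And>x. 0 \<le> f x" "\<And>x. f x \<le> F"
    and h: "h \<in> borel_measurable borel" "\<And>x. 0 \<le> h x" "\<And>x y. h (x + y) \<le> 2 * h x + 2 * h y"
      "integrable \<mu> h" "integrable \<nu> h"
    and b: "\<And>x. (\<integral>y. f (x + y) \<partial>\<nu>) \<le> b" "\<And>y. (\<integral>x. f (x + y) \<partial>\<mu>) \<le> b"
  shows "integrable (conv \<mu> \<nu>) (\<lambda>x. f x * h x)"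
    "(\<integral>x. f x * h x \<partial>conv \<mu> \<nu>) \<le> 2 * b * ((\<integral>x. h x \<partial>\<mu>) + (\<integral>x. h x \<partial>\<nu>))"
proof -
  interpret \<mu>: prob_space \<mu> by (rule bprobD[OF \<mu>])
  interpret \<nu>: prob_space \<nu> by (rule bprobD[OF \<nu>])
  interpret P: pair_prob_space \<mu> \<nu> ..
  note [measurable_cong] = bprobD(2)[OF \<mu>] bprobD(2)[OF \<nu>]
  note [measurable] = f(1) h(1)
  let ?P = "\<mu> \<Otimes>\<^sub>M \<nu>"
  note c = P.integrable_pair_components
  have fh: "\<bar>f z * h x\<bar> \<le> \<bar>F * h x\<bar>" for z x
    using f(2)[of z] f(3)[of z] h(2)[of x] by (simp add: abs_mult mult_right_mono)
  have i1: "integrable ?P (\<lambda>(x, y). f (x + y) * h x)"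
    by (rule Bochner_Integration.integrable_bound[OF integrable_mult_right[OF c(1)[OF h(4)], of F]])
      (use fh in \<open>auto simp: case_prod_unfold\<close>)
  have i2: "integrable ?P (\<lambda>(x, y). f (x + y) * h y)"
    by (rule Bochner_Integration.integrable_bound[OF integrable_mult_right[OF c(2)[OF h(5)], of F]])
      (use fh in \<open>auto simp: case_prod_unfold\<close>)
  have i12: "integrable ?P (\<lambda>p. 2 * (case p of (x, y) \<Rightarrow> f (x + y) * h x) + 2 * (case p of (x, y) \<Rightarrow> f (x + y) * h y))"
    using i1 i2 by auto
  have le: "f (x + y) * h (x + y) \<le> 2 * (f (x + y) * h x) + 2 * (f (x + y) * h y)" for x y
    using mult_left_mono[OF h(3)[of x y] f(2)[of "x + y"]] by (simp add: algebra_simps)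
  have i: "integrable ?P (\<lambda>(x, y). f (x + y) * h (x + y))"
    by (rule Bochner_Integration.integrable_bound[OF i12])
      (use le f(2) h(2) in \<open>auto simp: abs_mult intro!: order_trans[OF le]\<close>)
  show ic: "integrable (conv \<mu> \<nu>) (\<lambda>x. f x * h x)"
    using i by (subst integrable_conv[OF \<mu> \<nu>]) auto
  have "(\<integral>x. f x * h x \<partial>conv \<mu> \<nu>) = (\<integral>p. (case p of (x, y) \<Rightarrow> f (x + y) * h (x + y)) \<partial>?P)"
    by (subst integral_conv[OF \<mu> \<nu> _ ic]) (simp, rule P.integral_fst[OF i])
  also have "\<dots> \<le> (\<integral>p. 2 * (case p of (x, y) \<Rightarrow> f (x + y) * h x) + 2 * (case p of (x, y) \<Rightarrow> f (x + y) * h y) \<partial>?P)"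
    by (rule integral_mono[OF i i12]) (auto intro: le)
  also have "\<dots> = 2 * (\<integral>p. (case p of (x, y) \<Rightarrow> f (x + y) * h x) \<partial>?P) + 2 * (\<integral>p. (case p of (x, y) \<Rightarrow> f (x + y) * h y) \<partial>?P)"
    using i1 i2 by simp
  also have "(\<integral>p. (case p of (x, y) \<Rightarrow> f (x + y) * h x) \<partial>?P) = (\<integral>x. (\<integral>y. f (x + y) * h x \<partial>\<nu>) \<partial>\<mu>)"
    by (rule P.integral_fst[OF i1, symmetric])
  also have "\<dots> \<le> (\<integral>x. b * h x \<partial>\<mu>)"
    using P.integrable_fst[OF i1] b(1) h(2,4) by (intro integral_mono) (auto intro: mult_right_mono)
  also have "(\<integral>p. (case p of (x, y) \<Rightarrow> f (x + y) * h y) \<partial>?P) = (\<integral>y. (\<integral>x. f (x + y) * h y \<partial>\<mu>) \<partial>\<nu>)"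
    by (rule P.integral_snd[OF i2, symmetric])
  also have "\<dots> \<le> (\<integral>y. b * h y \<partial>\<nu>)"
    using P.integrable_snd[OF i2] b(2) h(2,5) by (intro integral_mono) (auto intro: mult_right_mono)
  finally show "(\<integral>x. f x * h x \<partial>conv \<mu> \<nu>) \<le> 2 * b * ((\<integral>x. h x \<partial>\<mu>) + (\<integral>x. h x \<partial>\<nu>))"
    by (simp add: algebra_simps)
qed

lemma normal_density_le: "s > 0 \<Longrightarrow> normal_density c s x \<le> 1 / (sqrt (2 * pi) * s)"
  by (simp add: normal_density_def real_sqrt_mult divide_right_mono)

lemma normal_density_shift: "normal_density c s (x + y) = normal_density (c - x) s y"
  by (simp add: normal_density_def algebra_simps)

lemma bounded_linear_diff_onproj: "orthonormal C \<Longrightarrow> bounded_linear (\<lambda>y. y - onproj C y)"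
proof (rule bounded_linear_intro[where K = 1])
  assume C: "orthonormal C"
  show "norm (y - onproj C y) \<le> norm y * 1" for y :: 'a
    using onproj_best_approx[OF C span_zero, of y] by simp
qed (simp_all add: onproj_def inner_add_right scaleR_add_left sum.distrib scaleR_sum_right algebra_simps)

text \<open>The bound uses n although the sum has k terms, so that both blocks of a sum of n terms
  share it.\<close>

lemma cpow_second_moment_linear_le:
  fixes \<mu> :: "'h::{second_countable_topology, real_inner, banach} measure" and A :: "'h \<Rightarrow> 'h"
  assumes \<mu>: "bprob \<mu>" and int: "integrable \<mu> (\<lambda>x. (norm x)\<^sup>2)" and "k \<le> n"
    and A: "bounded_linear A" "\<And>x. norm (A x) \<le> norm x"
  shows "integrable (cpow \<mu> k) (\<lambda>x. (norm (A x))\<^sup>2)"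
    "(\<integral>x. (norm (A x))\<^sup>2 \<partial>cpow \<mu> k) \<le> real n * (\<integral>x. (norm (A x))\<^sup>2 \<partial>\<mu>) + (real n * norm (\<integral>x. x \<partial>\<mu>))\<^sup>2"
proof -
  have [measurable]: "A \<in> borel_measurable borel"
    using A(1) by (intro borel_measurable_continuous_onI linear_continuous_on)
  note [measurable_cong] = bprobD(2)[OF \<mu>] bprobD(2)[OF bprob_cpow[OF \<mu>]]
  interpret prob_space \<mu> by (rule bprobD[OF \<mu>])
  let ?\<nu> = "distr \<mu> borel A"
  have \<nu>: "bprob ?\<nu>" by (auto simp: bprob_def intro!: prob_space_distr)
  have intA: "integrable \<mu> (\<lambda>x. (norm (A x))\<^sup>2)"
    by (rule Bochner_Integration.integrable_bound[OF int]) (auto intro!: power_mono A(2))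
  then have int\<nu>: "integrable ?\<nu> (\<lambda>x. (norm x)\<^sup>2)" by (subst integrable_distr_eq) auto
  have "integrable (cpow ?\<nu> k) (\<lambda>x. (norm x)\<^sup>2)" using cpow_second_moment[OF \<nu> int\<nu>] by blast
  then show "integrable (cpow \<mu> k) (\<lambda>x. (norm (A x))\<^sup>2)"
    unfolding cpow_distr_linear[OF \<mu> A(1)] by (subst (asm) integrable_distr_eq) auto
  have j: "integrable \<mu> (\<lambda>x. x)" by (rule integrable_of_square[OF _ _ int]) (unfold_locales, measurable)
  have "(\<integral>x. (norm (A x))\<^sup>2 \<partial>cpow \<mu> k) = (\<integral>x. (norm x)\<^sup>2 \<partial>cpow ?\<nu> k)"
    unfolding cpow_distr_linear[OF \<mu> A(1)] by (subst integral_distr) auto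
  also have "\<dots> \<le> real n * (\<integral>x. (norm x)\<^sup>2 \<partial>?\<nu>) + (real n * norm (\<integral>x. x \<partial>?\<nu>))\<^sup>2"
    by (rule cpow_second_moment_le[OF \<nu> int\<nu> \<open>k \<le> n\<close>])
  also have "(\<integral>x. (norm x)\<^sup>2 \<partial>?\<nu>) = (\<integral>x. (norm (A x))\<^sup>2 \<partial>\<mu>)" by (subst integral_distr) auto
  also have "(\<integral>x. x \<partial>?\<nu>) = A (\<integral>x. x \<partial>\<mu>)"
    by (subst integral_distr) (auto intro!: integral_bounded_linear A(1) j)
  also have "(real n * norm (A (\<integral>x. x \<partial>\<mu>)))\<^sup>2 \<le> (real n * norm (\<integral>x. x \<partial>\<mu>))\<^sup>2"
    by (intro power_mono mult_left_mono A) auto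
  finally show "(\<integral>x. (norm (A x))\<^sup>2 \<partial>cpow \<mu> k) \<le> real n * (\<integral>x. (norm (A x))\<^sup>2 \<partial>\<mu>) + (real n * norm (\<integral>x. x \<partial>\<mu>))\<^sup>2"
    by simp
qed

text \<open>\<open>tight\<close> and \<open>mean\<close> bound the two terms in the second moment of
  the residual of a sum of n vectors: n times the one-step second moment, and the square of n times
  the mean.\<close>

locale local_limit_tight = local_limit \<zeta> m g a0 \<sigma> q \<zeta>0
  for \<zeta> :: "nat \<Rightarrow> 'h::{real_inner, banach, second_countable_topology} measure"
    and m g a0 \<sigma> q \<zeta>0 +
  fixes C :: "nat \<Rightarrow> 'h set"
  assumes C: "\<And>k. orthonormal (C k)" "\<And>y. (\<lambda>k. onproj (C k) y) \<longlonglongrightarrow> y"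
    and tight: "\<And>\<epsilon>. \<epsilon> > 0 \<Longrightarrow> eventually (\<lambda>k. eventually (\<lambda>n.
        real n * (\<integral>x. (norm (x - onproj (C k) x))\<^sup>2 \<partial>\<zeta> n) \<le> \<epsilon>) sequentially) sequentially"
    and mean: "(\<lambda>n. real n * norm (\<integral>x. x \<partial>\<zeta> n)) \<longlonglongrightarrow> 0"
begin

text \<open>In the estimate for split sums, the kernel averaged over one block gives at most B /
  \<open>m n\<close>, while the residual of the other block has a small second moment. The factor
  \<open>m n\<close> in front cancels.\<close>

lemma weighted_tight:
  assumes s: "s > 0" and \<epsilon>: "\<epsilon> > 0"
  shows "eventually (\<lambda>k. eventually (\<lambda>n.
      integrable (cpow (\<zeta> n) n) (\<lambda>y. normal_density c s (m n * (g \<bullet> y)) * (norm (y - onproj (C k) y))\<^sup>2)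
      \<and> m n * (\<integral>y. normal_density c s (m n * (g \<bullet> y)) * (norm (y - onproj (C k) y))\<^sup>2 \<partial>cpow (\<zeta> n) n) \<le> \<epsilon>)
      sequentially) sequentially"
proof -
  obtain B where B: "B > 0" "eventually (\<lambda>n. \<forall>k c. n \<le> 3 * k \<longrightarrow> k \<le> n \<longrightarrow>
       m n * (\<integral>y. normal_density c s (m n * (g \<bullet> y)) \<partial>cpow (\<zeta> n) k) \<le> B) sequentially"
    using anticoncentration[OF s] by blast
  \<comment> \<open>Each of the two blocks has residual second moment at most 2 \<epsilon>', and the
    prefactor is 2 B; hence the 8.\<close>
  define \<epsilon>' where "\<epsilon>' = \<epsilon> / (8 * B)"
  have \<epsilon>': "\<epsilon>' > 0" using \<epsilon> B by (simp add: \<epsilon>'_def)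
  have "(\<lambda>n. (real n * norm (\<integral>x. x \<partial>\<zeta> n))\<^sup>2) \<longlonglongrightarrow> 0\<^sup>2" by (intro tendsto_power mean)
  then have ev2: "eventually (\<lambda>n. (real n * norm (\<integral>x. x \<partial>\<zeta> n))\<^sup>2 < \<epsilon>') sequentially"
    using \<epsilon>' by (intro order_tendstoD(2)) auto
  from tight[OF \<epsilon>'] show ?thesis
  proof eventually_elim
    case (elim k)
    define A where "A = (\<lambda>y. y - onproj (C k) y)"
    have A: "bounded_linear A" "\<And>x. norm (A x) \<le> norm x"
      using bounded_linear_diff_onproj[OF C(1)] onproj_best_approx[OF C(1) span_zero]
      by (auto simp: A_def)
    interpret A: bounded_linear A by (rule A)
    have [measurable]: "A \<in> borel_measurable borel"
      using A(1) by (intro borel_measurable_continuous_onI linear_continuous_on)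
    from elim B(2) ev2 eventually_m_pos eventually_ge_at_top[of 2] show ?case
    proof eventually_elim
      case (elim n)
      \<comment> \<open>For n \<ge> 2 both halves contain at least n / 3 summands, as the
        anticoncentration bound demands.\<close>
      define k1 where "k1 = n div 2"
      define k2 where "k2 = n - n div 2"
      have k: "n \<le> 3 * k1" "k1 \<le> n" "n \<le> 3 * k2" "k2 \<le> n" "k1 + k2 = n"
        using elim(5) by (auto simp: k1_def k2_def)
      let ?f = "\<lambda>y. normal_density c s (m n * (g \<bullet> y))"
      have sq: "(norm (A (x + y)))\<^sup>2 \<le> 2 * (norm (A x))\<^sup>2 + 2 * (norm (A y))\<^sup>2" for x y
      proof -
        have "(norm (A (x + y)))\<^sup>2 \<le> (norm (A x) + norm (A y))\<^sup>2"
          unfolding A.add by (intro power_mono norm_triangle_ineq) auto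
        also have "\<dots> \<le> 2 * (norm (A x))\<^sup>2 + 2 * (norm (A y))\<^sup>2"
          using zero_le_power2[of "norm (A x) - norm (A y)"] by (simp add: power2_sum power2_diff)
        finally show ?thesis .
      qed
      note mom = cpow_second_moment_linear_le[OF \<zeta>[of n] \<zeta>_sq[of n] _ A]
      have bnd: "(\<integral>x. (norm (A x))\<^sup>2 \<partial>cpow (\<zeta> n) k) \<le> 2 * \<epsilon>'" if "k \<le> n" for k
        using mom(2)[OF that] elim(1,3) by (simp add: A_def)
      have b: "(\<integral>y. normal_density c' s (m n * (g \<bullet> y)) \<partial>cpow (\<zeta> n) j) \<le> B / m n"
        if "n \<le> 3 * j" "j \<le> n" for j c'
        using elim(2,4) that by (simp add: field_simps)
      \<comment> \<open>Fixing one block merely moves the centre of the kernel, which is why a bound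
        uniform in the centre was proved.\<close>
      have f1: "?f (x + y) = normal_density (c - m n * (g \<bullet> x)) s (m n * (g \<bullet> y))" for x y
        by (simp add: inner_add_right distrib_left normal_density_shift)
      have f2: "?f (x + y) = normal_density (c - m n * (g \<bullet> y)) s (m n * (g \<bullet> x))" for x y
        using f1[of y x] by (simp add: add.commute)
      have bb: "(\<integral>y. ?f (x + y) \<partial>cpow (\<zeta> n) k2) \<le> B / m n" "(\<integral>x. ?f (x + y) \<partial>cpow (\<zeta> n) k1) \<le> B / m n" for x y
        unfolding f1 using k b[of k2 "c - m n * (g \<bullet> x)"]
        by simp (use f2 k b[of k1 "c - m n * (g \<bullet> y)"] in \<open>simp add: f1[symmetric]\<close>)
      have fm: "?f \<in> borel_measurable borel" "(\<lambda>x. (norm (A x))\<^sup>2) \<in> borel_measurable borel" by measurable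
      note w = integral_conv_weight_le[OF bprob_cpow[OF \<zeta>] bprob_cpow[OF \<zeta>] fm(1) normal_density_nonneg
          normal_density_le[OF s] fm(2) zero_le_power2 sq mom(1)[OF k(2)] mom(1)[OF k(4)] bb]
      have cp: "conv (cpow (\<zeta> n) k1) (cpow (\<zeta> n) k2) = cpow (\<zeta> n) n"
        using cpow_add[OF \<zeta>, of n k1 k2] k(5) by simp
      have "m n * (\<integral>x. ?f x * (norm (A x))\<^sup>2 \<partial>cpow (\<zeta> n) n)
        \<le> m n * (2 * (B / m n) * ((\<integral>x. (norm (A x))\<^sup>2 \<partial>cpow (\<zeta> n) k1) + (\<integral>x. (norm (A x))\<^sup>2 \<partial>cpow (\<zeta> n) k2)))"
        using w(2) elim(4) unfolding cp by (intro mult_left_mono) auto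
      also have "\<dots> = 2 * B * ((\<integral>x. (norm (A x))\<^sup>2 \<partial>cpow (\<zeta> n) k1) + (\<integral>x. (norm (A x))\<^sup>2 \<partial>cpow (\<zeta> n) k2))"
        using elim(4) by simp
      also have "\<dots> \<le> 2 * B * (2 * \<epsilon>' + 2 * \<epsilon>')"
        using B(1) k by (intro mult_left_mono add_mono bnd) auto
      also have "\<dots> = \<epsilon>" using B(1) by (simp add: \<epsilon>'_def)
      finally show ?case using w(1) unfolding cp by (simp add: A_def)
    qed
  qed
qed

text \<open>The density at 0 of the normal law with variance \<open>\<sigma>\<^sup>2\<close>, the
  limit law of g \<bullet> Y.\<close>

definition C0 :: real where "C0 = 1 / (sqrt (2 * pi) * \<sigma>)"

lemma C0_pos: "C0 > 0" using \<sigma> by (simp add: C0_def)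

text \<open>The kernel-weighted laws are finite measures whose characteristic functions converge to
  that of \<open>C0\<close> times \<zeta>0 and which are tight by \<open>weighted_tight\<close>; the
  general convergence result then gives functions of the norm.\<close>

lemma local_limit_norm:
  assumes s: "s > 0" and \<psi>: "continuous_on UNIV \<psi>"
  shows "(\<lambda>n. m n * (\<integral>y. normal_density c s (m n * (g \<bullet> y)) * \<psi> (exp (- (norm y)\<^sup>2)) \<partial>cpow (\<zeta> n) n))
     \<longlonglongrightarrow> C0 * (\<integral>y. \<psi> (exp (- (norm y)\<^sup>2)) \<partial>\<zeta>0)"
proof -
  have [measurable]: "\<psi> \<in> borel_measurable borel" using \<psi> by (rule borel_measurable_continuous_onI)
  \<comment> \<open>\<open>m 0\<close> may be negative, but a density has to be nonnegative;
    eventually M and m agree.\<close>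
  define M where "M n = max (m n) 0" for n
  let ?W = "\<lambda>n y. M n * normal_density c s (m n * (g \<bullet> y))"
  define \<rho> where "\<rho> n = density (cpow (\<zeta> n) n) (\<lambda>y. ennreal (?W n y))" for n
  define \<rho>0 where "\<rho>0 = density \<zeta>0 (\<lambda>y. ennreal C0)"
  note p = bprob_cpow[OF \<zeta>]
  note [measurable_cong] = bprobD(2)[OF p] bprobD(2)[OF \<zeta>0]
  have W0: "0 \<le> ?W n y" for n y by (simp add: M_def)
  have int\<rho>: "(\<integral>y. f y \<partial>\<rho> n) = M n * (\<integral>y. normal_density c s (m n * (g \<bullet> y)) * f y \<partial>cpow (\<zeta> n) n)"
    if [measurable]: "f \<in> borel_measurable borel" for f :: "'h \<Rightarrow> real" and n
  proof -
    have "(\<integral>y. f y \<partial>\<rho> n) = (\<integral>y. ?W n y *\<^sub>R f y \<partial>cpow (\<zeta> n) n)"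
      unfolding \<rho>_def by (rule integral_density) (use W0 in auto)
    then show ?thesis by (simp add: mult.assoc)
  qed
  have int\<rho>0: "(\<integral>y. f y \<partial>\<rho>0) = C0 * (\<integral>y. f y \<partial>\<zeta>0)"
    if [measurable]: "f \<in> borel_measurable borel" for f :: "'h \<Rightarrow> real"
  proof -
    have "(\<integral>y. f y \<partial>\<rho>0) = (\<integral>y. C0 *\<^sub>R f y \<partial>\<zeta>0)"
      unfolding \<rho>0_def by (rule integral_density) (use C0_pos in auto)
    then show ?thesis by simp
  qed
  have sets\<rho>: "sets (\<rho> n) = sets borel" "sets \<rho>0 = sets borel" for n
    using bprobD(2)[OF p] bprobD(2)[OF \<zeta>0] by (auto simp: \<rho>_def \<rho>0_def)
  have fin: "finite_measure (\<rho> n)" for n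
  proof (rule finite_measureI)
    interpret prob_space "cpow (\<zeta> n) n" by (rule bprobD[OF p])
    have "emeasure (\<rho> n) (space (\<rho> n)) = (\<integral>\<^sup>+y. ennreal (?W n y) \<partial>cpow (\<zeta> n) n)"
      unfolding \<rho>_def by (subst emeasure_density) (auto intro!: nn_integral_cong)
    also have "\<dots> \<le> (\<integral>\<^sup>+y. ennreal (M n * (1 / (sqrt (2 * pi) * s))) \<partial>cpow (\<zeta> n) n)"
      by (intro nn_integral_mono ennreal_leI mult_left_mono normal_density_le s) (simp add: M_def)
    also have "\<dots> < \<infinity>" by (simp add: emeasure_space_1 ennreal_mult_less_top)
    finally show "emeasure (\<rho> n) (space (\<rho> n)) \<noteq> \<infinity>" by simp
  qed
  have fin0: "finite_measure \<rho>0"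
  proof (rule finite_measureI)
    interpret prob_space \<zeta>0 by (rule bprobD[OF \<zeta>0])
    show "emeasure \<rho>0 (space \<rho>0) \<noteq> \<infinity>"
      unfolding \<rho>0_def by (subst emeasure_density) (auto simp: emeasure_space_1 bprobD(3)[OF \<zeta>0] ennreal_mult_eq_top_iff)
  qed
  have chf\<rho>: "chf (\<rho> n) u = M n * (\<integral>y. of_real (normal_density c s (m n * (g \<bullet> y))) * iexp (u \<bullet> y) \<partial>cpow (\<zeta> n) n)" for n u
  proof -
    have "chf (\<rho> n) u = (\<integral>y. ?W n y *\<^sub>R iexp (u \<bullet> y) \<partial>cpow (\<zeta> n) n)"
      unfolding \<rho>_def chf_def by (rule integral_density) (use W0 in auto)
    then show ?thesis by (simp add: scaleR_conv_of_real mult.assoc)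
  qed
  have chf\<rho>0: "chf \<rho>0 u = C0 *\<^sub>R chf \<zeta>0 u" for u
  proof -
    have "chf \<rho>0 u = (\<integral>y. C0 *\<^sub>R iexp (u \<bullet> y) \<partial>\<zeta>0)"
      unfolding \<rho>0_def chf_def by (rule integral_density) (use C0_pos in auto)
    then show ?thesis by (simp add: chf_def)
  qed
  have evM: "eventually (\<lambda>n. M n = m n) sequentially"
    using eventually_m_pos by eventually_elim (simp add: M_def)
  have lim: "(\<lambda>n. chf (\<rho> n) u) \<longlonglongrightarrow> chf \<rho>0 u" for u
    unfolding chf\<rho>0 C0_def
    by (rule Lim_transform_eventually[OF local_chf_limit[OF s, where c = c]])
      (use evM in \<open>eventually_elim, simp add: chf\<rho>\<close>)
  have mass: "measure (\<rho> n) UNIV = Re (chf (\<rho> n) 0)" for n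
    by (simp add: chf_def sets_eq_imp_space_eq[OF sets\<rho>(1)])
  \<comment> \<open>The total masses are values of characteristic functions at 0, hence a convergent
    and so bounded sequence.\<close>
  have "Bseq (\<lambda>n. chf (\<rho> n) 0)" using lim convergent_imp_Bseq convergent_def by blast
  then obtain K where K: "\<And>n. norm (chf (\<rho> n) 0) \<le> K" by (auto simp: Bseq_def)
  have massK: "measure (\<rho> n) UNIV \<le> K" for n
    unfolding mass using complex_Re_le_cmod[of "chf (\<rho> n) 0"] K[of n] by linarith
  have tight': "eventually (\<lambda>k. eventually (\<lambda>n. integrable (\<rho> n) (\<lambda>y. (norm (y - onproj (C k) y))\<^sup>2)
           \<and> (\<integral>y. (norm (y - onproj (C k) y))\<^sup>2 \<partial>\<rho> n) \<le> \<epsilon>) sequentially) sequentially" if "\<epsilon> > 0" for \<epsilon>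
    using weighted_tight[OF s that, of c]
  proof eventually_elim
    case (elim k)
    with evM show ?case
    proof eventually_elim
      case (elim n)
      have "integrable (\<rho> n) (\<lambda>y. (norm (y - onproj (C k) y))\<^sup>2)"
        unfolding \<rho>_def by (subst integrable_density) (use W0[of n] elim in \<open>auto simp: mult.assoc zero_le_mult_iff\<close>)
      then show ?case using elim by (simp add: int\<rho>)
    qed
  qed
  have "(\<lambda>n. \<integral>y. \<psi> (exp (- (norm y)\<^sup>2)) \<partial>\<rho> n) \<longlonglongrightarrow> (\<integral>y. \<psi> (exp (- (norm y)\<^sup>2)) \<partial>\<rho>0)"
    by (rule tendsto_integral_exp_norm[OF fin sets\<rho>(1) massK fin0 sets\<rho>(2) lim C tight' \<psi>])
  then have *: "(\<lambda>n. M n * (\<integral>y. normal_density c s (m n * (g \<bullet> y)) * \<psi> (exp (- (norm y)\<^sup>2)) \<partial>cpow (\<zeta> n) n))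
     \<longlonglongrightarrow> C0 * (\<integral>y. \<psi> (exp (- (norm y)\<^sup>2)) \<partial>\<zeta>0)"
    by (simp add: int\<rho> int\<rho>0)
  show ?thesis
    by (rule Lim_transform_eventually[OF *]) (use evM in \<open>eventually_elim, simp\<close>)
qed

end

section \<open>From windows to the exponential weight on the ball\<close>

definition exp_tail :: "real \<Rightarrow> real \<Rightarrow> real" where
  "exp_tail c0 c = indicator {c0..} c * exp (- c)"

lemma exp_tail_nonneg [simp]: "0 \<le> exp_tail c0 c"
  by (simp add: exp_tail_def)

lemma borel_measurable_exp_tail [measurable]: "exp_tail c0 \<in> borel_measurable borel"
  unfolding exp_tail_def[abs_def] by measurable

lemma exp_tail_integral:
  "integrable lborel (exp_tail c0)" "(\<integral>c. exp_tail c0 c \<partial>lborel) = exp (- c0)"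
proof -
  have "has_bochner_integral lborel (\<lambda>x. exp_tail 0 x) 1"
    using has_bochner_integral_I0i_power_exp_m'[of 0] by (simp add: exp_tail_def mult.commute)
  then have "has_bochner_integral lborel (\<lambda>x. exp_tail 0 (- c0 + 1 * x)) (1 /\<^sub>R \<bar>1\<bar>)"
    by (subst (asm) lborel_has_bochner_integral_real_affine_iff[of 1 _ _ "- c0"]) simp_all
  then have "has_bochner_integral lborel (\<lambda>x. exp (- c0) * exp_tail 0 (- c0 + x)) (exp (- c0))"
    using has_bochner_integral_mult_right[of "exp (- c0)" lborel _ 1] by simp
  moreover have "exp (- c0) * exp_tail 0 (- c0 + x) = exp_tail c0 x" for x
    by (auto simp: exp_tail_def indicator_def exp_add[symmetric])
  ultimately have "has_bochner_integral lborel (exp_tail c0) (exp (- c0))" by simp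
  then show "integrable lborel (exp_tail c0)" "(\<integral>c. exp_tail c0 c \<partial>lborel) = exp (- c0)"
    by (auto simp: has_bochner_integral_iff)
qed

context local_limit_tight
begin

text \<open>The window limit is averaged over the centre c with the weight
  \<open>exp_tail c0 c\<close>. Fubini moves the integral over c outside, where the
  anticoncentration bound, uniform in c, permits dominated convergence.\<close>

lemma
  fixes V :: "real \<Rightarrow> real \<Rightarrow> real"
  assumes s: "s > 0"
    and V: "(\<lambda>p. V (fst p) (snd p)) \<in> borel_measurable (borel \<Otimes>\<^sub>M borel)"
      "\<And>c. continuous_on UNIV (V c)" "\<And>c x. 0 \<le> V c x" "\<And>c x. V c x \<le> 1"
  shows smoothed_integrable: "integrable (cpow (\<zeta> n) n)
        (\<lambda>y. \<integral>c. exp_tail c0 c * (normal_density c s (m n * (g \<bullet> y)) * V c (exp (- (norm y)\<^sup>2))) \<partial>lborel)" (is "?I n")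
    and smoothed_inner_integrable:
      "integrable lborel (\<lambda>c. exp_tail c0 c * (normal_density c s x * V c z))"
    and smoothed_limit: "(\<lambda>n. m n * (\<integral>y. (\<integral>c. exp_tail c0 c * (normal_density c s (m n * (g \<bullet> y)) * V c (exp (- (norm y)\<^sup>2))) \<partial>lborel) \<partial>cpow (\<zeta> n) n))
        \<longlonglongrightarrow> C0 * (\<integral>y. (\<integral>c. exp_tail c0 c * V c (exp (- (norm y)\<^sup>2)) \<partial>lborel) \<partial>\<zeta>0)"
proof -
  note p = bprob_cpow[OF \<zeta>]
  note [measurable_cong] = bprobD(2)[OF p] bprobD(2)[OF \<zeta>0]
  note Vm = measurable_compose[OF _ V(1)]
  have [measurable]: "(\<lambda>x. V (f x) (h x)) \<in> borel_measurable M" if "f \<in> borel_measurable M" "h \<in> borel_measurable M"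
    for f h and M :: "'z measure"
    using measurable_compose[OF measurable_Pair[OF that] V(1)] by simp
  have nd: "(\<lambda>p. normal_density (f p) s (h p)) \<in> borel_measurable M"
    if [measurable]: "f \<in> borel_measurable M" "h \<in> borel_measurable M" for f h and M :: "'z measure"
    unfolding normal_density_def by measurable
  note [measurable] = nd
  let ?F = "1 / (sqrt (2 * pi) * s)"
  have F: "?F > 0" using s by simp
  have K: "\<bar>exp_tail c0 c * (normal_density c s x * V c z)\<bar> \<le> exp_tail c0 c * ?F" for c x z
  proof -
    have "normal_density c s x * V c z \<le> ?F * 1" using s V F by (intro mult_mono normal_density_le) auto
    then have "exp_tail c0 c * (normal_density c s x * V c z) \<le> exp_tail c0 c * ?F"
      by (intro mult_left_mono) auto
    then show ?thesis using V by (simp add: abs_mult)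
  qed
  have iF: "integrable lborel (\<lambda>c. exp_tail c0 c * ?F)" by (intro integrable_mult_left exp_tail_integral)
  show "integrable lborel (\<lambda>c. exp_tail c0 c * (normal_density c s x * V c z))" for x z
    by (rule Bochner_Integration.integrable_bound[OF iF])
      (use K F in \<open>auto simp only: real_norm_def abs_mult[of "exp_tail _ _" ?F] abs_of_pos abs_of_nonneg exp_tail_nonneg intro!: AE_I2\<close>, measurable)
  have prod_int: "integrable (lborel \<Otimes>\<^sub>M \<nu>) f"
    if \<nu>: "bprob \<nu>" and [measurable]: "f \<in> borel_measurable (lborel \<Otimes>\<^sub>M \<nu>)"
      and b: "\<And>c y. \<bar>f (c, y)\<bar> \<le> exp_tail c0 c * b" for \<nu> :: "'h measure" and f and b :: real
  proof -
    interpret \<nu>: prob_space \<nu> by (rule bprobD[OF \<nu>])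
    interpret P: pair_sigma_finite lborel \<nu> ..
    have "integrable (lborel \<Otimes>\<^sub>M \<nu>) (\<lambda>p. exp_tail c0 (fst p) * b)"
    proof (rule P.Fubini_integrable)
      show "integrable lborel (\<lambda>x. LINT y|\<nu>. norm (exp_tail c0 (fst (x, y)) * b))"
        by (simp add: abs_mult \<nu>.prob_space exp_tail_integral)
    qed auto
    then show ?thesis
      by (rule Bochner_Integration.integrable_bound) (use b in \<open>auto intro!: order_trans[OF b]\<close>)
  qed
  have KV: "\<bar>exp_tail c0 c * V c z\<bar> \<le> exp_tail c0 c * 1" for c z
    unfolding abs_mult using V by (intro mult_mono) auto
  have int: "integrable (lborel \<Otimes>\<^sub>M cpow (\<zeta> n) n)
      (\<lambda>(c, y). exp_tail c0 c * (normal_density c s (m n * (g \<bullet> y)) * V c (exp (- (norm y)\<^sup>2))))" for n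
    by (rule prod_int[OF p]) (measurable, unfold split_conv, rule K)
  have int0: "integrable (lborel \<Otimes>\<^sub>M \<zeta>0) (\<lambda>(c, y). exp_tail c0 c * V c (exp (- (norm y)\<^sup>2)))"
    by (rule prod_int[OF \<zeta>0]) (measurable, unfold split_conv, rule KV)
  have swap: "(\<integral>y. (\<integral>c. exp_tail c0 c * (normal_density c s (m n * (g \<bullet> y)) * V c (exp (- (norm y)\<^sup>2))) \<partial>lborel) \<partial>cpow (\<zeta> n) n)
     = (\<integral>c. exp_tail c0 c * (\<integral>y. normal_density c s (m n * (g \<bullet> y)) * V c (exp (- (norm y)\<^sup>2)) \<partial>cpow (\<zeta> n) n) \<partial>lborel)" for n
  proof -
    interpret \<nu>: prob_space "cpow (\<zeta> n) n" by (rule bprobD[OF p])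
    interpret P: pair_sigma_finite lborel "cpow (\<zeta> n) n" ..
    show ?thesis using P.Fubini_integral[OF int] by simp
  qed
  have swap0: "(\<integral>y. (\<integral>c. exp_tail c0 c * V c (exp (- (norm y)\<^sup>2)) \<partial>lborel) \<partial>\<zeta>0)
     = (\<integral>c. exp_tail c0 c * (\<integral>y. V c (exp (- (norm y)\<^sup>2)) \<partial>\<zeta>0) \<partial>lborel)"
  proof -
    interpret \<nu>: prob_space \<zeta>0 by (rule bprobD[OF \<zeta>0])
    interpret P: pair_sigma_finite lborel \<zeta>0 ..
    show ?thesis using P.Fubini_integral[OF int0] by simp
  qed
  show "?I n" for n
  proof -
    interpret \<nu>: prob_space "cpow (\<zeta> n) n" by (rule bprobD[OF p])
    interpret P: pair_sigma_finite lborel "cpow (\<zeta> n) n" ..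
    show "?I n" using P.integrable_snd[OF int] .
  qed
  obtain B where B: "B > 0" "eventually (\<lambda>n. \<forall>k c. n \<le> 3 * k \<longrightarrow> k \<le> n \<longrightarrow>
       m n * (\<integral>y. normal_density c s (m n * (g \<bullet> y)) \<partial>cpow (\<zeta> n) k) \<le> B) sequentially"
    using anticoncentration[OF s] by blast
  obtain n0 where "\<forall>n\<ge>n0. (\<forall>k c. n \<le> 3 * k \<longrightarrow> k \<le> n \<longrightarrow>
       m n * (\<integral>y. normal_density c s (m n * (g \<bullet> y)) \<partial>cpow (\<zeta> n) k) \<le> B) \<and> m n > 0"
    using eventually_conj[OF B(2) eventually_m_pos] unfolding eventually_sequentially by blast
  then have n0: "m n * (\<integral>y. normal_density c s (m n * (g \<bullet> y)) \<partial>cpow (\<zeta> n) n) \<le> B" "m n > 0" if "n \<ge> n0" for n c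
    using that by auto
  let ?G = "\<lambda>n c. \<integral>y. normal_density c s (m n * (g \<bullet> y)) * V c (exp (- (norm y)\<^sup>2)) \<partial>cpow (\<zeta> n) n"
  have G: "0 \<le> m n * ?G n c" "m n * ?G n c \<le> B" if n: "n \<ge> n0" for n c
  proof -
    interpret \<nu>: prob_space "cpow (\<zeta> n) n" by (rule bprobD[OF p])
    show "0 \<le> m n * ?G n c" using n0(2)[OF n] V by simp
    have "?G n c \<le> (\<integral>y. normal_density c s (m n * (g \<bullet> y)) \<partial>cpow (\<zeta> n) n)"
    proof (rule integral_mono)
      show i: "integrable (cpow (\<zeta> n) n) (\<lambda>y. normal_density c s (m n * (g \<bullet> y)))"
        by (rule \<nu>.integrable_bounded[where B = ?F]) (use normal_density_le[OF s] in auto)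
      show "integrable (cpow (\<zeta> n) n) (\<lambda>y. normal_density c s (m n * (g \<bullet> y)) * V c (exp (- (norm y)\<^sup>2)))"
        by (rule Bochner_Integration.integrable_bound[OF i]) (use V in \<open>auto simp: abs_mult mult_left_le\<close>)
    qed (use V in \<open>auto simp: mult_left_le\<close>)
    then have "m n * ?G n c \<le> m n * (\<integral>y. normal_density c s (m n * (g \<bullet> y)) \<partial>cpow (\<zeta> n) n)"
      using n0(2)[OF n] by (intro mult_left_mono) auto
    then show "m n * ?G n c \<le> B" using n0(1)[OF n, of c] by linarith
  qed
  have Gm: "(\<lambda>c. ?G n c) \<in> borel_measurable borel" for n
  proof -
    interpret \<nu>: prob_space "cpow (\<zeta> n) n" by (rule bprobD[OF p])
    show ?thesis by measurable
  qed
  have "(\<lambda>n. \<integral>c. exp_tail c0 c * (m (n + n0) * ?G (n + n0) c) \<partial>lborel)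
     \<longlonglongrightarrow> (\<integral>c. exp_tail c0 c * (C0 * (\<integral>y. V c (exp (- (norm y)\<^sup>2)) \<partial>\<zeta>0)) \<partial>lborel)"
  proof (rule integral_dominated_convergence[where w = "\<lambda>c. exp_tail c0 c * B"])
    show "integrable lborel (\<lambda>c. exp_tail c0 c * B)" by (intro integrable_mult_left exp_tail_integral)
    show "AE c in lborel. (\<lambda>n. exp_tail c0 c * (m (n + n0) * ?G (n + n0) c))
        \<longlonglongrightarrow> exp_tail c0 c * (C0 * (\<integral>y. V c (exp (- (norm y)\<^sup>2)) \<partial>\<zeta>0))"
      by (intro AE_I2 tendsto_mult_left LIMSEQ_ignore_initial_segment[OF local_limit_norm[OF s V(2)]])
    show "AE c in lborel. norm (exp_tail c0 c * (m (n + n0) * ?G (n + n0) c)) \<le> exp_tail c0 c * B" for n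
    proof (rule AE_I2)
      fix c
      have "\<bar>m (n + n0) * ?G (n + n0) c\<bar> \<le> B" using G[of "n + n0" c] by simp
      then show "norm (exp_tail c0 c * (m (n + n0) * ?G (n + n0) c)) \<le> exp_tail c0 c * B"
        unfolding real_norm_def abs_mult[of "exp_tail c0 c"] by (simp add: mult_left_mono)
    qed
    show "(\<lambda>c. exp_tail c0 c * (m (n + n0) * ?G (n + n0) c)) \<in> borel_measurable lborel" for n
      using Gm[of "n + n0"] by measurable
    interpret \<nu>: prob_space \<zeta>0 by (rule bprobD[OF \<zeta>0])
    show "(\<lambda>c. exp_tail c0 c * (C0 * (\<integral>y. V c (exp (- (norm y)\<^sup>2)) \<partial>\<zeta>0))) \<in> borel_measurable lborel"
      by measurable
  qed
  then have "(\<lambda>n. \<integral>c. exp_tail c0 c * (m n * ?G n c) \<partial>lborel)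
     \<longlonglongrightarrow> (\<integral>c. exp_tail c0 c * (C0 * (\<integral>y. V c (exp (- (norm y)\<^sup>2)) \<partial>\<zeta>0)) \<partial>lborel)" by (rule LIMSEQ_offset)
  then show "(\<lambda>n. m n * (\<integral>y. (\<integral>c. exp_tail c0 c * (normal_density c s (m n * (g \<bullet> y)) * V c (exp (- (norm y)\<^sup>2))) \<partial>lborel) \<partial>cpow (\<zeta> n) n))
        \<longlonglongrightarrow> C0 * (\<integral>y. (\<integral>c. exp_tail c0 c * V c (exp (- (norm y)\<^sup>2)) \<partial>lborel) \<partial>\<zeta>0)"
    unfolding swap swap0 by (simp only: mult.left_commute[of "exp_tail _ _"] integral_mult_right_zero)
qed

end

text \<open>Half of the exponent pays for the small factor, and the other half remains as a kernel
  of width sqrt 2 s; the factor sqrt 2 is the ratio of the normalising constants. The tail error is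
  thus again a kernel weight, to which the same limit theorem applies.\<close>

lemma normal_density_tail:
  assumes s: "s > 0" and d: "\<delta> \<ge> 0" "\<bar>c - x\<bar> \<ge> \<delta>"
  shows "normal_density c s x \<le> sqrt 2 * exp (- \<delta>\<^sup>2 / (4 * s\<^sup>2)) * normal_density c (sqrt 2 * s) x"
proof -
  have "\<delta>\<^sup>2 \<le> (x - c)\<^sup>2" using d by (metis abs_minus_commute abs_of_nonneg power2_abs power_mono)
  then have "- (x - c)\<^sup>2 / (2 * s\<^sup>2) \<le> - \<delta>\<^sup>2 / (4 * s\<^sup>2) - (x - c)\<^sup>2 / (2 * (sqrt 2 * s)\<^sup>2)"
    using s by (simp add: power_mult_distrib field_simps)
  then have "exp (- (x - c)\<^sup>2 / (2 * s\<^sup>2)) \<le> exp (- \<delta>\<^sup>2 / (4 * s\<^sup>2)) * exp (- (x - c)\<^sup>2 / (2 * (sqrt 2 * s)\<^sup>2))"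
    by (simp add: exp_add[symmetric])
  moreover have "1 / sqrt (2 * pi * (sqrt 2 * s)\<^sup>2) * sqrt 2 = 1 / sqrt (2 * pi * s\<^sup>2)"
    using s by (simp add: real_sqrt_mult power_mult_distrib) (simp add: field_simps)
  ultimately have "1 / sqrt (2 * pi * s\<^sup>2) * exp (- (x - c)\<^sup>2 / (2 * s\<^sup>2))
      \<le> (1 / sqrt (2 * pi * (sqrt 2 * s)\<^sup>2) * sqrt 2) * (exp (- \<delta>\<^sup>2 / (4 * s\<^sup>2)) * exp (- (x - c)\<^sup>2 / (2 * (sqrt 2 * s)\<^sup>2)))"
    by (simp only:) (intro mult_left_mono, auto)
  then show ?thesis unfolding normal_density_def by (simp only: mult_ac)
qed

lemma normal_density_commute: "normal_density c s x = normal_density x s c"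
  by (simp add: normal_density_def power2_commute)

definition ramp :: "real \<Rightarrow> real \<Rightarrow> real \<Rightarrow> real" where
  "ramp a b x = max 0 (min 1 ((x - a) / (b - a)))"

lemma ramp_bounds: "0 \<le> ramp a b x" "ramp a b x \<le> 1" by (auto simp: ramp_def)

lemma ramp_eq_1: "a < b \<Longrightarrow> b \<le> x \<Longrightarrow> ramp a b x = 1"
  by (simp add: ramp_def field_simps)

lemma ramp_eq_0: "a < b \<Longrightarrow> x \<le> a \<Longrightarrow> ramp a b x = 0"
  by (simp add: ramp_def divide_nonpos_pos)

text \<open>A continuous surrogate, in the variable \<open>exp (- r)\<close>, for the indicator of \<open>r < \<kappa> * c\<close>.\<close>

definition cutoff :: "real \<Rightarrow> real \<Rightarrow> real \<Rightarrow> real \<Rightarrow> real" where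
  "cutoff \<kappa> \<delta> c x = ramp (exp (- \<kappa> * c)) (exp (- \<kappa> * (c - \<delta>))) x"

lemma cutoff:
  assumes "\<kappa> > 0" "\<delta> > 0"
  shows "0 \<le> cutoff \<kappa> \<delta> c x" "cutoff \<kappa> \<delta> c x \<le> 1"
    "r \<le> \<kappa> * (c - \<delta>) \<Longrightarrow> cutoff \<kappa> \<delta> c (exp (- r)) = 1"
    "\<kappa> * c \<le> r \<Longrightarrow> cutoff \<kappa> \<delta> c (exp (- r)) = 0"
    "continuous_on UNIV (cutoff \<kappa> \<delta> c)"
    "(\<lambda>p. cutoff \<kappa> \<delta> (fst p + h) (snd p)) \<in> borel_measurable (borel \<Otimes>\<^sub>M borel)"
proof -
  have lt: "exp (- \<kappa> * c) < exp (- \<kappa> * (c - \<delta>))" using assms by simp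
  show "0 \<le> cutoff \<kappa> \<delta> c x" "cutoff \<kappa> \<delta> c x \<le> 1" by (auto simp: cutoff_def ramp_bounds)
  show "r \<le> \<kappa> * (c - \<delta>) \<Longrightarrow> cutoff \<kappa> \<delta> c (exp (- r)) = 1"
    unfolding cutoff_def by (rule ramp_eq_1[OF lt]) simp
  show "\<kappa> * c \<le> r \<Longrightarrow> cutoff \<kappa> \<delta> c (exp (- r)) = 0"
    unfolding cutoff_def by (rule ramp_eq_0[OF lt]) simp
  show "continuous_on UNIV (cutoff \<kappa> \<delta> c)"
    unfolding cutoff_def[abs_def] ramp_def using lt by (intro continuous_intros) auto
  show "(\<lambda>p. cutoff \<kappa> \<delta> (fst p + h) (snd p)) \<in> borel_measurable (borel \<Otimes>\<^sub>M borel)"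
    unfolding cutoff_def[abs_def] ramp_def by measurable
qed

context local_limit_tight
begin

text \<open>The kernel replaces x by a nearby centre c. Shifting the cutoff by 2 \<delta> outwards
  or by \<delta> inwards makes it majorise or minorise the sharp condition as long as |c - x| \<le>
  \<delta>; more distant centres are charged to the wider kernel with factor \<eta>.\<close>

lemma ball_window_bounds:
  assumes s: "s > 0" and \<kappa>: "\<kappa> > 0" and \<delta>: "\<delta> > 0" and \<eta>: "\<eta> = sqrt 2 * exp (- \<delta>\<^sup>2 / (4 * s\<^sup>2))"
  defines "F \<equiv> \<lambda>x r. if r < \<kappa> * x then exp (- x) else 0"
  assumes r: "r \<ge> 0"
  shows "(1 - \<eta>) * exp (- \<delta>) * F x r
      \<le> (\<integral>c. exp_tail (- 2 * \<delta>) c * (normal_density c s x * cutoff \<kappa> \<delta> (c + 2 * \<delta>) (exp (- r))) \<partial>lborel)" (is ?upper)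
    and "(\<integral>c. exp_tail 0 c * (normal_density c s x * cutoff \<kappa> \<delta> (c - \<delta>) (exp (- r))) \<partial>lborel)
      \<le> exp \<delta> * F x r + \<eta> * (\<integral>c. exp_tail 0 c * (normal_density c (sqrt 2 * s) x * 1) \<partial>lborel)" (is ?lower)
proof -
  have s2: "sqrt 2 * s > 0" using s by simp
  note cut = cutoff[OF \<kappa> \<delta>]
  have \<eta>0: "\<eta> \<ge> 0" by (simp add: \<eta>)
  have i: "integrable lborel (\<lambda>c. exp_tail c0 c * (normal_density c s x * cutoff \<kappa> \<delta> (c + h) z))" for c0 h z
    by (rule smoothed_inner_integrable[OF s, where V = "\<lambda>c. cutoff \<kappa> \<delta> (c + h)"]) (use cut in auto)
  have i2: "integrable lborel (\<lambda>c. exp_tail c0 c * (normal_density c (sqrt 2 * s) x * 1))" for c0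
    by (rule smoothed_inner_integrable[OF s2, where V = "\<lambda>c x. 1"]) auto
  have nd: "integrable lborel (\<lambda>c. normal_density c t x)" "(\<integral>c. normal_density c t x \<partial>lborel) = 1" if "t > 0" for t
    using that by (auto simp: normal_density_commute[of _ t x] fun_eq_iff)
  show ?upper
  proof (cases "r < \<kappa> * x")
    case False
    then show ?thesis using cut by (auto simp: F_def intro!: Bochner_Integration.integral_nonneg)
  next
    case True
    then have "\<kappa> * x > 0" using r by linarith
    then have x: "x > 0" using \<kappa> by (simp add: zero_less_mult_iff)
    \<comment> \<open>Subtracting \<eta> times the wider kernel makes the left side nonpositive for
      |c - x| > \<delta>, while for smaller distance the cutoff equals 1. Integrated over c, the two
      kernels give 1 - \<eta>.\<close>
    have *: "exp (- x - \<delta>) * (normal_density c s x - \<eta> * normal_density c (sqrt 2 * s) x)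
       \<le> exp_tail (- 2 * \<delta>) c * (normal_density c s x * cutoff \<kappa> \<delta> (c + 2 * \<delta>) (exp (- r)))" for c
    proof (cases "\<bar>c - x\<bar> \<le> \<delta>")
      case d: True
      have "\<kappa> * x \<le> \<kappa> * (c + \<delta>)" using d \<kappa> by (intro mult_left_mono) auto
      then have 1: "cutoff \<kappa> \<delta> (c + 2 * \<delta>) (exp (- r)) = 1" using True by (intro cut(3)) (simp add: algebra_simps)
      have 2: "exp (- x - \<delta>) \<le> exp_tail (- 2 * \<delta>) c" using d x \<delta> by (auto simp: exp_tail_def)
      have "exp (- x - \<delta>) * (normal_density c s x - \<eta> * normal_density c (sqrt 2 * s) x) \<le> exp (- x - \<delta>) * normal_density c s x"
        using \<eta>0 by (intro mult_left_mono) auto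
      also have "\<dots> \<le> exp_tail (- 2 * \<delta>) c * normal_density c s x" using 2 by (intro mult_right_mono) auto
      finally show ?thesis using 1 by simp
    next
      case False
      then have "normal_density c s x - \<eta> * normal_density c (sqrt 2 * s) x \<le> 0"
        using normal_density_tail[OF s, of \<delta> c x] \<delta> by (simp add: \<eta>)
      then have "exp (- x - \<delta>) * (normal_density c s x - \<eta> * normal_density c (sqrt 2 * s) x) \<le> 0"
        by (intro mult_nonneg_nonpos) auto
      also have "0 \<le> exp_tail (- 2 * \<delta>) c * (normal_density c s x * cutoff \<kappa> \<delta> (c + 2 * \<delta>) (exp (- r)))"
        using cut by simp
      finally show ?thesis .
    qed
    have "(1 - \<eta>) * exp (- \<delta>) * F x r = (\<integral>c. exp (- x - \<delta>) * (normal_density c s x - \<eta> * normal_density c (sqrt 2 * s) x) \<partial>lborel)"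
    proof -
      have "exp (- x - \<delta>) = exp (- \<delta>) * exp (- x)" by (simp add: exp_add[symmetric])
      then show ?thesis using True nd[OF s] nd[OF s2] by (simp only:) (simp add: F_def algebra_simps)
    qed
    also have "\<dots> \<le> (\<integral>c. exp_tail (- 2 * \<delta>) c * (normal_density c s x * cutoff \<kappa> \<delta> (c + 2 * \<delta>) (exp (- r))) \<partial>lborel)"
      using * nd[OF s] nd[OF s2] i by (intro integral_mono) auto
    finally show ?thesis .
  qed
  show ?lower
  proof -
    \<comment> \<open>Within distance \<delta>, a nonzero cutoff forces r < \<kappa> (c - \<delta>)
      \<le> \<kappa> x, so \<open>F x r\<close> is exp (- x).\<close>
    have *: "exp_tail 0 c * (normal_density c s x * cutoff \<kappa> \<delta> (c - \<delta>) (exp (- r)))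
       \<le> exp \<delta> * F x r * normal_density c s x + \<eta> * (exp_tail 0 c * (normal_density c (sqrt 2 * s) x * 1))" for c
    proof (cases "\<bar>c - x\<bar> \<le> \<delta>")
      case d: True
      have "exp_tail 0 c * cutoff \<kappa> \<delta> (c - \<delta>) (exp (- r)) \<le> exp \<delta> * F x r"
      proof (cases "r < \<kappa> * (c - \<delta>)")
        case True
        have "\<kappa> * (c - \<delta>) \<le> \<kappa> * x" using d \<kappa> by (intro mult_left_mono) auto
        then have F: "F x r = exp (- x)" using True by (simp add: F_def)
        have "exp_tail 0 c \<le> exp \<delta> * exp (- x)" using d by (auto simp: exp_tail_def indicator_def exp_add[symmetric])
        then have "exp_tail 0 c * cutoff \<kappa> \<delta> (c - \<delta>) (exp (- r)) \<le> exp \<delta> * exp (- x) * 1"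
          using cut by (intro mult_mono) auto
        then show ?thesis using F by simp
      next
        case False
        then show ?thesis by (simp add: cut(4) F_def)
      qed
      then have "exp_tail 0 c * cutoff \<kappa> \<delta> (c - \<delta>) (exp (- r)) * normal_density c s x \<le> exp \<delta> * F x r * normal_density c s x"
        by (rule mult_right_mono) simp
      then show ?thesis using \<eta>0 by (simp add: mult_ac add_increasing2)
    next
      case False
      have "normal_density c s x * cutoff \<kappa> \<delta> (c - \<delta>) (exp (- r)) \<le> \<eta> * normal_density c (sqrt 2 * s) x * 1"
        using normal_density_tail[OF s, of \<delta> c x] \<delta> False cut \<eta>0 unfolding \<eta>
        by (intro mult_mono) auto
      then have "exp_tail 0 c * (normal_density c s x * cutoff \<kappa> \<delta> (c - \<delta>) (exp (- r))) \<le> exp_tail 0 c * (\<eta> * normal_density c (sqrt 2 * s) x * 1)"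
        by (rule mult_left_mono) simp
      then show ?thesis by (simp add: mult_ac F_def add_increasing)
    qed
    have "(\<integral>c. exp_tail 0 c * (normal_density c s x * cutoff \<kappa> \<delta> (c - \<delta>) (exp (- r))) \<partial>lborel)
      \<le> (\<integral>c. exp \<delta> * F x r * normal_density c s x + \<eta> * (exp_tail 0 c * (normal_density c (sqrt 2 * s) x * 1)) \<partial>lborel)"
      using * nd[OF s] i[of 0 "- \<delta>"] i2[of 0] by (intro integral_mono) auto
    also have "\<dots> = exp \<delta> * F x r + \<eta> * (\<integral>c. exp_tail 0 c * (normal_density c (sqrt 2 * s) x * 1) \<partial>lborel)"
      using nd[OF s] i2[of 0] by simp
    finally show ?thesis .
  qed
qed

text \<open>Up to shifts by multiples of \<delta> the cutoff is the indicator of c \<ge> r /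
  \<kappa>, and integrating exp (- c) over that half-line produces exp (- r / \<kappa>).\<close>

lemma cutoff_laplace:
  assumes \<kappa>: "\<kappa> > 0" and \<delta>: "\<delta> > 0" and r: "r \<ge> 0"
  shows "(\<integral>c. exp_tail (- 2 * \<delta>) c * cutoff \<kappa> \<delta> (c + 2 * \<delta>) (exp (- r)) \<partial>lborel) \<le> exp (2 * \<delta>) * exp (- r / \<kappa>)"
    and "exp (- 2 * \<delta>) * exp (- r / \<kappa>) \<le> (\<integral>c. exp_tail 0 c * cutoff \<kappa> \<delta> (c - \<delta>) (exp (- r)) \<partial>lborel)"
    and "integrable lborel (\<lambda>c. exp_tail c0 c * cutoff \<kappa> \<delta> (c + h) (exp (- r)))"
proof -
  note cut = cutoff[OF \<kappa> \<delta>]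
  have [measurable]: "(\<lambda>c. cutoff \<kappa> \<delta> (c + h) z) \<in> borel_measurable borel" for h z
    unfolding cutoff_def ramp_def by measurable
  show i: "integrable lborel (\<lambda>c. exp_tail c0 c * cutoff \<kappa> \<delta> (c + h) (exp (- r)))" for c0 h
    by (rule Bochner_Integration.integrable_bound[OF exp_tail_integral(1)[of c0]])
      (use cut in \<open>auto simp: abs_mult mult_left_le\<close>)
  have "(\<integral>c. exp_tail (- 2 * \<delta>) c * cutoff \<kappa> \<delta> (c + 2 * \<delta>) (exp (- r)) \<partial>lborel) \<le> (\<integral>c. exp_tail (r / \<kappa> - 2 * \<delta>) c \<partial>lborel)"
  proof (rule integral_mono[OF i exp_tail_integral(1)])
    fix c
    show "exp_tail (- 2 * \<delta>) c * cutoff \<kappa> \<delta> (c + 2 * \<delta>) (exp (- r)) \<le> exp_tail (r / \<kappa> - 2 * \<delta>) c"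
    proof (cases "\<kappa> * (c + 2 * \<delta>) \<le> r")
      case True then show ?thesis by (simp add: cut(4))
    next
      case False
      then have "r / \<kappa> < c + 2 * \<delta>" using \<kappa> by (simp add: field_simps)
      then show ?thesis using cut(2)[of "c + 2 * \<delta>"] by (auto simp: exp_tail_def indicator_def mult_left_le)
    qed
  qed
  also have "\<dots> = exp (2 * \<delta>) * exp (- r / \<kappa>)" by (simp add: exp_tail_integral exp_add[symmetric])
  finally show "(\<integral>c. exp_tail (- 2 * \<delta>) c * cutoff \<kappa> \<delta> (c + 2 * \<delta>) (exp (- r)) \<partial>lborel) \<le> exp (2 * \<delta>) * exp (- r / \<kappa>)" .
  have "exp (- 2 * \<delta>) * exp (- r / \<kappa>) = (\<integral>c. exp_tail (r / \<kappa> + 2 * \<delta>) c \<partial>lborel)"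
    by (simp add: exp_tail_integral exp_add[symmetric])
  also have "\<dots> \<le> (\<integral>c. exp_tail 0 c * cutoff \<kappa> \<delta> (c - \<delta>) (exp (- r)) \<partial>lborel)"
  proof (rule integral_mono[OF exp_tail_integral(1)])
    show "integrable lborel (\<lambda>c. exp_tail 0 c * cutoff \<kappa> \<delta> (c - \<delta>) (exp (- r)))" using i[of 0 "- \<delta>"] by simp
    fix c
    show "exp_tail (r / \<kappa> + 2 * \<delta>) c \<le> exp_tail 0 c * cutoff \<kappa> \<delta> (c - \<delta>) (exp (- r))"
    proof (cases "r / \<kappa> + 2 * \<delta> \<le> c")
      case True
      then have "r \<le> \<kappa> * (c - \<delta> - \<delta>)" using \<kappa> by (simp add: field_simps)
      moreover have "0 \<le> c" using True \<delta> r \<kappa> by (smt (verit) divide_nonneg_pos)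
      ultimately show ?thesis by (simp add: cut(3) exp_tail_def)
    next
      case False then show ?thesis using cut by (simp add: exp_tail_def)
    qed
  qed
  finally show "exp (- 2 * \<delta>) * exp (- r / \<kappa>) \<le> (\<integral>c. exp_tail 0 c * cutoff \<kappa> \<delta> (c - \<delta>) (exp (- r)) \<partial>lborel)" .
qed

text \<open>For fixed \<delta> and kernel width s, n tends to infinity in both window bounds; the
  wider kernel in the error term has the finite limit \<open>C0\<close>. Letting \<delta> tend to 0
  closes the gap between the bounds.\<close>

theorem ball_limit:
  assumes \<kappa>: "\<kappa> > 0"
  shows "(\<lambda>n. m n * (\<integral>y. (if (norm y)\<^sup>2 < \<kappa> * (m n * (g \<bullet> y)) then exp (- (m n * (g \<bullet> y))) else 0) \<partial>cpow (\<zeta> n) n))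
     \<longlonglongrightarrow> C0 * (\<integral>y. exp (- (norm y)\<^sup>2 / \<kappa>) \<partial>\<zeta>0)"
proof -
  define A where "A n = m n * (\<integral>y. (if (norm y)\<^sup>2 < \<kappa> * (m n * (g \<bullet> y)) then exp (- (m n * (g \<bullet> y))) else 0) \<partial>cpow (\<zeta> n) n)" for n
  define E where "E = (\<integral>y. exp (- (norm y)\<^sup>2 / \<kappa>) \<partial>\<zeta>0)"
  note p = bprob_cpow[OF \<zeta>]
  note [measurable_cong] = bprobD(2)[OF p] bprobD(2)[OF \<zeta>0]
  interpret \<zeta>0: prob_space \<zeta>0 by (rule bprobD[OF \<zeta>0])
  have E: "integrable \<zeta>0 (\<lambda>y. exp (- (norm y)\<^sup>2 / \<kappa>))"
    by (rule \<zeta>0.integrable_bounded[where B = 1]) (use \<kappa> in auto)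
  have Fi: "integrable (cpow (\<zeta> n) n) (\<lambda>y. if (norm y)\<^sup>2 < \<kappa> * (m n * (g \<bullet> y)) then exp (- (m n * (g \<bullet> y))) else 0)" for n
  proof -
    interpret \<nu>: prob_space "cpow (\<zeta> n) n" by (rule bprobD[OF p])
    show ?thesis
    proof (rule \<nu>.integrable_bounded[where B = 1])
      fix y :: 'h
      have "0 < m n * (g \<bullet> y)" if "(norm y)\<^sup>2 < \<kappa> * (m n * (g \<bullet> y))"
        using that \<kappa> zero_le_power2[of "norm y"] by (smt (verit) mult_nonneg_nonpos)
      then show "norm (if (norm y)\<^sup>2 < \<kappa> * (m n * (g \<bullet> y)) then exp (- (m n * (g \<bullet> y))) else 0) \<le> 1" by auto
    qed measurable
  qed
  have bounds: "eventually (\<lambda>n. A n \<le> exp (4 * \<delta>) / (1 - \<delta>) * (C0 * E) + \<delta>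
        \<and> exp (- \<delta>) * (exp (- 2 * \<delta>) * (C0 * E) - \<delta> * C0 - \<delta>) \<le> A n) sequentially"
    if \<delta>: "0 < \<delta>" "\<delta> < 1" for \<delta>
  proof -
    \<comment> \<open>For given \<delta> the width s is taken so small that the tail factor \<eta>
      falls below \<delta>.\<close>
    have "((\<lambda>s. sqrt 2 * exp (- \<delta>\<^sup>2 / (4 * s\<^sup>2))) \<longlongrightarrow> 0) (at_right 0)"
      using \<delta>(1) by real_asymp
    then have "eventually (\<lambda>s. sqrt 2 * exp (- \<delta>\<^sup>2 / (4 * s\<^sup>2)) < \<delta> \<and> s > 0) (at_right 0)"
      using \<delta>(1) by (intro eventually_conj order_tendstoD(2)) (auto simp: eventually_at_right_less)
    then obtain s where s: "s > 0" "sqrt 2 * exp (- \<delta>\<^sup>2 / (4 * s\<^sup>2)) < \<delta>"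
      using eventually_happens by (metis (no_types, lifting) trivial_limit_at_right_real)
    define \<eta> where "\<eta> = sqrt 2 * exp (- \<delta>\<^sup>2 / (4 * s\<^sup>2))"
    have \<eta>: "0 \<le> \<eta>" "\<eta> < \<delta>" using s(2) by (auto simp: \<eta>_def)
    have s2: "sqrt 2 * s > 0" using s by simp
    note cut = cutoff[OF \<kappa> \<delta>(1)]
    let ?VU = "\<lambda>c. cutoff \<kappa> \<delta> (c + 2 * \<delta>)" and ?VL = "\<lambda>c. cutoff \<kappa> \<delta> (c - \<delta>)"
    have VL: "(\<lambda>p. ?VL (fst p) (snd p)) \<in> borel_measurable (borel \<Otimes>\<^sub>M borel)" using cut(6)[of "- \<delta>"] by simp
    define U where "U n = m n * (\<integral>y. (\<integral>c. exp_tail (- 2 * \<delta>) c * (normal_density c s (m n * (g \<bullet> y)) * ?VU c (exp (- (norm y)\<^sup>2))) \<partial>lborel) \<partial>cpow (\<zeta> n) n)" for n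
    define L where "L n = m n * (\<integral>y. (\<integral>c. exp_tail 0 c * (normal_density c s (m n * (g \<bullet> y)) * ?VL c (exp (- (norm y)\<^sup>2))) \<partial>lborel) \<partial>cpow (\<zeta> n) n)" for n
    define Q where "Q n = m n * (\<integral>y. (\<integral>c. exp_tail 0 c * (normal_density c (sqrt 2 * s) (m n * (g \<bullet> y)) * 1) \<partial>lborel) \<partial>cpow (\<zeta> n) n)" for n
    have iU: "integrable (cpow (\<zeta> n) n) (\<lambda>y. \<integral>c. exp_tail (- 2 * \<delta>) c * (normal_density c s (m n * (g \<bullet> y)) * ?VU c (exp (- (norm y)\<^sup>2))) \<partial>lborel)" for n
      by (rule smoothed_integrable[OF s(1) cut(6,5,1,2)])
    have iL: "integrable (cpow (\<zeta> n) n) (\<lambda>y. \<integral>c. exp_tail 0 c * (normal_density c s (m n * (g \<bullet> y)) * ?VL c (exp (- (norm y)\<^sup>2))) \<partial>lborel)" for n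
      by (rule smoothed_integrable[OF s(1) VL cut(5,1,2)])
    have iQ: "integrable (cpow (\<zeta> n) n) (\<lambda>y. \<integral>c. exp_tail 0 c * (normal_density c (sqrt 2 * s) (m n * (g \<bullet> y)) * 1) \<partial>lborel)" for n
      by (rule smoothed_integrable[OF s2, where V = "\<lambda>_ _. 1"]) auto
    have limU: "U \<longlonglongrightarrow> C0 * (\<integral>y. (\<integral>c. exp_tail (- 2 * \<delta>) c * ?VU c (exp (- (norm y)\<^sup>2)) \<partial>lborel) \<partial>\<zeta>0)"
      unfolding U_def by (rule smoothed_limit[OF s(1) cut(6,5,1,2)])
    have limL: "L \<longlonglongrightarrow> C0 * (\<integral>y. (\<integral>c. exp_tail 0 c * ?VL c (exp (- (norm y)\<^sup>2)) \<partial>lborel) \<partial>\<zeta>0)"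
      unfolding L_def by (rule smoothed_limit[OF s(1) VL cut(5,1,2)])
    have "Q \<longlonglongrightarrow> C0 * (\<integral>y. (\<integral>c. exp_tail 0 c * 1 \<partial>lborel) \<partial>\<zeta>0)"
      unfolding Q_def by (rule smoothed_limit[OF s2, where V = "\<lambda>_ _. 1"]) auto
    then have limQ: "Q \<longlonglongrightarrow> C0" by (simp add: exp_tail_integral \<zeta>0.prob_space)
    have iV: "integrable \<zeta>0 (\<lambda>y. \<integral>c. exp_tail c0 c * cutoff \<kappa> \<delta> (c + h) (exp (- (norm y)\<^sup>2)) \<partial>lborel)" for c0 h
    proof (rule \<zeta>0.integrable_bounded[where B = "exp (- c0)"])
      note [measurable] = measurable_compose[OF measurable_Pair cut(6)[of h], simplified]
      show "(\<lambda>y. \<integral>c. exp_tail c0 c * cutoff \<kappa> \<delta> (c + h) (exp (- (norm y)\<^sup>2)) \<partial>lborel) \<in> borel_measurable \<zeta>0"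
        unfolding cutoff_def ramp_def by measurable
      fix y :: 'h
      have "(\<integral>c. exp_tail c0 c * cutoff \<kappa> \<delta> (c + h) (exp (- (norm y)\<^sup>2)) \<partial>lborel) \<le> (\<integral>c. exp_tail c0 c \<partial>lborel)"
        by (rule integral_mono[OF cutoff_laplace(3)[OF \<kappa> \<delta>(1)] exp_tail_integral(1)]) (use cut in \<open>auto simp: mult_left_le\<close>)
      moreover have "0 \<le> (\<integral>c. exp_tail c0 c * cutoff \<kappa> \<delta> (c + h) (exp (- (norm y)\<^sup>2)) \<partial>lborel)"
        using cut by (intro Bochner_Integration.integral_nonneg) auto
      ultimately show "norm (\<integral>c. exp_tail c0 c * cutoff \<kappa> \<delta> (c + h) (exp (- (norm y)\<^sup>2)) \<partial>lborel) \<le> exp (- c0)"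
        by (simp add: exp_tail_integral)
    qed
    have "(\<integral>y. (\<integral>c. exp_tail (- 2 * \<delta>) c * ?VU c (exp (- (norm y)\<^sup>2)) \<partial>lborel) \<partial>\<zeta>0) \<le> (\<integral>y. exp (2 * \<delta>) * exp (- (norm y)\<^sup>2 / \<kappa>) \<partial>\<zeta>0)"
      by (rule integral_mono[OF iV integrable_mult_right[OF E]]) (use cutoff_laplace(1)[OF \<kappa> \<delta>(1)] in auto)
    then have leU: "C0 * (\<integral>y. (\<integral>c. exp_tail (- 2 * \<delta>) c * ?VU c (exp (- (norm y)\<^sup>2)) \<partial>lborel) \<partial>\<zeta>0) \<le> exp (2 * \<delta>) * (C0 * E)"
      using mult_left_mono[of _ _ C0] C0_pos by (fastforce simp: E_def mult_ac)
    have "(\<integral>y. exp (- 2 * \<delta>) * exp (- (norm y)\<^sup>2 / \<kappa>) \<partial>\<zeta>0) \<le> (\<integral>y. (\<integral>c. exp_tail 0 c * ?VL c (exp (- (norm y)\<^sup>2)) \<partial>lborel) \<partial>\<zeta>0)"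
      by (rule integral_mono[OF integrable_mult_right[OF E]]) (use iV[of 0 "- \<delta>"] cutoff_laplace(2)[OF \<kappa> \<delta>(1)] in auto)
    then have leL: "exp (- 2 * \<delta>) * (C0 * E) \<le> C0 * (\<integral>y. (\<integral>c. exp_tail 0 c * ?VL c (exp (- (norm y)\<^sup>2)) \<partial>lborel) \<partial>\<zeta>0)"
      using mult_left_mono[of _ _ C0] C0_pos by (fastforce simp: E_def mult_ac)
    \<comment> \<open>Dividing by \<open>(1 - \<delta>) * exp (- \<delta>)\<close> later turns
      \<epsilon> into exactly \<delta>.\<close>
    define \<epsilon> where "\<epsilon> = \<delta> * (1 - \<delta>) * exp (- \<delta>)"
    have \<epsilon>: "\<epsilon> > 0" using \<delta> by (simp add: \<epsilon>_def)
    have evU: "eventually (\<lambda>n. U n < exp (2 * \<delta>) * (C0 * E) + \<epsilon>) sequentially"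
      using leU \<epsilon> by (intro order_tendstoD(2)[OF limU]) linarith
    have evL: "eventually (\<lambda>n. L n > exp (- 2 * \<delta>) * (C0 * E) - \<delta> / 2) sequentially"
      using leL \<delta> by (intro order_tendstoD(1)[OF limL]) linarith
    have evQ: "eventually (\<lambda>n. Q n < C0 + 1 / 2) sequentially"
      by (intro order_tendstoD(2)[OF limQ]) simp
    show ?thesis using evU evL evQ eventually_m_pos
    proof eventually_elim
      case (elim n)
      have "m n * (\<integral>y. (1 - \<eta>) * exp (- \<delta>) * (if (norm y)\<^sup>2 < \<kappa> * (m n * (g \<bullet> y)) then exp (- (m n * (g \<bullet> y))) else 0) \<partial>cpow (\<zeta> n) n) \<le> U n"
        unfolding U_def using elim(4)
        by (intro mult_left_mono integral_mono[OF integrable_mult_right[OF Fi] iU] ball_window_bounds(1)[OF s(1) \<kappa> \<delta>(1) \<eta>_def]) auto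
      then have "(1 - \<eta>) * exp (- \<delta>) * A n \<le> U n" by (simp add: A_def mult_ac)
      moreover have A0: "0 \<le> A n" unfolding A_def using elim(4) by (intro mult_nonneg_nonneg Bochner_Integration.integral_nonneg) auto
      moreover have "(1 - \<delta>) * exp (- \<delta>) * A n \<le> (1 - \<eta>) * exp (- \<delta>) * A n"
        using \<eta> A0 by (intro mult_right_mono) auto
      ultimately have *: "(1 - \<delta>) * exp (- \<delta>) * A n \<le> exp (2 * \<delta>) * (C0 * E) + \<epsilon>" using elim(1) by linarith
      have pos: "0 < (1 - \<delta>) * exp (- \<delta>)" using \<delta> by simp
      have "A n \<le> (exp (2 * \<delta>) * (C0 * E) + \<epsilon>) / ((1 - \<delta>) * exp (- \<delta>))"
        using * pos by (subst pos_le_divide_eq[OF pos]) (simp add: mult_ac)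
      also have "\<dots> = exp (3 * \<delta>) / (1 - \<delta>) * (C0 * E) + \<delta>"
        using \<delta> by (simp add: \<epsilon>_def exp_minus field_simps flip: exp_add)
      also have "\<dots> \<le> exp (4 * \<delta>) / (1 - \<delta>) * (C0 * E) + \<delta>"
        using \<delta> C0_pos by (intro add_mono mult_right_mono divide_right_mono) (auto simp: E_def intro!: mult_nonneg_nonneg Bochner_Integration.integral_nonneg)
      finally have up: "A n \<le> exp (4 * \<delta>) / (1 - \<delta>) * (C0 * E) + \<delta>" .
      have "L n \<le> m n * (\<integral>y. exp \<delta> * (if (norm y)\<^sup>2 < \<kappa> * (m n * (g \<bullet> y)) then exp (- (m n * (g \<bullet> y))) else 0)
          + \<eta> * (\<integral>c. exp_tail 0 c * (normal_density c (sqrt 2 * s) (m n * (g \<bullet> y)) * 1) \<partial>lborel) \<partial>cpow (\<zeta> n) n)"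
        unfolding L_def using elim(4)
        by (intro mult_left_mono integral_mono[OF iL Bochner_Integration.integrable_add[OF integrable_mult_right[OF Fi] integrable_mult_right[OF iQ]]]
             ball_window_bounds(2)[OF s(1) \<kappa> \<delta>(1) \<eta>_def]) auto
      also have "\<dots> = exp \<delta> * A n + \<eta> * Q n"
        by (subst Bochner_Integration.integral_add[OF integrable_mult_right[OF Fi] integrable_mult_right[OF iQ]])
          (simp add: A_def Q_def algebra_simps)
      also have "\<dots> \<le> exp \<delta> * A n + \<delta> * (C0 + 1 / 2)"
      proof -
        have "\<eta> * Q n \<le> \<eta> * (C0 + 1 / 2)" using elim(3) \<eta> by (intro mult_left_mono) auto
        also have "\<dots> \<le> \<delta> * (C0 + 1 / 2)" using \<eta> C0_pos by (intro mult_right_mono) auto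
        finally show ?thesis by simp
      qed
      finally have "exp (- 2 * \<delta>) * (C0 * E) - \<delta> * C0 - \<delta> \<le> exp \<delta> * A n"
        using elim(2) by (simp add: algebra_simps)
      then have "exp (- \<delta>) * (exp (- 2 * \<delta>) * (C0 * E) - \<delta> * C0 - \<delta>) \<le> exp (- \<delta>) * (exp \<delta> * A n)"
        by (intro mult_left_mono) auto
      also have "\<dots> = A n" by (simp add: exp_minus)
      finally show ?case using up by blast
    qed
  qed
  have lim1: "((\<lambda>\<delta>. exp (4 * \<delta>) / (1 - \<delta>) * (C0 * E) + \<delta>) \<longlongrightarrow> C0 * E) (at_right 0)"
    by (rule tendsto_eq_rhs, (rule tendsto_intros | simp)+)
  have lim2: "((\<lambda>\<delta>. exp (- \<delta>) * (exp (- 2 * \<delta>) * (C0 * E) - \<delta> * C0 - \<delta>)) \<longlongrightarrow> C0 * E) (at_right 0)"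
    by (rule tendsto_eq_rhs, (rule tendsto_intros | simp)+)
  have "A \<longlonglongrightarrow> C0 * E"
  proof (rule order_tendstoI)
    fix a assume "a < C0 * E"
    then have "eventually (\<lambda>\<delta>. a < exp (- \<delta>) * (exp (- 2 * \<delta>) * (C0 * E) - \<delta> * C0 - \<delta>)) (at_right 0)"
      by (rule order_tendstoD(1)[OF lim2])
    moreover have "eventually (\<lambda>\<delta>::real. 0 < \<delta> \<and> \<delta> < 1) (at_right 0)"
      using eventually_at_right_real[of 0 "1::real"] by simp
    ultimately have "eventually (\<lambda>\<delta>. a < exp (- \<delta>) * (exp (- 2 * \<delta>) * (C0 * E) - \<delta> * C0 - \<delta>) \<and> 0 < \<delta> \<and> \<delta> < 1) (at_right 0)"
      by (rule eventually_conj)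
    then obtain \<delta> where "a < exp (- \<delta>) * (exp (- 2 * \<delta>) * (C0 * E) - \<delta> * C0 - \<delta>)" "0 < \<delta>" "\<delta> < 1"
      using eventually_happens by (metis (no_types, lifting) trivial_limit_at_right_real)
    with bounds show "eventually (\<lambda>n. a < A n) sequentially"
      by (smt (verit, ccfv_threshold) eventually_mono)
  next
    fix a assume "C0 * E < a"
    then have "eventually (\<lambda>\<delta>. exp (4 * \<delta>) / (1 - \<delta>) * (C0 * E) + \<delta> < a) (at_right 0)"
      by (rule order_tendstoD(2)[OF lim1])
    moreover have "eventually (\<lambda>\<delta>::real. 0 < \<delta> \<and> \<delta> < 1) (at_right 0)"
      using eventually_at_right_real[of 0 "1::real"] by simp
    ultimately have "eventually (\<lambda>\<delta>. exp (4 * \<delta>) / (1 - \<delta>) * (C0 * E) + \<delta> < a \<and> 0 < \<delta> \<and> \<delta> < 1) (at_right 0)"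
      by (rule eventually_conj)
    then obtain \<delta> where "exp (4 * \<delta>) / (1 - \<delta>) * (C0 * E) + \<delta> < a" "0 < \<delta>" "\<delta> < 1"
      using eventually_happens by (metis (no_types, lifting) trivial_limit_at_right_real)
    with bounds show "eventually (\<lambda>n. A n < a) sequentially"
      by (smt (verit, ccfv_threshold) eventually_mono)
  qed
  then show ?thesis unfolding A_def E_def .
qed

end

section \<open>Exponential tilting\<close>

lemma abs_exp_minus_linear_le: "\<bar>exp y - 1 - y\<bar> \<le> y\<^sup>2 * exp \<bar>y\<bar>" for y :: real
proof -
  obtain t where t: "\<bar>t\<bar> \<le> \<bar>y\<bar>" "exp y = (\<Sum>m<2. y ^ m / fact m) + exp t / fact 2 * y ^ 2"
    using Maclaurin_exp_le[of y 2] by auto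
  then have "exp y - 1 - y = exp t / 2 * y\<^sup>2" by (simp add: numeral_2_eq_2)
  moreover have "exp t \<le> exp \<bar>y\<bar>" using t(1) by simp
  ultimately have "\<bar>exp y - 1 - y\<bar> \<le> exp \<bar>y\<bar> / 2 * y\<^sup>2"
    by (simp only: abs_mult) (intro mult_mono, auto)
  also have "\<dots> \<le> exp \<bar>y\<bar> * y\<^sup>2" by (intro mult_right_mono) auto
  finally show ?thesis by (simp add: mult.commute)
qed

lemma abs_exp_minus_quadratic_le: "\<bar>exp y - 1 - y - y\<^sup>2 / 2\<bar> \<le> \<bar>y\<bar> ^ 3 * exp \<bar>y\<bar>" for y :: real
proof -
  obtain t where t: "\<bar>t\<bar> \<le> \<bar>y\<bar>" "exp y = (\<Sum>m<3. y ^ m / fact m) + exp t / fact 3 * y ^ 3"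
    using Maclaurin_exp_le[of y 3] by auto
  then have "exp y - 1 - y - y\<^sup>2 / 2 = exp t / 6 * y ^ 3" by (simp add: numeral_3_eq_3 fact_numeral power2_eq_square)
  moreover have "exp t \<le> exp \<bar>y\<bar>" using t(1) by simp
  ultimately have "\<bar>exp y - 1 - y - y\<^sup>2 / 2\<bar> \<le> exp \<bar>y\<bar> / 6 * \<bar>y\<bar> ^ 3"
    by (simp only: abs_mult power_abs) (intro mult_mono, auto)
  also have "\<dots> \<le> exp \<bar>y\<bar> * \<bar>y\<bar> ^ 3" by (intro mult_right_mono) auto
  finally show ?thesis by (simp add: mult.commute)
qed

lemma iexp_quadratic_bound: "norm (iexp x - (1 + \<i> * x - of_real (x\<^sup>2 / 2))) \<le> \<bar>x\<bar> ^ 3"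
proof -
  have "(\<Sum>k\<le>2. (\<i> * complex_of_real x) ^ k / fact k) = 1 + \<i> * x - of_real (x\<^sup>2 / 2)"
    by (simp add: numeral_2_eq_2 power_mult_distrib flip: of_real_power)
  then have "norm (iexp x - (1 + \<i> * x - of_real (x\<^sup>2 / 2))) \<le> \<bar>x\<bar> ^ 3 / fact 3"
    using iexp_approx1[of x 2] by (simp add: numeral_3_eq_3)
  also have "\<dots> \<le> \<bar>x\<bar> ^ 3" by (simp add: divide_le_eq fact_numeral)
  finally show ?thesis .
qed

text \<open>An exponential moment in the single direction g is assumed; together with the cube of
  the norm it dominates Taylor remainders up to third order.\<close>

locale tilting =
  fixes \<mu> :: "'h::{real_inner, banach, second_countable_topology} measure" and g :: 'h and t0 :: real
  assumes \<mu>: "bprob \<mu>" and t0: "t0 > 0"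
    and third: "integrable \<mu> (\<lambda>x. norm x ^ 3 * exp (t0 * \<bar>g \<bullet> x\<bar>))"
    and mean0: "(\<integral>x. x \<partial>\<mu>) = 0"
begin

sublocale prob_space \<mu> by (rule bprobD[OF \<mu>])

lemma sets_\<mu> [measurable_cong]: "sets \<mu> = sets borel" by (rule bprobD[OF \<mu>])

text \<open>One majorant for all tilting factors with parameter between 0 and
  \<open>t0\<close>.\<close>

definition wt :: "'h \<Rightarrow> real" where "wt x = exp (t0 * \<bar>g \<bullet> x\<bar>)"

lemma borel_measurable_wt [measurable]: "wt \<in> borel_measurable borel"
  unfolding wt_def[abs_def] by measurable

lemma wt_ge_1: "wt x \<ge> 1" using t0 by (simp add: wt_def)

lemma wt_pos [simp]: "0 < wt x" by (simp add: wt_def)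

lemma wt_nonneg [simp]: "0 \<le> wt x" by (simp add: wt_def)

text \<open>Outside the unit ball lower powers are dominated by the cube; inside it
  \<open>wt\<close> is at most \<open>exp (t0 * norm g)\<close>.\<close>

lemma integrable_wt: "k \<le> 3 \<Longrightarrow> integrable \<mu> (\<lambda>x. norm x ^ k * wt x)"
proof (rule Bochner_Integration.integrable_bound)
  assume k: "k \<le> 3"
  show "integrable \<mu> (\<lambda>x. exp (t0 * norm g) + norm x ^ 3 * wt x)" using third by (simp add: wt_def)
  show "AE x in \<mu>. norm (norm x ^ k * wt x) \<le> norm (exp (t0 * norm g) + norm x ^ 3 * wt x)"
  proof (rule AE_I2)
    fix x :: 'h
    have "norm x ^ k * wt x \<le> exp (t0 * norm g) + norm x ^ 3 * wt x"
    proof (cases "norm x \<le> 1")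
      case True
      have "\<bar>g \<bullet> x\<bar> \<le> norm g * norm x" by (rule Cauchy_Schwarz_ineq2)
      also have "\<dots> \<le> norm g * 1" using True by (intro mult_left_mono) auto
      finally have "wt x \<le> exp (t0 * norm g)" using t0 by (simp add: wt_def)
      moreover have "norm x ^ k * wt x \<le> 1 * wt x" using True by (intro mult_right_mono power_le_one) auto
      ultimately show ?thesis by (smt (verit) mult_nonneg_nonneg norm_ge_zero wt_nonneg zero_le_power)
    next
      case False
      then have "norm x ^ k \<le> norm x ^ 3" using k by (intro power_increasing) auto
      then have "norm x ^ k * wt x \<le> norm x ^ 3 * wt x" by (intro mult_right_mono) auto
      then show ?thesis by (simp add: add_increasing)
    qed
    then show "norm (norm x ^ k * wt x) \<le> norm (exp (t0 * norm g) + norm x ^ 3 * wt x)" by simp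
  qed
qed measurable

lemma integrable_dominated:
  fixes f :: "'h \<Rightarrow> 'b::{banach, second_countable_topology}"
  assumes "f \<in> borel_measurable borel" "\<And>x. norm (f x) \<le> L * (norm x ^ k * wt x)" "k \<le> 3"
  shows "integrable \<mu> f" "norm (\<integral>x. f x \<partial>\<mu>) \<le> L * (\<integral>x. norm x ^ k * wt x \<partial>\<mu>)"
proof -
  note [measurable] = assms(1)
  have i: "integrable \<mu> (\<lambda>x. L * (norm x ^ k * wt x))" by (intro integrable_mult_right integrable_wt assms)
  show f: "integrable \<mu> f"
    by (rule Bochner_Integration.integrable_bound[OF i]) (use assms(2) order_trans abs_ge_self in \<open>auto intro!: AE_I2, fastforce\<close>)
  have "norm (\<integral>x. f x \<partial>\<mu>) \<le> (\<integral>x. norm (f x) \<partial>\<mu>)" by (rule integral_norm_bound)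
  also have "\<dots> \<le> (\<integral>x. L * (norm x ^ k * wt x) \<partial>\<mu>)"
    using assms(2) f i by (intro integral_mono) auto
  finally show "norm (\<integral>x. f x \<partial>\<mu>) \<le> L * (\<integral>x. norm x ^ k * wt x \<partial>\<mu>)" by simp
qed

definition W :: "nat \<Rightarrow> real" where "W k = (\<integral>x. norm x ^ k * wt x \<partial>\<mu>)"

lemma W_nonneg: "0 \<le> W k" unfolding W_def by (intro Bochner_Integration.integral_nonneg) auto

lemma integrable_poly:
  fixes f :: "'h \<Rightarrow> 'b::{banach, second_countable_topology}"
  assumes "f \<in> borel_measurable borel" "\<And>x. norm (f x) \<le> L * norm x ^ k" "k \<le> 3" "0 \<le> L"
  shows "integrable \<mu> f"
proof (rule integrable_dominated(1)[OF assms(1) _ assms(3)])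
  fix x
  have "norm x ^ k * 1 \<le> norm x ^ k * wt x" using wt_ge_1 by (intro mult_left_mono) auto
  then show "norm (f x) \<le> L * (norm x ^ k * wt x)"
    using assms(2)[of x] mult_left_mono[OF _ assms(4)] by (smt (verit, ccfv_SIG) mult.right_neutral)
qed

text \<open>The covariance form of \<mu>; \<open>a0\<close> is the covariance operator applied to g,
  and thus the derivative at 0 of the tilted mean.\<close>

definition q :: "'h \<Rightarrow> real" where "q u = (\<integral>x. (u \<bullet> x)\<^sup>2 \<partial>\<mu>)"
definition a0 :: 'h where "a0 = (\<integral>x. (g \<bullet> x) *\<^sub>R x \<partial>\<mu>)"

lemma integrable_id: "integrable \<mu> (\<lambda>x. x)"
  by (rule integrable_poly[where L = 1 and k = 1]) auto

lemma integrable_sq: "integrable \<mu> (\<lambda>x. (norm x)\<^sup>2)"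
  by (rule integrable_poly[where L = 1 and k = 2]) auto

lemma integrable_inner2: "integrable \<mu> (\<lambda>x. (u \<bullet> x) * (v \<bullet> x))"
proof (rule integrable_poly[where L = "norm u * norm v" and k = 2])
  fix x
  have "\<bar>u \<bullet> x\<bar> * \<bar>v \<bullet> x\<bar> \<le> (norm u * norm x) * (norm v * norm x)"
    by (intro mult_mono Cauchy_Schwarz_ineq2) auto
  then show "norm (u \<bullet> x * (v \<bullet> x)) \<le> norm u * norm v * norm x ^ 2"
    by (simp add: abs_mult power2_eq_square mult_ac)
qed auto

lemma integrable_scaled: "integrable \<mu> (\<lambda>x. (u \<bullet> x) *\<^sub>R x)"
proof (rule integrable_poly[where L = "norm u" and k = 2])
  fix x
  have "\<bar>u \<bullet> x\<bar> * norm x \<le> (norm u * norm x) * norm x"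
    by (intro mult_right_mono Cauchy_Schwarz_ineq2) auto
  then show "norm ((u \<bullet> x) *\<^sub>R x) \<le> norm u * norm x ^ 2"
    by (simp add: power2_eq_square mult_ac)
qed auto

lemma inner_a0: "a0 \<bullet> u = (\<integral>x. (g \<bullet> x) * (u \<bullet> x) \<partial>\<mu>)"
proof -
  have "a0 \<bullet> u = (\<integral>x. ((g \<bullet> x) *\<^sub>R x) \<bullet> u \<partial>\<mu>)"
    unfolding a0_def by (rule integral_inner_left[symmetric]) (use integrable_scaled in blast)
  then show ?thesis by (simp add: inner_commute)
qed

lemma inner_mean: "(\<integral>x. u \<bullet> x \<partial>\<mu>) = 0"
  using integral_inner_right[of u \<mu> "\<lambda>x. x"] integrable_id mean0 by simp

lemma q_expand: "q (w *\<^sub>R g + u) = q g * w\<^sup>2 + 2 * w * (a0 \<bullet> u) + q u"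
proof -
  have "q (w *\<^sub>R g + u) = (\<integral>x. w\<^sup>2 * ((g \<bullet> x) * (g \<bullet> x)) + 2 * w * ((g \<bullet> x) * (u \<bullet> x)) + (u \<bullet> x) * (u \<bullet> x) \<partial>\<mu>)"
    unfolding q_def by (rule Bochner_Integration.integral_cong)
      (simp_all add: inner_add_left power2_eq_square algebra_simps)
  also have "\<dots> = w\<^sup>2 * (\<integral>x. (g \<bullet> x) * (g \<bullet> x) \<partial>\<mu>) + 2 * w * (\<integral>x. (g \<bullet> x) * (u \<bullet> x) \<partial>\<mu>) + (\<integral>x. (u \<bullet> x) * (u \<bullet> x) \<partial>\<mu>)"
    by (simp only: Bochner_Integration.integral_add Bochner_Integration.integrable_add integrable_mult_right
        integrable_inner2 integral_mult_right_zero)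
  finally show ?thesis by (simp add: inner_a0 q_def power2_eq_square mult_ac)
qed

definition \<phi> :: "real \<Rightarrow> real" where "\<phi> \<tau> = (\<integral>x. exp (\<tau> * (g \<bullet> x)) \<partial>\<mu>)"

lemma exp_tilt_le: "0 \<le> \<tau> \<Longrightarrow> \<tau> \<le> t0 \<Longrightarrow> exp \<bar>\<tau> * (g \<bullet> x)\<bar> \<le> wt x"
  by (auto simp: wt_def abs_mult intro!: mult_right_mono)

lemma exp_tilt_le': "0 \<le> \<tau> \<Longrightarrow> \<tau> \<le> t0 \<Longrightarrow> exp (\<tau> * (g \<bullet> x)) \<le> wt x"
  using exp_tilt_le[of \<tau> x] by (smt (verit) exp_le_cancel_iff)

lemma integrable_exp_tilt: "0 \<le> \<tau> \<Longrightarrow> \<tau> \<le> t0 \<Longrightarrow> integrable \<mu> (\<lambda>x. exp (\<tau> * (g \<bullet> x)))"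
  by (rule integrable_dominated(1)[where L = 1 and k = 0]) (auto simp: exp_tilt_le')

text \<open>From exp y \<ge> 1 + y and the vanishing mean. It allows the normalising factor of the
  tilt to be dropped in upper bounds.\<close>

lemma \<phi>_ge_1: assumes "0 \<le> \<tau>" "\<tau> \<le> t0" shows "\<phi> \<tau> \<ge> 1"
proof -
  have i: "integrable \<mu> (\<lambda>x. \<tau> * (g \<bullet> x))" using integrable_id by simp
  have "(\<integral>x. 1 + \<tau> * (g \<bullet> x) \<partial>\<mu>) \<le> \<phi> \<tau>"
    unfolding \<phi>_def using i by (intro integral_mono integrable_exp_tilt assms) (auto intro: exp_ge_add_one_self)
  moreover have "(\<integral>x. 1 + \<tau> * (g \<bullet> x) \<partial>\<mu>) = 1"
    using i inner_mean[of g] by (subst Bochner_Integration.integral_add) (auto simp: prob_space)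
  ultimately show ?thesis by simp
qed

lemma power_inner_le: "\<bar>g \<bullet> x\<bar> ^ k \<le> norm g ^ k * norm x ^ k"
  using power_mono[OF Cauchy_Schwarz_ineq2[of g x], of k] by (simp add: power_mult_distrib)

lemma \<phi>_quadratic:
  assumes "0 \<le> \<tau>" "\<tau> \<le> t0"
  shows "\<bar>\<phi> \<tau> - 1 - \<tau>\<^sup>2 * q g / 2\<bar> \<le> \<tau> ^ 3 * (norm g ^ 3 * W 3)"
    and "\<bar>\<phi> \<tau> - 1\<bar> \<le> \<tau>\<^sup>2 * ((norm g)\<^sup>2 * W 2)"
proof -
  have i: "integrable \<mu> (\<lambda>x. \<tau> * (g \<bullet> x))" using integrable_id by simp
  have i2: "integrable \<mu> (\<lambda>x. (\<tau> * (g \<bullet> x))\<^sup>2)"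
    using integrable_mult_right[OF integrable_inner2[of g g], of "\<tau>\<^sup>2"] by (simp add: power2_eq_square mult_ac)
  have ie: "integrable \<mu> (\<lambda>x. exp (\<tau> * (g \<bullet> x)))" by (rule integrable_exp_tilt[OF assms])
  have z: "(\<integral>x. \<tau> * (g \<bullet> x) \<partial>\<mu>) = 0" using inner_mean[of g] by simp
  have "\<phi> \<tau> - 1 - \<tau>\<^sup>2 * q g / 2 = (\<integral>x. exp (\<tau> * (g \<bullet> x)) - 1 - \<tau> * (g \<bullet> x) - (\<tau> * (g \<bullet> x))\<^sup>2 / 2 \<partial>\<mu>)"
    using i i2 ie z by (simp add: \<phi>_def prob_space q_def power_mult_distrib)
  also have "\<bar>\<dots>\<bar> \<le> \<tau> ^ 3 * norm g ^ 3 * (\<integral>x. norm x ^ 3 * wt x \<partial>\<mu>)"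
    unfolding real_norm_def[symmetric]
  proof (rule integrable_dominated(2))
    fix x
    have "\<bar>exp (\<tau> * (g \<bullet> x)) - 1 - \<tau> * (g \<bullet> x) - (\<tau> * (g \<bullet> x))\<^sup>2 / 2\<bar> \<le> \<bar>\<tau> * (g \<bullet> x)\<bar> ^ 3 * exp \<bar>\<tau> * (g \<bullet> x)\<bar>"
      by (rule abs_exp_minus_quadratic_le)
    also have "\<dots> \<le> (\<tau> ^ 3 * (norm g ^ 3 * norm x ^ 3)) * wt x"
      using assms by (intro mult_mono exp_tilt_le) (auto simp: abs_mult power_mult_distrib intro!: mult_left_mono power_inner_le)
    finally show "norm (exp (\<tau> * (g \<bullet> x)) - 1 - \<tau> * (g \<bullet> x) - (\<tau> * (g \<bullet> x))\<^sup>2 / 2) \<le> \<tau> ^ 3 * norm g ^ 3 * (norm x ^ 3 * wt x)"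
      by (simp add: mult_ac)
  qed auto
  finally show "\<bar>\<phi> \<tau> - 1 - \<tau>\<^sup>2 * q g / 2\<bar> \<le> \<tau> ^ 3 * (norm g ^ 3 * W 3)" by (simp add: W_def mult_ac)
  have "\<phi> \<tau> - 1 = (\<integral>x. exp (\<tau> * (g \<bullet> x)) - 1 - \<tau> * (g \<bullet> x) \<partial>\<mu>)"
    using i ie z by (simp add: \<phi>_def prob_space)
  also have "\<bar>\<dots>\<bar> \<le> \<tau>\<^sup>2 * (norm g)\<^sup>2 * (\<integral>x. norm x ^ 2 * wt x \<partial>\<mu>)"
    unfolding real_norm_def[symmetric]
  proof (rule integrable_dominated(2))
    fix x
    have "\<bar>exp (\<tau> * (g \<bullet> x)) - 1 - \<tau> * (g \<bullet> x)\<bar> \<le> (\<tau> * (g \<bullet> x))\<^sup>2 * exp \<bar>\<tau> * (g \<bullet> x)\<bar>"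
      by (rule abs_exp_minus_linear_le)
    also have "\<dots> \<le> (\<tau>\<^sup>2 * ((norm g)\<^sup>2 * (norm x)\<^sup>2)) * wt x"
      using assms power_inner_le[of x 2] by (intro mult_mono exp_tilt_le) (auto simp: power_mult_distrib intro!: mult_left_mono)
    finally show "norm (exp (\<tau> * (g \<bullet> x)) - 1 - \<tau> * (g \<bullet> x)) \<le> \<tau>\<^sup>2 * (norm g)\<^sup>2 * (norm x ^ 2 * wt x)"
      by (simp add: mult_ac)
  qed auto
  finally show "\<bar>\<phi> \<tau> - 1\<bar> \<le> \<tau>\<^sup>2 * ((norm g)\<^sup>2 * W 2)" by (simp add: W_def mult_ac)
qed

text \<open>The Esscher transform of \<mu> in direction g.\<close>

definition tilt :: "real \<Rightarrow> 'h measure" where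
  "tilt \<tau> = density \<mu> (\<lambda>x. ennreal (exp (\<tau> * (g \<bullet> x)) / \<phi> \<tau>))"

lemma integral_tilt:
  fixes f :: "'h \<Rightarrow> 'b::{banach, second_countable_topology}"
  assumes "0 \<le> \<tau>" "\<tau> \<le> t0" "f \<in> borel_measurable borel"
  shows "(\<integral>x. f x \<partial>tilt \<tau>) = (\<integral>x. exp (\<tau> * (g \<bullet> x)) *\<^sub>R f x \<partial>\<mu>) /\<^sub>R \<phi> \<tau>"
    and "integrable (tilt \<tau>) f \<longleftrightarrow> integrable \<mu> (\<lambda>x. exp (\<tau> * (g \<bullet> x)) *\<^sub>R f x)"
proof -
  note [measurable] = assms(3)
  have \<phi>: "\<phi> \<tau> > 0" using \<phi>_ge_1[OF assms(1,2)] by simp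
  have "(\<integral>x. f x \<partial>tilt \<tau>) = (\<integral>x. (exp (\<tau> * (g \<bullet> x)) / \<phi> \<tau>) *\<^sub>R f x \<partial>\<mu>)"
    unfolding tilt_def by (rule integral_density) (use \<phi> in auto)
  also have "\<dots> = (\<integral>x. inverse (\<phi> \<tau>) *\<^sub>R (exp (\<tau> * (g \<bullet> x)) *\<^sub>R f x) \<partial>\<mu>)"
    by (simp add: divide_inverse mult.commute)
  also have "\<dots> = (\<integral>x. exp (\<tau> * (g \<bullet> x)) *\<^sub>R f x \<partial>\<mu>) /\<^sub>R \<phi> \<tau>" by (rule integral_scaleR_right)
  finally show "(\<integral>x. f x \<partial>tilt \<tau>) = (\<integral>x. exp (\<tau> * (g \<bullet> x)) *\<^sub>R f x \<partial>\<mu>) /\<^sub>R \<phi> \<tau>" .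
  have "integrable (tilt \<tau>) f \<longleftrightarrow> integrable \<mu> (\<lambda>x. (exp (\<tau> * (g \<bullet> x)) / \<phi> \<tau>) *\<^sub>R f x)"
    unfolding tilt_def by (rule integrable_density) (use \<phi> in auto)
  also have "(\<lambda>x. (exp (\<tau> * (g \<bullet> x)) / \<phi> \<tau>) *\<^sub>R f x) = (\<lambda>x. inverse (\<phi> \<tau>) *\<^sub>R (exp (\<tau> * (g \<bullet> x)) *\<^sub>R f x))"
    by (simp add: divide_inverse mult.commute)
  also have "integrable \<mu> \<dots> \<longleftrightarrow> integrable \<mu> (\<lambda>x. exp (\<tau> * (g \<bullet> x)) *\<^sub>R f x)"
  proof
    assume "integrable \<mu> (\<lambda>x. inverse (\<phi> \<tau>) *\<^sub>R (exp (\<tau> * (g \<bullet> x)) *\<^sub>R f x))"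
    from integrable_scaleR_right[OF this, of "\<phi> \<tau>"] show "integrable \<mu> (\<lambda>x. exp (\<tau> * (g \<bullet> x)) *\<^sub>R f x)"
      using \<phi> by (simp add: mult.assoc[symmetric])
  qed (intro integrable_scaleR_right)
  finally show "integrable (tilt \<tau>) f \<longleftrightarrow> integrable \<mu> (\<lambda>x. exp (\<tau> * (g \<bullet> x)) *\<^sub>R f x)" .
qed

lemma bprob_tilt: assumes "0 \<le> \<tau>" "\<tau> \<le> t0" shows "bprob (tilt \<tau>)"
proof -
  have \<phi>: "\<phi> \<tau> > 0" using \<phi>_ge_1[OF assms] by simp
  have "emeasure (tilt \<tau>) (space (tilt \<tau>)) = (\<integral>\<^sup>+x. ennreal (exp (\<tau> * (g \<bullet> x)) / \<phi> \<tau>) \<partial>\<mu>)"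
    unfolding tilt_def by (subst emeasure_density) (auto intro!: nn_integral_cong)
  also have "\<dots> = ennreal (\<integral>x. exp (\<tau> * (g \<bullet> x)) / \<phi> \<tau> \<partial>\<mu>)"
    using \<phi> integrable_exp_tilt[OF assms] by (intro nn_integral_eq_integral) auto
  also have "\<dots> = 1" using \<phi> by (simp add: \<phi>_def)
  finally show ?thesis by (auto simp: bprob_def tilt_def sets_\<mu> intro: prob_spaceI)
qed

lemma tilt_dominated:
  fixes f :: "'h \<Rightarrow> 'b::{banach, second_countable_topology}"
  assumes \<tau>: "0 \<le> \<tau>" "\<tau> \<le> t0" and f: "f \<in> borel_measurable borel" "\<And>x. norm (f x) \<le> L * norm x ^ k" "k \<le> 3" "0 \<le> L"
  shows "integrable (tilt \<tau>) f" "norm (\<integral>x. f x \<partial>tilt \<tau>) \<le> L * W k"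
proof -
  note [measurable] = f(1)
  have "norm (exp (\<tau> * (g \<bullet> x)) *\<^sub>R f x) \<le> L * (norm x ^ k * wt x)" for x
  proof -
    have "exp (\<tau> * (g \<bullet> x)) * norm (f x) \<le> wt x * (L * norm x ^ k)"
      using f(2) exp_tilt_le'[OF \<tau>] by (intro mult_mono) auto
    then show ?thesis by (simp add: mult_ac)
  qed
  note d = integrable_dominated[OF _ this f(3)]
  show "integrable (tilt \<tau>) f" unfolding integral_tilt(2)[OF \<tau> f(1)] by (rule d(1)) measurable
  have "norm (\<integral>x. f x \<partial>tilt \<tau>) \<le> norm (\<integral>x. exp (\<tau> * (g \<bullet> x)) *\<^sub>R f x \<partial>\<mu>)"
    unfolding integral_tilt(1)[OF \<tau> f(1)] using \<phi>_ge_1[OF \<tau>]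
    by (simp add: mult_left_le_one_le inverse_le_1_iff)
  also have "\<dots> \<le> L * W k" unfolding W_def by (rule d(2)) measurable
  finally show "norm (\<integral>x. f x \<partial>tilt \<tau>) \<le> L * W k" .
qed

text \<open>The zeroth-order term in the expansion of the exponential is the mean of \<mu>, which
  vanishes, and the first-order term is \<tau> times \<open>a0\<close>. The normalisation adds an
  error \<phi> \<tau> - 1 of order \<tau>^2 times \<tau> \<open>a0\<close>, where the extra \<tau>
  is bounded by \<open>t0\<close>.\<close>

lemma tilt_mean:
  assumes \<tau>: "0 \<le> \<tau>" "\<tau> \<le> t0"
  shows "norm ((\<integral>x. x \<partial>tilt \<tau>) - \<tau> *\<^sub>R a0) \<le> \<tau>\<^sup>2 * ((norm g)\<^sup>2 * (W 3 + t0 * norm a0 * W 2))"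
proof -
  have \<phi>: "\<phi> \<tau> \<ge> 1" by (rule \<phi>_ge_1[OF \<tau>])
  have ie: "integrable \<mu> (\<lambda>x. exp (\<tau> * (g \<bullet> x)) *\<^sub>R x)"
    using tilt_dominated(1)[OF \<tau>, of "\<lambda>x. x" 1 1] integral_tilt(2)[OF \<tau>, of "\<lambda>x. x"] by simp
  have "(\<integral>x. exp (\<tau> * (g \<bullet> x)) *\<^sub>R x \<partial>\<mu>) - \<tau> *\<^sub>R a0 = (\<integral>x. (exp (\<tau> * (g \<bullet> x)) - 1 - \<tau> * (g \<bullet> x)) *\<^sub>R x \<partial>\<mu>)"
  proof -
    have "(\<integral>x. (exp (\<tau> * (g \<bullet> x)) - 1 - \<tau> * (g \<bullet> x)) *\<^sub>R x \<partial>\<mu>) =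
       (\<integral>x. exp (\<tau> * (g \<bullet> x)) *\<^sub>R x - x - \<tau> *\<^sub>R ((g \<bullet> x) *\<^sub>R x) \<partial>\<mu>)"
      by (simp add: scaleR_diff_left)
    also have "\<dots> = (\<integral>x. exp (\<tau> * (g \<bullet> x)) *\<^sub>R x \<partial>\<mu>) - (\<integral>x. x \<partial>\<mu>) - \<tau> *\<^sub>R a0"
      unfolding a0_def integral_scaleR_right[symmetric]
      by (simp only: Bochner_Integration.integral_diff Bochner_Integration.integrable_diff ie integrable_id
          integrable_scaleR_right integrable_scaled)
    finally show ?thesis by (simp add: mean0)
  qed
  also have "norm \<dots> \<le> \<tau>\<^sup>2 * (norm g)\<^sup>2 * (\<integral>x. norm x ^ 3 * wt x \<partial>\<mu>)"
  proof (rule integrable_dominated(2))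
    fix x
    have "\<bar>exp (\<tau> * (g \<bullet> x)) - 1 - \<tau> * (g \<bullet> x)\<bar> \<le> (\<tau> * (g \<bullet> x))\<^sup>2 * exp \<bar>\<tau> * (g \<bullet> x)\<bar>"
      by (rule abs_exp_minus_linear_le)
    also have "\<dots> \<le> (\<tau>\<^sup>2 * ((norm g)\<^sup>2 * (norm x)\<^sup>2)) * wt x"
      using \<tau> power_inner_le[of x 2] by (intro mult_mono exp_tilt_le) (auto simp: power_mult_distrib intro!: mult_left_mono)
    finally have "\<bar>exp (\<tau> * (g \<bullet> x)) - 1 - \<tau> * (g \<bullet> x)\<bar> * norm x \<le> (\<tau>\<^sup>2 * ((norm g)\<^sup>2 * (norm x)\<^sup>2)) * wt x * norm x"
      by (rule mult_right_mono) simp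
    then show "norm ((exp (\<tau> * (g \<bullet> x)) - 1 - \<tau> * (g \<bullet> x)) *\<^sub>R x) \<le> \<tau>\<^sup>2 * (norm g)\<^sup>2 * (norm x ^ 3 * wt x)"
      by (simp add: mult_ac power2_eq_square power3_eq_cube)
  qed auto
  finally have 1: "norm ((\<integral>x. exp (\<tau> * (g \<bullet> x)) *\<^sub>R x \<partial>\<mu>) - \<tau> *\<^sub>R a0) \<le> \<tau>\<^sup>2 * (norm g)\<^sup>2 * W 3"
    by (simp add: W_def)
  have "(\<integral>x. x \<partial>tilt \<tau>) - \<tau> *\<^sub>R a0 = inverse (\<phi> \<tau>) *\<^sub>R (((\<integral>x. exp (\<tau> * (g \<bullet> x)) *\<^sub>R x \<partial>\<mu>) - \<tau> *\<^sub>R a0) - (\<phi> \<tau> - 1) *\<^sub>R (\<tau> *\<^sub>R a0))"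
    using \<phi> by (simp add: integral_tilt(1)[OF \<tau>] algebra_simps)
  also have "norm \<dots> \<le> 1 * (norm (((\<integral>x. exp (\<tau> * (g \<bullet> x)) *\<^sub>R x \<partial>\<mu>) - \<tau> *\<^sub>R a0) - (\<phi> \<tau> - 1) *\<^sub>R (\<tau> *\<^sub>R a0)))"
    unfolding norm_scaleR using \<phi> by (intro mult_right_mono) (auto simp: inverse_le_1_iff)
  also have "\<dots> \<le> norm ((\<integral>x. exp (\<tau> * (g \<bullet> x)) *\<^sub>R x \<partial>\<mu>) - \<tau> *\<^sub>R a0) + norm ((\<phi> \<tau> - 1) *\<^sub>R (\<tau> *\<^sub>R a0))"
    by (simp only: mult_1) (rule norm_triangle_ineq4)
  also have "norm ((\<phi> \<tau> - 1) *\<^sub>R (\<tau> *\<^sub>R a0)) \<le> (\<tau>\<^sup>2 * ((norm g)\<^sup>2 * W 2)) * (t0 * norm a0)"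
    unfolding norm_scaleR using \<phi>_quadratic(2)[OF \<tau>] \<tau> by (intro mult_mono) auto
  finally show ?thesis using 1 by (simp add: algebra_simps)
qed

lemma tilt_limit:
  fixes f :: "'h \<Rightarrow> 'b::{banach, second_countable_topology}"
  assumes \<tau>: "\<And>n. 0 \<le> \<tau> n" "\<And>n. \<tau> n \<le> t0" "\<tau> \<longlonglongrightarrow> 0"
    and f: "f \<in> borel_measurable borel" "\<And>x. norm (f x) \<le> L * norm x ^ k" "k \<le> 3" "0 \<le> L"
  shows "(\<lambda>n. \<integral>x. f x \<partial>tilt (\<tau> n)) \<longlonglongrightarrow> (\<integral>x. f x \<partial>\<mu>)"
proof -
  note [measurable] = f(1)
  have "(\<lambda>n. (\<tau> n)\<^sup>2 * ((norm g)\<^sup>2 * W 2)) \<longlonglongrightarrow> 0\<^sup>2 * ((norm g)\<^sup>2 * W 2)"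
    by (intro tendsto_intros \<tau>)
  then have z: "(\<lambda>n. (\<tau> n)\<^sup>2 * ((norm g)\<^sup>2 * W 2)) \<longlonglongrightarrow> 0" by simp
  have "\<forall>\<^sub>F n in sequentially. norm (\<phi> (\<tau> n) - 1) \<le> (\<tau> n)\<^sup>2 * ((norm g)\<^sup>2 * W 2)"
    unfolding real_norm_def by (intro always_eventually allI \<phi>_quadratic(2) \<tau>(1,2))
  then have "(\<lambda>n. \<phi> (\<tau> n) - 1) \<longlonglongrightarrow> 0" using z by (rule Lim_null_comparison)
  then have \<phi>1: "(\<lambda>n. \<phi> (\<tau> n)) \<longlonglongrightarrow> 1" by (rule LIM_zero_cancel)
  have "(\<lambda>n. \<integral>x. exp (\<tau> n * (g \<bullet> x)) *\<^sub>R f x \<partial>\<mu>) \<longlonglongrightarrow> (\<integral>x. f x \<partial>\<mu>)"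
  proof (rule integral_dominated_convergence[where w = "\<lambda>x. L * (norm x ^ k * wt x)"])
    show "integrable \<mu> (\<lambda>x. L * (norm x ^ k * wt x))" by (intro integrable_mult_right integrable_wt f)
    show "AE x in \<mu>. (\<lambda>n. exp (\<tau> n * (g \<bullet> x)) *\<^sub>R f x) \<longlonglongrightarrow> f x"
    proof (rule AE_I2)
      fix x
      have "(\<lambda>n. exp (\<tau> n * (g \<bullet> x)) *\<^sub>R f x) \<longlonglongrightarrow> exp (0 * (g \<bullet> x)) *\<^sub>R f x" by (intro tendsto_intros \<tau>)
      then show "(\<lambda>n. exp (\<tau> n * (g \<bullet> x)) *\<^sub>R f x) \<longlonglongrightarrow> f x" by simp
    qed
    show "AE x in \<mu>. norm (exp (\<tau> n * (g \<bullet> x)) *\<^sub>R f x) \<le> L * (norm x ^ k * wt x)" for n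
    proof (rule AE_I2)
      fix x
      have "exp (\<tau> n * (g \<bullet> x)) * norm (f x) \<le> wt x * (L * norm x ^ k)"
        using f(2) exp_tilt_le'[OF \<tau>(1,2)] by (intro mult_mono) auto
      then show "norm (exp (\<tau> n * (g \<bullet> x)) *\<^sub>R f x) \<le> L * (norm x ^ k * wt x)" by (simp add: mult_ac)
    qed
  qed measurable
  from tendsto_scaleR[OF tendsto_inverse[OF \<phi>1] this] show ?thesis
    unfolding integral_tilt(1)[OF \<tau>(1,2) f(1)] by simp
qed

text \<open>The tilting factors of independent summands multiply to a function of the sum alone, so
  the change of measure passes through every convolution step. Nonnegative integrals keep the
  induction free of integrability side conditions.\<close>

lemma nn_integral_cpow_tilt:
  assumes \<tau>: "0 \<le> \<tau>" "\<tau> \<le> t0" and "f \<in> borel_measurable borel"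
  shows "(\<integral>\<^sup>+x. f x \<partial>cpow \<mu> n) = ennreal (\<phi> \<tau> ^ n) * (\<integral>\<^sup>+x. f x * ennreal (exp (- (\<tau> * (g \<bullet> x)))) \<partial>cpow (tilt \<tau>) n)"
  using assms(3)
proof (induction n arbitrary: f)
  case 0
  note [measurable] = 0
  show ?case by (simp add: nn_integral_return)
next
  case (Suc n f)
  note [measurable] = Suc.prems
  note [measurable_cong] = bprobD(2)[OF bprob_tilt[OF \<tau>]] bprobD(2)[OF bprob_cpow[OF \<mu>]] bprobD(2)[OF bprob_cpow[OF bprob_tilt[OF \<tau>]]]
  have \<phi>: "\<phi> \<tau> > 0" using \<phi>_ge_1[OF \<tau>] by simp
  interpret T: prob_space "tilt \<tau>" by (rule bprobD[OF bprob_tilt[OF \<tau>]])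
  have one: "(\<integral>\<^sup>+y. h y \<partial>\<mu>) = ennreal (\<phi> \<tau>) * (\<integral>\<^sup>+y. h y * ennreal (exp (- (\<tau> * (g \<bullet> y)))) \<partial>tilt \<tau>)"
    if [measurable]: "h \<in> borel_measurable borel" for h
  proof -
    have "ennreal (\<phi> \<tau>) * (\<integral>\<^sup>+y. h y * ennreal (exp (- (\<tau> * (g \<bullet> y)))) \<partial>tilt \<tau>)
      = (\<integral>\<^sup>+y. ennreal (\<phi> \<tau>) * (ennreal (exp (\<tau> * (g \<bullet> y)) / \<phi> \<tau>) * (h y * ennreal (exp (- (\<tau> * (g \<bullet> y)))))) \<partial>\<mu>)"
      unfolding tilt_def by (subst nn_integral_density) (auto simp: nn_integral_cmult)
    also have "\<dots> = (\<integral>\<^sup>+y. h y \<partial>\<mu>)"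
    proof (rule nn_integral_cong)
      fix y
      have "\<phi> \<tau> * (exp (\<tau> * (g \<bullet> y)) / \<phi> \<tau>) * exp (- (\<tau> * (g \<bullet> y))) = 1"
        using \<phi> by (simp add: exp_minus)
      then have "ennreal (\<phi> \<tau>) * ennreal (exp (\<tau> * (g \<bullet> y)) / \<phi> \<tau>) * ennreal (exp (- (\<tau> * (g \<bullet> y)))) = 1"
        using \<phi> by (simp add: ennreal_mult[symmetric])
      then show "ennreal (\<phi> \<tau>) * (ennreal (exp (\<tau> * (g \<bullet> y)) / \<phi> \<tau>) * (h y * ennreal (exp (- (\<tau> * (g \<bullet> y)))))) = h y"
        by (metis (no_types, lifting) mult.assoc mult.commute mult.right_neutral)
    qed
    finally show ?thesis by simp
  qed
  define G where "G x = (\<integral>\<^sup>+y. f (x + y) * ennreal (exp (- (\<tau> * (g \<bullet> y)))) \<partial>tilt \<tau>)" for x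
  have [measurable]: "G \<in> borel_measurable borel" unfolding G_def[abs_def] by measurable
  have "(\<integral>\<^sup>+x. f x \<partial>cpow \<mu> (Suc n)) = (\<integral>\<^sup>+x. \<integral>\<^sup>+y. f (x + y) \<partial>\<mu> \<partial>cpow \<mu> n)"
    by (simp add: nn_integral_conv[OF bprob_cpow[OF \<mu>] \<mu>])
  also have "\<dots> = (\<integral>\<^sup>+x. ennreal (\<phi> \<tau>) * G x \<partial>cpow \<mu> n)"
    by (subst one) (auto simp: G_def)
  also have "\<dots> = ennreal (\<phi> \<tau>) * (\<integral>\<^sup>+x. G x \<partial>cpow \<mu> n)" by (rule nn_integral_cmult) measurable
  also have "(\<integral>\<^sup>+x. G x \<partial>cpow \<mu> n) = ennreal (\<phi> \<tau> ^ n) * (\<integral>\<^sup>+x. G x * ennreal (exp (- (\<tau> * (g \<bullet> x)))) \<partial>cpow (tilt \<tau>) n)"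
    by (rule Suc.IH) measurable
  also have "(\<integral>\<^sup>+x. G x * ennreal (exp (- (\<tau> * (g \<bullet> x)))) \<partial>cpow (tilt \<tau>) n)
     = (\<integral>\<^sup>+x. (\<integral>\<^sup>+y. f (x + y) * ennreal (exp (- (\<tau> * (g \<bullet> (x + y))))) \<partial>tilt \<tau>) \<partial>cpow (tilt \<tau>) n)"
  proof (rule nn_integral_cong)
    fix x
    have "G x * ennreal (exp (- (\<tau> * (g \<bullet> x)))) = (\<integral>\<^sup>+y. f (x + y) * ennreal (exp (- (\<tau> * (g \<bullet> y)))) * ennreal (exp (- (\<tau> * (g \<bullet> x)))) \<partial>tilt \<tau>)"
      unfolding G_def by (rule nn_integral_multc[symmetric]) measurable
    also have "\<dots> = (\<integral>\<^sup>+y. f (x + y) * ennreal (exp (- (\<tau> * (g \<bullet> (x + y))))) \<partial>tilt \<tau>)"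
      by (intro nn_integral_cong)
        (simp add: mult.assoc ennreal_mult[symmetric] exp_add[symmetric] inner_add_right algebra_simps)
    finally show "G x * ennreal (exp (- (\<tau> * (g \<bullet> x)))) = (\<integral>\<^sup>+y. f (x + y) * ennreal (exp (- (\<tau> * (g \<bullet> (x + y))))) \<partial>tilt \<tau>)" .
  qed
  also have "\<dots> = (\<integral>\<^sup>+x. f x * ennreal (exp (- (\<tau> * (g \<bullet> x)))) \<partial>cpow (tilt \<tau>) (Suc n))"
    by (simp add: nn_integral_conv[OF bprob_cpow[OF bprob_tilt[OF \<tau>]] bprob_tilt[OF \<tau>]])
  finally show ?case using \<phi> by (simp add: ennreal_mult mult.assoc)
qed

end

lemma cube_sum_le: "0 \<le> a \<Longrightarrow> 0 \<le> b \<Longrightarrow> (a + b) ^ 3 \<le> 4 * a ^ 3 + 4 * b ^ 3" for a b :: real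
proof -
  assume "0 \<le> a" "0 \<le> b"
  then have "0 \<le> 3 * (a + b) * (a - b)\<^sup>2" by simp
  also have "\<dots> = 4 * a ^ 3 + 4 * b ^ 3 - (a + b) ^ 3" by (simp add: power2_eq_square power3_eq_cube algebra_simps)
  finally show ?thesis by simp
qed

text \<open>
  The tilts \<open>\<tau> n\<close> may vanish, so that \<open>\<tau> = 0\<close> gives the central limit theorem for \<open>\<mu>\<close> itself.
  Centring at \<open>\<tau> n *\<^sub>R a0\<close> instead of the exact mean costs the \<open>drift\<close>, which is of order \<open>(\<tau> n)\<^sup>2\<close>.
\<close>

locale tilting_array = tilting \<mu> g t0
  for \<mu> :: "'h::{real_inner, banach, second_countable_topology} measure" and g t0 +
  fixes \<tau> :: "nat \<Rightarrow> real"
  assumes \<tau>: "\<And>n. 0 \<le> \<tau> n" "\<And>n. \<tau> n \<le> t0"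
    and m_sq_lim: "(\<lambda>n. sqrt n * (\<tau> n)\<^sup>2) \<longlonglongrightarrow> 0"
    and \<tau>_lim: "\<tau> \<longlonglongrightarrow> 0"
begin

text \<open>One summand of the normalised tilted sum; the whole sum has law
  \<open>cpow (\<zeta> n) n\<close>. At n = 0 the inverse of 0 is 0 and the law is the unit mass at
  0.\<close>

definition \<zeta> :: "nat \<Rightarrow> 'h measure" where
  "\<zeta> n = distr (tilt (\<tau> n)) borel (\<lambda>x. inverse (sqrt n) *\<^sub>R (x - \<tau> n *\<^sub>R a0))"

lemmas bprob_tilt_\<tau> = bprob_tilt[OF \<tau>(1,2)]

lemma sets_tilt [measurable_cong]: "sets (tilt (\<tau> n)) = sets borel"
  by (rule bprobD[OF bprob_tilt_\<tau>])

lemma bprob_\<zeta>: "bprob (\<zeta> n)"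
proof -
  interpret T: prob_space "tilt (\<tau> n)" by (rule bprobD[OF bprob_tilt_\<tau>])
  show ?thesis unfolding \<zeta>_def bprob_def by (auto intro!: T.prob_space_distr)
qed

lemma integral_\<zeta>:
  fixes f :: "'h \<Rightarrow> 'b::{banach, second_countable_topology}"
  assumes "f \<in> borel_measurable borel"
  shows "(\<integral>x. f x \<partial>\<zeta> n) = (\<integral>x. f (inverse (sqrt n) *\<^sub>R (x - \<tau> n *\<^sub>R a0)) \<partial>tilt (\<tau> n))"
    "integrable (\<zeta> n) f \<longleftrightarrow> integrable (tilt (\<tau> n)) (\<lambda>x. f (inverse (sqrt n) *\<^sub>R (x - \<tau> n *\<^sub>R a0)))"
proof -
  note [measurable] = assms
  show "(\<integral>x. f x \<partial>\<zeta> n) = (\<integral>x. f (inverse (sqrt n) *\<^sub>R (x - \<tau> n *\<^sub>R a0)) \<partial>tilt (\<tau> n))"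
    unfolding \<zeta>_def by (subst integral_distr) auto
  show "integrable (\<zeta> n) f \<longleftrightarrow> integrable (tilt (\<tau> n)) (\<lambda>x. f (inverse (sqrt n) *\<^sub>R (x - \<tau> n *\<^sub>R a0)))"
    unfolding \<zeta>_def by (subst integrable_distr_eq) auto
qed

lemma tilt_moments:
  "integrable (tilt (\<tau> n)) (\<lambda>x. x - \<tau> n *\<^sub>R a0)"
  "integrable (tilt (\<tau> n)) (\<lambda>x. (norm (x - \<tau> n *\<^sub>R a0))\<^sup>2)"
  "integrable (tilt (\<tau> n)) (\<lambda>x. norm (x - \<tau> n *\<^sub>R a0) ^ 3)"
  "(\<integral>x. norm (x - \<tau> n *\<^sub>R a0) ^ 3 \<partial>tilt (\<tau> n)) \<le> 4 * W 3 + 4 * (t0 * norm a0) ^ 3"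
proof -
  interpret T: prob_space "tilt (\<tau> n)" by (rule bprobD[OF bprob_tilt_\<tau>])
  have i: "integrable (tilt (\<tau> n)) (\<lambda>x. norm x ^ k)" if "k \<le> 3" for k
    by (rule tilt_dominated(1)[OF \<tau>(1,2), where L = 1]) (use that in auto)
  have i1: "integrable (tilt (\<tau> n)) (\<lambda>x. x)"
    by (rule tilt_dominated(1)[OF \<tau>(1,2), where L = 1 and k = 1]) auto
  then show "integrable (tilt (\<tau> n)) (\<lambda>x. x - \<tau> n *\<^sub>R a0)" by simp
  let ?c = "4 * (t0 * norm a0) ^ 3"
  have le3: "norm (x - \<tau> n *\<^sub>R a0) ^ 3 \<le> 4 * norm x ^ 3 + ?c" for x
  proof -
    have "norm (\<tau> n *\<^sub>R a0) \<le> t0 * norm a0" using \<tau>(1,2)[of n] by (auto intro: mult_right_mono)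
    then have "norm (x - \<tau> n *\<^sub>R a0) \<le> norm x + t0 * norm a0"
      using norm_triangle_ineq4[of x "\<tau> n *\<^sub>R a0"] by linarith
    then have "norm (x - \<tau> n *\<^sub>R a0) ^ 3 \<le> (norm x + t0 * norm a0) ^ 3" by (rule power_mono) simp
    also have "\<dots> \<le> 4 * norm x ^ 3 + ?c" using t0 by (intro cube_sum_le) auto
    finally show ?thesis .
  qed
  have ib: "integrable (tilt (\<tau> n)) (\<lambda>x. 4 * norm x ^ 3 + ?c)" using i[of 3] by simp
  show i3: "integrable (tilt (\<tau> n)) (\<lambda>x. norm (x - \<tau> n *\<^sub>R a0) ^ 3)"
    by (rule Bochner_Integration.integrable_bound[OF ib]) (use le3 t0 in auto)
  have "(\<integral>x. norm (x - \<tau> n *\<^sub>R a0) ^ 3 \<partial>tilt (\<tau> n)) \<le> (\<integral>x. 4 * norm x ^ 3 + ?c \<partial>tilt (\<tau> n))"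
    by (rule integral_mono[OF i3 ib le3])
  also have "\<dots> = 4 * (\<integral>x. norm x ^ 3 \<partial>tilt (\<tau> n)) + ?c" using i[of 3] by (simp add: T.prob_space)
  also have "(\<integral>x. norm x ^ 3 \<partial>tilt (\<tau> n)) \<le> 1 * W 3"
    using tilt_dominated(2)[OF \<tau>(1,2), of "\<lambda>x. norm x ^ 3" 1 3] by simp
  finally show "(\<integral>x. norm (x - \<tau> n *\<^sub>R a0) ^ 3 \<partial>tilt (\<tau> n)) \<le> 4 * W 3 + ?c" by simp
  show "integrable (tilt (\<tau> n)) (\<lambda>x. (norm (x - \<tau> n *\<^sub>R a0))\<^sup>2)"
  proof (rule Bochner_Integration.integrable_bound)
    show "integrable (tilt (\<tau> n)) (\<lambda>x. 1 + norm (x - \<tau> n *\<^sub>R a0) ^ 3)" using i3 by simp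
    have "z\<^sup>2 \<le> 1 + z ^ 3" if "0 \<le> z" for z :: real
    proof (cases "z \<le> 1")
      case True then show ?thesis using that power_le_one[of z 2] by (simp add: add_increasing2)
    next
      case False
      then have "z\<^sup>2 \<le> z ^ 3" by (intro power_increasing) auto
      then show ?thesis by simp
    qed
    then show "AE x in tilt (\<tau> n). norm ((norm (x - \<tau> n *\<^sub>R a0))\<^sup>2) \<le> norm (1 + norm (x - \<tau> n *\<^sub>R a0) ^ 3)"
      by auto
  qed measurable
qed

definition K3 :: real where "K3 = 4 * W 3 + 4 * (t0 * norm a0) ^ 3"

lemma K3_nonneg: "K3 \<ge> 0" using W_nonneg t0 by (simp add: K3_def)

definition K1 :: real where "K1 = (norm g)\<^sup>2 * (W 3 + t0 * norm a0 * W 2)"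

lemma K1_nonneg: "K1 \<ge> 0" using W_nonneg t0 by (simp add: K1_def)

definition drift :: "nat \<Rightarrow> 'h" where "drift n = (\<integral>x. x - \<tau> n *\<^sub>R a0 \<partial>tilt (\<tau> n))"

lemma norm_drift: "norm (drift n) \<le> (\<tau> n)\<^sup>2 * K1"
proof -
  interpret T: prob_space "tilt (\<tau> n)" by (rule bprobD[OF bprob_tilt_\<tau>])
  have i1: "integrable (tilt (\<tau> n)) (\<lambda>x. x)"
    by (rule tilt_dominated(1)[OF \<tau>(1,2), where L = 1 and k = 1]) auto
  then have "drift n = (\<integral>x. x \<partial>tilt (\<tau> n)) - \<tau> n *\<^sub>R a0" by (simp add: drift_def T.prob_space)
  then show ?thesis using tilt_mean[OF \<tau>(1,2)] by (simp add: K1_def)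
qed

definition var :: "nat \<Rightarrow> 'h \<Rightarrow> real" where "var n h = (\<integral>x. (h \<bullet> (x - \<tau> n *\<^sub>R a0))\<^sup>2 \<partial>tilt (\<tau> n))"

lemma integrable_var: "integrable (tilt (\<tau> n)) (\<lambda>x. (h \<bullet> (x - \<tau> n *\<^sub>R a0))\<^sup>2)"
proof (rule Bochner_Integration.integrable_bound)
  show "integrable (tilt (\<tau> n)) (\<lambda>x. (norm h)\<^sup>2 * (norm (x - \<tau> n *\<^sub>R a0))\<^sup>2)"
    by (intro integrable_mult_right tilt_moments)
  show "AE x in tilt (\<tau> n). norm ((h \<bullet> (x - \<tau> n *\<^sub>R a0))\<^sup>2) \<le> norm ((norm h)\<^sup>2 * (norm (x - \<tau> n *\<^sub>R a0))\<^sup>2)"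
    using power_mono[OF Cauchy_Schwarz_ineq2, of _ _ 2] by (intro AE_I2) (fastforce simp: power_mult_distrib)
qed measurable

lemma var_lim: "(\<lambda>n. var n h) \<longlonglongrightarrow> q h"
proof -
  have "var n h = (\<integral>x. (h \<bullet> x)\<^sup>2 \<partial>tilt (\<tau> n)) - 2 * \<tau> n * (h \<bullet> a0) * (\<integral>x. h \<bullet> x \<partial>tilt (\<tau> n)) + (\<tau> n * (h \<bullet> a0))\<^sup>2" for n
  proof -
    interpret T: prob_space "tilt (\<tau> n)" by (rule bprobD[OF bprob_tilt_\<tau>])
    have 1: "integrable (tilt (\<tau> n)) (\<lambda>x. h \<bullet> x)"
      by (rule tilt_dominated(1)[OF \<tau>(1,2), where L = "norm h" and k = 1]) (auto simp: Cauchy_Schwarz_ineq2)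
    have 2: "integrable (tilt (\<tau> n)) (\<lambda>x. (h \<bullet> x)\<^sup>2)"
      by (rule tilt_dominated(1)[OF \<tau>(1,2), where L = "(norm h)\<^sup>2" and k = 2])
        (use power_mono[OF Cauchy_Schwarz_ineq2[of h], of _ 2] in \<open>auto simp: power_mult_distrib\<close>)
    have "var n h = (\<integral>x. (h \<bullet> x)\<^sup>2 - (2 * \<tau> n * (h \<bullet> a0)) * (h \<bullet> x) + (\<tau> n * (h \<bullet> a0))\<^sup>2 \<partial>tilt (\<tau> n))"
      unfolding var_def by (rule Bochner_Integration.integral_cong) (simp_all add: inner_diff_right power2_diff)
    then show ?thesis using 1 2 by (simp add: T.prob_space)
  qed
  moreover have "(\<lambda>n. \<integral>x. (h \<bullet> x)\<^sup>2 \<partial>tilt (\<tau> n)) \<longlonglongrightarrow> q h" unfolding q_def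
    by (rule tilt_limit[OF \<tau>(1,2) \<tau>_lim, where L = "(norm h)\<^sup>2" and k = 2])
      (use power_mono[OF Cauchy_Schwarz_ineq2[of h], of _ 2] in \<open>auto simp: power_mult_distrib\<close>)
  moreover have "(\<lambda>n. \<integral>x. h \<bullet> x \<partial>tilt (\<tau> n)) \<longlonglongrightarrow> (\<integral>x. h \<bullet> x \<partial>\<mu>)"
    by (rule tilt_limit[OF \<tau>(1,2) \<tau>_lim, where L = "norm h" and k = 1]) (auto simp: Cauchy_Schwarz_ineq2)
  ultimately have "(\<lambda>n. var n h) \<longlonglongrightarrow> q h - 2 * 0 * (h \<bullet> a0) * (\<integral>x. h \<bullet> x \<partial>\<mu>) + (0 * (h \<bullet> a0))\<^sup>2"
    by (simp only:) (intro tendsto_intros \<tau>_lim)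
  then show ?thesis by simp
qed

text \<open>The second-order expansion of each character is integrated; the third-order remainder is
  controlled by \<open>K3\<close>, a bound for the third moments that holds for all tilts of the
  array.\<close>

lemma chf_\<zeta>_approx:
  assumes "n \<ge> 1"
  shows "norm (chf (\<zeta> n) h - (1 + \<i> * of_real ((h \<bullet> drift n) / sqrt n) - of_real (var n h / (2 * real n))))
    \<le> norm h ^ 3 * K3 / (n * sqrt n)"
proof -
  interpret T: prob_space "tilt (\<tau> n)" by (rule bprobD[OF bprob_tilt_\<tau>])
  let ?s = "sqrt n"
  have s: "?s > 0" using assms by simp
  let ?y = "\<lambda>x. h \<bullet> (x - \<tau> n *\<^sub>R a0)"
  have i1: "integrable (tilt (\<tau> n)) ?y" using tilt_moments(1) by (rule integrable_inner_right)
  have e1: "(\<integral>x. \<i> * of_real (?y x / ?s) \<partial>tilt (\<tau> n)) = \<i> * of_real ((h \<bullet> drift n) / ?s)"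
    using integral_inner_right[of h "tilt (\<tau> n)" "\<lambda>x. x - \<tau> n *\<^sub>R a0"] tilt_moments(1)
    by (simp add: drift_def)
  have e2: "(\<integral>x. of_real ((?y x / ?s)\<^sup>2 / 2) \<partial>tilt (\<tau> n)) = complex_of_real (var n h / (2 * real n))"
    unfolding integral_complex_of_real by (simp add: var_def power_divide mult.commute)
  have e: "chf (\<zeta> n) h = (\<integral>x. iexp (?y x / ?s) \<partial>tilt (\<tau> n))"
    unfolding chf_def by (subst integral_\<zeta>) (simp_all add: divide_inverse mult.commute)
  have i2: "integrable (tilt (\<tau> n)) (\<lambda>x. complex_of_real ((?y x / ?s)\<^sup>2 / 2))"
    using integrable_var[of n h] by (intro integrable_of_real) (simp add: power_divide)
  have i3: "integrable (tilt (\<tau> n)) (\<lambda>x. \<i> * complex_of_real (?y x / ?s))"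
    using i1 by (intro integrable_mult_right integrable_of_real) simp
  have i4: "integrable (tilt (\<tau> n)) (\<lambda>x. iexp (?y x / ?s))"
    by (rule T.integrable_bounded[where B = 1]) auto
  have c: "integrable (tilt (\<tau> n)) (\<lambda>x. 1 :: complex)" by simp
  define E where "E x = iexp (?y x / ?s) - (1 + \<i> * of_real (?y x / ?s) - of_real ((?y x / ?s)\<^sup>2 / 2))" for x
  note i23 = Bochner_Integration.integrable_diff[OF Bochner_Integration.integrable_add[OF c i3] i2]
  have iE: "integrable (tilt (\<tau> n)) E"
    unfolding E_def[abs_def] by (rule Bochner_Integration.integrable_diff[OF i4 i23])
  have "(\<integral>x. E x \<partial>tilt (\<tau> n))
    = (\<integral>x. iexp (?y x / ?s) \<partial>tilt (\<tau> n)) - ((\<integral>x. 1 \<partial>tilt (\<tau> n)) + (\<integral>x. \<i> * of_real (?y x / ?s) \<partial>tilt (\<tau> n))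
      - (\<integral>x. of_real ((?y x / ?s)\<^sup>2 / 2) \<partial>tilt (\<tau> n)))"
    unfolding Bochner_Integration.integral_add[OF c i3, symmetric]
      Bochner_Integration.integral_diff[OF Bochner_Integration.integrable_add[OF c i3] i2, symmetric] E_def
    by (rule Bochner_Integration.integral_diff[OF i4 i23])
  also have "(\<integral>x. (1::complex) \<partial>tilt (\<tau> n)) = 1" by (simp add: T.prob_space)
  finally have "chf (\<zeta> n) h - (1 + \<i> * of_real ((h \<bullet> drift n) / ?s) - of_real (var n h / (2 * real n)))
    = (\<integral>x. E x \<partial>tilt (\<tau> n))"
    unfolding e1 e2 e by (rule sym)
  also have "norm \<dots> \<le> (\<integral>x. norm (E x) \<partial>tilt (\<tau> n))"
    by (rule integral_norm_bound)
  also have "\<dots> \<le> (\<integral>x. norm h ^ 3 / (n * ?s) * norm (x - \<tau> n *\<^sub>R a0) ^ 3 \<partial>tilt (\<tau> n))"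
  proof (rule integral_mono[OF integrable_norm[OF iE] integrable_mult_right[OF tilt_moments(3)]])
    fix x
    have "norm (E x) \<le> \<bar>?y x / ?s\<bar> ^ 3" unfolding E_def by (rule iexp_quadratic_bound)
    also have "\<dots> = \<bar>?y x\<bar> ^ 3 / (n * ?s)"
      using s by (simp add: power_divide) (simp add: power3_eq_cube)
    also have "\<dots> \<le> (norm h * norm (x - \<tau> n *\<^sub>R a0)) ^ 3 / (n * ?s)"
      by (intro divide_right_mono power_mono Cauchy_Schwarz_ineq2) auto
    finally show "norm (E x) \<le> norm h ^ 3 / (n * ?s) * norm (x - \<tau> n *\<^sub>R a0) ^ 3"
      by (simp add: power_mult_distrib)
  qed
  also have "\<dots> \<le> norm h ^ 3 / (n * ?s) * K3"
    unfolding integral_mult_right_zero K3_def by (intro mult_left_mono tilt_moments) auto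
  finally show ?thesis by simp
qed

text \<open>The comparison numbers w n = exp (- q h / (2 n)) have the limit as their n-th power. For
  two numbers in the unit disc, n-th powers differ by at most n times their distance, so an error of
  order o (1 / n) in one factor suffices.\<close>

lemma clt_\<zeta>: "(\<lambda>n. chf (\<zeta> n) h ^ n) \<longlonglongrightarrow> exp (- q h / 2)"
proof -
  have qh: "q h \<ge> 0" unfolding q_def by (intro Bochner_Integration.integral_nonneg) simp
  define w where "w n = exp (- q h / 2 / real n)" for n
  have lim1: "(\<lambda>n. real n * (w n - 1)) \<longlonglongrightarrow> - q h / 2"
    unfolding w_def by real_asymp
  have s0: "(\<lambda>n. inverse (sqrt (real n))) \<longlonglongrightarrow> 0" by real_asymp
  have drift0: "(\<lambda>n. sqrt n * norm (drift n)) \<longlonglongrightarrow> 0"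
  proof (rule Lim_null_comparison)
    show "\<forall>\<^sub>F n in sequentially. norm (sqrt n * norm (drift n)) \<le> sqrt n * (\<tau> n)\<^sup>2 * K1"
      using norm_drift by (auto simp: abs_mult mult.assoc intro!: always_eventually mult_left_mono)
    show "(\<lambda>n. sqrt n * (\<tau> n)\<^sup>2 * K1) \<longlonglongrightarrow> 0" using tendsto_mult_left_zero[OF m_sq_lim] .
  qed
  have "(\<lambda>n. norm (chf (\<zeta> n) h ^ n - complex_of_real (w n) ^ n)) \<longlonglongrightarrow> 0"
  proof (rule Lim_null_comparison)
    let ?B = "\<lambda>n. norm h * (sqrt n * norm (drift n)) + \<bar>- (var n h / 2) - real n * (w n - 1)\<bar> + norm h ^ 3 * K3 * inverse (sqrt n)"
    show "\<forall>\<^sub>F n in sequentially. norm (norm (chf (\<zeta> n) h ^ n - complex_of_real (w n) ^ n)) \<le> ?B n"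
      using eventually_ge_at_top[of 1]
    proof eventually_elim
      case (elim n)
      let ?a = "(h \<bullet> drift n) / sqrt n" and ?b = "var n h / (2 * real n)"
      have "norm (complex_of_real (w n)) \<le> 1" using qh by (simp add: w_def divide_nonpos_nonneg)
      then have "norm (chf (\<zeta> n) h ^ n - complex_of_real (w n) ^ n) \<le> n * norm (chf (\<zeta> n) h - complex_of_real (w n))"
        by (intro norm_power_diff norm_chf_le_1[OF bprob_\<zeta>])
      also have "\<dots> \<le> n * (norm (chf (\<zeta> n) h - (1 + \<i> * of_real ?a - of_real ?b)) + norm (\<i> * of_real ?a) + norm (complex_of_real (1 - ?b - w n)))"
      proof (intro mult_left_mono)
        have eq: "chf (\<zeta> n) h - complex_of_real (w n) = (chf (\<zeta> n) h - (1 + \<i> * of_real ?a - of_real ?b)) + \<i> * of_real ?a + complex_of_real (1 - ?b - w n)"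
          by simp
        show "norm (chf (\<zeta> n) h - complex_of_real (w n)) \<le> norm (chf (\<zeta> n) h - (1 + \<i> * of_real ?a - of_real ?b)) + norm (\<i> * of_real ?a) + norm (complex_of_real (1 - ?b - w n))"
          unfolding eq by (intro norm_triangle_le add_mono norm_triangle_ineq order_refl)
      qed simp
      also have "\<dots> \<le> n * (norm h ^ 3 * K3 / (n * sqrt n) + norm h * norm (drift n) / sqrt n + \<bar>1 - ?b - w n\<bar>)"
      proof (intro mult_left_mono add_mono)
        show "norm (chf (\<zeta> n) h - (1 + \<i> * of_real ?a - of_real ?b)) \<le> norm h ^ 3 * K3 / (n * sqrt n)"
          by (rule chf_\<zeta>_approx[OF elim])
        show "norm (\<i> * complex_of_real ?a) \<le> norm h * norm (drift n) / sqrt n"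
          using Cauchy_Schwarz_ineq2[of h "drift n"] unfolding norm_mult norm_of_real by (simp add: divide_right_mono)
        show "norm (complex_of_real (1 - ?b - w n)) \<le> \<bar>1 - ?b - w n\<bar>" by (simp only: norm_of_real)
      qed simp
      also have "\<dots> = ?B n"
      proof -
        have 1: "n * (norm h ^ 3 * K3 / (n * sqrt n)) = norm h ^ 3 * K3 * inverse (sqrt n)" using elim by (simp add: field_simps)
        have "n / sqrt n = sqrt n" using elim by (simp add: real_div_sqrt)
        then have 2: "n * (norm h * norm (drift n) / sqrt n) = norm h * (sqrt n * norm (drift n))"
          by (metis (no_types, opaque_lifting) mult.assoc mult.commute times_divide_eq_right)
        have 3: "n * \<bar>1 - ?b - w n\<bar> = \<bar>n * (1 - ?b - w n)\<bar>" by (simp add: abs_mult)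
        have 4: "n * (1 - ?b - w n) = - (var n h / 2) - real n * (w n - 1)" using elim by (simp add: field_simps)
        show ?thesis using 1 2 3 4 by (simp add: distrib_left)
      qed
      finally show ?case by simp
    qed
    have "?B \<longlonglongrightarrow> norm h * 0 + \<bar>- (q h / 2) - (- q h / 2)\<bar> + norm h ^ 3 * K3 * 0"
      by (intro tendsto_intros drift0 var_lim lim1 s0) simp
    then show "?B \<longlonglongrightarrow> 0" by simp
  qed
  then have d: "(\<lambda>n. chf (\<zeta> n) h ^ n - complex_of_real (w n) ^ n) \<longlonglongrightarrow> 0"
    by (rule tendsto_norm_zero_cancel)
  have "eventually (\<lambda>n. complex_of_real (exp (- q h / 2)) = complex_of_real (w n) ^ n) sequentially"
    using eventually_ge_at_top[of 1]
    by eventually_elim (simp add: w_def exp_of_nat_mult[symmetric] flip: of_real_power)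
  then have "(\<lambda>n. complex_of_real (w n) ^ n) \<longlonglongrightarrow> complex_of_real (exp (- q h / 2))"
    by (rule Lim_transform_eventually[OF tendsto_const])
  from tendsto_add[OF d this] show ?thesis by simp
qed

lemma cpow_\<zeta>:
  "cpow (\<zeta> n) k = distr (cpow (tilt (\<tau> n)) k) borel (\<lambda>x. inverse (sqrt n) *\<^sub>R (x - (real k * \<tau> n) *\<^sub>R a0))"
proof (rule chf_unique)
  note p = bprob_cpow[OF bprob_tilt_\<tau>]
  interpret T: prob_space "cpow (tilt (\<tau> n)) k" by (rule bprobD[OF p])
  note [measurable_cong] = bprobD(2)[OF p]
  show "finite_measure (cpow (\<zeta> n) k)" "sets (cpow (\<zeta> n) k) = sets borel"
    by (auto intro!: bprobD(4,2) bprob_cpow bprob_\<zeta>)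
  show "finite_measure (distr (cpow (tilt (\<tau> n)) k) borel (\<lambda>x. inverse (sqrt n) *\<^sub>R (x - (real k * \<tau> n) *\<^sub>R a0)))"
    by (rule T.finite_measure_distr) measurable
  show "sets (distr (cpow (tilt (\<tau> n)) k) borel (\<lambda>x. inverse (sqrt n) *\<^sub>R (x - (real k * \<tau> n) *\<^sub>R a0))) = sets borel"
    by simp
  fix u
  let ?v = "inverse (sqrt n) *\<^sub>R u" and ?e = "iexp (- (inverse (sqrt n) * (\<tau> n * (u \<bullet> a0))))"
  have e: "iexp (u \<bullet> (inverse (sqrt n) *\<^sub>R (x - (real j * \<tau> n) *\<^sub>R a0))) = ?e ^ j * iexp (?v \<bullet> x)" for x j
    unfolding exp_of_nat_mult[symmetric] exp_add[symmetric]
    by (rule arg_cong[where f = exp]) (simp add: inner_diff_right algebra_simps)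
  have "chf (\<zeta> n) u = ?e * chf (tilt (\<tau> n)) ?v"
    using e[of _ 1] unfolding \<zeta>_def
    by (subst chf_distr[OF sets_tilt]) (measurable, simp add: chf_def)
  then have "chf (cpow (\<zeta> n) k) u = ?e ^ k * chf (tilt (\<tau> n)) ?v ^ k"
    by (simp add: chf_cpow[OF bprob_\<zeta>] power_mult_distrib)
  also have "\<dots> = ?e ^ k * chf (cpow (tilt (\<tau> n)) k) ?v"
    by (simp only: chf_cpow[OF bprob_tilt_\<tau>])
  also have "\<dots> = ?e ^ k * (\<integral>x. iexp (?v \<bullet> x) \<partial>cpow (tilt (\<tau> n)) k)"
    by (simp only: chf_def)
  also have "\<dots> = chf (distr (cpow (tilt (\<tau> n)) k) borel (\<lambda>x. inverse (sqrt n) *\<^sub>R (x - (real k * \<tau> n) *\<^sub>R a0))) u"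
    by (subst chf_distr[OF bprobD(2)[OF p]]) (measurable, simp only: e integral_mult_right_zero)
  finally show "chf (cpow (\<zeta> n) k) u = chf (distr (cpow (tilt (\<tau> n)) k) borel (\<lambda>x. inverse (sqrt n) *\<^sub>R (x - (real k * \<tau> n) *\<^sub>R a0))) u" .
qed

end

locale tilting_seq = tilting_array \<mu> g t0 \<tau>
  for \<mu> :: "'h::{real_inner, banach, second_countable_topology} measure" and g t0 \<tau> +
  fixes \<zeta>0 :: "'h measure"
  assumes \<tau>_pos: "\<And>n. n \<ge> 1 \<Longrightarrow> \<tau> n > 0"
    and m_top: "filterlim (\<lambda>n. sqrt n * \<tau> n) at_top sequentially"
    and m_cube: "(\<lambda>n. real n * \<tau> n ^ 3) \<longlonglongrightarrow> 0"
    and \<sigma>2: "q g > 0"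
    and \<zeta>0: "bprob \<zeta>0" and chf_\<zeta>0: "\<And>u. chf \<zeta>0 u = exp (- (q u - (a0 \<bullet> u)\<^sup>2 / q g) / 2)"
begin

text \<open>The second-order expansion gives 1 minus a multiple of w^2 / n plus errors. The lower
  limit K makes the variance in direction w g dominate that of u; the upper limit \<delta> sqrt n
  keeps the cubic remainder below a fraction of w^2 / n.\<close>

lemma decay_\<zeta>:
  "\<exists>K c \<delta>. c > 0 \<and> \<delta> > 0 \<and> eventually (\<lambda>n. \<forall>w. K \<le> \<bar>w\<bar> \<and> \<bar>w\<bar> \<le> \<delta> * sqrt n
        \<longrightarrow> norm (chf (\<zeta> n) (w *\<^sub>R g + u)) \<le> exp (- (c * w\<^sup>2 / n))) sequentially"
proof -
  define s where "s = q g"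
  have s: "s > 0" using \<sigma>2 by (simp add: s_def)
  define L where "L = norm g + norm u + 1"
  have L: "L \<ge> 1" by (simp add: L_def)
  have qu: "q u \<ge> 0" unfolding q_def by (intro Bochner_Integration.integral_nonneg) simp
  define V where "V = q u + 1"
  \<comment> \<open>From K on, V \<le> s w^2 / 8, half of the lower bound s w^2 / 4 for the
    contribution of g; also |w| \<ge> 1, so u is absorbed into L |w|.\<close>
  define K where "K = max 1 (sqrt (8 * V / s))"
  have "eventually (\<lambda>n. (\<integral>x. (norm (x - \<tau> n *\<^sub>R a0))\<^sup>2 \<partial>tilt (\<tau> n)) \<le> K3 + 1) sequentially"
  proof (intro always_eventually allI)
    fix n
    interpret T: prob_space "tilt (\<tau> n)" by (rule bprobD[OF bprob_tilt_\<tau>])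
    have "z\<^sup>2 \<le> z ^ 3 + 1" if "0 \<le> z" for z :: real
    proof (cases "z \<le> 1")
      case True then show ?thesis using that power_le_one[of z 2] by (simp add: add_increasing)
    next
      case False
      then have "z\<^sup>2 \<le> z ^ 3" by (intro power_increasing) auto
      then show ?thesis by simp
    qed
    then have "(\<integral>x. (norm (x - \<tau> n *\<^sub>R a0))\<^sup>2 \<partial>tilt (\<tau> n)) \<le> (\<integral>x. norm (x - \<tau> n *\<^sub>R a0) ^ 3 + 1 \<partial>tilt (\<tau> n))"
      using tilt_moments[of n] by (intro integral_mono) auto
    also have "\<dots> \<le> K3 + 1" using tilt_moments[of n] by (simp add: K3_def T.prob_space)
    finally show "(\<integral>x. (norm (x - \<tau> n *\<^sub>R a0))\<^sup>2 \<partial>tilt (\<tau> n)) \<le> K3 + 1" .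
  qed
  then have ev_sq: "eventually (\<lambda>n. (\<integral>x. (norm (x - \<tau> n *\<^sub>R a0))\<^sup>2 \<partial>tilt (\<tau> n)) \<le> K3 + 1) sequentially" .
  \<comment> \<open>The first entry keeps \<open>1 - ?b\<close> nonnegative, the second makes the
    cubic remainder at most (s / 64) w^2 / n.\<close>
  define \<delta> where "\<delta> = min (1 / (L * (K3 + 1))) (s / (64 * (L ^ 3 * (K3 + 1))))"
  have \<delta>: "\<delta> > 0" using L K3_nonneg s by (simp add: \<delta>_def)
  have \<delta>1: "\<delta> * (L * (K3 + 1)) \<le> 1"
  proof -
    have "\<delta> * (L * (K3 + 1)) \<le> 1 / (L * (K3 + 1)) * (L * (K3 + 1))"
      using L K3_nonneg by (intro mult_right_mono) (auto simp: \<delta>_def)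
    then show ?thesis using L K3_nonneg by simp
  qed
  have \<delta>2: "\<delta> * (L ^ 3 * K3) \<le> s / 64"
  proof -
    have "\<delta> * (L ^ 3 * K3) \<le> \<delta> * (L ^ 3 * (K3 + 1))" using L \<delta> by (intro mult_left_mono) auto
    also have "\<dots> \<le> s / (64 * (L ^ 3 * (K3 + 1))) * (L ^ 3 * (K3 + 1))"
      using L K3_nonneg by (intro mult_right_mono) (auto simp: \<delta>_def)
    also have "\<dots> = s / 64" using L K3_nonneg by simp
    finally show ?thesis .
  qed
  have "(\<lambda>n. sqrt n * (\<tau> n)\<^sup>2 * (L * K1)) \<longlonglongrightarrow> 0" by (rule tendsto_mult_left_zero[OF m_sq_lim])
  then have ev1: "eventually (\<lambda>n. sqrt n * (\<tau> n)\<^sup>2 * (L * K1) < s / 64) sequentially"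
    using s by (intro order_tendstoD(2)) auto
  have ev2: "eventually (\<lambda>n. var n g > s / 2) sequentially"
    using var_lim[of g] s by (intro order_tendstoD(1)) (auto simp: s_def)
  have ev3: "eventually (\<lambda>n. var n u < V) sequentially"
    using var_lim[of u] by (intro order_tendstoD(2)) (auto simp: V_def)
  have "eventually (\<lambda>n. \<forall>w. K \<le> \<bar>w\<bar> \<and> \<bar>w\<bar> \<le> \<delta> * sqrt n
        \<longrightarrow> norm (chf (\<zeta> n) (w *\<^sub>R g + u)) \<le> exp (- ((s / 32) * w\<^sup>2 / n))) sequentially"
    using ev1 ev2 ev3 ev_sq eventually_ge_at_top[of 1]
  proof eventually_elim
    case (elim n)
    show ?case
    proof (intro allI impI)
      fix w assume w: "K \<le> \<bar>w\<bar> \<and> \<bar>w\<bar> \<le> \<delta> * sqrt n"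
      let ?h = "w *\<^sub>R g + u"
      have n: "real n > 0" using elim(5) by simp
      have w1: "\<bar>w\<bar> \<ge> 1" using w by (simp add: K_def)
      then have w2: "w\<^sup>2 \<ge> \<bar>w\<bar>" using mult_left_mono[of 1 "\<bar>w\<bar>" "\<bar>w\<bar>"] by (simp add: power2_eq_square)
      have "sqrt (8 * V / s) \<le> \<bar>w\<bar>" using w by (simp add: K_def)
      then have "8 * V / s \<le> w\<^sup>2" by (metis abs_ge_zero power2_abs real_sqrt_le_iff real_sqrt_abs)
      then have V8: "V \<le> s * w\<^sup>2 / 8" using s by (simp add: field_simps)
      have nh: "norm ?h \<le> L * \<bar>w\<bar>"
      proof -
        have "norm ?h \<le> \<bar>w\<bar> * norm g + norm u" using norm_triangle_ineq[of "w *\<^sub>R g" u] by simp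
        also have "norm u \<le> \<bar>w\<bar> * norm u" using w1 mult_right_mono[of 1 "\<bar>w\<bar>" "norm u"] by simp
        also have "\<bar>w\<bar> * norm g + \<bar>w\<bar> * norm u \<le> L * \<bar>w\<bar>" by (simp add: L_def algebra_simps)
        finally show ?thesis by simp
      qed
      let ?a = "(?h \<bullet> drift n) / sqrt n" and ?b = "var n ?h / (2 * real n)"
      have var_lower: "s * w\<^sup>2 / 8 \<le> var n ?h"
      proof -
        have "(\<integral>x. w\<^sup>2 / 2 * (g \<bullet> (x - \<tau> n *\<^sub>R a0))\<^sup>2 - (u \<bullet> (x - \<tau> n *\<^sub>R a0))\<^sup>2 \<partial>tilt (\<tau> n)) \<le> var n ?h"
          unfolding var_def
        proof (rule integral_mono)
          fix x
          let ?A = "w * (g \<bullet> (x - \<tau> n *\<^sub>R a0))" and ?B = "u \<bullet> (x - \<tau> n *\<^sub>R a0)"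
          have "A\<^sup>2 / 2 - B\<^sup>2 \<le> (A + B)\<^sup>2" for A B :: real
            using zero_le_power2[of "A + 2 * B"] by (simp add: power2_eq_square algebra_simps)
          from this[of ?A ?B] show "w\<^sup>2 / 2 * (g \<bullet> (x - \<tau> n *\<^sub>R a0))\<^sup>2 - (u \<bullet> (x - \<tau> n *\<^sub>R a0))\<^sup>2 \<le> (?h \<bullet> (x - \<tau> n *\<^sub>R a0))\<^sup>2"
            by (simp add: power_mult_distrib inner_add_left)
        qed (use integrable_var in auto)
        then have "w\<^sup>2 / 2 * var n g - var n u \<le> var n ?h" using integrable_var by (simp add: var_def)
        moreover have "w\<^sup>2 / 2 * (s / 2) \<le> w\<^sup>2 / 2 * var n g" using elim(2) by (intro mult_left_mono) auto
        ultimately show ?thesis using elim(3) V8 by (simp add: field_simps)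
      qed
      have var_upper: "var n ?h \<le> 2 * real n"
      proof -
        have "var n ?h \<le> (\<integral>x. (norm ?h)\<^sup>2 * (norm (x - \<tau> n *\<^sub>R a0))\<^sup>2 \<partial>tilt (\<tau> n))"
          unfolding var_def
          by (rule integral_mono[OF integrable_var integrable_mult_right[OF tilt_moments(2)]])
            (use power_mono[OF Cauchy_Schwarz_ineq2[of ?h], of _ 2] in \<open>simp add: power_mult_distrib\<close>)
        also have "\<dots> \<le> (L * \<bar>w\<bar>)\<^sup>2 * (K3 + 1)"
          unfolding integral_mult_right_zero using elim(4) nh
          by (intro mult_mono power_mono) (auto intro!: Bochner_Integration.integral_nonneg)
        also have "\<dots> \<le> (L * (\<delta> * sqrt n))\<^sup>2 * (K3 + 1)"
          using w L K3_nonneg by (intro mult_right_mono power_mono mult_left_mono) auto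
        also have "\<dots> \<le> (L * (\<delta> * sqrt n))\<^sup>2 * (K3 + 1)\<^sup>2"
          using K3_nonneg by (intro mult_left_mono) (auto simp: power2_eq_square)
        also have "\<dots> = (\<delta> * (L * (K3 + 1)))\<^sup>2 * n" by (simp add: power_mult_distrib)
        also have "\<dots> \<le> 1 * real n" using \<delta>1 \<delta> L K3_nonneg by (intro mult_right_mono power_le_one) auto
        finally show ?thesis by simp
      qed
      have b: "0 \<le> 1 - ?b" using var_upper n by (simp add: field_simps)
      have A: "\<bar>?a\<bar> \<le> s / 64 * w\<^sup>2 / n"
      proof -
        have "\<bar>?h \<bullet> drift n\<bar> \<le> norm ?h * norm (drift n)" by (rule Cauchy_Schwarz_ineq2)
        also have "\<dots> \<le> (L * \<bar>w\<bar>) * ((\<tau> n)\<^sup>2 * K1)" using L by (intro mult_mono nh norm_drift) auto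
        finally have "\<bar>?a\<bar> \<le> (L * \<bar>w\<bar>) * ((\<tau> n)\<^sup>2 * K1) / sqrt n" using n by (simp add: divide_right_mono)
        also have "\<dots> = \<bar>w\<bar> * (sqrt n * (\<tau> n)\<^sup>2 * (L * K1)) / n"
          using n by (simp add: field_simps)
        also have "\<dots> \<le> w\<^sup>2 * (s / 64) / n"
          using elim(1) w2 K1_nonneg L by (intro divide_right_mono mult_mono) auto
        finally show ?thesis by (simp add: mult.commute)
      qed
      have Rm: "norm ?h ^ 3 * K3 / (n * sqrt n) \<le> s / 64 * w\<^sup>2 / n"
      proof -
        have "norm ?h ^ 3 * K3 \<le> (L * \<bar>w\<bar>) ^ 3 * K3" using K3_nonneg by (intro mult_right_mono power_mono nh) auto
        also have "\<dots> = w\<^sup>2 * (\<bar>w\<bar> * (L ^ 3 * K3))" by (simp add: power_mult_distrib power3_eq_cube power2_eq_square mult_ac)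
        also have "\<dots> \<le> w\<^sup>2 * ((\<delta> * sqrt n) * (L ^ 3 * K3))"
          using w L K3_nonneg by (intro mult_left_mono mult_right_mono) auto
        also have "\<dots> = w\<^sup>2 * (\<delta> * (L ^ 3 * K3)) * sqrt n" by simp
        also have "\<dots> \<le> w\<^sup>2 * (s / 64) * sqrt n" by (intro mult_right_mono mult_left_mono \<delta>2) auto
        finally have "norm ?h ^ 3 * K3 / (n * sqrt n) \<le> w\<^sup>2 * (s / 64) * sqrt n / (n * sqrt n)"
          using n by (intro divide_right_mono) auto
        then show ?thesis using n by (simp add: mult.commute)
      qed
      have "norm (chf (\<zeta> n) ?h) \<le> norm (1 + \<i> * of_real ?a - of_real ?b) + norm ?h ^ 3 * K3 / (n * sqrt n)"
        using chf_\<zeta>_approx[OF elim(5), of ?h] norm_triangle_sub[of "chf (\<zeta> n) ?h" "1 + \<i> * of_real ?a - of_real ?b"]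
        by linarith
      also have "norm (1 + \<i> * of_real ?a - complex_of_real ?b) \<le> norm (complex_of_real (1 - ?b)) + norm (\<i> * complex_of_real ?a)"
      proof -
        have eq: "1 + \<i> * of_real ?a - complex_of_real ?b = complex_of_real (1 - ?b) + \<i> * complex_of_real ?a" by simp
        show ?thesis unfolding eq by (rule norm_triangle_ineq)
      qed
      also have "norm (complex_of_real (1 - ?b)) = 1 - ?b" using b by (simp only: norm_of_real abs_of_nonneg)
      also have "norm (\<i> * complex_of_real ?a) = \<bar>?a\<bar>" by (simp only: norm_mult norm_ii norm_of_real mult_1)
      \<comment> \<open>The variance yields s / 16; drift and remainder cost s / 64 each, which
        leaves s / 32.\<close>
      also have "1 - ?b + \<bar>?a\<bar> + norm ?h ^ 3 * K3 / (n * sqrt n) \<le> 1 - s / 16 * w\<^sup>2 / n + s / 64 * w\<^sup>2 / n + s / 64 * w\<^sup>2 / n"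
      proof (intro add_mono A Rm)
        have "s * w\<^sup>2 / 8 / (2 * real n) \<le> ?b" using var_lower n by (intro divide_right_mono) auto
        then show "1 - ?b \<le> 1 - s / 16 * w\<^sup>2 / n" by (simp add: field_simps)
      qed
      also have "\<dots> = 1 + (- ((s / 32) * w\<^sup>2 / n))" by (simp add: field_simps)
      also have "\<dots> \<le> exp (- ((s / 32) * w\<^sup>2 / n))" by (rule exp_ge_add_one_self)
      finally show "norm (chf (\<zeta> n) ?h) \<le> exp (- ((s / 32) * w\<^sup>2 / n))" by simp
    qed
  qed
  then show ?thesis using s \<delta> by (intro exI[of _ K] exI[of _ "s / 32"] exI[of _ \<delta>]) auto
qed

lemma local_limit_tight_\<zeta>:
  assumes C: "\<And>k. orthonormal (C k)" "\<And>y. (\<lambda>k. onproj (C k) y) \<longlonglongrightarrow> y"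
  shows "local_limit_tight \<zeta> (\<lambda>n. sqrt n * \<tau> n) g a0 (sqrt (q g)) q \<zeta>0 C"
proof unfold_locales
  show "bprob (\<zeta> n)" for n by (rule bprob_\<zeta>)
  show "bprob \<zeta>0" by (rule \<zeta>0)
  show "integrable (\<zeta> n) (\<lambda>x. (norm x)\<^sup>2)" for n
    using tilt_moments(2)[of n] by (subst integral_\<zeta>(2)) (auto simp: power_mult_distrib)
  show "sqrt n * \<tau> n > 0" if "n \<ge> 1" for n using \<tau>_pos[OF that] that by simp
  show "filterlim (\<lambda>n. sqrt (real n) * \<tau> n) at_top sequentially" by (rule m_top)
  show "\<forall>\<^sub>F n in sequentially. (sqrt (real n) * \<tau> n)\<^sup>2 \<le> sqrt (real n)"
  proof -
    have "\<forall>\<^sub>F n in sequentially. sqrt n * (\<tau> n)\<^sup>2 < 1" using m_sq_lim by (intro order_tendstoD(2)) auto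
    then show ?thesis
    proof eventually_elim
      case (elim n)
      have "(sqrt n * \<tau> n)\<^sup>2 = sqrt n * (sqrt n * (\<tau> n)\<^sup>2)" by (simp add: power_mult_distrib)
      also have "\<dots> \<le> sqrt n * 1" using elim by (intro mult_left_mono) auto
      finally show ?case by simp
    qed
  qed
  show "sqrt (q g) > 0" using \<sigma>2 by simp
  show "q (w *\<^sub>R g + u) = (sqrt (q g))\<^sup>2 * w\<^sup>2 + 2 * w * (a0 \<bullet> u) + q u" for w u
    using q_expand \<sigma>2 by simp
  show "chf \<zeta>0 u = complex_of_real (exp (- (q u - (a0 \<bullet> u)\<^sup>2 / (sqrt (q g))\<^sup>2) / 2))" for u
    using chf_\<zeta>0 \<sigma>2 by simp
  show "(\<lambda>n. chf (\<zeta> n) h ^ n) \<longlonglongrightarrow> complex_of_real (exp (- q h / 2))" for h by (rule clt_\<zeta>)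
  show "\<exists>K c \<delta>. 0 < c \<and> 0 < \<delta> \<and> (\<forall>\<^sub>F n in sequentially. \<forall>w. K \<le> \<bar>w\<bar> \<and> \<bar>w\<bar> \<le> \<delta> * sqrt (real n) \<longrightarrow>
       cmod (chf (\<zeta> n) (w *\<^sub>R g + u)) \<le> exp (- (c * w\<^sup>2 / real n)))" for u
    by (rule decay_\<zeta>)
  show "orthonormal (C k)" "(\<lambda>k. onproj (C k) y) \<longlonglongrightarrow> y" for k y by (rule C)+
  show "(\<lambda>n. real n * norm (\<integral>x. x \<partial>\<zeta> n)) \<longlonglongrightarrow> 0"
  proof (rule Lim_null_comparison)
    show "(\<lambda>n. sqrt n * (\<tau> n)\<^sup>2 * K1) \<longlonglongrightarrow> 0" by (rule tendsto_mult_left_zero[OF m_sq_lim])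
    show "\<forall>\<^sub>F n in sequentially. norm (real n * norm (\<integral>x. x \<partial>\<zeta> n)) \<le> sqrt n * (\<tau> n)\<^sup>2 * K1"
      using eventually_ge_at_top[of 1]
    proof eventually_elim
      case (elim n)
      have "(\<integral>x. x \<partial>\<zeta> n) = inverse (sqrt n) *\<^sub>R drift n"
        unfolding drift_def by (subst integral_\<zeta>) auto
      then have "real n * norm (\<integral>x. x \<partial>\<zeta> n) = (n / sqrt n) * norm (drift n)" by (simp add: divide_inverse)
      also have "\<dots> = sqrt n * norm (drift n)" by (simp add: real_div_sqrt)
      also have "\<dots> \<le> sqrt n * ((\<tau> n)\<^sup>2 * K1)" by (intro mult_left_mono norm_drift) simp
      finally show ?case by (simp add: mult.assoc)
    qed
  qed
  show "\<forall>\<^sub>F k in sequentially. \<forall>\<^sub>F n in sequentially. real n * (\<integral>x. (norm (x - onproj (C k) x))\<^sup>2 \<partial>\<zeta> n) \<le> \<epsilon>"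
    if \<epsilon>: "\<epsilon> > 0" for \<epsilon>
  proof -
    have le: "norm (x - onproj (C k) x) \<le> norm x" for x k
      using onproj_best_approx[OF C(1) span_zero, of x k] by simp
    have sq: "(norm (x - onproj (C k) x))\<^sup>2 * wt x \<le> 1 * (norm x ^ 2 * wt x)" for x k
      using power_mono[OF le, of x k 2] by (simp add: mult_right_mono)
    \<comment> \<open>Weighting with \<open>wt\<close> dominates every tilt at once, so this single
      limit gives tightness uniformly in n. Below, twice \<epsilon> / 4 pays for the residual and
      \<epsilon> / 2 for the recentring.\<close>
    have "(\<lambda>k. \<integral>x. (norm (x - onproj (C k) x))\<^sup>2 * wt x \<partial>\<mu>) \<longlonglongrightarrow> (\<integral>x. 0 \<partial>\<mu>)"
    proof (rule integral_dominated_convergence[where w = "\<lambda>x. norm x ^ 2 * wt x"])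
      show "integrable \<mu> (\<lambda>x. norm x ^ 2 * wt x)" by (rule integrable_wt) simp
      show "AE x in \<mu>. (\<lambda>k. (norm (x - onproj (C k) x))\<^sup>2 * wt x) \<longlonglongrightarrow> 0"
      proof (rule AE_I2)
        fix x
        have "(\<lambda>k. (norm (x - onproj (C k) x))\<^sup>2 * wt x) \<longlonglongrightarrow> (norm (x - x))\<^sup>2 * wt x"
          by (intro tendsto_intros C)
        then show "(\<lambda>k. (norm (x - onproj (C k) x))\<^sup>2 * wt x) \<longlonglongrightarrow> 0" by simp
      qed
      show "AE x in \<mu>. norm ((norm (x - onproj (C k) x))\<^sup>2 * wt x) \<le> norm x ^ 2 * wt x" for k
        using sq by (intro AE_I2) simp
    qed measurable
    then have "\<forall>\<^sub>F k in sequentially. (\<integral>x. (norm (x - onproj (C k) x))\<^sup>2 * wt x \<partial>\<mu>) < \<epsilon> / 4"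
      using \<epsilon> by (intro order_tendstoD(2)) auto
    then show ?thesis
    proof eventually_elim
      case (elim k)
      let ?A = "\<lambda>x. x - onproj (C k) x"
      interpret A: bounded_linear ?A by (rule bounded_linear_diff_onproj[OF C(1)])
      have l: "(\<lambda>n. 2 * ((\<tau> n)\<^sup>2 * (norm a0)\<^sup>2)) \<longlonglongrightarrow> 2 * (0\<^sup>2 * (norm a0)\<^sup>2)" by (intro tendsto_intros \<tau>_lim)
      have "\<forall>\<^sub>F n in sequentially. 2 * ((\<tau> n)\<^sup>2 * (norm a0)\<^sup>2) < \<epsilon> / 2"
        using \<epsilon> by (intro order_tendstoD(2)[OF l]) simp
      then show ?case using eventually_ge_at_top[of 1]
      proof eventually_elim
        case (elim n)
        interpret T: prob_space "tilt (\<tau> n)" by (rule bprobD[OF bprob_tilt_\<tau>])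
        have iA: "integrable (tilt (\<tau> n)) (\<lambda>x. (norm (?A x))\<^sup>2)"
          by (rule tilt_dominated(1)[OF \<tau>(1,2), where L = 1 and k = 2]) (use power_mono[OF le, of _ k 2] in auto)
        have "real n * (\<integral>x. (norm (?A x))\<^sup>2 \<partial>\<zeta> n) = real n * (\<integral>x. inverse n * (norm (?A (x - \<tau> n *\<^sub>R a0)))\<^sup>2 \<partial>tilt (\<tau> n))"
          by (subst integral_\<zeta>) (measurable, simp only: A.scaleR norm_scaleR power_mult_distrib, simp add: power_inverse)
        also have "\<dots> = (\<integral>x. (norm (?A (x - \<tau> n *\<^sub>R a0)))\<^sup>2 \<partial>tilt (\<tau> n))"
          using elim(2) unfolding integral_mult_right_zero by simp
        also have "\<dots> \<le> (\<integral>x. 2 * (norm (?A x))\<^sup>2 + 2 * ((\<tau> n)\<^sup>2 * (norm a0)\<^sup>2) \<partial>tilt (\<tau> n))"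
        proof (rule integral_mono)
          show "integrable (tilt (\<tau> n)) (\<lambda>x. (norm (?A (x - \<tau> n *\<^sub>R a0)))\<^sup>2)"
            by (rule Bochner_Integration.integrable_bound[OF tilt_moments(2)[of n]])
              (measurable, use power_mono[OF le, of _ k 2] in auto)
          show "integrable (tilt (\<tau> n)) (\<lambda>x. 2 * (norm (?A x))\<^sup>2 + 2 * ((\<tau> n)\<^sup>2 * (norm a0)\<^sup>2))"
            using iA by auto
          fix x
          have "(norm (?A (x - \<tau> n *\<^sub>R a0)))\<^sup>2 \<le> (norm (?A x) + norm (\<tau> n *\<^sub>R a0))\<^sup>2"
            using norm_triangle_ineq4[of "?A x" "?A (\<tau> n *\<^sub>R a0)"] le[of "\<tau> n *\<^sub>R a0" k]
            unfolding A.diff by (intro power_mono) auto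
          also have "\<dots> \<le> 2 * (norm (?A x))\<^sup>2 + 2 * (norm (\<tau> n *\<^sub>R a0))\<^sup>2"
            using zero_le_power2[of "norm (?A x) - norm (\<tau> n *\<^sub>R a0)"] unfolding power2_sum power2_diff by linarith
          finally show "(norm (?A (x - \<tau> n *\<^sub>R a0)))\<^sup>2 \<le> 2 * (norm (?A x))\<^sup>2 + 2 * ((\<tau> n)\<^sup>2 * (norm a0)\<^sup>2)"
            by (simp add: power_mult_distrib)
        qed
        also have "\<dots> = 2 * (\<integral>x. (norm (?A x))\<^sup>2 \<partial>tilt (\<tau> n)) + 2 * ((\<tau> n)\<^sup>2 * (norm a0)\<^sup>2)"
          using iA by (simp add: T.prob_space)
        also have "(\<integral>x. (norm (?A x))\<^sup>2 \<partial>tilt (\<tau> n)) \<le> (\<integral>x. (norm (?A x))\<^sup>2 * wt x \<partial>\<mu>)"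
        proof -
          have i: "integrable \<mu> (\<lambda>x. exp (\<tau> n * (g \<bullet> x)) * (norm (?A x))\<^sup>2)"
            using iA integral_tilt(2)[OF \<tau>(1,2), of "\<lambda>x. (norm (?A x))\<^sup>2"] by simp
          have i': "integrable \<mu> (\<lambda>x. (norm (?A x))\<^sup>2 * wt x)"
            by (rule integrable_dominated(1)[where L = 1 and k = 2]) (measurable, use sq in auto)
          have "(\<integral>x. (norm (?A x))\<^sup>2 \<partial>tilt (\<tau> n)) = inverse (\<phi> (\<tau> n)) * (\<integral>x. exp (\<tau> n * (g \<bullet> x)) * (norm (?A x))\<^sup>2 \<partial>\<mu>)"
            using integral_tilt(1)[OF \<tau>(1,2), of "\<lambda>x. (norm (?A x))\<^sup>2"] by simp
          also have "\<dots> \<le> 1 * (\<integral>x. exp (\<tau> n * (g \<bullet> x)) * (norm (?A x))\<^sup>2 \<partial>\<mu>)"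
            using \<phi>_ge_1[OF \<tau>(1,2)] by (intro mult_right_mono Bochner_Integration.integral_nonneg) (auto simp: inverse_le_1_iff)
          also have "\<dots> \<le> (\<integral>x. (norm (?A x))\<^sup>2 * wt x \<partial>\<mu>)"
            unfolding mult_1
          proof (rule integral_mono[OF i i'])
            fix x
            show "exp (\<tau> n * (g \<bullet> x)) * (norm (?A x))\<^sup>2 \<le> (norm (?A x))\<^sup>2 * wt x"
              using mult_right_mono[OF exp_tilt_le'[OF \<tau>(1,2)], of "(norm (?A x))\<^sup>2" n x] by (simp add: mult.commute)
          qed
          finally show ?thesis .
        qed
        finally show ?case using elim(1) \<open>_ < \<epsilon> / 4\<close> by linarith
      qed
    qed
  qed
qed

text \<open>Replacing ln \<phi> by \<phi> - 1 costs order n \<tau>^4, the square of sqrt n \<tau>^2,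
  and replacing \<phi> - 1 by \<tau>^2 q g / 2 costs order n \<tau>^3; both vanish.\<close>

lemma \<phi>_power_lim: "(\<lambda>n. \<phi> (\<tau> n) ^ n * exp (- ((sqrt n * \<tau> n)\<^sup>2 * q g / 2))) \<longlonglongrightarrow> 1"
proof -
  define x where "x n = \<phi> (\<tau> n) - 1" for n
  have x: "0 \<le> x n" "\<bar>x n - (\<tau> n)\<^sup>2 * q g / 2\<bar> \<le> \<tau> n ^ 3 * (norm g ^ 3 * W 3)" "x n \<le> (\<tau> n)\<^sup>2 * ((norm g)\<^sup>2 * W 2)" for n
    using \<phi>_ge_1[OF \<tau>(1,2), of n] \<phi>_quadratic[OF \<tau>(1,2), of n] by (auto simp: x_def)
  have "(\<lambda>n. (\<tau> n)\<^sup>2 * ((norm g)\<^sup>2 * W 2)) \<longlonglongrightarrow> 0\<^sup>2 * ((norm g)\<^sup>2 * W 2)" by (intro tendsto_intros \<tau>_lim)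
  then have "eventually (\<lambda>n. (\<tau> n)\<^sup>2 * ((norm g)\<^sup>2 * W 2) < 1) sequentially" by (intro order_tendstoD(2)) auto
  then have "eventually (\<lambda>n. norm (real n * ln (\<phi> (\<tau> n)) - (sqrt n * \<tau> n)\<^sup>2 * q g / 2)
     \<le> (sqrt n * (\<tau> n)\<^sup>2 * ((norm g)\<^sup>2 * W 2))\<^sup>2 + (real n * \<tau> n ^ 3) * (norm g ^ 3 * W 3)) sequentially"
  proof eventually_elim
    case (elim n)
    then have "x n \<le> 1" using x(3)[of n] by linarith
    then have 1: "\<bar>ln (1 + x n) - x n\<bar> \<le> (x n)\<^sup>2"
      using abs_ln_one_plus_x_minus_x_bound_nonneg[OF x(1)[of n]] by simp
    also have "(x n)\<^sup>2 \<le> ((\<tau> n)\<^sup>2 * ((norm g)\<^sup>2 * W 2))\<^sup>2" using x by (intro power_mono)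
    finally have 2: "real n * \<bar>ln (1 + x n) - x n\<bar> \<le> real n * ((\<tau> n)\<^sup>2 * ((norm g)\<^sup>2 * W 2))\<^sup>2"
      by (rule mult_left_mono) simp
    have 3: "real n * \<bar>x n - (\<tau> n)\<^sup>2 * q g / 2\<bar> \<le> real n * (\<tau> n ^ 3 * (norm g ^ 3 * W 3))"
      by (rule mult_left_mono[OF x(2)]) simp
    have "real n * ln (\<phi> (\<tau> n)) - (sqrt n * \<tau> n)\<^sup>2 * q g / 2
       = real n * (ln (1 + x n) - x n) + real n * (x n - (\<tau> n)\<^sup>2 * q g / 2)"
      by (simp add: x_def power_mult_distrib algebra_simps)
    also have "norm \<dots> \<le> real n * \<bar>ln (1 + x n) - x n\<bar> + real n * \<bar>x n - (\<tau> n)\<^sup>2 * q g / 2\<bar>"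
      by (rule order_trans[OF norm_triangle_ineq]) (simp add: abs_mult)
    also have "\<dots> \<le> real n * ((\<tau> n)\<^sup>2 * ((norm g)\<^sup>2 * W 2))\<^sup>2 + real n * (\<tau> n ^ 3 * (norm g ^ 3 * W 3))"
      using 2 3 by (rule add_mono)
    finally show ?case by (simp add: power_mult_distrib mult.assoc)
  qed
  moreover have "(\<lambda>n. (sqrt n * (\<tau> n)\<^sup>2 * ((norm g)\<^sup>2 * W 2))\<^sup>2 + (real n * \<tau> n ^ 3) * (norm g ^ 3 * W 3)) \<longlonglongrightarrow>
      (0 * ((norm g)\<^sup>2 * W 2))\<^sup>2 + 0 * (norm g ^ 3 * W 3)" by (intro tendsto_intros m_sq_lim m_cube)
  then have "(\<lambda>n. (sqrt n * (\<tau> n)\<^sup>2 * ((norm g)\<^sup>2 * W 2))\<^sup>2 + (real n * \<tau> n ^ 3) * (norm g ^ 3 * W 3)) \<longlonglongrightarrow> 0"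
    by simp
  ultimately have "(\<lambda>n. real n * ln (\<phi> (\<tau> n)) - (sqrt n * \<tau> n)\<^sup>2 * q g / 2) \<longlonglongrightarrow> 0"
    by (rule Lim_null_comparison)
  then have "(\<lambda>n. exp (real n * ln (\<phi> (\<tau> n)) - (sqrt n * \<tau> n)\<^sup>2 * q g / 2)) \<longlonglongrightarrow> exp 0" by (rule tendsto_exp)
  moreover have "exp (real n * ln (\<phi> (\<tau> n)) - (sqrt n * \<tau> n)\<^sup>2 * q g / 2) = \<phi> (\<tau> n) ^ n * exp (- ((sqrt n * \<tau> n)\<^sup>2 * q g / 2))" for n
    using \<phi>_ge_1[OF \<tau>(1,2), of n] unfolding exp_diff exp_of_nat_mult by (simp add: exp_minus inverse_eq_divide)
  ultimately show ?thesis by simp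
qed

text \<open>Undoing the tilt at the dominating point contributes exp (- m^2 q g), of which the
  normalising constants \<phi>^n give back asymptotically exp (m^2 q g / 2). What remains is the
  expectation treated by \<open>ball_limit\<close>.\<close>

theorem tilted_ball_limit:
  assumes \<kappa>: "\<kappa> > 0" and z: "z = (\<kappa> / 2) *\<^sub>R g"
  shows "(\<lambda>n. measure (cpow \<mu> n) ((*\<^sub>R) (real n * \<tau> n) ` {x. norm (x - (a0 + z)) < norm z})
      * ((sqrt n * \<tau> n) * exp ((sqrt n * \<tau> n)\<^sup>2 * q g / 2)))
    \<longlonglongrightarrow> (1 / (sqrt (2 * pi) * sqrt (q g))) * (\<integral>y. exp (- (norm y)\<^sup>2 / \<kappa>) \<partial>\<zeta>0)"
proof -
  obtain C :: "nat \<Rightarrow> 'h set" where C: "\<And>k. orthonormal (C k)" "\<And>y. (\<lambda>k. onproj (C k) y) \<longlonglongrightarrow> y"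
    by (rule orthonormal_exhaustion) blast
  interpret L: local_limit_tight \<zeta> "\<lambda>n. sqrt n * \<tau> n" g a0 "sqrt (q g)" q \<zeta>0 C
    by (rule local_limit_tight_\<zeta>[OF C])
  define m where "m n = sqrt n * \<tau> n" for n
  define F where "F n y = (if (norm y)\<^sup>2 < \<kappa> * (m n * (g \<bullet> y)) then exp (- (m n * (g \<bullet> y))) else 0)" for n and y :: 'h
  define B where "B n = (*\<^sub>R) (real n * \<tau> n) ` {x. norm (x - (a0 + z)) < norm z}" for n
  have F0: "0 \<le> F n y" for n y by (simp add: F_def)
  have [measurable]: "F n \<in> borel_measurable borel" for n unfolding F_def[abs_def] by measurable
  have ga: "g \<bullet> a0 = q g"
    using inner_a0[of g] by (simp add: q_def power2_eq_square inner_commute)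
  have exact: "measure (cpow \<mu> n) (B n) = \<phi> (\<tau> n) ^ n * exp (- ((m n)\<^sup>2 * q g)) * (\<integral>y. F n y \<partial>cpow (\<zeta> n) n)" if n: "n \<ge> 1" for n
  proof -
    define c where "c = real n * \<tau> n"
    have c: "c > 0" using \<tau>_pos[OF n] n by (simp add: c_def)
    have s: "sqrt n > 0" using n by simp
    have memB: "x \<in> B n \<longleftrightarrow> norm (x - c *\<^sub>R (a0 + z)) < c * norm z" for x
    proof -
      have "x \<in> B n \<longleftrightarrow> norm (inverse c *\<^sub>R x - (a0 + z)) < norm z"
      proof
        assume "x \<in> B n"
        then obtain y where "x = c *\<^sub>R y" "norm (y - (a0 + z)) < norm z" by (auto simp: B_def c_def)
        then show "norm (inverse c *\<^sub>R x - (a0 + z)) < norm z" using c by simp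
      next
        assume "norm (inverse c *\<^sub>R x - (a0 + z)) < norm z"
        then show "x \<in> B n" unfolding B_def c_def[symmetric]
          using c by (intro image_eqI[of _ _ "inverse c *\<^sub>R x"]) auto
      qed
      also have "\<dots> \<longleftrightarrow> c * norm (inverse c *\<^sub>R x - (a0 + z)) < c * norm z" using c by simp
      also have "c * norm (inverse c *\<^sub>R x - (a0 + z)) = norm (c *\<^sub>R (inverse c *\<^sub>R x - (a0 + z)))" using c by simp
      also have "c *\<^sub>R (inverse c *\<^sub>R x - (a0 + z)) = x - c *\<^sub>R (a0 + z)" using c by (simp add: scaleR_diff_right)
      finally show ?thesis .
    qed
    have [measurable]: "B n \<in> sets borel"
    proof -
      have "B n = {x. norm (x - c *\<^sub>R (a0 + z)) < c * norm z}" using memB by blast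
      then show ?thesis by simp
    qed
    note pt = bprob_cpow[OF bprob_tilt_\<tau>]
    note [measurable_cong] = bprobD(2)[OF bprob_cpow[OF \<mu>]] bprobD(2)[OF pt]
    interpret P: prob_space "cpow \<mu> n" by (rule bprobD[OF bprob_cpow[OF \<mu>]])
    interpret T: prob_space "cpow (tilt (\<tau> n)) n" by (rule bprobD[OF pt])
    let ?y = "\<lambda>x. inverse (sqrt n) *\<^sub>R (x - c *\<^sub>R a0)"
    \<comment> \<open>With c = n \<tau> and x = c a0 + sqrt n w, the squares of c times the norm of
      z cancel, because a0 lies on the sphere; a condition comparing the squared norm of w with a
      linear functional is left. The factor exp (- m^2 q g) splits off because g \<bullet> a0 = q
      g.\<close>
    have pt_eq: "indicator (B n) x * exp (- (\<tau> n * (g \<bullet> x))) = exp (- ((m n)\<^sup>2 * q g)) * F n (?y x)" for x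
    proof -
      let ?w = "?y x"
      have x: "x = c *\<^sub>R a0 + sqrt n *\<^sub>R ?w" using s by simp
      have e: "\<tau> n * (g \<bullet> x) = (m n)\<^sup>2 * q g + m n * (g \<bullet> ?w)"
      proof -
        define v where "v = g \<bullet> ?w"
        have "g \<bullet> x = g \<bullet> (c *\<^sub>R a0 + sqrt n *\<^sub>R ?w)" using x by (rule arg_cong)
        also have "\<dots> = c * q g + sqrt n * v" by (simp only: inner_add_right inner_scaleR_right ga v_def)
        finally have "\<tau> n * (g \<bullet> x) = (m n)\<^sup>2 * q g + m n * v"
          by (simp add: c_def m_def power_mult_distrib power2_eq_square algebra_simps)
        then show ?thesis by (simp only: v_def)
      qed
      have zz: "c * (2 * (?w \<bullet> z)) * sqrt n = real n * (\<kappa> * (m n * (g \<bullet> ?w)))"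
        by (simp add: z c_def m_def inner_commute)
      have "x \<in> B n \<longleftrightarrow> norm (sqrt n *\<^sub>R ?w - c *\<^sub>R z) < c * norm z"
        unfolding memB using s by (simp add: scaleR_add_right diff_diff_eq)
      also have "\<dots> \<longleftrightarrow> (norm (sqrt n *\<^sub>R ?w - c *\<^sub>R z))\<^sup>2 < (c * norm z)\<^sup>2"
        using c by (auto intro: power_strict_mono dest: power_less_imp_less_base)
      also have "(norm (sqrt n *\<^sub>R ?w - c *\<^sub>R z))\<^sup>2 = real n * (norm ?w)\<^sup>2 - c * (2 * (?w \<bullet> z)) * sqrt n + (c * norm z)\<^sup>2"
      proof -
        have "(norm (v - u))\<^sup>2 = (norm v)\<^sup>2 - 2 * (v \<bullet> u) + (norm u)\<^sup>2" for v u :: 'h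
          by (simp add: power2_norm_eq_inner inner_diff_left inner_diff_right inner_commute)
        from this[of "sqrt n *\<^sub>R ?w" "c *\<^sub>R z"] show ?thesis
          by (simp only: norm_scaleR power_mult_distrib inner_scaleR_left inner_scaleR_right) (simp add: power_mult_distrib mult_ac)
      qed
      finally have "x \<in> B n \<longleftrightarrow> real n * (norm ?w)\<^sup>2 < real n * (\<kappa> * (m n * (g \<bullet> ?w)))" unfolding zz by auto
      then have i: "x \<in> B n \<longleftrightarrow> (norm ?w)\<^sup>2 < \<kappa> * (m n * (g \<bullet> ?w))" using n by simp
      show ?thesis unfolding e F_def using i by (simp add: indicator_def exp_add[symmetric])
    qed
    have iF: "integrable (cpow (tilt (\<tau> n)) n) (\<lambda>x. F n (?y x))"
    proof (rule T.integrable_bounded[where B = 1])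
      fix x
      have Fle: "F n v \<le> 1" for v
      proof (cases "(norm v)\<^sup>2 < \<kappa> * (m n * (g \<bullet> v))")
        case True
        then have "0 < \<kappa> * (m n * (g \<bullet> v))" using zero_le_power2 le_less_trans by blast
        then have "0 < m n * (g \<bullet> v)" using \<kappa> by (simp only: zero_less_mult_iff) linarith
        then show ?thesis using True by (simp add: F_def)
      next
        case False then show ?thesis by (simp only: F_def if_False zero_le_one)
      qed
      show "norm (F n (?y x)) \<le> 1"
        unfolding real_norm_def abs_of_nonneg[OF F0] by (rule Fle)
    qed measurable
    have "ennreal (measure (cpow \<mu> n) (B n)) = (\<integral>\<^sup>+x. indicator (B n) x \<partial>cpow \<mu> n)"
      by (simp add: P.emeasure_eq_measure)
    also have "\<dots> = ennreal (\<phi> (\<tau> n) ^ n) * (\<integral>\<^sup>+x. indicator (B n) x * ennreal (exp (- (\<tau> n * (g \<bullet> x)))) \<partial>cpow (tilt (\<tau> n)) n)"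
      by (rule nn_integral_cpow_tilt[OF \<tau>]) measurable
    also have "(\<integral>\<^sup>+x. indicator (B n) x * ennreal (exp (- (\<tau> n * (g \<bullet> x)))) \<partial>cpow (tilt (\<tau> n)) n)
      = (\<integral>\<^sup>+x. ennreal (exp (- ((m n)\<^sup>2 * q g)) * F n (?y x)) \<partial>cpow (tilt (\<tau> n)) n)"
    proof (rule nn_integral_cong)
      fix x
      have "indicator (B n) x * ennreal (exp (- (\<tau> n * (g \<bullet> x)))) = ennreal (indicator (B n) x * exp (- (\<tau> n * (g \<bullet> x))))"
        by (simp add: indicator_def)
      then show "indicator (B n) x * ennreal (exp (- (\<tau> n * (g \<bullet> x)))) = ennreal (exp (- ((m n)\<^sup>2 * q g)) * F n (?y x))"
        unfolding pt_eq .
    qed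
    also have "\<dots> = ennreal (\<integral>x. exp (- ((m n)\<^sup>2 * q g)) * F n (?y x) \<partial>cpow (tilt (\<tau> n)) n)"
      by (rule nn_integral_eq_integral[OF integrable_mult_right[OF iF]]) (simp add: F0)
    also have "(\<integral>x. exp (- ((m n)\<^sup>2 * q g)) * F n (?y x) \<partial>cpow (tilt (\<tau> n)) n) = exp (- ((m n)\<^sup>2 * q g)) * (\<integral>y. F n y \<partial>cpow (\<zeta> n) n)"
      unfolding cpow_\<zeta> c_def by (subst integral_distr) auto
    finally have "ennreal (measure (cpow \<mu> n) (B n)) = ennreal (\<phi> (\<tau> n) ^ n * (exp (- ((m n)\<^sup>2 * q g)) * (\<integral>y. F n y \<partial>cpow (\<zeta> n) n)))"
      using \<phi>_ge_1[OF \<tau>, of n] by (subst ennreal_mult) (auto intro!: mult_nonneg_nonneg Bochner_Integration.integral_nonneg F0)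
    then show ?thesis
      using \<phi>_ge_1[OF \<tau>, of n] by (subst (asm) ennreal_inj) (auto intro!: mult_nonneg_nonneg Bochner_Integration.integral_nonneg F0)
  qed
  have "(\<lambda>n. (\<phi> (\<tau> n) ^ n * exp (- ((m n)\<^sup>2 * q g / 2))) * (m n * (\<integral>y. F n y \<partial>cpow (\<zeta> n) n)))
     \<longlonglongrightarrow> 1 * (L.C0 * (\<integral>y. exp (- (norm y)\<^sup>2 / \<kappa>) \<partial>\<zeta>0))"
    unfolding F_def m_def by (intro tendsto_mult \<phi>_power_lim L.ball_limit[OF \<kappa>])
  then have lim: "(\<lambda>n. (\<phi> (\<tau> n) ^ n * exp (- ((m n)\<^sup>2 * q g / 2))) * (m n * (\<integral>y. F n y \<partial>cpow (\<zeta> n) n)))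
     \<longlonglongrightarrow> (1 / (sqrt (2 * pi) * sqrt (q g))) * (\<integral>y. exp (- (norm y)\<^sup>2 / \<kappa>) \<partial>\<zeta>0)"
    unfolding L.C0_def by simp
  have ev: "\<forall>\<^sub>F n in sequentially. (\<phi> (\<tau> n) ^ n * exp (- ((m n)\<^sup>2 * q g / 2))) * (m n * (\<integral>y. F n y \<partial>cpow (\<zeta> n) n))
      = measure (cpow \<mu> n) (B n) * (m n * exp ((m n)\<^sup>2 * q g / 2))"
    using eventually_ge_at_top[of 1]
  proof eventually_elim
    case (elim n)
    have "exp (- ((m n)\<^sup>2 * q g)) * exp ((m n)\<^sup>2 * q g / 2) = exp (- ((m n)\<^sup>2 * q g / 2))"
      by (simp add: exp_add[symmetric])
    note e = this
    show ?case unfolding exact[OF elim] e[symmetric] by (simp only: mult_ac)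
  qed
  from Lim_transform_eventually[OF lim ev] show ?thesis unfolding B_def m_def .
qed

end

section \<open>The Gaussian measure\<close>

lemma iexp_normal_density:
  assumes "s > 0"
  shows "(\<integral>x. iexp (t * x) \<partial>density lborel (\<lambda>x. ennreal (normal_density 0 s x))) = of_real (exp (- (t * s)\<^sup>2 / 2))"
proof -
  have "(\<integral>x. iexp (t * x) \<partial>density lborel (\<lambda>x. ennreal (normal_density 0 s x))) = (\<integral>x. normal_density 0 s x *\<^sub>R iexp (t * x) \<partial>lborel)"
    by (rule integral_density) auto
  also have "\<dots> = \<bar>s\<bar> *\<^sub>R (\<integral>y. normal_density 0 s (0 + s * y) *\<^sub>R iexp (t * (0 + s * y)) \<partial>lborel)"
    by (rule lborel_integral_real_affine) (use assms in simp)
  also have "\<dots> = (\<integral>y. std_normal_density y *\<^sub>R iexp (t * s * y) \<partial>lborel)"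
    unfolding integral_scaleR_right[symmetric]
  proof (rule Bochner_Integration.integral_cong[OF refl])
    fix y
    have "\<bar>s\<bar> * normal_density 0 s (0 + s * y) = std_normal_density y"
      using assms by (simp add: normal_density_def real_sqrt_mult power_mult_distrib)
    then show "\<bar>s\<bar> *\<^sub>R (normal_density 0 s (0 + s * y) *\<^sub>R iexp (t * (0 + s * y))) = std_normal_density y *\<^sub>R iexp (t * s * y)"
      by (simp add: mult.assoc)
  qed
  also have "\<dots> = (\<integral>y. iexp (t * s * y) \<partial>std_normal_distribution)"
    by (rule integral_density[symmetric]) auto
  also have "\<dots> = of_real (exp (- (t * s)\<^sup>2 / 2))"
    using fun_cong[OF char_std_normal_distribution, of "t * s"] unfolding char_def by (simp only:)
  finally show ?thesis .
qed

text \<open>Under \<open>\<gamma>\<close> the functional \<open>g\<close> and the residual \<open>resid\<close> (the vector \<open>G\<^sub>2\<close>) are independent.\<close>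

locale gaussian_split =
  fixes \<gamma> :: "'h::{real_inner, banach, second_countable_topology} measure" and q :: "'h \<Rightarrow> real" and g a0 :: 'h
  assumes \<gamma>: "bprob \<gamma>" and chf_\<gamma>: "\<And>u. chf \<gamma> u = exp (- q u / 2)"
    and sq_int: "integrable \<gamma> (\<lambda>x. (norm x)\<^sup>2)" and mean_\<gamma>: "(\<integral>x. x \<partial>\<gamma>) = 0"
    and q_expand: "\<And>w u. q (w *\<^sub>R g + u) = q g * w\<^sup>2 + 2 * w * (a0 \<bullet> u) + q u"
    and qg: "q g > 0" and ga: "g \<bullet> a0 = q g"
begin

definition \<sigma> :: real where "\<sigma> = sqrt (q g)"

lemma \<sigma>: "\<sigma> > 0" "\<sigma>\<^sup>2 = q g" using qg by (auto simp: \<sigma>_def)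

definition resid :: "'h \<Rightarrow> 'h" where "resid y = y - (g \<bullet> y) *\<^sub>R (a0 /\<^sub>R q g)"

lemma g_resid: "g \<bullet> resid y = 0" using ga qg by (simp add: resid_def inner_diff_right)

lemma borel_measurable_resid [measurable]: "resid \<in> borel_measurable borel"
  unfolding resid_def[abs_def] by measurable

definition \<zeta>0 :: "'h measure" where "\<zeta>0 = distr \<gamma> borel resid"

lemma sets_\<gamma> [measurable_cong]: "sets \<gamma> = sets borel" by (rule bprobD[OF \<gamma>])

lemma bprob_\<zeta>0: "bprob \<zeta>0"
proof -
  interpret prob_space \<gamma> by (rule bprobD[OF \<gamma>])
  show ?thesis unfolding \<zeta>0_def bprob_def by (auto intro!: prob_space_distr)
qed

text \<open>Moving \<open>resid\<close> to the other side of the inner product shifts the frequency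
  u along g, to the point of that line where q is smallest.\<close>

lemma chf_\<zeta>0: "chf \<zeta>0 u = exp (- (q u - (a0 \<bullet> u)\<^sup>2 / q g) / 2)"
proof -
  let ?w = "- ((a0 \<bullet> u) / q g)"
  have "chf \<zeta>0 u = (\<integral>y. iexp (u \<bullet> resid y) \<partial>\<gamma>)"
    unfolding \<zeta>0_def by (rule chf_distr) (auto simp: sets_\<gamma>)
  also have "\<dots> = chf \<gamma> (?w *\<^sub>R g + u)"
    unfolding chf_def by (rule Bochner_Integration.integral_cong)
      (simp_all add: resid_def inner_add_left inner_diff_right inner_commute divide_inverse algebra_simps)
  also have "q (?w *\<^sub>R g + u) = q u - (a0 \<bullet> u)\<^sup>2 / q g"
    unfolding q_expand using qg by (simp add: power2_eq_square field_simps)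
  then have "chf \<gamma> (?w *\<^sub>R g + u) = exp (- (q u - (a0 \<bullet> u)\<^sup>2 / q g) / 2)" unfolding chf_\<gamma> by simp
  finally show ?thesis .
qed

lemma \<zeta>0_sq_int: "integrable \<zeta>0 (\<lambda>x. (norm x)\<^sup>2)"
proof -
  have bl: "bounded_linear resid" unfolding resid_def
    by (intro bounded_linear_sub bounded_linear_ident bounded_linear_scaleR_left[THEN bounded_linear_compose] bounded_linear_inner_right)
  obtain K where K: "\<And>x. norm (resid x) \<le> norm x * K" using bounded_linear.bounded[OF bl] by blast
  have "integrable \<gamma> (\<lambda>x. (norm (resid x))\<^sup>2)"
  proof (rule Bochner_Integration.integrable_bound)
    show "integrable \<gamma> (\<lambda>x. K\<^sup>2 * (norm x)\<^sup>2)" using sq_int by simp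
    show "AE x in \<gamma>. norm ((norm (resid x))\<^sup>2) \<le> norm (K\<^sup>2 * (norm x)\<^sup>2)"
    proof (rule AE_I2)
      fix x
      have "(norm (resid x))\<^sup>2 \<le> (norm x * K)\<^sup>2" by (intro power_mono K) simp
      then show "norm ((norm (resid x))\<^sup>2) \<le> norm (K\<^sup>2 * (norm x)\<^sup>2)" by (simp add: power_mult_distrib mult.commute)
    qed
  qed measurable
  then show ?thesis unfolding \<zeta>0_def by (subst integrable_distr_eq) auto
qed

lemma \<zeta>0_mean: "integrable \<zeta>0 (\<lambda>x. x)" "(\<integral>x. x \<partial>\<zeta>0) = 0"
proof -
  interpret prob_space \<gamma> by (rule bprobD[OF \<gamma>])
  have i: "integrable \<gamma> (\<lambda>x. x)" by (rule integrable_of_square[OF _ _ sq_int]) (unfold_locales, measurable)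
  show "integrable \<zeta>0 (\<lambda>x. x)" by (rule integrable_of_square[OF _ _ \<zeta>0_sq_int]) (auto intro: bprobD(4)[OF bprob_\<zeta>0] simp: measurable_def bprobD(2,3)[OF bprob_\<zeta>0])
  have "(\<integral>x. x \<partial>\<zeta>0) = (\<integral>x. resid x \<partial>\<gamma>)" unfolding \<zeta>0_def by (subst integral_distr) auto
  also have "\<dots> = (\<integral>x. x \<partial>\<gamma>) - (\<integral>x. g \<bullet> x \<partial>\<gamma>) *\<^sub>R (a0 /\<^sub>R q g)"
    unfolding resid_def using i by simp
  also have "\<dots> = 0" using i by (simp add: mean_\<gamma>)
  finally show "(\<integral>x. x \<partial>\<zeta>0) = 0" .
qed

text \<open>The exponent q u is the sum of \<open>(a0 \<bullet> u)\<^sup>2 / q g\<close> and the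
  exponent of \<zeta>0, so the characteristic function factorises and uniqueness yields the product
  structure.\<close>

lemma split: "\<gamma> = distr (std_normal_distribution \<Otimes>\<^sub>M \<zeta>0) borel (\<lambda>(\<xi>, z). (\<xi> / \<sigma>) *\<^sub>R a0 + z)"
proof (rule chf_unique)
  interpret N: real_distribution std_normal_distribution by (rule real_dist_normal_dist)
  interpret Z: prob_space \<zeta>0 by (rule bprobD[OF bprob_\<zeta>0])
  interpret P: pair_prob_space std_normal_distribution \<zeta>0 ..
  note [measurable_cong] = bprobD(2)[OF bprob_\<zeta>0]
  show "finite_measure \<gamma>" "sets \<gamma> = sets borel" using bprobD[OF \<gamma>] by auto
  show "finite_measure (distr (std_normal_distribution \<Otimes>\<^sub>M \<zeta>0) borel (\<lambda>(\<xi>, z). (\<xi> / \<sigma>) *\<^sub>R a0 + z))"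
    by (rule P.finite_measure_distr) measurable
  show "sets (distr (std_normal_distribution \<Otimes>\<^sub>M \<zeta>0) borel (\<lambda>(\<xi>, z). (\<xi> / \<sigma>) *\<^sub>R a0 + z)) = sets borel" by simp
  fix u
  have "chf (distr (std_normal_distribution \<Otimes>\<^sub>M \<zeta>0) borel (\<lambda>(\<xi>, z). (\<xi> / \<sigma>) *\<^sub>R a0 + z)) u
    = (\<integral>p. (case p of (\<xi>, z) \<Rightarrow> iexp (u \<bullet> ((\<xi> / \<sigma>) *\<^sub>R a0 + z))) \<partial>(std_normal_distribution \<Otimes>\<^sub>M \<zeta>0))"
    unfolding chf_def by (subst integral_distr) (auto simp: case_prod_unfold)
  also have "\<dots> = (\<integral>\<xi>. (\<integral>z. iexp (u \<bullet> ((\<xi> / \<sigma>) *\<^sub>R a0 + z)) \<partial>\<zeta>0) \<partial>std_normal_distribution)"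
    by (rule P.integral_fst[symmetric], rule finite_measure.integrable_bounded[where B = 1], unfold_locales) auto
  also have "\<dots> = (\<integral>\<xi>. iexp ((u \<bullet> a0) / \<sigma> * \<xi>) * chf \<zeta>0 u \<partial>std_normal_distribution)"
  proof (rule Bochner_Integration.integral_cong[OF refl])
    fix \<xi>
    have "iexp (u \<bullet> ((\<xi> / \<sigma>) *\<^sub>R a0 + z)) = iexp ((u \<bullet> a0) / \<sigma> * \<xi>) * iexp (u \<bullet> z)" for z
      unfolding exp_add[symmetric] by (rule arg_cong[where f = exp]) (simp add: inner_add_right algebra_simps)
    then show "(\<integral>z. iexp (u \<bullet> ((\<xi> / \<sigma>) *\<^sub>R a0 + z)) \<partial>\<zeta>0) = iexp ((u \<bullet> a0) / \<sigma> * \<xi>) * chf \<zeta>0 u"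
      unfolding chf_def by (simp only: integral_mult_right_zero)
  qed
  also have "\<dots> = char std_normal_distribution ((u \<bullet> a0) / \<sigma>) * chf \<zeta>0 u"
    unfolding char_def by (simp only: integral_mult_left_zero)
  also have "\<dots> = complex_of_real (exp (- ((u \<bullet> a0) / \<sigma>)\<^sup>2 / 2) * exp (- (q u - (a0 \<bullet> u)\<^sup>2 / q g) / 2))"
    by (simp add: char_std_normal_distribution chf_\<zeta>0)
  also have "exp (- ((u \<bullet> a0) / \<sigma>)\<^sup>2 / 2) * exp (- (q u - (a0 \<bullet> u)\<^sup>2 / q g) / 2) = exp (- q u / 2)"
    by (simp add: exp_add[symmetric] power_divide \<sigma>(2) inner_commute) (simp add: field_simps)
  finally show "chf \<gamma> u = chf (distr (std_normal_distribution \<Otimes>\<^sub>M \<zeta>0) borel (\<lambda>(\<xi>, z). (\<xi> / \<sigma>) *\<^sub>R a0 + z)) u"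
    by (simp add: chf_\<gamma>)
qed

lemma AE_\<zeta>0: "AE z in \<zeta>0. g \<bullet> z = 0"
  unfolding \<zeta>0_def by (subst AE_distr_iff) (auto simp: g_resid)

lemma integral_split:
  fixes f :: "'h \<Rightarrow> 'b::{banach, second_countable_topology}"
  assumes [measurable]: "f \<in> borel_measurable borel" and i: "integrable \<gamma> f"
  shows "(\<integral>y. f y \<partial>\<gamma>) = (\<integral>z. (\<integral>\<xi>. std_normal_density \<xi> *\<^sub>R f ((\<xi> / \<sigma>) *\<^sub>R a0 + z) \<partial>lborel) \<partial>\<zeta>0)"
proof -
  interpret N: real_distribution std_normal_distribution by (rule real_dist_normal_dist)
  interpret Z: prob_space \<zeta>0 by (rule bprobD[OF bprob_\<zeta>0])
  interpret P: pair_prob_space std_normal_distribution \<zeta>0 ..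
  note [measurable_cong] = bprobD(2)[OF bprob_\<zeta>0]
  have i': "integrable (std_normal_distribution \<Otimes>\<^sub>M \<zeta>0) (\<lambda>(\<xi>, z). f ((\<xi> / \<sigma>) *\<^sub>R a0 + z))"
    using i by (subst (asm) split, subst (asm) integrable_distr_eq) (auto simp: case_prod_unfold)
  have "(\<integral>y. f y \<partial>\<gamma>) = (\<integral>p. (case p of (\<xi>, z) \<Rightarrow> f ((\<xi> / \<sigma>) *\<^sub>R a0 + z)) \<partial>(std_normal_distribution \<Otimes>\<^sub>M \<zeta>0))"
    by (subst split, subst integral_distr) (auto simp: case_prod_unfold)
  also have "\<dots> = (\<integral>z. (\<integral>\<xi>. f ((\<xi> / \<sigma>) *\<^sub>R a0 + z) \<partial>std_normal_distribution) \<partial>\<zeta>0)"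
    by (rule P.integral_snd[OF i', symmetric])
  also have "\<dots> = (\<integral>z. (\<integral>\<xi>. std_normal_density \<xi> *\<^sub>R f ((\<xi> / \<sigma>) *\<^sub>R a0 + z) \<partial>lborel) \<partial>\<zeta>0)"
    by (intro Bochner_Integration.integral_cong refl integral_density) auto
  finally show ?thesis .
qed

lemma std_normal_tilt: "std_normal_density \<xi> * exp (\<sigma> * \<xi>) = exp (q g / 2) * normal_density \<sigma> 1 \<xi>"
  unfolding normal_density_def std_normal_density_def \<sigma>(2)[symmetric]
  by (simp add: exp_add[symmetric] power2_diff) (simp add: algebra_simps add_divide_distrib diff_divide_distrib)

text \<open>Almost surely g \<bullet> y is \<sigma> \<xi>, so both integrals reduce to
  one-dimensional Gaussian ones, where the exponential factor moves the mean of \<xi> to \<sigma>.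
  They turn the defining equations of a dominating functional into explicit formulas.\<close>

lemma mgf_\<gamma>: "(\<integral>y. exp (g \<bullet> y) \<partial>\<gamma>) = exp (q g / 2)"
  and tilted_mean_\<gamma>: "(\<integral>y. exp (g \<bullet> y - q g / 2) *\<^sub>R y \<partial>\<gamma>) = a0"
proof -
  interpret N: real_distribution std_normal_distribution by (rule real_dist_normal_dist)
  interpret Z: prob_space \<zeta>0 by (rule bprobD[OF bprob_\<zeta>0])
  interpret L: pair_sigma_finite std_normal_distribution \<zeta>0 ..
  note [measurable_cong] = bprobD(2)[OF bprob_\<zeta>0]
  have gy: "AE z in \<zeta>0. \<forall>\<xi>. g \<bullet> ((\<xi> / \<sigma>) *\<^sub>R a0 + z) = \<sigma> * \<xi>"
    using AE_\<zeta>0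
  proof eventually_elim
    case (elim z)
    have "q g / \<sigma> = \<sigma>" using \<sigma> by (simp add: power2_eq_square field_simps flip: \<sigma>(2))
    then have "\<xi> / \<sigma> * q g = \<sigma> * \<xi>" for \<xi> by (metis mult.commute times_divide_eq_left times_divide_eq_right)
    then show ?case using elim ga by (simp add: inner_add_right)
  qed
  have nd1: "integrable lborel (\<lambda>\<xi>. normal_density \<sigma> 1 \<xi> * \<xi>)" "(\<integral>\<xi>. normal_density \<sigma> 1 \<xi> * \<xi> \<partial>lborel) = \<sigma>"
    using normal_moment_nz_1[of 1 \<sigma>] by (auto simp: has_bochner_integral_iff)
  have AEp: "AE p in std_normal_distribution \<Otimes>\<^sub>M \<zeta>0. g \<bullet> ((fst p / \<sigma>) *\<^sub>R a0 + snd p) = \<sigma> * fst p"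
  proof -
    have 1: "AE \<xi> in std_normal_distribution. AE z in \<zeta>0. g \<bullet> ((fst (\<xi>, z) / \<sigma>) *\<^sub>R a0 + snd (\<xi>, z)) = \<sigma> * fst (\<xi>, z)"
    proof (rule AE_I2)
      fix \<xi>
      show "AE z in \<zeta>0. g \<bullet> ((fst (\<xi>, z) / \<sigma>) *\<^sub>R a0 + snd (\<xi>, z)) = \<sigma> * fst (\<xi>, z)"
        using gy by eventually_elim simp
    qed
    have 2: "{p \<in> space (std_normal_distribution \<Otimes>\<^sub>M \<zeta>0). g \<bullet> ((fst p / \<sigma>) *\<^sub>R a0 + snd p) = \<sigma> * fst p} \<in> sets (std_normal_distribution \<Otimes>\<^sub>M \<zeta>0)"
      by measurable
    show ?thesis by (rule L.AE_pair_measure[OF 2 1])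
  qed
  have iexp1: "integrable std_normal_distribution (\<lambda>\<xi>. exp (\<sigma> * \<xi>))"
    by (subst integrable_density) (auto simp: std_normal_tilt)
  have iexp2: "integrable std_normal_distribution (\<lambda>\<xi>. exp (\<sigma> * \<xi>) * \<xi>)"
    by (subst integrable_density) (use nd1 in \<open>auto simp: mult.assoc[symmetric] std_normal_tilt\<close>, simp add: mult.assoc)
  have i1: "integrable \<gamma> (\<lambda>y. exp (g \<bullet> y))"
  proof (subst split, subst integrable_distr_eq)
    have "integrable (std_normal_distribution \<Otimes>\<^sub>M \<zeta>0) (\<lambda>p. exp (\<sigma> * fst p))"
      by (rule L.Fubini_integrable) (auto simp: Z.prob_space iexp1)
    then show "integrable (std_normal_distribution \<Otimes>\<^sub>M \<zeta>0) (\<lambda>p. exp (g \<bullet> (case p of (\<xi>, z) \<Rightarrow> (\<xi> / \<sigma>) *\<^sub>R a0 + z)))"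
      by (rule integrable_cong_AE_imp) (use AEp in \<open>auto simp: case_prod_unfold\<close>)
  qed auto
  have "(\<integral>y. exp (g \<bullet> y) \<partial>\<gamma>) = (\<integral>z. (\<integral>\<xi>. std_normal_density \<xi> *\<^sub>R exp (g \<bullet> ((\<xi> / \<sigma>) *\<^sub>R a0 + z)) \<partial>lborel) \<partial>\<zeta>0)"
    by (rule integral_split[OF _ i1]) measurable
  also have "\<dots> = (\<integral>z. exp (q g / 2) \<partial>\<zeta>0)"
  proof (rule integral_cong_AE)
    show "AE z in \<zeta>0. (\<integral>\<xi>. std_normal_density \<xi> *\<^sub>R exp (g \<bullet> ((\<xi> / \<sigma>) *\<^sub>R a0 + z)) \<partial>lborel) = exp (q g / 2)"
      using gy by eventually_elim (simp add: std_normal_tilt)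
  qed measurable
  finally show "(\<integral>y. exp (g \<bullet> y) \<partial>\<gamma>) = exp (q g / 2)" by (simp add: Z.prob_space)
  have i2: "integrable \<gamma> (\<lambda>y. exp (g \<bullet> y - q g / 2) *\<^sub>R y)"
  proof (subst split, subst integrable_distr_eq)
    have 1: "integrable (std_normal_distribution \<Otimes>\<^sub>M \<zeta>0) (\<lambda>p. (exp (\<sigma> * fst p) * fst p) *\<^sub>R a0)"
      by (rule L.Fubini_integrable) (use integrable_abs[OF iexp2] iexp2 in \<open>auto simp: Z.prob_space\<close>)
    have 2: "integrable (std_normal_distribution \<Otimes>\<^sub>M \<zeta>0) (\<lambda>p. exp (\<sigma> * fst p) *\<^sub>R snd p)"
    proof (rule L.Fubini_integrable)
      have "integrable std_normal_distribution (\<lambda>x. exp (\<sigma> * x) * (\<integral>y. norm y \<partial>\<zeta>0))"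
        by (rule integrable_mult_left) (rule iexp1)
      then show "integrable std_normal_distribution (\<lambda>x. \<integral>y. norm (exp (\<sigma> * fst (x, y)) *\<^sub>R snd (x, y)) \<partial>\<zeta>0)"
        by simp
      show "AE x in std_normal_distribution. integrable \<zeta>0 (\<lambda>y. exp (\<sigma> * fst (x, y)) *\<^sub>R snd (x, y))"
        using \<zeta>0_mean(1) by (intro AE_I2) simp
    qed measurable
    have "integrable (std_normal_distribution \<Otimes>\<^sub>M \<zeta>0) (\<lambda>p. exp (- q g / 2) *\<^sub>R ((1 / \<sigma>) *\<^sub>R ((exp (\<sigma> * fst p) * fst p) *\<^sub>R a0) + exp (\<sigma> * fst p) *\<^sub>R snd p))"
      by (intro integrable_scaleR_right Bochner_Integration.integrable_add 1 2)
    then show "integrable (std_normal_distribution \<Otimes>\<^sub>M \<zeta>0) (\<lambda>p. exp (g \<bullet> (case p of (\<xi>, z) \<Rightarrow> (\<xi> / \<sigma>) *\<^sub>R a0 + z) - q g / 2) *\<^sub>R (case p of (\<xi>, z) \<Rightarrow> (\<xi> / \<sigma>) *\<^sub>R a0 + z))"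
    proof (rule integrable_cong_AE_imp)
      show "AE p in std_normal_distribution \<Otimes>\<^sub>M \<zeta>0. exp (- q g / 2) *\<^sub>R ((1 / \<sigma>) *\<^sub>R ((exp (\<sigma> * fst p) * fst p) *\<^sub>R a0) + exp (\<sigma> * fst p) *\<^sub>R snd p)
        = exp (g \<bullet> (case p of (\<xi>, z) \<Rightarrow> (\<xi> / \<sigma>) *\<^sub>R a0 + z) - q g / 2) *\<^sub>R (case p of (\<xi>, z) \<Rightarrow> (\<xi> / \<sigma>) *\<^sub>R a0 + z)"
        using AEp
      proof eventually_elim
        case (elim p)
        define x where "x = fst p"
        have e: "exp (\<sigma> * x - q g / 2) = exp (- q g / 2) * exp (\<sigma> * x)" by (simp add: exp_add[symmetric])
        have gp: "g \<bullet> ((x / \<sigma>) *\<^sub>R a0 + snd p) = \<sigma> * x" using elim by (simp only: x_def)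
        have "exp (- q g / 2) *\<^sub>R ((1 / \<sigma>) *\<^sub>R ((exp (\<sigma> * x) * x) *\<^sub>R a0) + exp (\<sigma> * x) *\<^sub>R snd p)
          = exp (\<sigma> * x - q g / 2) *\<^sub>R ((x / \<sigma>) *\<^sub>R a0 + snd p)"
          unfolding e scaleR_add_right scaleR_scaleR by (simp add: mult.assoc)
        then show ?case unfolding case_prod_unfold x_def[symmetric] gp .
      qed
    qed measurable
  qed measurable
  have "(\<integral>y. exp (g \<bullet> y - q g / 2) *\<^sub>R y \<partial>\<gamma>)
    = (\<integral>z. (\<integral>\<xi>. std_normal_density \<xi> *\<^sub>R (exp (g \<bullet> ((\<xi> / \<sigma>) *\<^sub>R a0 + z) - q g / 2) *\<^sub>R ((\<xi> / \<sigma>) *\<^sub>R a0 + z)) \<partial>lborel) \<partial>\<zeta>0)"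
    by (rule integral_split[OF _ i2]) measurable
  also have "\<dots> = (\<integral>z. a0 + z \<partial>\<zeta>0)"
  proof (rule integral_cong_AE)
    show "AE z in \<zeta>0. (\<integral>\<xi>. std_normal_density \<xi> *\<^sub>R (exp (g \<bullet> ((\<xi> / \<sigma>) *\<^sub>R a0 + z) - q g / 2) *\<^sub>R ((\<xi> / \<sigma>) *\<^sub>R a0 + z)) \<partial>lborel) = a0 + z"
      using gy
    proof eventually_elim
      case (elim z)
      have "std_normal_density \<xi> *\<^sub>R (exp (g \<bullet> ((\<xi> / \<sigma>) *\<^sub>R a0 + z) - q g / 2) *\<^sub>R ((\<xi> / \<sigma>) *\<^sub>R a0 + z))
        = (normal_density \<sigma> 1 \<xi> * \<xi>) *\<^sub>R ((1 / \<sigma>) *\<^sub>R a0) + normal_density \<sigma> 1 \<xi> *\<^sub>R z" for \<xi>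
      proof -
        have "std_normal_density \<xi> * exp (\<sigma> * \<xi> - q g / 2) = normal_density \<sigma> 1 \<xi>"
          using std_normal_tilt[of \<xi>] by (simp add: exp_diff)
        then show ?thesis unfolding elim[rule_format]
          by (simp add: scaleR_add_right mult.assoc)
      qed
      then have "(\<integral>\<xi>. std_normal_density \<xi> *\<^sub>R (exp (g \<bullet> ((\<xi> / \<sigma>) *\<^sub>R a0 + z) - q g / 2) *\<^sub>R ((\<xi> / \<sigma>) *\<^sub>R a0 + z)) \<partial>lborel)
        = (\<integral>\<xi>. normal_density \<sigma> 1 \<xi> * \<xi> \<partial>lborel) *\<^sub>R ((1 / \<sigma>) *\<^sub>R a0) + (\<integral>\<xi>. normal_density \<sigma> 1 \<xi> \<partial>lborel) *\<^sub>R z"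
        using nd1 by (simp only:) (subst Bochner_Integration.integral_add, auto)
      then show ?case using \<sigma> nd1 by simp
    qed
  qed measurable
  also have "\<dots> = a0" using \<zeta>0_mean by (simp add: Z.prob_space)
  finally show "(\<integral>y. exp (g \<bullet> y - q g / 2) *\<^sub>R y \<partial>\<gamma>) = a0" .
qed

text \<open>After the split, \<xi> = m \<sigma> + s / (m \<sigma>) is substituted. Then s = 0 is the
  hyperplane tangent to the scaled ball at m a0, the normal density becomes exp (- s) up to a
  vanishing quadratic term and the explicit factor, and dominated convergence applies in s and in
  z.\<close>

theorem gaussian_ball_limit:
  fixes m :: "nat \<Rightarrow> real"
  assumes \<kappa>: "\<kappa> > 0" and z: "z0 = (\<kappa> / 2) *\<^sub>R g" and m: "\<And>n. n \<ge> 1 \<Longrightarrow> m n > 0" "filterlim m at_top sequentially"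
  shows "(\<lambda>n. measure \<gamma> ((*\<^sub>R) (m n) ` {x. norm (x - (a0 + z0)) < norm z0}) * (m n * exp ((m n)\<^sup>2 * q g / 2)))
    \<longlonglongrightarrow> (1 / (sqrt (2 * pi) * sqrt (q g))) * (\<integral>y. exp (- (norm y)\<^sup>2 / \<kappa>) \<partial>\<zeta>0)"
proof -
  interpret G: prob_space \<gamma> by (rule bprobD[OF \<gamma>])
  interpret Z: prob_space \<zeta>0 by (rule bprobD[OF bprob_\<zeta>0])
  note [measurable_cong] = bprobD(2)[OF bprob_\<zeta>0]
  define B where "B n = {x. norm (x - m n *\<^sub>R (a0 + z0)) < m n * norm z0}" for n
  have [measurable]: "B n \<in> sets borel" for n unfolding B_def by measurable
  have Beq: "(*\<^sub>R) (m n) ` {x. norm (x - (a0 + z0)) < norm z0} = B n" if n: "n \<ge> 1" for n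
  proof (intro equalityI subsetI)
    fix x assume "x \<in> (*\<^sub>R) (m n) ` {x. norm (x - (a0 + z0)) < norm z0}"
    then obtain y where y: "x = m n *\<^sub>R y" "norm (y - (a0 + z0)) < norm z0" by auto
    have "norm (x - m n *\<^sub>R (a0 + z0)) = m n * norm (y - (a0 + z0))"
      unfolding y(1) scaleR_diff_right[symmetric] norm_scaleR using m(1)[OF n] by simp
    then show "x \<in> B n" using y(2) m(1)[OF n] by (simp add: B_def)
  next
    fix x assume x: "x \<in> B n"
    have "x - m n *\<^sub>R (a0 + z0) = m n *\<^sub>R (inverse (m n) *\<^sub>R x - (a0 + z0))"
      using m(1)[OF n] by (simp add: scaleR_diff_right)
    then have "m n * norm (inverse (m n) *\<^sub>R x - (a0 + z0)) < m n * norm z0"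
      using x m(1)[OF n] by (simp add: B_def)
    then show "x \<in> (*\<^sub>R) (m n) ` {x. norm (x - (a0 + z0)) < norm z0}"
      using m(1)[OF n] by (intro image_eqI[of _ _ "inverse (m n) *\<^sub>R x"]) auto
  qed
  define H where "H n z s = (if (norm ((s / (m n * q g)) *\<^sub>R a0 + z))\<^sup>2 < \<kappa> * s then exp (- s - s\<^sup>2 / (2 * (m n)\<^sup>2 * q g)) else 0)" for n z s
  have Hm: "(\<lambda>p. H n (fst p) (snd p)) \<in> borel_measurable (borel \<Otimes>\<^sub>M borel)" for n
    unfolding H_def by measurable
  have [measurable]: "H n z \<in> borel_measurable borel" for n z unfolding H_def[abs_def] by measurable
  have H0: "0 \<le> H n z s" for n z s by (simp add: H_def)
  have H1: "H n z s \<le> exp_tail 0 s" for n z s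
  proof (cases "(norm ((s / (m n * q g)) *\<^sub>R a0 + z))\<^sup>2 < \<kappa> * s")
    case True
    then have "0 < \<kappa> * s" using zero_le_power2 le_less_trans by blast
    then have "s > 0" using \<kappa> by (simp add: zero_less_mult_iff)
    then show ?thesis using qg by (simp add: H_def exp_tail_def)
  next
    case False then show ?thesis by (simp add: H_def del: not_less)
  qed
  have exact: "measure \<gamma> (B n) * (m n * exp ((m n)\<^sup>2 * q g / 2)) = (1 / (sqrt (2 * pi) * \<sigma>)) * (\<integral>z. (\<integral>s. H n z s \<partial>lborel) \<partial>\<zeta>0)"
    if n: "n \<ge> 1" for n
  proof -
    have mn: "m n > 0" by (rule m(1)[OF n])
    have "measure \<gamma> (B n) = (\<integral>y. indicat_real (B n) y \<partial>\<gamma>)" by (simp add: sets_eq_imp_space_eq[OF sets_\<gamma>])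
    also have "\<dots> = (\<integral>z. (\<integral>\<xi>. std_normal_density \<xi> *\<^sub>R indicat_real (B n) ((\<xi> / \<sigma>) *\<^sub>R a0 + z) \<partial>lborel) \<partial>\<zeta>0)"
      by (rule integral_split) (measurable, auto intro!: G.integrable_bounded[where B = 1] simp: indicator_def)
    also have "\<dots> = (\<integral>z. (1 / (m n * \<sigma>)) * ((1 / sqrt (2 * pi)) * exp (- ((m n)\<^sup>2 * q g / 2)) * (\<integral>s. H n z s \<partial>lborel)) \<partial>\<zeta>0)"
    proof (rule integral_cong_AE)
      show "AE z in \<zeta>0. (\<integral>\<xi>. std_normal_density \<xi> *\<^sub>R indicat_real (B n) ((\<xi> / \<sigma>) *\<^sub>R a0 + z) \<partial>lborel)
         = (1 / (m n * \<sigma>)) * ((1 / sqrt (2 * pi)) * exp (- ((m n)\<^sup>2 * q g / 2)) * (\<integral>s. H n z s \<partial>lborel))"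
        using AE_\<zeta>0
      proof eventually_elim
        case (elim z)
        let ?c = "1 / (m n * \<sigma>)"
        have "(\<integral>\<xi>. std_normal_density \<xi> *\<^sub>R indicat_real (B n) ((\<xi> / \<sigma>) *\<^sub>R a0 + z) \<partial>lborel)
          = \<bar>?c\<bar> *\<^sub>R (\<integral>s. std_normal_density (m n * \<sigma> + ?c * s) *\<^sub>R indicat_real (B n) (((m n * \<sigma> + ?c * s) / \<sigma>) *\<^sub>R a0 + z) \<partial>lborel)"
          by (rule lborel_integral_real_affine) (use mn \<sigma> in simp)
        also have "(\<lambda>s. std_normal_density (m n * \<sigma> + ?c * s) *\<^sub>R indicat_real (B n) (((m n * \<sigma> + ?c * s) / \<sigma>) *\<^sub>R a0 + z))
          = (\<lambda>s. ((1 / sqrt (2 * pi)) * exp (- ((m n)\<^sup>2 * q g / 2))) * H n z s)"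
        proof
          fix s
          define y where "y = (s / (m n * q g)) *\<^sub>R a0 + z"
          have c1: "(m n * \<sigma> + ?c * s) / \<sigma> = m n + s / (m n * q g)"
            using mn \<sigma> by (simp add: add_divide_distrib power2_eq_square flip: \<sigma>(2))
          have gy: "g \<bullet> y = s / m n" using elim ga qg by (simp add: y_def inner_add_right)
          have yz: "y \<bullet> z0 = \<kappa> / 2 * (s / m n)" using gy by (simp add: z inner_commute)
          have "((m n * \<sigma> + ?c * s) / \<sigma>) *\<^sub>R a0 + z - m n *\<^sub>R (a0 + z0) = y - m n *\<^sub>R z0"
            unfolding c1 y_def by (simp add: algebra_simps)
          then have "((m n * \<sigma> + ?c * s) / \<sigma>) *\<^sub>R a0 + z \<in> B n \<longleftrightarrow> norm (y - m n *\<^sub>R z0) < m n * norm z0"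
            by (simp add: B_def)
          also have "\<dots> \<longleftrightarrow> (norm (y - m n *\<^sub>R z0))\<^sup>2 < (m n * norm z0)\<^sup>2"
            using mn by (auto intro: power_strict_mono dest: power_less_imp_less_base)
          also have "(norm (y - m n *\<^sub>R z0))\<^sup>2 = (norm y)\<^sup>2 - 2 * m n * (y \<bullet> z0) + (m n * norm z0)\<^sup>2"
            by (simp add: power2_norm_eq_inner inner_diff_left inner_diff_right inner_commute power_mult_distrib)
              (simp add: power2_eq_square)
          also have "2 * m n * (y \<bullet> z0) = \<kappa> * s" unfolding yz using mn by simp
          finally have i: "((m n * \<sigma> + ?c * s) / \<sigma>) *\<^sub>R a0 + z \<in> B n \<longleftrightarrow> (norm y)\<^sup>2 < \<kappa> * s" by auto
          have "(m n * \<sigma> + ?c * s)\<^sup>2 = (m n)\<^sup>2 * q g + 2 * s + s\<^sup>2 / ((m n)\<^sup>2 * q g)"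
            using mn \<sigma> by (simp add: power2_sum power_mult_distrib power_divide)
          then have e: "std_normal_density (m n * \<sigma> + ?c * s) = ((1 / sqrt (2 * pi)) * exp (- ((m n)\<^sup>2 * q g / 2))) * exp (- s - s\<^sup>2 / (2 * (m n)\<^sup>2 * q g))"
            unfolding std_normal_density_def by (simp add: exp_add[symmetric] add_divide_distrib diff_divide_distrib mult_ac)
          show "std_normal_density (m n * \<sigma> + ?c * s) *\<^sub>R indicat_real (B n) (((m n * \<sigma> + ?c * s) / \<sigma>) *\<^sub>R a0 + z)
            = ((1 / sqrt (2 * pi)) * exp (- ((m n)\<^sup>2 * q g / 2))) * H n z s"
            unfolding e H_def y_def[symmetric] using i by (simp add: indicator_def)
        qed
        finally show ?case using mn \<sigma> by (simp only: integral_mult_right_zero real_scaleR_def) simp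
      qed
    qed (use Hm in measurable)
    also have "\<dots> = (1 / (m n * \<sigma>)) * ((1 / sqrt (2 * pi)) * exp (- ((m n)\<^sup>2 * q g / 2)) * (\<integral>z. (\<integral>s. H n z s \<partial>lborel) \<partial>\<zeta>0))"
      by (simp only: integral_mult_right_zero)
    finally show ?thesis using mn by (simp add: exp_minus field_simps)
  qed
  have m0: "(\<lambda>n. inverse (m n)) \<longlonglongrightarrow> 0" by (rule tendsto_inverse_0_at_top[OF m(2)])
  have inner: "(\<lambda>n. \<integral>s. H n z s \<partial>lborel) \<longlonglongrightarrow> exp (- (norm z)\<^sup>2 / \<kappa>)" for z
  proof -
    have "(\<lambda>n. \<integral>s. H n z s \<partial>lborel) \<longlonglongrightarrow> (\<integral>s. exp_tail ((norm z)\<^sup>2 / \<kappa>) s \<partial>lborel)"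
    proof (rule integral_dominated_convergence[OF _ _ exp_tail_integral(1)[of 0]])
      show "AE s in lborel. (\<lambda>n. H n z s) \<longlonglongrightarrow> exp_tail ((norm z)\<^sup>2 / \<kappa>) s"
        \<comment> \<open>At this single s the strict inequality may flip in the limit; it is a null
          set.\<close>
        using AE_lborel_singleton[of "(norm z)\<^sup>2 / \<kappa>"]
      proof eventually_elim
        case (elim s)
        have l: "(\<lambda>n. (norm ((s / (m n * q g)) *\<^sub>R a0 + z))\<^sup>2) \<longlonglongrightarrow> (norm z)\<^sup>2"
        proof -
          have "(\<lambda>n. (norm ((s * inverse (m n) * inverse (q g)) *\<^sub>R a0 + z))\<^sup>2) \<longlonglongrightarrow> (norm ((s * 0 * inverse (q g)) *\<^sub>R a0 + z))\<^sup>2"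
            by (intro tendsto_intros m0)
          then show ?thesis by (simp add: divide_inverse mult.assoc)
        qed
        have l2: "(\<lambda>n. exp (- s - s\<^sup>2 / (2 * (m n)\<^sup>2 * q g))) \<longlonglongrightarrow> exp (- s)"
        proof -
          have "(\<lambda>n. exp (- s - s\<^sup>2 * (inverse (m n))\<^sup>2 * inverse (2 * q g))) \<longlonglongrightarrow> exp (- s - s\<^sup>2 * 0\<^sup>2 * inverse (2 * q g))"
            by (intro tendsto_intros m0)
          moreover have "s\<^sup>2 * (inverse (m n))\<^sup>2 * inverse (2 * q g) = s\<^sup>2 / (2 * (m n)\<^sup>2 * q g)" for n
            by (simp add: field_simps power_inverse)
          ultimately have "(\<lambda>n. exp (- s - s\<^sup>2 / (2 * (m n)\<^sup>2 * q g))) \<longlonglongrightarrow> exp (- s - s\<^sup>2 * 0\<^sup>2 * inverse (2 * q g))"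
            by (simp only:)
          then show ?thesis by simp
        qed
        consider "(norm z)\<^sup>2 < \<kappa> * s" | "(norm z)\<^sup>2 > \<kappa> * s" using elim \<kappa> by (fastforce simp: field_simps)
        then show ?case
        proof cases
          case 1
          then have "s \<in> {(norm z)\<^sup>2 / \<kappa>..}" using \<kappa> by (simp add: field_simps)
          then have e: "exp_tail ((norm z)\<^sup>2 / \<kappa>) s = exp (- s)" by (simp add: exp_tail_def)
          have "\<forall>\<^sub>F n in sequentially. (norm ((s / (m n * q g)) *\<^sub>R a0 + z))\<^sup>2 < \<kappa> * s" by (rule order_tendstoD(2)[OF l 1])
          then have "\<forall>\<^sub>F n in sequentially. exp (- s - s\<^sup>2 / (2 * (m n)\<^sup>2 * q g)) = H n z s"
            by eventually_elim (simp add: H_def)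
          then show ?thesis unfolding e by (rule Lim_transform_eventually[OF l2])
        next
          case 2
          then have "s \<notin> {(norm z)\<^sup>2 / \<kappa>..}" using \<kappa> by (simp add: field_simps)
          then have e: "exp_tail ((norm z)\<^sup>2 / \<kappa>) s = 0" by (simp add: exp_tail_def)
          have "\<forall>\<^sub>F n in sequentially. (norm ((s / (m n * q g)) *\<^sub>R a0 + z))\<^sup>2 > \<kappa> * s" by (rule order_tendstoD(1)[OF l 2])
          then have "\<forall>\<^sub>F n in sequentially. 0 = H n z s"
            by eventually_elim (simp add: H_def)
          then show ?thesis unfolding e by (rule Lim_transform_eventually[OF tendsto_const])
        qed
      qed
      show "AE s in lborel. norm (H n z s) \<le> exp_tail 0 s" for n using H0 H1 by simp
    qed measurable
    then show ?thesis by (simp add: exp_tail_integral)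
  qed
  have "(\<lambda>n. \<integral>z. (\<integral>s. H n z s \<partial>lborel) \<partial>\<zeta>0) \<longlonglongrightarrow> (\<integral>z. exp (- (norm z)\<^sup>2 / \<kappa>) \<partial>\<zeta>0)"
  proof (rule integral_dominated_convergence[where w = "\<lambda>_. 1"])
    show "AE z in \<zeta>0. (\<lambda>n. \<integral>s. H n z s \<partial>lborel) \<longlonglongrightarrow> exp (- (norm z)\<^sup>2 / \<kappa>)" using inner by simp
    show "AE z in \<zeta>0. norm (\<integral>s. H n z s \<partial>lborel) \<le> 1" for n
    proof (rule AE_I2)
      fix z
      have i: "integrable lborel (H n z)"
        by (rule Bochner_Integration.integrable_bound[OF exp_tail_integral(1)[of 0]]) (use H0 H1 in auto)
      have "(\<integral>s. H n z s \<partial>lborel) \<le> (\<integral>s. exp_tail 0 s \<partial>lborel)" by (rule integral_mono[OF i exp_tail_integral(1) H1])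
      moreover have "0 \<le> (\<integral>s. H n z s \<partial>lborel)" by (intro Bochner_Integration.integral_nonneg H0)
      ultimately show "norm (\<integral>s. H n z s \<partial>lborel) \<le> 1" by (simp add: exp_tail_integral)
    qed
    show "(\<lambda>z. \<integral>s. H n z s \<partial>lborel) \<in> borel_measurable \<zeta>0" for n using Hm by measurable
    show "(\<lambda>z. exp (- (norm z)\<^sup>2 / \<kappa>)) \<in> borel_measurable \<zeta>0" by measurable
  qed simp
  then have lim: "(\<lambda>n. (1 / (sqrt (2 * pi) * \<sigma>)) * (\<integral>z. (\<integral>s. H n z s \<partial>lborel) \<partial>\<zeta>0)) \<longlonglongrightarrow> (1 / (sqrt (2 * pi) * sqrt (q g))) * (\<integral>y. exp (- (norm y)\<^sup>2 / \<kappa>) \<partial>\<zeta>0)"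
    unfolding \<sigma>_def by (intro tendsto_mult tendsto_const)
  have "\<forall>\<^sub>F n in sequentially. (1 / (sqrt (2 * pi) * \<sigma>)) * (\<integral>z. (\<integral>s. H n z s \<partial>lborel) \<partial>\<zeta>0)
     = measure \<gamma> ((*\<^sub>R) (m n) ` {x. norm (x - (a0 + z0)) < norm z0}) * (m n * exp ((m n)\<^sup>2 * q g / 2))"
    using eventually_ge_at_top[of 1] by eventually_elim (simp only: Beq exact)
  with lim show ?thesis by (rule Lim_transform_eventually)
qed

end

section \<open>Laws of partial sums and the Laplace form of the limit constant\<close>

lemma (in prob_space) distr_partial_sum:
  fixes X :: "nat \<Rightarrow> 'a \<Rightarrow> 'h::{second_countable_topology, real_normed_vector}"
  assumes ind: "indep_vars (\<lambda>_. borel) X UNIV" and ident: "\<And>j. distr M borel (X j) = distr M borel (X 0)"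
  shows "distr M borel (\<lambda>\<omega>. \<Sum>j=1..n. X j \<omega>) = cpow (distr M borel (X 0)) n"
\<comment> \<open>\<open>X 0\<close> stands for the generic vector and only supplies the common law;
  the sum itself starts at index 1.\<close>
proof (induction n)
  case 0
  show ?case by (simp add: distr_const)
next
  case (Suc n)
  have rv [measurable]: "random_variable borel (X j)" for j using ind by (auto simp: indep_vars_def)
  have "indep_var (PiM {1..n} (\<lambda>_. borel)) (\<lambda>\<omega>. restrict (\<lambda>i. X i \<omega>) {1..n})
      (PiM {Suc n} (\<lambda>_. borel)) (\<lambda>\<omega>. restrict (\<lambda>i. X i \<omega>) {Suc n})"
    by (rule indep_var_restrict[OF ind]) auto
  then have "indep_var borel ((\<lambda>x. \<Sum>j=1..n. x j) \<circ> (\<lambda>\<omega>. restrict (\<lambda>i. X i \<omega>) {1..n}))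
      borel ((\<lambda>x. x (Suc n)) \<circ> (\<lambda>\<omega>. restrict (\<lambda>i. X i \<omega>) {Suc n}))"
    by (rule indep_var_compose) measurable
  then have "indep_var borel (\<lambda>\<omega>. \<Sum>j=1..n. X j \<omega>) borel (X (Suc n))"
    by (simp add: comp_def)
  then have e: "distr M borel (\<lambda>\<omega>. \<Sum>j=1..n. X j \<omega>) \<Otimes>\<^sub>M distr M borel (X (Suc n))
      = distr M (borel \<Otimes>\<^sub>M borel) (\<lambda>\<omega>. (\<Sum>j=1..n. X j \<omega>, X (Suc n) \<omega>))"
    unfolding indep_var_distribution_eq by blast
  have "cpow (distr M borel (X 0)) (Suc n) = distr (distr M borel (\<lambda>\<omega>. \<Sum>j=1..n. X j \<omega>) \<Otimes>\<^sub>M distr M borel (X (Suc n))) borel (\<lambda>(x, y). x + y)"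
    unfolding Suc.IH ident[of "Suc n"] by (simp only: cpow.simps conv_def)
  also have "\<dots> = distr M borel (\<lambda>\<omega>. \<Sum>j=1..Suc n. X j \<omega>)"
    unfolding e by (subst distr_distr) (auto simp: comp_def)
  finally show ?case ..
qed

text \<open>By Fubini, for fixed y the variable s runs over the half-line from
  \<open>(norm y)\<^sup>2 / \<kappa>\<close>. This links the integral in the claim to the
  expectation found in the limits.\<close>

lemma laplace_window:
  fixes \<zeta> :: "'h::{second_countable_topology, real_normed_vector} measure"
  assumes \<zeta>: "bprob \<zeta>" and \<kappa>: "\<kappa> > 0"
  shows "(LBINT s:{0..}. exp (- s) * measure \<zeta> {y. (norm y)\<^sup>2 \<le> \<kappa> * s}) = (\<integral>y. exp (- (norm y)\<^sup>2 / \<kappa>) \<partial>\<zeta>)"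
proof -
  interpret Z: prob_space \<zeta> by (rule bprobD[OF \<zeta>])
  interpret P: pair_sigma_finite lborel \<zeta> ..
  note [measurable_cong] = bprobD(2)[OF \<zeta>]
  define f where "f s y = exp_tail 0 s * indicator {y. (norm y)\<^sup>2 \<le> \<kappa> * s} y" for s and y :: 'h
  have fm: "(\<lambda>(s, y). f s y) \<in> borel_measurable (lborel \<Otimes>\<^sub>M \<zeta>)"
    unfolding f_def indicator_def by (simp add: case_prod_unfold) measurable
  have "integrable (lborel \<Otimes>\<^sub>M \<zeta>) (\<lambda>p. exp_tail 0 (fst p))"
    by (rule P.Fubini_integrable) (auto simp: Z.prob_space exp_tail_integral)
  then have fi: "integrable (lborel \<Otimes>\<^sub>M \<zeta>) (\<lambda>(s, y). f s y)"
    by (rule Bochner_Integration.integrable_bound[OF _ fm]) (auto simp: f_def indicator_def)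
  have "(LBINT s:{0..}. exp (- s) * measure \<zeta> {y. (norm y)\<^sup>2 \<le> \<kappa> * s}) = (\<integral>s. (\<integral>y. f s y \<partial>\<zeta>) \<partial>lborel)"
    unfolding set_lebesgue_integral_def
  proof (rule Bochner_Integration.integral_cong[OF refl])
    fix s
    have "(\<integral>y. f s y \<partial>\<zeta>) = exp_tail 0 s * measure \<zeta> {y. (norm y)\<^sup>2 \<le> \<kappa> * s}"
      unfolding f_def by (simp add: bprobD(3)[OF \<zeta>])
    then show "indicat_real {0..} s *\<^sub>R (exp (- s) * measure \<zeta> {y. (norm y)\<^sup>2 \<le> \<kappa> * s}) = (\<integral>y. f s y \<partial>\<zeta>)"
      by (simp add: exp_tail_def)
  qed
  also have "\<dots> = (\<integral>y. (\<integral>s. f s y \<partial>lborel) \<partial>\<zeta>)" by (rule P.Fubini_integral[OF fi, symmetric])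
  also have "\<dots> = (\<integral>y. exp (- (norm y)\<^sup>2 / \<kappa>) \<partial>\<zeta>)"
  proof (rule Bochner_Integration.integral_cong[OF refl])
    fix y :: 'h
    have "f s y = exp_tail ((norm y)\<^sup>2 / \<kappa>) s" for s
    proof (cases "(norm y)\<^sup>2 \<le> \<kappa> * s")
      case True
      then have "0 \<le> \<kappa> * s" using zero_le_power2 order_trans by blast
      then show ?thesis using True \<kappa> by (simp add: f_def exp_tail_def zero_le_mult_iff field_simps)
    next
      case False
      then have "\<not> (norm y)\<^sup>2 / \<kappa> \<le> s" using \<kappa> by (simp add: field_simps)
      then show ?thesis using False by (simp add: f_def exp_tail_def)
    qed
    then show "(\<integral>s. f s y \<partial>lborel) = exp (- (norm y)\<^sup>2 / \<kappa>)" by (simp add: exp_tail_integral)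
  qed
  finally show ?thesis .
qed

text \<open>Degenerate marginals obey the same formulas with v = 0.\<close>

lemma centered_gaussian_functional:
  fixes \<gamma> :: "'h::{real_inner, second_countable_topology} measure"
  assumes "centered_gaussian \<gamma>"
  obtains v where "v \<ge> 0" "(\<integral>y. iexp (u \<bullet> y) \<partial>\<gamma>) = of_real (exp (- v / 2))" "(\<integral>y. u \<bullet> y \<partial>\<gamma>) = 0" "(\<integral>y. (u \<bullet> y)\<^sup>2 \<partial>\<gamma>) = v"
proof -
  interpret prob_space \<gamma> using assms by (simp add: centered_gaussian_def)
  have s [measurable_cong]: "sets \<gamma> = sets borel" using assms by (simp add: centered_gaussian_def)
  let ?d = "distr \<gamma> borel (\<lambda>y. u \<bullet> y)"
  have e: "(\<integral>y. iexp (u \<bullet> y) \<partial>\<gamma>) = (\<integral>x. iexp (1 * x) \<partial>?d)" "(\<integral>y. u \<bullet> y \<partial>\<gamma>) = (\<integral>x. x \<partial>?d)" "(\<integral>y. (u \<bullet> y)\<^sup>2 \<partial>\<gamma>) = (\<integral>x. x\<^sup>2 \<partial>?d)"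
    by (subst integral_distr; simp)+
  have "distr \<gamma> borel (blinfun_apply (blinfun_inner_right u)) = return borel 0
     \<or> (\<exists>\<sigma>>0. distr \<gamma> borel (blinfun_apply (blinfun_inner_right u)) = density lborel (\<lambda>x. ennreal (normal_density 0 \<sigma> x)))"
    using assms unfolding centered_gaussian_def by blast
  then have "?d = return borel 0 \<or> (\<exists>\<sigma>>0. ?d = density lborel (\<lambda>x. ennreal (normal_density 0 \<sigma> x)))"
    by (simp only: blinfun_inner_right.rep_eq)
  then show ?thesis
  proof (elim disjE exE conjE)
    assume "?d = return borel 0"
    then have "v \<ge> 0 \<and> (\<integral>y. iexp (u \<bullet> y) \<partial>\<gamma>) = of_real (exp (- v / 2)) \<and> (\<integral>y. u \<bullet> y \<partial>\<gamma>) = 0 \<and> (\<integral>y. (u \<bullet> y)\<^sup>2 \<partial>\<gamma>) = v" if "v = 0" for v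
      unfolding e using that by (simp add: integral_return)
    from that[of 0] this[of 0] show ?thesis by auto
  next
    fix \<sigma> :: real assume \<sigma>: "\<sigma> > 0" and d: "?d = density lborel (\<lambda>x. ennreal (normal_density 0 \<sigma> x))"
    have "(\<integral>x. x \<partial>?d) = (\<integral>x. normal_density 0 \<sigma> x * x \<partial>lborel)"
      unfolding d by (subst integral_density) auto
    then have 1: "(\<integral>x. x \<partial>?d) = 0" using normal_moment_nz_1[OF \<sigma>, of 0] by (simp add: has_bochner_integral_iff)
    have "(\<integral>x. x\<^sup>2 \<partial>?d) = (\<integral>x. normal_density 0 \<sigma> x * x\<^sup>2 \<partial>lborel)"
      unfolding d by (subst integral_density) auto
    also have "\<dots> = \<sigma>\<^sup>2"
      using normal_moment_even[OF \<sigma>, of 0 1] by (simp add: has_bochner_integral_iff fact_numeral)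
    finally have 2: "(\<integral>x. x\<^sup>2 \<partial>?d) = \<sigma>\<^sup>2" .
    have 3: "(\<integral>x. iexp (1 * x) \<partial>?d) = of_real (exp (- \<sigma>\<^sup>2 / 2))"
      unfolding d iexp_normal_density[OF \<sigma>] by simp
    show ?thesis by (rule that[of "\<sigma>\<^sup>2"]) (use 1 2 3 e in auto)
  qed
qed

section \<open>The covariance of the Gaussian limit\<close>

locale gaussian_limit =
  fixes \<mu> \<gamma> :: "'h::{real_inner, banach, second_countable_topology} measure"
  assumes \<mu>: "bprob \<mu>" and cube: "integrable \<mu> (\<lambda>x. norm x ^ 3)" and mean: "(\<integral>x. x \<partial>\<mu>) = 0"
    and gauss: "centered_gaussian \<gamma>"
    and weak: "weak_conv_measure (\<lambda>n. distr (cpow \<mu> n) borel (\<lambda>x. x /\<^sub>R sqrt (real n))) \<gamma>"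
begin

definition q :: "'h \<Rightarrow> real" where "q u = (\<integral>x. (u \<bullet> x)\<^sup>2 \<partial>\<mu>)"

lemma \<gamma>: "bprob \<gamma>" using gauss by (simp add: centered_gaussian_def bprob_def)

sublocale G: prob_space \<gamma> by (rule bprobD[OF \<gamma>])

lemma sets_\<gamma> [measurable_cong]: "sets \<gamma> = sets borel" by (rule bprobD[OF \<gamma>])

text \<open>In direction 0 the exponential weight is 1, so the third moment alone provides the
  required integrability, and the array is the untilted one.\<close>

sublocale T: tilting_array \<mu> 0 1 "\<lambda>_. 0"
  by unfold_locales (use \<mu> cube mean in auto)

lemma q_eq: "T.q = q" by (simp add: q_def[abs_def] T.q_def[abs_def])

lemma tilt_0: "T.tilt 0 = \<mu>"
proof -
  have "T.\<phi> 0 = 1" by (simp add: T.\<phi>_def T.prob_space)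
  then show ?thesis by (simp add: T.tilt_def density_1)
qed

lemma scaled_law: "distr (cpow \<mu> n) borel (\<lambda>x. x /\<^sub>R sqrt (real n)) = cpow (T.\<zeta> n) n"
  unfolding T.cpow_\<zeta> by (simp add: tilt_0)

text \<open>The characteristic functions of the normalised sums have two limits, one from weak
  convergence and one from the central limit theorem. They are split into cosine and sine because
  weak convergence is phrased with real test functions.\<close>

lemma chf_\<gamma>: "chf \<gamma> u = exp (- q u / 2)"
proof -
  let ?\<nu> = "\<lambda>n. cpow (T.\<zeta> n) n"
  have p: "bprob (?\<nu> n)" for n by (intro bprob_cpow T.bprob_\<zeta>)
  have split: "chf \<kappa> u = of_real (\<integral>y. cos (u \<bullet> y) \<partial>\<kappa>) + \<i> * of_real (\<integral>y. sin (u \<bullet> y) \<partial>\<kappa>)"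
    if \<kappa>: "bprob \<kappa>" for \<kappa> :: "'h measure"
  proof -
    interpret prob_space \<kappa> by (rule bprobD[OF \<kappa>])
    note [measurable_cong] = bprobD(2)[OF \<kappa>]
    have c: "integrable \<kappa> (\<lambda>y. cos (u \<bullet> y))" by (rule integrable_bounded[where B = 1]) auto
    have s: "integrable \<kappa> (\<lambda>y. sin (u \<bullet> y))" by (rule integrable_bounded[where B = 1]) auto
    have "chf \<kappa> u = (\<integral>y. of_real (cos (u \<bullet> y)) + \<i> * of_real (sin (u \<bullet> y)) \<partial>\<kappa>)"
      unfolding chf_def by (rule Bochner_Integration.integral_cong) (auto simp: exp_Euler cos_of_real sin_of_real)
    also have "\<dots> = (\<integral>y. complex_of_real (cos (u \<bullet> y)) \<partial>\<kappa>) + (\<integral>y. \<i> * of_real (sin (u \<bullet> y)) \<partial>\<kappa>)"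
      by (rule Bochner_Integration.integral_add) (intro integrable_mult_right integrable_of_real c s)+
    finally show ?thesis by (simp only: integral_mult_right_zero integral_complex_of_real)
  qed
  have lim: "(\<lambda>n. \<integral>y. f y \<partial>?\<nu> n) \<longlonglongrightarrow> (\<integral>y. f y \<partial>\<gamma>)" if "continuous_on UNIV f" "bounded (range f)" for f :: "'h \<Rightarrow> real"
    using weak that unfolding weak_conv_measure_def scaled_law by blast
  have "(\<lambda>n. of_real (\<integral>y. cos (u \<bullet> y) \<partial>?\<nu> n) + \<i> * of_real (\<integral>y. sin (u \<bullet> y) \<partial>?\<nu> n))
     \<longlonglongrightarrow> of_real (\<integral>y. cos (u \<bullet> y) \<partial>\<gamma>) + \<i> * of_real (\<integral>y. sin (u \<bullet> y) \<partial>\<gamma>)"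
    by (intro tendsto_intros lim continuous_intros boundedI[where B = 1]) auto
  then have 1: "(\<lambda>n. chf (?\<nu> n) u) \<longlonglongrightarrow> chf \<gamma> u" unfolding split[OF p] split[OF \<gamma>] .
  have 2: "(\<lambda>n. chf (?\<nu> n) u) \<longlonglongrightarrow> exp (- q u / 2)"
    using T.clt_\<zeta>[of u] unfolding chf_cpow[OF T.bprob_\<zeta>] q_eq .
  show ?thesis by (rule LIMSEQ_unique[OF 1 2])
qed

lemma gaussian_second_moment: "(\<integral>y. (u \<bullet> y)\<^sup>2 \<partial>\<gamma>) = q u" "(\<integral>y. u \<bullet> y \<partial>\<gamma>) = 0"
proof -
  obtain v where v: "(\<integral>y. iexp (u \<bullet> y) \<partial>\<gamma>) = of_real (exp (- v / 2))" "(\<integral>y. u \<bullet> y \<partial>\<gamma>) = 0" "(\<integral>y. (u \<bullet> y)\<^sup>2 \<partial>\<gamma>) = v"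
    using centered_gaussian_functional[OF gauss] by blast
  have "complex_of_real (exp (- v / 2)) = of_real (exp (- q u / 2))"
    using v(1) chf_\<gamma>[of u] by (simp add: chf_def)
  then have "v = q u" by (simp only: of_real_eq_iff exp_inj_iff)
  then show "(\<integral>y. (u \<bullet> y)\<^sup>2 \<partial>\<gamma>) = q u" "(\<integral>y. u \<bullet> y \<partial>\<gamma>) = 0" using v by auto
qed

text \<open>The normalised sums have second moment E for every n \<ge> 1; truncated second moments
  pass to the weak limit, and monotone convergence removes the truncation. The bound comes from the
  sums, without Fernique's theorem.\<close>

lemma integrable_norm_sq: "integrable \<gamma> (\<lambda>x. (norm x)\<^sup>2)"
proof -
  let ?\<nu> = "\<lambda>n. cpow (T.\<zeta> n) n"
  define E where "E = (\<integral>x. (norm x)\<^sup>2 \<partial>\<mu>)"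
  have sq: "integrable \<mu> (\<lambda>x. (norm x)\<^sup>2)" by (rule T.integrable_sq)
  have E0: "E \<ge> 0" unfolding E_def by (intro Bochner_Integration.integral_nonneg) simp
  have trunc: "(\<integral>x. min ((norm x)\<^sup>2) (real k) \<partial>\<gamma>) \<le> E" for k :: nat
  proof -
    have "(\<lambda>n. \<integral>x. min ((norm x)\<^sup>2) (real k) \<partial>?\<nu> n) \<longlonglongrightarrow> (\<integral>x. min ((norm x)\<^sup>2) (real k) \<partial>\<gamma>)"
    proof -
      have "continuous_on UNIV (\<lambda>x::'h. min ((norm x)\<^sup>2) (real k))" by (intro continuous_intros)
      moreover have "bounded (range (\<lambda>x::'h. min ((norm x)\<^sup>2) (real k)))"
        by (rule boundedI[where B = "real k"]) (auto simp: abs_of_nonneg)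
      ultimately show ?thesis using weak unfolding weak_conv_measure_def scaled_law by blast
    qed
    moreover have "\<forall>\<^sub>F n in sequentially. (\<integral>x. min ((norm x)\<^sup>2) (real k) \<partial>?\<nu> n) \<le> E"
      using eventually_ge_at_top[of 1]
    proof eventually_elim
      case (elim n)
      note p = bprob_cpow[OF \<mu>]
      note [measurable_cong] = bprobD(2)[OF p]
      interpret C: prob_space "cpow \<mu> n" by (rule bprobD[OF p])
      have i: "integrable (cpow \<mu> n) (\<lambda>x. (norm x)\<^sup>2)" using cpow_second_moment[OF \<mu> sq] by blast
      have "(\<integral>x. min ((norm x)\<^sup>2) (real k) \<partial>?\<nu> n) = (\<integral>x. min ((norm (x /\<^sub>R sqrt n))\<^sup>2) (real k) \<partial>cpow \<mu> n)"
        unfolding scaled_law[symmetric] by (subst integral_distr) auto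
      also have "\<dots> \<le> (\<integral>x. inverse n * (norm x)\<^sup>2 \<partial>cpow \<mu> n)"
      proof (rule integral_mono)
        show "integrable (cpow \<mu> n) (\<lambda>x. min ((norm (x /\<^sub>R sqrt n))\<^sup>2) (real k))"
          by (rule C.integrable_bounded[where B = "real k"]) (auto simp: abs_of_nonneg)
        show "integrable (cpow \<mu> n) (\<lambda>x. inverse n * (norm x)\<^sup>2)" using i by simp
        show "min ((norm (x /\<^sub>R sqrt n))\<^sup>2) (real k) \<le> inverse n * (norm x)\<^sup>2" for x :: 'h
          by (simp add: power_mult_distrib power_inverse)
      qed
      also have "\<dots> = inverse n * (real n * E)"
        using cpow_second_moment[OF \<mu> sq, of n] by (simp add: mean E_def)
      also have "\<dots> = E" using elim by simp
      finally show ?case .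
    qed
    ultimately show ?thesis by (rule tendsto_upperbound) simp
  qed
  have "(\<integral>\<^sup>+x. ennreal ((norm x)\<^sup>2) \<partial>\<gamma>) \<le> ennreal E"
  proof -
    have "(\<integral>\<^sup>+x. ennreal ((norm x)\<^sup>2) \<partial>\<gamma>) = (\<integral>\<^sup>+x. (SUP k::nat. ennreal (min ((norm x)\<^sup>2) (real k))) \<partial>\<gamma>)"
    proof (rule nn_integral_cong)
      fix x :: 'h
      obtain k :: nat where k: "(norm x)\<^sup>2 \<le> real k" using real_arch_simple by blast
      show "ennreal ((norm x)\<^sup>2) = (SUP k::nat. ennreal (min ((norm x)\<^sup>2) (real k)))"
      proof (rule antisym)
        show "ennreal ((norm x)\<^sup>2) \<le> (SUP k::nat. ennreal (min ((norm x)\<^sup>2) (real k)))"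
          by (rule SUP_upper2[of k]) (use k in \<open>auto simp: min_absorb1\<close>)
        show "(SUP k::nat. ennreal (min ((norm x)\<^sup>2) (real k))) \<le> ennreal ((norm x)\<^sup>2)"
          by (rule SUP_least) (simp add: ennreal_leI)
      qed
    qed
    also have "\<dots> = (SUP k::nat. \<integral>\<^sup>+x. ennreal (min ((norm x)\<^sup>2) (real k)) \<partial>\<gamma>)"
    proof (rule nn_integral_monotone_convergence_SUP)
      show "incseq (\<lambda>k x. ennreal (min ((norm x)\<^sup>2) (real k)))"
        by (auto simp: incseq_def le_fun_def intro!: ennreal_leI)
    qed measurable
    also have "\<dots> \<le> ennreal E"
    proof (rule SUP_least)
      fix k :: nat
      have "integrable \<gamma> (\<lambda>x. min ((norm x)\<^sup>2) (real k))"
        by (rule G.integrable_bounded[where B = "real k"]) (auto simp: abs_of_nonneg)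
      then have "(\<integral>\<^sup>+x. ennreal (min ((norm x)\<^sup>2) (real k)) \<partial>\<gamma>) = ennreal (\<integral>x. min ((norm x)\<^sup>2) (real k) \<partial>\<gamma>)"
        by (intro nn_integral_eq_integral) auto
      then show "(\<integral>\<^sup>+x. ennreal (min ((norm x)\<^sup>2) (real k)) \<partial>\<gamma>) \<le> ennreal E" using trunc[of k] by (simp add: ennreal_leI)
    qed
    finally show ?thesis .
  qed
  then show ?thesis by (intro integrableI_bounded) (auto simp: less_top[symmetric] top_unique)
qed

lemma integrable_id: "integrable \<gamma> (\<lambda>x. x)"
  by (rule integrable_of_square[OF _ _ integrable_norm_sq]) (unfold_locales, measurable)

lemma mean_\<gamma>: "(\<integral>x. x \<partial>\<gamma>) = 0"
proof -
  have "(\<integral>x. x \<partial>\<gamma>) \<bullet> (\<integral>x. x \<partial>\<gamma>) = 0"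
    using integral_inner_right[of "\<integral>x. x \<partial>\<gamma>" \<gamma> "\<lambda>x. x"] integrable_id gaussian_second_moment(2) by simp
  then show ?thesis by simp
qed

lemma integrable_lin_scaled:
  assumes "bounded_linear f"
  shows "integrable \<gamma> (\<lambda>x. f x *\<^sub>R x)" "integrable \<gamma> (\<lambda>x. f x * (u \<bullet> x))"
proof -
  obtain K where K: "\<And>x. \<bar>f x\<bar> \<le> norm x * K" using bounded_linear.bounded[OF assms] by auto
  have [measurable]: "f \<in> borel_measurable borel"
    using assms by (intro borel_measurable_continuous_onI linear_continuous_on)
  have i: "integrable \<gamma> (\<lambda>x. L * (norm x)\<^sup>2)" for L using integrable_norm_sq by simp
  show 1: "integrable \<gamma> (\<lambda>x. f x *\<^sub>R x)"
  proof (rule Bochner_Integration.integrable_bound[OF i[of K]])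
    show "AE x in \<gamma>. norm (f x *\<^sub>R x) \<le> norm (K * (norm x)\<^sup>2)"
    proof (rule AE_I2)
      fix x
      have "\<bar>f x\<bar> * norm x \<le> norm x * K * norm x" by (intro mult_right_mono K) simp
      also have "\<dots> = K * (norm x)\<^sup>2" by (simp add: power2_eq_square)
      finally show "norm (f x *\<^sub>R x) \<le> norm (K * (norm x)\<^sup>2)" by simp
    qed
  qed measurable
  show "integrable \<gamma> (\<lambda>x. f x * (u \<bullet> x))"
    using integrable_inner_right[OF 1, of u] by simp
qed

definition cov :: "'h \<Rightarrow> 'h" where "cov u = (\<integral>x. (u \<bullet> x) *\<^sub>R x \<partial>\<gamma>)"

lemma inner_cov: "v \<bullet> cov u = (\<integral>x. (u \<bullet> x) * (v \<bullet> x) \<partial>\<gamma>)"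
  unfolding cov_def using integrable_lin_scaled(1)[OF bounded_linear_inner_right[of u]]
  by (subst integral_inner_right[symmetric]) auto

text \<open>The two laws have the same covariance form q, and polarisation turns this into equality
  of the operators.\<close>

lemma cov_eq: "cov u = (\<integral>x. (u \<bullet> x) *\<^sub>R x \<partial>\<mu>)"
proof -
  have eq: "v \<bullet> cov u = v \<bullet> (\<integral>x. (u \<bullet> x) *\<^sub>R x \<partial>\<mu>)" for v
  proof -
    have pol: "(u \<bullet> x) * (v \<bullet> x) = (((u + v) \<bullet> x)\<^sup>2 - (u \<bullet> x)\<^sup>2 - (v \<bullet> x)\<^sup>2) / 2" for x
      by (simp add: inner_add_left power2_eq_square algebra_simps)
    have i\<gamma>: "integrable \<gamma> (\<lambda>x. (w \<bullet> x)\<^sup>2)" for w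
      using integrable_lin_scaled(2)[OF bounded_linear_inner_right[of w], of w] by (simp add: power2_eq_square)
    have i\<mu>: "integrable \<mu> (\<lambda>x. (w \<bullet> x)\<^sup>2)" for w
      using T.integrable_inner2[of w w] by (simp add: power2_eq_square)
    have "v \<bullet> cov u = (q (u + v) - q u - q v) / 2"
      unfolding inner_cov pol using i\<gamma> by (simp add: gaussian_second_moment)
    also have "\<dots> = (\<integral>x. (u \<bullet> x) * (v \<bullet> x) \<partial>\<mu>)"
      unfolding pol using i\<mu> by (simp add: q_def)
    also have "\<dots> = v \<bullet> (\<integral>x. (u \<bullet> x) *\<^sub>R x \<partial>\<mu>)"
      using T.integrable_scaled[of u] by (subst integral_inner_right[symmetric]) auto
    finally show ?thesis .
  qed
  have "(cov u - (\<integral>x. (u \<bullet> x) *\<^sub>R x \<partial>\<mu>)) \<bullet> (cov u - (\<integral>x. (u \<bullet> x) *\<^sub>R x \<partial>\<mu>)) = 0"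
    using eq[of "cov u - (\<integral>x. (u \<bullet> x) *\<^sub>R x \<partial>\<mu>)"] by (simp add: inner_diff_right)
  then show ?thesis by simp
qed

lemma bounded_linear_cov: "bounded_linear cov"
proof (rule bounded_linear_intro[where K = "\<integral>x. (norm x)\<^sup>2 \<partial>\<gamma>"])
  have i: "integrable \<gamma> (\<lambda>x. (u \<bullet> x) *\<^sub>R x)" for u by (rule integrable_lin_scaled(1)[OF bounded_linear_inner_right])
  show "cov (u + v) = cov u + cov v" for u v unfolding cov_def by (simp add: inner_add_left scaleR_add_left i)
  show "cov (r *\<^sub>R u) = r *\<^sub>R cov u" for r u
    unfolding cov_def integral_scaleR_right[symmetric] by simp
  show "norm (cov u) \<le> norm u * (\<integral>x. (norm x)\<^sup>2 \<partial>\<gamma>)" for u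
  proof -
    have "norm (cov u) \<le> (\<integral>x. norm ((u \<bullet> x) *\<^sub>R x) \<partial>\<gamma>)" unfolding cov_def by (rule integral_norm_bound)
    also have "\<dots> \<le> (\<integral>x. norm u * (norm x)\<^sup>2 \<partial>\<gamma>)"
    proof (rule integral_mono)
      show "norm ((u \<bullet> x) *\<^sub>R x) \<le> norm u * (norm x)\<^sup>2" for x
        using mult_right_mono[OF Cauchy_Schwarz_ineq2[of u x] norm_ge_zero[of x]] by (simp add: power2_eq_square mult.assoc)
    qed (rule integrable_norm[OF i], use integrable_norm_sq in simp)
    finally show ?thesis by simp
  qed
qed

lemma cov_pos: "u \<bullet> cov u \<ge> 0"
  unfolding inner_cov by (intro Bochner_Integration.integral_nonneg) simp

end

section \<open>Existence of the dominating point of a ball\<close>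

text \<open>
  The dominating point is \<open>a - z\<close> where \<open>z = inverse (1 + t cov) a\<close> and \<open>t > 0\<close> is chosen such that
  \<open>norm z = R\<close>: the norm of the resolvent falls continuously from \<open>norm a\<close> at \<open>t = 0\<close> to below \<open>R\<close>,
  the latter because the ball contains a point of the range of the covariance operator.
\<close>

lemma resolvent_exists:
  fixes A :: "'h::{real_inner, banach} \<Rightarrow> 'h"
  assumes A: "bounded_linear A" and pos: "\<And>u. u \<bullet> A u \<ge> 0" and t: "t \<ge> 0"
  shows "\<exists>z. z + t *\<^sub>R A z = a"
proof -
  interpret A: bounded_linear A by fact
  obtain K where K: "K \<ge> 0" "\<And>x. norm (A x) \<le> norm x * K" using A.nonneg_bounded by blast
  define L where "L = 1 + t * K"
  have L: "L \<ge> 1" using t K by (simp add: L_def)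
  \<comment> \<open>The step size of a damped fixed-point iteration: z + t A z is strongly monotone
    with constant 1 and Lipschitz with constant L, and s = 1 / L^2 minimises the squared contraction
    factor 1 - 2 s + s^2 L^2, with value 1 - s.\<close>
  define s where "s = 1 / L\<^sup>2"
  have s: "s > 0" "s \<le> 1" using L by (auto simp: s_def divide_le_eq)
  let ?B = "\<lambda>z. z + t *\<^sub>R A z"
  let ?T = "\<lambda>z. z - s *\<^sub>R (?B z - a)"
  have B: "norm (?B z) \<le> L * norm z" for z
  proof -
    have "norm (?B z) \<le> norm z + t * norm (A z)" using norm_triangle_ineq[of z "t *\<^sub>R A z"] t by simp
    also have "\<dots> \<le> norm z + t * (norm z * K)" using t K by (intro add_left_mono mult_left_mono) auto
    finally show ?thesis by (simp add: L_def algebra_simps)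
  qed
  have contr: "norm (z - s *\<^sub>R ?B z) \<le> sqrt (1 - s) * norm z" for z
  proof -
    have "(norm (z - s *\<^sub>R ?B z))\<^sup>2 = (norm z)\<^sup>2 - 2 * s * (z \<bullet> ?B z) + s\<^sup>2 * (norm (?B z))\<^sup>2"
    proof -
      have "(norm (z - s *\<^sub>R v))\<^sup>2 = (norm z)\<^sup>2 - 2 * s * (z \<bullet> v) + s\<^sup>2 * (norm v)\<^sup>2" for v
        by (simp add: power2_norm_eq_inner inner_diff_left inner_diff_right inner_commute) (simp add: power2_eq_square)
      then show ?thesis .
    qed
    also have "\<dots> \<le> (norm z)\<^sup>2 - 2 * s * (norm z)\<^sup>2 + s\<^sup>2 * (L * norm z)\<^sup>2"
    proof (intro add_mono diff_mono mult_left_mono power_mono B)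
      show "(norm z)\<^sup>2 \<le> z \<bullet> ?B z" using pos[of z] t by (simp add: inner_add_right power2_norm_eq_inner)
    qed (use s in auto)
    also have "\<dots> = (1 - s) * (norm z)\<^sup>2"
    proof -
      have "s\<^sup>2 * L\<^sup>2 = s" using L by (simp add: s_def power2_eq_square)
      then have "s\<^sup>2 * (L * norm z)\<^sup>2 = s * (norm z)\<^sup>2" by (simp only: power_mult_distrib mult.assoc[symmetric])
      then show ?thesis by (simp only:) (simp add: algebra_simps)
    qed
    also have "\<dots> = (sqrt (1 - s) * norm z)\<^sup>2" using s by (simp add: power_mult_distrib)
    finally show ?thesis using s by (simp add: power2_le_iff_abs_le)
  qed
  have "\<exists>!z. ?T z = z"
  proof (rule banach_fix_type)
    show "0 \<le> sqrt (1 - s)" "sqrt (1 - s) < 1" using s by auto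
    show "\<forall>x y. dist (?T x) (?T y) \<le> sqrt (1 - s) * dist x y"
    proof (intro allI)
      fix x y
      have eq: "?T x - ?T y = (x - y) - s *\<^sub>R ?B (x - y)" by (simp add: A.diff algebra_simps)
      show "dist (?T x) (?T y) \<le> sqrt (1 - s) * dist x y" unfolding dist_norm eq by (rule contr)
    qed
  qed
  then obtain z where "?T z = z" by blast
  then have "?B z = a" using s by simp
  then show ?thesis by blast
qed

text \<open>Pair the equation with z; positivity discards the term with A. Applied with a = 0 it
  also gives uniqueness of the resolvent.\<close>

lemma resolvent_bound:
  fixes A :: "'h::real_inner \<Rightarrow> 'h"
  assumes pos: "\<And>u. u \<bullet> A u \<ge> 0" and t: "t \<ge> 0" and "z + t *\<^sub>R A z = a"
  shows "norm z \<le> norm a"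
proof (cases "z = 0")
  case False
  have "norm z * norm z \<le> z \<bullet> (z + t *\<^sub>R A z)"
    using pos[of z] t by (simp add: inner_add_right power2_norm_eq_inner[symmetric] power2_eq_square)
  also have "\<dots> \<le> norm z * norm a" unfolding assms(3) by (rule norm_cauchy_schwarz)
  finally show ?thesis using False by simp
qed simp

context gaussian_limit
begin

text \<open>A point of the Hilbert space generating \<gamma> is only a limit of vectors in the range
  of \<open>cov_op \<gamma>\<close>, but since the ball is open such a vector y already lies in it.
  Then a = (a - y) + y: the resolvent does not enlarge the first part, and the second part decays
  like 1 / t.\<close>

lemma dominating_exists:
  assumes R: "R > 0" "norm a > R" and D: "{x. norm (x - a) < R} \<inter> gaussian_hilbert \<gamma> \<noteq> {}"
  obtains t z where "t > 0" "norm z = R" "z + t *\<^sub>R cov z = a"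
proof -
  interpret A: bounded_linear cov by (rule bounded_linear_cov)
  obtain K where K: "K \<ge> 0" "\<And>x. norm (cov x) \<le> norm x * K" using A.nonneg_bounded by blast
  define Z where "Z t = (SOME z. z + t *\<^sub>R cov z = a)" for t
  have Z: "Z t + t *\<^sub>R cov (Z t) = a" if "t \<ge> 0" for t
    unfolding Z_def by (rule someI_ex[OF resolvent_exists[OF bounded_linear_cov cov_pos that]])
  have nZ: "norm (Z t) \<le> norm a" if "t \<ge> 0" for t
    by (rule resolvent_bound[OF cov_pos that Z[OF that]])
  obtain x where x: "norm (x - a) < R" "x \<in> gaussian_hilbert \<gamma>" using D by blast
  then obtain F where F: "(\<lambda>n. cov_op \<gamma> (F n)) \<longlonglongrightarrow> x" by (auto simp: gaussian_hilbert_def)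
  have "(\<lambda>n. norm (cov_op \<gamma> (F n) - a)) \<longlonglongrightarrow> norm (x - a)" by (intro tendsto_intros F)
  then have "\<forall>\<^sub>F n in sequentially. norm (cov_op \<gamma> (F n) - a) < R" using x(1) by (rule order_tendstoD)
  then obtain n where n: "norm (cov_op \<gamma> (F n) - a) < R" by (meson eventually_happens' trivial_limit_sequentially)
  define f where "f = F n"
  define y where "y = cov_op \<gamma> f"
  have y: "norm (a - y) < R" using n by (simp add: y_def f_def norm_minus_commute)
  have large: "norm (Z t) \<le> norm (a - y) + norm f / t" if t: "t > 0" for t
  proof -
    obtain p where p: "p + t *\<^sub>R cov p = a - y" using resolvent_exists[OF bounded_linear_cov cov_pos, of t "a - y"] t by auto
    obtain r where r: "r + t *\<^sub>R cov r = y" using resolvent_exists[OF bounded_linear_cov cov_pos, of t y] t by auto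
    have "(Z t - (p + r)) + t *\<^sub>R cov (Z t - (p + r)) = (Z t + t *\<^sub>R cov (Z t)) - ((p + t *\<^sub>R cov p) + (r + t *\<^sub>R cov r))"
      by (simp add: A.diff A.add algebra_simps)
    also have "\<dots> = 0" using Z[of t] t p r by simp
    finally have "norm (Z t - (p + r)) \<le> norm (0::'h)"
      by (rule resolvent_bound[OF cov_pos less_imp_le[OF t]])
    then have Zpr: "Z t = p + r" by simp
    have np: "norm p \<le> norm (a - y)" by (rule resolvent_bound[OF cov_pos less_imp_le[OF t] p])
    have if_: "integrable \<gamma> (\<lambda>x. blinfun_apply f x *\<^sub>R x)" by (rule integrable_lin_scaled(1)[OF blinfun.bounded_linear_right])
    have ir: "integrable \<gamma> (\<lambda>x. (r \<bullet> x) *\<^sub>R x)" by (rule integrable_lin_scaled(1)[OF bounded_linear_inner_right])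
    define h where "h x = blinfun_apply f x - t * (r \<bullet> x)" for x
    have bh: "bounded_linear h" unfolding h_def[abs_def]
      by (intro bounded_linear_sub blinfun.bounded_linear_right bounded_linear_const_mult bounded_linear_inner_right)
    have hx: "(\<integral>x. h x *\<^sub>R x \<partial>\<gamma>) = r"
    proof -
      have "(\<integral>x. h x *\<^sub>R x \<partial>\<gamma>) = (\<integral>x. blinfun_apply f x *\<^sub>R x - t *\<^sub>R ((r \<bullet> x) *\<^sub>R x) \<partial>\<gamma>)"
        by (simp add: h_def scaleR_diff_left)
      also have "\<dots> = (\<integral>x. blinfun_apply f x *\<^sub>R x \<partial>\<gamma>) - (\<integral>x. t *\<^sub>R ((r \<bullet> x) *\<^sub>R x) \<partial>\<gamma>)"
        by (rule Bochner_Integration.integral_diff[OF if_ integrable_scaleR_right]) (rule ir)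
      also have "\<dots> = y - t *\<^sub>R cov r" unfolding integral_scaleR_right by (simp add: y_def cov_op_def cov_def)
      also have "\<dots> = r" using r by (simp add: algebra_simps)
      finally show ?thesis .
    qed
    \<comment> \<open>Applying h to r, the integral of h x times x, gives a second moment and hence
      a nonnegative number. This reads t times the squared norm of r \<le> f r, so the norm of r is
      at most \<open>norm f / t\<close>.\<close>
    have "h (\<integral>x. h x *\<^sub>R x \<partial>\<gamma>) = (\<integral>x. h (h x *\<^sub>R x) \<partial>\<gamma>)"
      by (rule integral_bounded_linear[OF bh integrable_lin_scaled(1)[OF bh], symmetric])
    also have "\<dots> = (\<integral>x. (h x)\<^sup>2 \<partial>\<gamma>)"
      by (rule Bochner_Integration.integral_cong) (simp_all add: linear_scale[OF bounded_linear.linear[OF bh]] power2_eq_square)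
    finally have "h r = (\<integral>x. (h x)\<^sup>2 \<partial>\<gamma>)" unfolding hx .
    then have "h r \<ge> 0" by simp
    then have "blinfun_apply f r - t * (r \<bullet> r) \<ge> 0" unfolding hx by (simp add: h_def)
    then have "t * (norm r * norm r) \<le> blinfun_apply f r" by (simp add: power2_norm_eq_inner[symmetric] power2_eq_square)
    also have "\<dots> \<le> norm f * norm r" using norm_blinfun[of f r] by simp
    finally have "t * norm r * norm r \<le> norm f * norm r" by simp
    then have "t * norm r \<le> norm f" by (cases "r = 0") auto
    then have nr: "norm r \<le> norm f / t" using t by (simp add: field_simps)
    show ?thesis unfolding Zpr using norm_triangle_ineq[of p r] np nr by linarith
  qed
  \<comment> \<open>At this T the decaying part fits into the slack \<open>R - norm (a - y)\<close>;
    the summand 1 keeps T positive.\<close>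
  define T where "T = norm f / (R - norm (a - y)) + 1"
  have T: "T > 0" using y by (simp add: T_def add_nonneg_pos)
  have ZT: "norm (Z T) \<le> R"
  proof -
    have "norm f / (R - norm (a - y)) \<le> T" by (simp add: T_def)
    then have "norm f \<le> T * (R - norm (a - y))" using y by (simp add: pos_divide_le_eq)
    then have "norm f / T \<le> R - norm (a - y)" using T by (simp add: pos_divide_le_eq mult.commute)
    then show ?thesis using large[OF T] by linarith
  qed
  have Z0: "Z 0 = a" using Z[of 0] by simp
  \<comment> \<open>The resolvent identity: the difference of two resolvents solves the resolvent
    equation with right-hand side (s - t) times cov (Z s).\<close>
  have lip: "norm (Z t - Z s) \<le> \<bar>t - s\<bar> * (norm a * K)" if "t \<ge> 0" "s \<ge> 0" for t s
  proof -
    have "(Z t - Z s) + t *\<^sub>R cov (Z t - Z s) = (Z t + t *\<^sub>R cov (Z t)) - (Z s + s *\<^sub>R cov (Z s)) + (s - t) *\<^sub>R cov (Z s)"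
      by (simp add: A.diff algebra_simps)
    also have "\<dots> = (s - t) *\<^sub>R cov (Z s)" using Z that by simp
    finally have "norm (Z t - Z s) \<le> norm ((s - t) *\<^sub>R cov (Z s))" by (rule resolvent_bound[OF cov_pos that(1)])
    also have "\<dots> \<le> \<bar>t - s\<bar> * (norm (Z s) * K)" unfolding norm_scaleR abs_minus_commute[of s t] by (intro mult_left_mono K) auto
    also have "\<dots> \<le> \<bar>t - s\<bar> * (norm a * K)" using nZ[OF that(2)] K by (intro mult_left_mono mult_right_mono) auto
    finally show ?thesis .
  qed
  have "continuous_on {0..T} Z"
  proof (rule lipschitz_on_continuous_on)
    show "(norm a * K)-lipschitz_on {0..T} Z"
      by (rule lipschitz_onI) (use lip K in \<open>auto simp: dist_norm mult.commute\<close>)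
  qed
  then have "continuous_on {0..T} (\<lambda>t. norm (Z t))" by (rule continuous_on_norm)
  then obtain t where t: "0 \<le> t" "t \<le> T" "norm (Z t) = R"
    using IVT2'[of "\<lambda>t. norm (Z t)" T R 0] ZT Z0 R T by auto
  have "t \<noteq> 0" using t Z0 R by auto
  then show ?thesis using that[of t "Z t"] t Z by auto
qed

end

section \<open>Asymptotics for balls\<close>

text \<open>Truncation at \<open>t0\<close> only affects finitely many \<open>n\<close>; at \<open>n = 0\<close> the junk value \<open>b 0 / 0 = 0\<close> is harmless.\<close>

lemma window_sequence:
  fixes b :: "nat \<Rightarrow> real" and t0 :: real
  assumes b: "\<And>n. n \<ge> 1 \<Longrightarrow> b n > 0" "filterlim (\<lambda>n. b n / sqrt n) at_top sequentially"
      "(\<lambda>n. b n / real n powr (2 / 3)) \<longlonglongrightarrow> 0"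
    and t0: "t0 > 0"
  defines "\<tau> \<equiv> \<lambda>n. min (b n / real n) t0"
  shows "0 \<le> \<tau> n" "\<tau> n \<le> t0" "n \<ge> 1 \<Longrightarrow> \<tau> n > 0"
    and "eventually (\<lambda>n. n \<ge> 1 \<and> \<tau> n = b n / real n) sequentially"
    and "filterlim (\<lambda>n. sqrt n * \<tau> n) at_top sequentially"
    and "(\<lambda>n. real n * \<tau> n ^ 3) \<longlonglongrightarrow> 0" "(\<lambda>n. sqrt n * (\<tau> n)\<^sup>2) \<longlonglongrightarrow> 0" "\<tau> \<longlonglongrightarrow> 0"
proof -
  show pos: "n \<ge> 1 \<Longrightarrow> \<tau> n > 0" for n using b(1)[of n] t0 by (simp add: \<tau>_def)
  show nonneg: "0 \<le> \<tau> n" for n using pos[of n] t0 by (cases "n = 0") (auto simp: \<tau>_def)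
  show "\<tau> n \<le> t0" by (simp add: \<tau>_def)
  have bn: "(\<lambda>n. b n / real n) \<longlonglongrightarrow> 0"
  proof (rule Lim_null_comparison[OF _ b(3)])
    show "\<forall>\<^sub>F n in sequentially. norm (b n / real n) \<le> b n / real n powr (2 / 3)"
      using eventually_ge_at_top[of 1]
    proof eventually_elim
      case (elim n)
      have "real n powr (2 / 3) \<le> real n powr 1" using elim by (intro powr_mono) auto
      then show ?case using b(1)[OF elim] elim by (simp add: frac_le)
    qed
  qed
  show ev: "\<forall>\<^sub>F n in sequentially. n \<ge> 1 \<and> \<tau> n = b n / real n"
    using order_tendstoD(2)[OF bn t0] eventually_ge_at_top[of 1]
    by eventually_elim (simp add: \<tau>_def)
  show top: "filterlim (\<lambda>n. sqrt n * \<tau> n) at_top sequentially"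
  proof (rule filterlim_cong[THEN iffD1, OF refl refl _ b(2)])
    show "\<forall>\<^sub>F n in sequentially. b n / sqrt n = sqrt n * \<tau> n"
      using ev by eventually_elim (simp add: real_div_sqrt field_simps flip: power2_eq_square)
  qed
  show cube: "(\<lambda>n. real n * \<tau> n ^ 3) \<longlonglongrightarrow> 0"
  proof (rule Lim_transform_eventually)
    show "(\<lambda>n. (b n / real n powr (2 / 3)) ^ 3) \<longlonglongrightarrow> 0" using tendsto_power[OF b(3), of 3] by simp
    show "\<forall>\<^sub>F n in sequentially. (b n / real n powr (2 / 3)) ^ 3 = real n * \<tau> n ^ 3"
      using ev
    proof eventually_elim
      case (elim n)
      have "(real n powr (2 / 3)) ^ 3 = (real n)\<^sup>2"
        using elim by (simp add: powr_power powr_numeral)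
      then have "(b n / real n powr (2 / 3)) ^ 3 = b n ^ 3 / (real n)\<^sup>2" by (simp only: power_divide)
      also have "\<dots> = real n * (b n / real n) ^ 3" using elim by (simp add: power_divide power3_eq_cube power2_eq_square)
      finally show ?case using elim by simp
    qed
  qed
  \<comment> \<open>Once sqrt n \<tau> \<ge> 1, an extra factor sqrt n \<tau> only increases a term,
    so the limits of sqrt n \<tau>^2 and of \<tau> follow in turn from the cubic one.\<close>
  have big: "\<forall>\<^sub>F n in sequentially. n \<ge> 1 \<and> 1 \<le> sqrt n * \<tau> n"
    using top unfolding filterlim_at_top by (intro eventually_conj eventually_ge_at_top) blast
  show sq: "(\<lambda>n. sqrt n * (\<tau> n)\<^sup>2) \<longlonglongrightarrow> 0"
  proof (rule Lim_null_comparison[OF _ cube])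
    show "\<forall>\<^sub>F n in sequentially. norm (sqrt n * (\<tau> n)\<^sup>2) \<le> real n * \<tau> n ^ 3"
      using big
    proof eventually_elim
      case (elim n)
      have "1 * (sqrt n * (\<tau> n)\<^sup>2) \<le> (sqrt n * \<tau> n) * (sqrt n * (\<tau> n)\<^sup>2)"
        using elim by (intro mult_right_mono) auto
      also have "\<dots> = (sqrt n * sqrt n) * (\<tau> n * (\<tau> n)\<^sup>2)" by (simp only: mult_ac)
      also have "\<dots> = real n * \<tau> n ^ 3" by (simp add: power3_eq_cube power2_eq_square)
      finally show ?case by simp
    qed
  qed
  show "\<tau> \<longlonglongrightarrow> 0"
  proof (rule Lim_null_comparison[OF _ sq])
    show "\<forall>\<^sub>F n in sequentially. norm (\<tau> n) \<le> sqrt n * (\<tau> n)\<^sup>2"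
      using big
    proof eventually_elim
      case (elim n)
      have "1 * \<tau> n \<le> (sqrt n * \<tau> n) * \<tau> n" using elim nonneg[of n] by (intro mult_right_mono) auto
      also have "\<dots> = sqrt n * (\<tau> n)\<^sup>2" by (simp only: power2_eq_square mult_ac)
      finally show ?case using nonneg[of n] by simp
    qed
  qed
qed

context gaussian_limit
begin

lemma q_expand: "q (w *\<^sub>R g + u) = q g * w\<^sup>2 + 2 * w * (cov g \<bullet> u) + q u"
proof -
  have i: "integrable \<gamma> (\<lambda>x. (u \<bullet> x) * (v \<bullet> x))" for u v
    by (rule integrable_lin_scaled(2)[OF bounded_linear_inner_right])
  have "q (w *\<^sub>R g + u) = (\<integral>x. w\<^sup>2 * ((g \<bullet> x) * (g \<bullet> x)) + 2 * w * ((g \<bullet> x) * (u \<bullet> x)) + (u \<bullet> x) * (u \<bullet> x) \<partial>\<gamma>)"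
    unfolding gaussian_second_moment(1)[symmetric]
    by (rule Bochner_Integration.integral_cong) (simp_all add: inner_add_left power2_eq_square algebra_simps)
  also have "\<dots> = w\<^sup>2 * q g + 2 * w * (u \<bullet> cov g) + q u"
    unfolding gaussian_second_moment(1)[symmetric] inner_cov using i by (simp add: power2_eq_square)
  finally show ?thesis by (simp add: inner_commute mult.commute)
qed

lemma inner_cov_self: "g \<bullet> cov g = q g"
  unfolding inner_cov gaussian_second_moment(1)[symmetric] by (simp add: power2_eq_square)

lemma gaussian_split: "q g > 0 \<Longrightarrow> gaussian_split \<gamma> q g (cov g)"
  by (rule gaussian_split.intro[OF \<gamma> chf_\<gamma> integrable_norm_sq mean_\<gamma> q_expand _ inner_cov_self])

lemma AE_eq_0:
  assumes "q g = 0"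
  shows "AE x in \<gamma>. g \<bullet> x = 0"
proof -
  have "integrable \<gamma> (\<lambda>x. (g \<bullet> x)\<^sup>2)"
    using integrable_lin_scaled(2)[OF bounded_linear_inner_right[of g], of g] by (simp add: power2_eq_square)
  then have "AE x in \<gamma>. (g \<bullet> x)\<^sup>2 = 0"
    using assms gaussian_second_moment(1)[of g] integral_nonneg_eq_0_iff_AE[of \<gamma> "\<lambda>x. (g \<bullet> x)\<^sup>2"] by auto
  then show ?thesis by simp
qed

lemma cov_eq_0:
  assumes "q g = 0"
  shows "cov g = 0"
proof -
  have "cov g = (\<integral>x. 0 \<partial>\<gamma>)" unfolding cov_def
    by (rule integral_cong_AE) (use AE_eq_0[OF assms] in auto)
  then show ?thesis by simp
qed

text \<open>Both probabilities are normalised by the same factor \<open>w n\<close> and reach the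
  same positive limit, so their ratio requires no further expansion. The ball is described by its
  boundary point cov g and a radius vector parallel to g, which is exactly what the dominating point
  provides.\<close>

theorem ball_asymptotics:
  fixes b :: "nat \<Rightarrow> real"
  assumes b: "\<And>n. n \<ge> 1 \<Longrightarrow> b n > 0" "filterlim (\<lambda>n. b n / sqrt n) at_top sequentially"
      "(\<lambda>n. b n / real n powr (2 / 3)) \<longlonglongrightarrow> 0"
    and t0: "t0 > 0" "integrable \<mu> (\<lambda>x. norm x ^ 3 * exp (t0 * \<bar>g \<bullet> x\<bar>))"
    and qg: "q g > 0" and \<kappa>: "\<kappa> > 0" and z: "z = (\<kappa> / 2) *\<^sub>R g"
  defines "w \<equiv> \<lambda>n. (b n / sqrt n) * exp ((b n / sqrt n)\<^sup>2 * q g / 2)"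
    and "c \<equiv> (1 / (sqrt (2 * pi) * sqrt (q g))) * (\<integral>y. exp (- (norm y)\<^sup>2 / \<kappa>) \<partial>gaussian_split.\<zeta>0 \<gamma> q g (cov g))"
    and "D \<equiv> {x. norm (x - (cov g + z)) < norm z}"
  shows "c > 0"
    and "(\<lambda>n. measure (cpow \<mu> n) ((*\<^sub>R) (b n) ` D) * w n) \<longlonglongrightarrow> c"
    and "(\<lambda>n. measure \<gamma> ((*\<^sub>R) (b n / sqrt n) ` D) * w n) \<longlonglongrightarrow> c"
proof -
  interpret S: gaussian_split \<gamma> q g "cov g" by (rule gaussian_split[OF qg])
  interpret Z: prob_space S.\<zeta>0 by (rule bprobD[OF S.bprob_\<zeta>0])
  interpret X: tilting \<mu> g t0 by unfold_locales (use \<mu> t0 mean in auto)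
  note \<tau> = window_sequence[OF b t0(1)]
  have ev: "\<forall>\<^sub>F n in sequentially. n \<ge> 1 \<and> min (b n / real n) t0 = b n / real n"
    by (rule \<tau>(4))
  have Xq: "X.q = q" by (simp add: X.q_def[abs_def] q_def[abs_def])
  have Xa: "X.a0 = cov g" by (simp add: X.a0_def cov_eq)
  interpret X: tilting_seq \<mu> g t0 "\<lambda>n. min (b n / real n) t0" S.\<zeta>0
    by unfold_locales (use \<tau> qg S.bprob_\<zeta>0 S.chf_\<zeta>0 in \<open>simp_all add: Xq Xa\<close>)
  have ms [measurable_cong]: "sets S.\<zeta>0 = sets borel" by (rule bprobD[OF S.bprob_\<zeta>0])
  have ie: "integrable S.\<zeta>0 (\<lambda>y. exp (- (norm y)\<^sup>2 / \<kappa>))"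
    using \<kappa> by (intro Z.integrable_bounded[where B = 1]) auto
  have "(\<integral>y. exp (- (norm y)\<^sup>2 / \<kappa>) \<partial>S.\<zeta>0) \<noteq> 0"
  proof
    assume "(\<integral>y. exp (- (norm y)\<^sup>2 / \<kappa>) \<partial>S.\<zeta>0) = 0"
    then have "AE y in S.\<zeta>0. exp (- (norm y)\<^sup>2 / \<kappa>) = 0"
      using integral_nonneg_eq_0_iff_AE[OF ie] by auto
    then have "AE y in S.\<zeta>0. False" by simp
    then show False by (rule Z.AE_False[THEN iffD1])
  qed
  moreover have "(\<integral>y. exp (- (norm y)\<^sup>2 / \<kappa>) \<partial>S.\<zeta>0) \<ge> 0" by (intro Bochner_Integration.integral_nonneg) simp
  ultimately have "(\<integral>y. exp (- (norm y)\<^sup>2 / \<kappa>) \<partial>S.\<zeta>0) > 0" by linarith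
  then show "c > 0" using qg unfolding c_def by (intro mult_pos_pos divide_pos_pos) auto
  show "(\<lambda>n. measure (cpow \<mu> n) ((*\<^sub>R) (b n) ` D) * w n) \<longlonglongrightarrow> c"
  proof (rule Lim_transform_eventually)
    show "(\<lambda>n. measure (cpow \<mu> n) ((*\<^sub>R) (real n * min (b n / real n) t0) ` D)
       * ((sqrt n * min (b n / real n) t0) * exp ((sqrt n * min (b n / real n) t0)\<^sup>2 * q g / 2))) \<longlonglongrightarrow> c"
      using X.tilted_ball_limit[OF \<kappa> z] unfolding Xq Xa c_def D_def .
    show "\<forall>\<^sub>F n in sequentially. measure (cpow \<mu> n) ((*\<^sub>R) (real n * min (b n / real n) t0) ` D)
       * ((sqrt n * min (b n / real n) t0) * exp ((sqrt n * min (b n / real n) t0)\<^sup>2 * q g / 2))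
       = measure (cpow \<mu> n) ((*\<^sub>R) (b n) ` D) * w n"
      using ev
    proof eventually_elim
      case (elim n)
      have 1: "min (b n / real n) t0 = b n / real n" using elim by blast
      have 2: "real n * (b n / real n) = b n" using elim by simp
      have 3: "sqrt n * (b n / real n) = b n / sqrt n" using elim by (simp add: field_simps)
      show ?case unfolding 1 2 3 w_def ..
    qed
  qed
  have "(\<lambda>n. measure \<gamma> ((*\<^sub>R) (b n / sqrt n) ` D) * ((b n / sqrt n) * exp ((b n / sqrt n)\<^sup>2 * q g / 2))) \<longlonglongrightarrow> c"
    unfolding D_def c_def by (rule S.gaussian_ball_limit[OF \<kappa> z _ b(2)]) (use b(1) in auto)
  then show "(\<lambda>n. measure \<gamma> ((*\<^sub>R) (b n / sqrt n) ` D) * w n) \<longlonglongrightarrow> c" unfolding w_def .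
qed

end

section \<open>Supporting functionals of balls and the conclusion\<close>

lemma centered_gaussian_distr:
  fixes \<gamma> :: "'a::{real_normed_vector, second_countable_topology} measure"
    and T :: "'a \<Rightarrow> 'b::{real_normed_vector, second_countable_topology}"
  assumes \<gamma>: "centered_gaussian \<gamma>" and T: "bounded_linear T"
  shows "centered_gaussian (distr \<gamma> borel T)"
proof -
  interpret prob_space \<gamma> using \<gamma> by (simp add: centered_gaussian_def)
  have [measurable_cong]: "sets \<gamma> = sets borel" using \<gamma> by (simp add: centered_gaussian_def)
  have [measurable]: "T \<in> borel_measurable borel"
    using T by (intro borel_measurable_continuous_onI linear_continuous_on)
  have e: "distr (distr \<gamma> borel T) borel (blinfun_apply f) = distr \<gamma> borel (blinfun_apply (f o\<^sub>L Blinfun T))" for f :: "'b \<Rightarrow>\<^sub>L real"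
  proof -
    have [measurable]: "blinfun_apply f \<in> borel_measurable borel"
      by (intro borel_measurable_continuous_onI continuous_intros)
    have "blinfun_apply f \<circ> T = blinfun_apply (f o\<^sub>L Blinfun T)"
      by (auto simp: fun_eq_iff bounded_linear_Blinfun_apply[OF T])
    then show ?thesis by (subst distr_distr) auto
  qed
  have "prob_space (distr \<gamma> borel T)" by (rule prob_space_distr) measurable
  moreover have "distr \<gamma> borel (blinfun_apply (f o\<^sub>L Blinfun T)) = return borel 0 \<or>
        (\<exists>\<sigma>>0. distr \<gamma> borel (blinfun_apply (f o\<^sub>L Blinfun T)) = density lborel (\<lambda>x. ennreal (normal_density 0 \<sigma> x)))"
      for f :: "'b \<Rightarrow>\<^sub>L real"
    using \<gamma> unfolding centered_gaussian_def by blast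
  ultimately show ?thesis unfolding centered_gaussian_def e by simp
qed

text \<open>The factor 0 does occur: at n = 0 the quotient b 0 / sqrt 0 is 0. The image is then
  empty or a singleton.\<close>

lemma scaled_ball_borel: "(*\<^sub>R) c ` {x. norm (x - a) < R} \<in> sets borel"
  for a :: "'h::real_normed_vector"
proof (cases "c = 0")
  case True
  then have "(*\<^sub>R) c ` {x. norm (x - a) < R} \<subseteq> {0}" by (simp add: image_subset_iff)
  then have "(*\<^sub>R) c ` {x. norm (x - a) < R} = {} \<or> (*\<^sub>R) c ` {x. norm (x - a) < R} = {0}" by (rule subset_singletonD)
  then show ?thesis by auto
next
  case False
  have "{x. norm (x - a) < R} = ball a R" by (auto simp: dist_norm norm_minus_commute)
  then show ?thesis using open_scaling[OF False open_ball[of a R]] by simp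
qed

lemma ratio_tendsto_1:
  fixes p r w :: "nat \<Rightarrow> real"
  assumes "(\<lambda>n. p n * w n) \<longlonglongrightarrow> c" "(\<lambda>n. r n * w n) \<longlonglongrightarrow> c" "c \<noteq> 0" "eventually (\<lambda>n. w n \<noteq> 0) sequentially"
  shows "(\<lambda>n. p n / r n) \<longlonglongrightarrow> 1"
proof (rule Lim_transform_eventually)
  show "(\<lambda>n. (p n * w n) / (r n * w n)) \<longlonglongrightarrow> 1"
    using tendsto_divide[OF assms(1,2,3)] assms(3) by simp
  show "\<forall>\<^sub>F n in sequentially. (p n * w n) / (r n * w n) = p n / r n"
    using assms(4) by eventually_elim simp
qed

text \<open>Equality in the Cauchy--Schwarz inequality: the supporting functional of a ball is radial.\<close>

lemma supporting_functional_ball: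
  fixes f :: "'h::real_inner \<Rightarrow> real"
  assumes f: "bounded_linear f" and R: "R > 0" "norm z = R" and pos: "f z > 0"
    and bound: "\<And>w. norm w < R \<Longrightarrow> f w \<le> f z"
  shows "f y = ((f z / R\<^sup>2) *\<^sub>R z) \<bullet> y"
proof -
  interpret f: bounded_linear f by fact
  define L where "L = f z / R"
  have L: "L > 0" "f z = L * R" using pos R by (auto simp: L_def)
  have le: "f w \<le> L * norm w" for w
  proof (cases "w = 0")
    case False
    have "f w * R \<le> f z * norm w"
    \<comment> \<open>The hypothesis covers the open ball only, so w is scaled to norm u R with u <
      1.\<close>
    proof (rule field_le_mult_one_interval)
      fix u :: real assume u: "0 < u" "u < 1"
      have "f ((u * R / norm w) *\<^sub>R w) \<le> f z"
        by (rule bound) (use u R False in simp)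
      then show "u * (f w * R) \<le> f z * norm w"
        using False by (simp add: f.scaleR field_simps)
    qed
    then show ?thesis using R by (simp add: L_def field_simps)
  qed (simp add: f.zero)
  have sq: "(f w)\<^sup>2 \<le> L\<^sup>2 * (norm w)\<^sup>2" for w
  proof -
    have "\<bar>f w\<bar> \<le> L * norm w" using le[of w] le[of "- w"] by (simp add: f.neg abs_le_iff)
    then have "\<bar>f w\<bar>\<^sup>2 \<le> (L * norm w)\<^sup>2" by (intro power_mono) auto
    then show ?thesis by (simp add: power_mult_distrib)
  qed
  have orth: "f v = 0" if v: "z \<bullet> v = 0" for v
  proof (rule ccontr)
    assume nz: "f v \<noteq> 0"
    \<comment> \<open>With this l the cross term 2 l L R f v exceeds
      \<open>L\<^sup>2 * (norm v)\<^sup>2\<close> by 1, which contradicts the Cauchy-Schwarz type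
      bound \<open>sq\<close> at l z + v.\<close>
    define l where "l = (L\<^sup>2 * (norm v)\<^sup>2 + 1) / (2 * L * R * f v)"
    have l: "2 * (l * L * R) * f v = L\<^sup>2 * (norm v)\<^sup>2 + 1"
      using nz L R by (simp add: l_def)
    have "(f (l *\<^sub>R z + v))\<^sup>2 \<le> L\<^sup>2 * (norm (l *\<^sub>R z + v))\<^sup>2" by (rule sq)
    also have "(norm (l *\<^sub>R z + v))\<^sup>2 = l\<^sup>2 * R\<^sup>2 + (norm v)\<^sup>2"
      unfolding R(2)[symmetric] power2_norm_eq_inner using v
      by (simp add: inner_add_left inner_add_right inner_commute[of v z] power2_eq_square)
    also have "f (l *\<^sub>R z + v) = l * L * R + f v" by (simp add: f.add f.scaleR L)
    finally have "2 * (l * L * R) * f v + (f v)\<^sup>2 \<le> L\<^sup>2 * (norm v)\<^sup>2"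
      by (simp add: power2_sum power_mult_distrib distrib_left mult_ac)
    then show False unfolding l using zero_le_power2[of "f v"] by linarith
  qed
  define s where "s = (z \<bullet> y) / R\<^sup>2"
  have "z \<bullet> (y - s *\<^sub>R z) = 0"
    using R by (simp add: inner_diff_right s_def power2_norm_eq_inner[symmetric])
  then have "f (y - s *\<^sub>R z) = 0" by (rule orth)
  then have "f y = s * f z" by (simp add: f.diff f.scaleR)
  then show ?thesis by (simp add: s_def)
qed

text \<open>Since f supports the ball at a boundary point, it is represented by a multiple g of the
  radius vector. If q g were 0, tilting would do nothing and the dominating point would be the mean
  0, which the closed ball excludes. With q g > 0 the Gaussian integrals evaluate the mean equation
  to cov g and the rate to q g - q g / 2.\<close>

lemma (in gaussian_limit) dominating_functional_ball:
  assumes R: "R > 0" and D: "D = {x. norm (x - a) < R}" and 0: "0 \<notin> closure D"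
    and a0: "a\<^sub>0 \<in> frontier D" and dom: "dominating_functional D \<gamma> a\<^sub>0 f"
    and pos: "blinfun_apply f a\<^sub>0 < blinfun_apply f a"
  obtains g where "\<And>y. blinfun_apply f y = g \<bullet> y" "q g > 0" "a\<^sub>0 = cov g"
    "norm (a - a\<^sub>0) = R" "a - a\<^sub>0 = (R\<^sup>2 / blinfun_apply f (a - a\<^sub>0)) *\<^sub>R g"
    "rate_fun \<gamma> a\<^sub>0 = ereal (q g / 2)"
proof -
  have Db: "D = ball a R" unfolding D by (auto simp: dist_norm norm_minus_commute)
  have nz: "norm (a - a\<^sub>0) = R" using a0 R by (simp add: Db dist_norm)
  have fz: "blinfun_apply f (a - a\<^sub>0) > 0" using pos by (simp add: blinfun.diff_right)
  define g where "g = (blinfun_apply f (a - a\<^sub>0) / R\<^sup>2) *\<^sub>R (a - a\<^sub>0)"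
  have fg: "blinfun_apply f y = g \<bullet> y" for y
    unfolding g_def
  proof (rule supporting_functional_ball[OF blinfun.bounded_linear_right R nz fz])
    fix w :: 'h assume "norm w < R"
    then have "a - w \<in> D" by (simp add: D)
    then have "blinfun_apply f (a - w) \<ge> blinfun_apply f a\<^sub>0"
      using dom unfolding dominating_functional_def by blast
    then show "blinfun_apply f w \<le> blinfun_apply f (a - a\<^sub>0)" by (simp add: blinfun.diff_right)
  qed
  have ag: "a - a\<^sub>0 = (R\<^sup>2 / blinfun_apply f (a - a\<^sub>0)) *\<^sub>R g" using fz R by (simp add: g_def)
  have rate: "rate_fun \<gamma> a\<^sub>0 = ereal (g \<bullet> a\<^sub>0 - ln (mgf \<gamma> f))"
    and a0': "a\<^sub>0 = (\<integral>x. exp (g \<bullet> x - ln (mgf \<gamma> f)) *\<^sub>R x \<partial>\<gamma>)"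
    using dom unfolding dominating_functional_def fg by blast+
  have mgf: "mgf \<gamma> f = (\<integral>x. exp (g \<bullet> x) \<partial>\<gamma>)" by (simp add: mgf_def fg)
  have "q g \<noteq> 0"
  proof
    assume q0: "q g = 0"
    have "mgf \<gamma> f = (\<integral>x. 1 \<partial>\<gamma>)" unfolding mgf
      by (rule integral_cong_AE) (use AE_eq_0[OF q0] in auto)
    then have m1: "mgf \<gamma> f = 1" by (simp add: G.prob_space)
    have "a\<^sub>0 = (\<integral>x. exp (g \<bullet> x) *\<^sub>R x \<partial>\<gamma>)" using a0' by (simp add: m1)
    also have "\<dots> = (\<integral>x. x \<partial>\<gamma>)"
      by (rule integral_cong_AE) (use AE_eq_0[OF q0] in auto)
    finally have "a\<^sub>0 = 0" by (simp add: mean_\<gamma>)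
    then show False using a0 0 by (simp add: frontier_def)
  qed
  moreover have "q g \<ge> 0" unfolding q_def by (intro Bochner_Integration.integral_nonneg) simp
  ultimately have qg: "q g > 0" by simp
  interpret S: gaussian_split \<gamma> q g "cov g" by (rule gaussian_split[OF qg])
  have ln: "ln (mgf \<gamma> f) = q g / 2" unfolding mgf S.mgf_\<gamma> by simp
  have ac: "a\<^sub>0 = cov g" using a0' unfolding ln S.tilted_mean_\<gamma> .
  have "rate_fun \<gamma> a\<^sub>0 = ereal (q g / 2)" using rate unfolding ln ac inner_cov_self by simp
  then show ?thesis using that[OF fg qg ac nz ag] by blast
qed

text \<open>Both claims rest on the normalised limits \<open>asym\<close>. For the first, g comes
  from the resolvent construction; for the second, g is read off the given functional, and the
  explicit expression times \<open>w g n\<close> equals the limit constant exactly.\<close>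

theorem theorem5:
  fixes M :: "'w measure" and N :: "'v measure"
    and X :: "nat \<Rightarrow> 'w \<Rightarrow> 'h::{real_inner, banach, second_countable_topology}"
    and S :: "nat \<Rightarrow> 'w \<Rightarrow> 'h"
    and \<gamma> :: "'h measure" and G :: "'v \<Rightarrow> 'h"
    and a :: 'h and R :: real and D :: "'h set"
    and b :: "nat \<Rightarrow> real"
  assumes "prob_space M"
    and indep: "prob_space.indep_vars M (\<lambda>_. borel) X UNIV"
    and ident: "\<And>j. distr M borel (X j) = distr M borel (X 0)"
    and mean: "(\<integral>\<omega>. X 0 \<omega> \<partial>M) = 0"
    and moments: "\<And>f::'h \<Rightarrow>\<^sub>L real. \<exists>t\<^sub>f>0. \<forall>t. 0 < \<bar>t\<bar> \<and> \<bar>t\<bar> < t\<^sub>f \<longrightarrow>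
          integrable M (\<lambda>\<omega>. norm (X 0 \<omega>) ^ 3 * exp (t * \<bar>blinfun_apply f (X 0 \<omega>)\<bar>))"
    and S: "\<And>n \<omega>. S n \<omega> = (\<Sum>j=1..n. X j \<omega>)"
    and gauss: "centered_gaussian \<gamma>"
    and clt: "weak_conv_measure (\<lambda>n. distr M borel (\<lambda>\<omega>. S n \<omega> /\<^sub>R sqrt (real n))) \<gamma>"
    and "prob_space N" and "G \<in> borel_measurable N" and law_G: "distr N borel G = \<gamma>"
    and "R > 0" and D: "D = {x. norm (x - a) < R}"
    and "D \<inter> gaussian_hilbert \<gamma> \<noteq> {}" and "0 \<notin> closure D"
    and "\<And>n. n \<ge> 1 \<Longrightarrow> b n > 0"
    and "filterlim (\<lambda>n. b n / sqrt (real n)) at_top sequentially"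
    and "(\<lambda>n. b n / real n powr (2/3)) \<longlonglongrightarrow> 0"
  shows "let PS = (\<lambda>n. measure M {\<omega> \<in> space M. S n \<omega> \<in> (*\<^sub>R) (b n) ` D});
             PG = (\<lambda>n. measure N {v \<in> space N. G v \<in> (*\<^sub>R) (b n / sqrt (real n)) ` D})
         in (\<lambda>n. PS n / PG n) \<longlonglongrightarrow> 1 \<and>
            (\<forall>a\<^sub>0 g. dominating_point D \<gamma> a\<^sub>0 \<and> associated_functional D \<gamma> a\<^sub>0 g \<longrightarrow>
               (let \<beta> = 1 / blinfun_apply g (a - a\<^sub>0);
                    \<sigma>2 = (\<integral>\<omega>. (blinfun_apply g (X 0 \<omega>))\<^sup>2 \<partial>M);
                    G1 = (\<lambda>v. blinfun_apply g (G v) *\<^sub>R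
                            ((\<integral>u. blinfun_apply g (G u) *\<^sub>R G u \<partial>N) /\<^sub>R \<sigma>2));
                    G2 = (\<lambda>v. G v - G1 v);
                    A = (\<lambda>n. (2 * pi * \<sigma>2 * (b n)\<^sup>2 / real n) powr (- 1 / 2)
                           * exp (- ((b n)\<^sup>2 / real n * real_of_ereal (rate_fun \<gamma> a\<^sub>0)))
                           * (LBINT s:{0..}. exp (- s) *
                                measure N {v \<in> space N. (norm (G2 v))\<^sup>2 \<le> 2 * s * \<beta> * R\<^sup>2}))
                in centered_gaussian (distr N borel G2) \<and>
                   (\<lambda>n. PS n / A n) \<longlonglongrightarrow> 1 \<and>
                   (\<lambda>n. PG n / A n) \<longlonglongrightarrow> 1))"
proof -
  note b = assms(16-18)
  interpret M: prob_space M by fact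
  interpret N: prob_space N by fact
  have [measurable]: "G \<in> borel_measurable N" by fact
  have [measurable]: "X j \<in> borel_measurable M" for j using indep by (auto simp: M.indep_vars_def)
  define \<mu> where "\<mu> = distr M borel (X 0)"
  have \<mu>: "bprob \<mu>" unfolding bprob_def \<mu>_def by (auto intro!: M.prob_space_distr)
  have mom: "\<exists>t0>0. integrable \<mu> (\<lambda>x. norm x ^ 3 * exp (t0 * \<bar>g \<bullet> x\<bar>))" for g
  proof -
    obtain t where t: "t > 0" "\<And>s. 0 < \<bar>s\<bar> \<Longrightarrow> \<bar>s\<bar> < t \<Longrightarrow>
        integrable M (\<lambda>\<omega>. norm (X 0 \<omega>) ^ 3 * exp (s * \<bar>blinfun_apply (blinfun_inner_right g) (X 0 \<omega>)\<bar>))"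
      using moments[of "blinfun_inner_right g"] by blast
    have "integrable M (\<lambda>\<omega>. norm (X 0 \<omega>) ^ 3 * exp (t / 2 * \<bar>g \<bullet> X 0 \<omega>\<bar>))"
      using t(2)[of "t / 2"] t(1) by simp
    then have "integrable \<mu> (\<lambda>x. norm x ^ 3 * exp (t / 2 * \<bar>g \<bullet> x\<bar>))"
      unfolding \<mu>_def by (subst integrable_distr_eq) auto
    then show ?thesis using t(1) by (intro exI[of _ "t / 2"]) simp
  qed
  have law_S: "distr M borel (S n) = cpow \<mu> n" for n
    using M.distr_partial_sum[OF indep ident, of n] unfolding S[abs_def] \<mu>_def .
  have [measurable]: "S n \<in> borel_measurable M" for n unfolding S[abs_def] by measurable
  interpret gaussian_limit \<mu> \<gamma>
  proof
    show "bprob \<mu>" "centered_gaussian \<gamma>" by fact+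
    \<comment> \<open>In direction 0 the exponential factor of the moment hypothesis is 1.\<close>
    show "integrable \<mu> (\<lambda>x. norm x ^ 3)" using mom[of 0] by auto
    show "(\<integral>x. x \<partial>\<mu>) = 0" unfolding \<mu>_def using mean by (subst integral_distr) auto
    show "weak_conv_measure (\<lambda>n. distr (cpow \<mu> n) borel (\<lambda>x. x /\<^sub>R sqrt (real n))) \<gamma>"
      using clt unfolding law_S[symmetric] by (subst distr_distr) (auto simp: comp_def)
  qed
  define PS where "PS n = measure M {\<omega> \<in> space M. S n \<omega> \<in> (*\<^sub>R) (b n) ` D}" for n
  define PG where "PG n = measure N {v \<in> space N. G v \<in> (*\<^sub>R) (b n / sqrt (real n)) ` D}" for n
  have PS: "PS n = measure (cpow \<mu> n) ((*\<^sub>R) (b n) ` D)" for n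
    unfolding PS_def law_S[symmetric] D
    by (subst measure_distr[OF _ scaled_ball_borel]) (auto intro!: arg_cong[where f = "measure M"])
  have PG: "PG n = measure \<gamma> ((*\<^sub>R) (b n / sqrt (real n)) ` D)" for n
    unfolding PG_def law_G[symmetric] D
    by (subst measure_distr[OF _ scaled_ball_borel]) (auto intro!: arg_cong[where f = "measure N"])
  define w where "w g n = (b n / sqrt n) * exp ((b n / sqrt n)\<^sup>2 * q g / 2)" for g and n :: nat
  define c where "c g \<kappa> = (1 / (sqrt (2 * pi) * sqrt (q g))) * (\<integral>y. exp (- (norm y)\<^sup>2 / \<kappa>) \<partial>gaussian_split.\<zeta>0 \<gamma> q g (cov g))" for g \<kappa>
  have w0: "w g n \<noteq> 0" if "n \<ge> 1" for g n using b(1)[OF that] that by (simp add: w_def)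
  then have w0_ev: "eventually (\<lambda>n. w g n \<noteq> 0) sequentially" for g
    using eventually_ge_at_top[of 1] by (rule eventually_mono[rotated])
  have asym: "c g \<kappa> > 0" "(\<lambda>n. PS n * w g n) \<longlonglongrightarrow> c g \<kappa>" "(\<lambda>n. PG n * w g n) \<longlonglongrightarrow> c g \<kappa>"
    if "q g > 0" "\<kappa> > 0" "a - cov g = (\<kappa> / 2) *\<^sub>R g" "norm (a - cov g) = R" for g \<kappa>
  proof -
    obtain t0 where t0: "t0 > 0" "integrable \<mu> (\<lambda>x. norm x ^ 3 * exp (t0 * \<bar>g \<bullet> x\<bar>))" using mom by blast
    have D': "{x. norm (x - (cov g + (a - cov g))) < norm (a - cov g)} = D" unfolding D that(4) by simp
    note B = ball_asymptotics[OF b t0 that(1,2,3)]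
    show "c g \<kappa> > 0" unfolding c_def by (rule B(1))
    show "(\<lambda>n. PS n * w g n) \<longlonglongrightarrow> c g \<kappa>" using B(2) unfolding D' PS[symmetric] c_def w_def .
    show "(\<lambda>n. PG n * w g n) \<longlonglongrightarrow> c g \<kappa>" using B(3) unfolding D' PG[symmetric] c_def w_def .
  qed
  have aR: "norm a > R"
  proof -
    have "D = ball a R" unfolding D by (auto simp: dist_norm norm_minus_commute)
    then show ?thesis using \<open>0 \<notin> closure D\<close> \<open>R > 0\<close> by simp
  qed
  have part1: "(\<lambda>n. PS n / PG n) \<longlonglongrightarrow> 1"
  proof -
    obtain t z where tz: "t > 0" "norm z = R" "z + t *\<^sub>R cov z = a"
      using dominating_exists[OF \<open>R > 0\<close> aR] \<open>D \<inter> gaussian_hilbert \<gamma> \<noteq> {}\<close> unfolding D by blast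
    \<comment> \<open>Then cov g = a - z lies on the sphere, and z = (1 / t) g, so \<kappa> = 2 /
      t.\<close>
    define g where "g = t *\<^sub>R z"
    have cg: "cov g = t *\<^sub>R cov z" unfolding g_def by (rule linear_scale[OF bounded_linear.linear[OF bounded_linear_cov]])
    have az: "a - cov g = z" unfolding cg using tz(3) by (simp add: algebra_simps)
    have "q g \<noteq> 0"
    proof
      assume "q g = 0"
      then have "z = a" using az cov_eq_0 by simp
      then show False using tz(2) aR by simp
    qed
    moreover have "q g \<ge> 0" unfolding q_def by (intro Bochner_Integration.integral_nonneg) simp
    ultimately have qg: "q g > 0" by simp
    have "a - cov g = ((2 / t) / 2) *\<^sub>R g" unfolding az using tz(1) by (simp add: g_def)
    note B = asym[OF qg _ this]
    show ?thesis
      by (rule ratio_tendsto_1[OF B(2) B(3) _ w0_ev]) (use B(1) tz az in auto)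
  qed
  have part2: "centered_gaussian (distr N borel G2) \<and> (\<lambda>n. PS n / A n) \<longlonglongrightarrow> 1 \<and> (\<lambda>n. PG n / A n) \<longlonglongrightarrow> 1"
    if dp: "dominating_point D \<gamma> a\<^sub>0" and af: "associated_functional D \<gamma> a\<^sub>0 f"
      and \<beta>: "\<beta> = 1 / blinfun_apply f (a - a\<^sub>0)" and \<sigma>2: "\<sigma>2 = (\<integral>\<omega>. (blinfun_apply f (X 0 \<omega>))\<^sup>2 \<partial>M)"
      and G2: "G2 = (\<lambda>v. G v - blinfun_apply f (G v) *\<^sub>R ((\<integral>u. blinfun_apply f (G u) *\<^sub>R G u \<partial>N) /\<^sub>R \<sigma>2))"
      and A: "A = (\<lambda>n. (2 * pi * \<sigma>2 * (b n)\<^sup>2 / real n) powr (- 1 / 2)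
                           * exp (- ((b n)\<^sup>2 / real n * real_of_ereal (rate_fun \<gamma> a\<^sub>0)))
                           * (LBINT s:{0..}. exp (- s) *
                                measure N {v \<in> space N. (norm (G2 v))\<^sup>2 \<le> 2 * s * \<beta> * R\<^sup>2}))"
    for a\<^sub>0 f \<beta> \<sigma>2 G2 A
  proof -
    have aD: "a \<in> D" using \<open>R > 0\<close> by (simp add: D)
    obtain h t where ht: "\<forall>x\<in>D. blinfun_apply h a\<^sub>0 < blinfun_apply h x" "t > 0" "f = t *\<^sub>R h"
        and dom: "dominating_functional D \<gamma> a\<^sub>0 f"
      using af unfolding associated_functional_def by blast
    have fpos: "blinfun_apply f a\<^sub>0 < blinfun_apply f a" using ht aD by (simp add: scaleR_blinfun.rep_eq)
    have a0: "a\<^sub>0 \<in> frontier D" using dp unfolding dominating_point_def by blast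
    obtain g where g: "\<And>y. blinfun_apply f y = g \<bullet> y" "q g > 0" "a\<^sub>0 = cov g"
        "norm (a - a\<^sub>0) = R" "a - a\<^sub>0 = (R\<^sup>2 / blinfun_apply f (a - a\<^sub>0)) *\<^sub>R g" "rate_fun \<gamma> a\<^sub>0 = ereal (q g / 2)"
      using dominating_functional_ball[OF \<open>R > 0\<close> D \<open>0 \<notin> closure D\<close> a0 dom fpos] by blast
    interpret Z: gaussian_split \<gamma> q g "cov g" by (rule gaussian_split[OF g(2)])
    \<comment> \<open>The radius vector is \<open>R\<^sup>2\<close> times \<beta> times g, hence
      \<kappa> / 2 is \<open>\<beta> * R\<^sup>2\<close>.\<close>
    define \<kappa> where "\<kappa> = 2 * \<beta> * R\<^sup>2"
    have \<kappa>: "\<kappa> > 0" using fpos \<open>R > 0\<close> by (simp add: \<kappa>_def \<beta> blinfun.diff_right)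
    have az: "a - cov g = (\<kappa> / 2) *\<^sub>R g" using g(5) by (simp add: \<kappa>_def \<beta> g(3))
    note B = asym[OF g(2) \<kappa> az g(4)[unfolded g(3)]]
    have "(\<integral>x. (g \<bullet> x)\<^sup>2 \<partial>\<mu>) = \<sigma>2" unfolding \<sigma>2 g(1) \<mu>_def by (subst integral_distr) auto
    then have s2: "\<sigma>2 = q g" by (simp add: q_def)
    have "(\<integral>x. (g \<bullet> x) *\<^sub>R x \<partial>distr N borel G) = (\<integral>u. blinfun_apply f (G u) *\<^sub>R G u \<partial>N)"
      unfolding g(1) by (subst integral_distr) auto
    then have "(\<integral>u. blinfun_apply f (G u) *\<^sub>R G u \<partial>N) = cov g" by (simp add: law_G cov_def)
    then have G2r: "G2 = (\<lambda>v. Z.resid (G v))" unfolding G2 s2 g(1) Z.resid_def by simp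
    have "distr (distr N borel G) borel Z.resid = distr N borel (Z.resid \<circ> G)"
      by (rule distr_distr) measurable
    then have law_G2: "distr N borel G2 = Z.\<zeta>0" by (simp add: law_G G2r Z.\<zeta>0_def comp_def)
    have 1: "centered_gaussian (distr N borel G2)"
      unfolding law_G2 Z.\<zeta>0_def
    proof (rule centered_gaussian_distr[OF gauss])
      show "bounded_linear Z.resid" unfolding Z.resid_def[abs_def]
        by (intro bounded_linear_sub bounded_linear_ident bounded_linear_scaleR_const bounded_linear_inner_right)
    qed
    have [measurable]: "G2 \<in> borel_measurable N" unfolding G2r by measurable
    have I: "(LBINT s:{0..}. exp (- s) * measure N {v \<in> space N. (norm (G2 v))\<^sup>2 \<le> 2 * s * \<beta> * R\<^sup>2})
        = (\<integral>y. exp (- (norm y)\<^sup>2 / \<kappa>) \<partial>Z.\<zeta>0)"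
    proof -
      have "measure N {v \<in> space N. (norm (G2 v))\<^sup>2 \<le> 2 * s * \<beta> * R\<^sup>2} = measure Z.\<zeta>0 {y. (norm y)\<^sup>2 \<le> \<kappa> * s}" for s
        unfolding law_G2[symmetric]
        by (subst measure_distr) (auto intro!: arg_cong[where f = "measure N"] simp: \<kappa>_def mult_ac)
      then show ?thesis unfolding laplace_window[OF Z.bprob_\<zeta>0 \<kappa>, symmetric] by simp
    qed
    \<comment> \<open>The rate q g / 2 makes the exponential factors cancel, and the power -1/2
      contributes 1 / m; from n = 1 on this is an identity, not merely a limit.\<close>
    have Aw: "A n * w g n = c g \<kappa>" if n: "n \<ge> 1" for n
    proof -
      define m where "m = b n / sqrt n"
      have m: "m > 0" using b(1)[OF n] n by (simp add: m_def)
      have m2: "(b n)\<^sup>2 / real n = m\<^sup>2" by (simp add: m_def power_divide)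
      have "(2 * pi * \<sigma>2 * (b n)\<^sup>2 / real n) powr (- 1 / 2) = (2 * pi * q g * m\<^sup>2) powr (- (1 / 2))"
        unfolding s2 m2[symmetric] by simp
      also have "\<dots> = 1 / sqrt (2 * pi * q g * m\<^sup>2)"
        unfolding powr_minus_divide using g(2) by (subst powr_half_sqrt) auto
      also have "sqrt (2 * pi * q g * m\<^sup>2) = sqrt (2 * pi) * sqrt (q g) * m"
        using m by (simp add: real_sqrt_mult)
      finally have p: "(2 * pi * \<sigma>2 * (b n)\<^sup>2 / real n) powr (- 1 / 2) = 1 / (sqrt (2 * pi) * sqrt (q g) * m)" .
      have "A n = 1 / (sqrt (2 * pi) * sqrt (q g) * m) * exp (- (m\<^sup>2 * q g / 2)) * (\<integral>y. exp (- (norm y)\<^sup>2 / \<kappa>) \<partial>Z.\<zeta>0)"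
        unfolding A p I g(6) m2 by simp
      moreover have "w g n = m * exp (m\<^sup>2 * q g / 2)" by (simp add: w_def m_def)
      ultimately show ?thesis unfolding c_def exp_minus using m by (simp add: field_simps)
    qed
    have 2: "(\<lambda>n. A n * w g n) \<longlonglongrightarrow> c g \<kappa>"
      by (rule tendsto_eventually, rule eventually_mono[OF eventually_ge_at_top[of 1]], rule Aw)
    have c0: "c g \<kappa> \<noteq> 0" using B(1) by simp
    show ?thesis
      using 1 ratio_tendsto_1[OF B(2) 2 c0 w0_ev] ratio_tendsto_1[OF B(3) 2 c0 w0_ev] by blast
  qed
  from part1 part2[OF _ _ refl refl refl refl] show ?thesis
    unfolding Let_def PS_def PG_def by blast
qed

end
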